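(* Let $\rho>0$ and $\kappa\in\mathbb{R}$. There exist $T>0$ and $c_{\rho,\kappa}>0$, depending only on $\rho$ and $\kappa$, such that, with $$C_{\rho,\kappa}=\frac{2e^{[1+(\kappa/\rho)]_+}}{\rho\,(1-e^{-2\rho T})},$$ the following holds. Let $n\ge 1$ and let $\mu=\mu_1\otimes\cdots\otimes\mu_n$, where for each $i=1,\dots,n$, $d\mu_i=e^{-V_i(x)}dx$ is a probability measure on $\mathbb{R}$ with $V_i:\mathbb{R}\to\mathbb{R}$ smooth and $V_i''(x)\ge-\kappa_i$ for all $x\in\mathbb{R}$, for some $\kappa_i\in\mathbb{R}$, with $\kappa=\max_{1\le i\le n}\kappa_i$. Assume that every $\mu_i$ is hypercontractive with constant $\rho$. Then for every smooth $f\in\mathcal{F}_+$ (subject to the integrability convention in the context), $$\mathrm{Ent}_\mu(e^{-f})\le C_{\rho,\kappa}\,\|\nabla f\|_\phi^2\;\mathbb{E}_\mu[e^{-f}],$$ and in particular $$\mu\Big(f-\int_{\mathbb{R}^n}f\,d\mu\le -t\Big)\le \exp\Big(-c_{\rho,\kappa}\frac{t^2}{2\|\nabla f\|_\phi^2}\Big),\qquad t\ge 0.$$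
   Context: Class of functions: $\mathcal{F}_+$ is the set of $f\in C^2(\mathbb{R}^n,\mathbb{R})$ that are monotone (either non-decreasing in every coordinate, or non-increasing in every coordinate) and satisfy $\partial^2_{ij}f\ge 0$ on $\mathbb{R}^n$ for all $i,j=1,\dots,n$ (including $i=j$). Entropy: for $g>0$, $\mathrm{Ent}_\mu(g)=\int g\log g\,d\mu-\big(\int g\,d\mu\big)\log\big(\int g\,d\mu\big)$; $\mathbb{E}_\mu[g]=\int g\,d\mu$; $[a]_+=\max(a,0)$. Hypercontractivity: "$\mu_i$ is hypercontractive with constant $\rho>0$" means that $\mu_i$ satisfies the logarithmic Sobolev inequality $\rho\,\mathrm{Ent}_{\mu_i}(g^2)\le 2\int_{\mathbb{R}}(g')^2d\mu_i$ for all $g$ in the domain of the Dirichlet form (e.g. locally Lipschitz $g\in L^2(\mu_i)$ with $g'\in L^2(\mu_i)$). Equivalently (Gross), the Markov semigroup $(P_t)_{t\ge0}$ with generator $g\mapsto g''-V_i'g'$ satisfies $\|P_tg\|_{L^2(\mu_i)}\le\|g\|_{L^p(\mu_i)}$ for all $t\geq 0$ and $g\in L^p(\mu_i)$ whenever $p\ge 1+e^{-2\rho t}$. Orlicz norm: $\phi:\mathbb{R}_+\to\mathbb{R}_+$ is a fixed convex function with $\phi(0)=0$ and $\phi(x)=\frac{x^2}{\log(e+x)}$ for $x\ge1$. For measurable $h:\mathbb{R}^n\to\mathbb{R}$, $\|h\|_\phi=\inf\{c>0:\int_{\mathbb{R}^n}\phi(|h|/c)\,d\mu\le 1\}$, and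 $\|\nabla f\|_\phi^2$ is shorthand for $\sum_{i=1}^n\|\partial_if\|_\phi^2$. Integrability convention: functions are assumed sufficiently integrable for the inequalities to make sense, i.e. $f\in L^1(\mu)$, $\|\partial_if\|_\phi<\infty$ for all $i$, and $e^{-\theta f}$ and $fe^{-\theta f}$ are in $L^1(\mu)$ for all $\theta\ge0$. The deviation inequality is understood for $\|\nabla f\|_\phi\ne 0$. *)

theory Defs
  imports "HOL-Probability.Probability"
begin

text \<open>
  \<open>\<real>\<^sup>n\<close> is the set of extensional functions on \<open>{..<n}\<close> (coordinates \<open>0, \<dots>, n - 1\<close>), i.e. the
  space of the product measures \<open>PiM {..<n} \<mu>\<close> for \<open>\<mu> i\<close> on \<^typ>\<open>real\<close>. The dimension must be a
  bound variable, since the constants in the theorem may not depend on it. The subspace topology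
  that \<open>Rn n\<close> inherits from the product topology on \<^typ>\<open>nat \<Rightarrow> real\<close> is the usual topology of
  \<open>\<real>\<^sup>n\<close>.
\<close>

definition Rn :: "nat \<Rightarrow> (nat \<Rightarrow> real) set" where
  "Rn n = PiE {..<n} (\<lambda>_. UNIV)"

definition partial_deriv :: "nat \<Rightarrow> ((nat \<Rightarrow> real) \<Rightarrow> real) \<Rightarrow> (nat \<Rightarrow> real) \<Rightarrow> real" where
  "partial_deriv i f x = deriv (\<lambda>t. f (x(i := t))) (x i)"

primrec Ck_on_Rn :: "nat \<Rightarrow> nat \<Rightarrow> ((nat \<Rightarrow> real) \<Rightarrow> real) \<Rightarrow> bool" where
  "Ck_on_Rn n 0 f \<longleftrightarrow> continuous_on (Rn n) f"
| "Ck_on_Rn n (Suc k) f \<longleftrightarrow>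
     continuous_on (Rn n) f \<and>
     (\<forall>i<n. (\<forall>x\<in>Rn n. (\<lambda>t. f (x(i := t))) differentiable (at (x i))) \<and>
            Ck_on_Rn n k (partial_deriv i f))"

definition smooth_on_Rn :: "nat \<Rightarrow> ((nat \<Rightarrow> real) \<Rightarrow> real) \<Rightarrow> bool" where
  "smooth_on_Rn n f \<longleftrightarrow> (\<forall>k. Ck_on_Rn n k f)"

definition smooth_real :: "(real \<Rightarrow> real) \<Rightarrow> bool" where
  "smooth_real v \<longleftrightarrow> (\<forall>k x. (deriv ^^ k) v differentiable (at x))"

definition F_plus :: "nat \<Rightarrow> ((nat \<Rightarrow> real) \<Rightarrow> real) set" where
  "F_plus n = {f. Ck_on_Rn n 2 f \<and>
     ((\<forall>i<n. \<forall>x\<in>Rn n. mono (\<lambda>t. f (x(i := t)))) \<or>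
      (\<forall>i<n. \<forall>x\<in>Rn n. antimono (\<lambda>t. f (x(i := t))))) \<and>
     (\<forall>i<n. \<forall>j<n. \<forall>x\<in>Rn n. partial_deriv i (partial_deriv j f) x \<ge> 0)}"

text \<open>
  Meaningful when \<open>g\<close> and \<open>g * ln g\<close> are integrable; at zeros of \<open>g\<close> the convention
  \<open>0 * ln 0 = 0\<close> is automatic.
\<close>

definition Ent :: "'a measure \<Rightarrow> ('a \<Rightarrow> real) \<Rightarrow> real" where
  "Ent M g = (\<integral>x. g x * ln (g x) \<partial>M) - (\<integral>x. g x \<partial>M) * ln (\<integral>x. g x \<partial>M)"

text \<open>
  The logarithmic Sobolev inequality with constant \<open>\<rho>\<close>. A locally Lipschitz \<open>g\<close> is differentiable
  Lebesgue-almost everywhere, and \<open>M\<close> is meant to have a Lebesgue density, so the values of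
  \<open>deriv g\<close> elsewhere are immaterial. (The first argument of \<open>local_lipschitz\<close> is an unused
  time domain.) The integrability clause says that the entropy of \<open>g\<^sup>2\<close>, which is a priori
  in \<open>[0, \<infinity>]\<close>, is finite; it is part of the inequality because the right-hand side is finite.
\<close>

definition hypercontractive :: "real measure \<Rightarrow> real \<Rightarrow> bool" where
  "hypercontractive M \<rho> \<longleftrightarrow>
     (\<forall>g :: real \<Rightarrow> real.
        local_lipschitz {0::real} UNIV (\<lambda>_. g) \<and>
        integrable M (\<lambda>x. (g x)\<^sup>2) \<and> integrable M (\<lambda>x. (deriv g x)\<^sup>2) \<longrightarrow>
          integrable M (\<lambda>x. (g x)\<^sup>2 * ln ((g x)\<^sup>2)) \<and>
          \<rho> * Ent M (\<lambda>x. (g x)\<^sup>2) \<le> 2 * (\<integral>x. (deriv g x)\<^sup>2 \<partial>M))"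

definition potential_measure :: "(real \<Rightarrow> real) \<Rightarrow> real measure" where
  "potential_measure v = density lborel (\<lambda>x. ennreal (exp (- v x)))"

text \<open>Only the values of \<open>\<phi>\<close> on \<open>[0, \<infinity>)\<close> matter.\<close>

definition admissible_phi :: "(real \<Rightarrow> real) \<Rightarrow> bool" where
  "admissible_phi \<phi> \<longleftrightarrow>
     convex_on {0..} \<phi> \<and> (\<forall>x\<ge>0. \<phi> x \<ge> 0) \<and> \<phi> 0 = 0 \<and>
     (\<forall>x\<ge>1. \<phi> x = x\<^sup>2 / ln (exp 1 + x))"

text \<open>The value is \<open>\<infinity>\<close> if no \<open>c\<close> is admissible.\<close>

definition orlicz_norm :: "(real \<Rightarrow> real) \<Rightarrow> 'a measure \<Rightarrow> ('a \<Rightarrow> real) \<Rightarrow> ennreal" where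
  "orlicz_norm \<phi> M h =
     Inf {ennreal c | c. c > 0 \<and> (\<integral>\<^sup>+x. ennreal (\<phi> (\<bar>h x\<bar> / c)) \<partial>M) \<le> 1}"

definition grad_orlicz_sq ::
  "(real \<Rightarrow> real) \<Rightarrow> nat \<Rightarrow> (nat \<Rightarrow> real) measure \<Rightarrow> ((nat \<Rightarrow> real) \<Rightarrow> real) \<Rightarrow> real" where
  "grad_orlicz_sq \<phi> n M f = (\<Sum>i<n. (enn2real (orlicz_norm \<phi> M (partial_deriv i f)))\<^sup>2)"

definition sufficiently_integrable ::
  "(real \<Rightarrow> real) \<Rightarrow> nat \<Rightarrow> (nat \<Rightarrow> real) measure \<Rightarrow> ((nat \<Rightarrow> real) \<Rightarrow> real) \<Rightarrow> bool" where
  "sufficiently_integrable \<phi> n M f \<longleftrightarrow>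
     integrable M f \<and>
     (\<forall>i<n. orlicz_norm \<phi> M (partial_deriv i f) < \<infinity>) \<and>
     (\<forall>\<theta>\<ge>0. integrable M (\<lambda>x. exp (- \<theta> * f x)) \<and> integrable M (\<lambda>x. f x * exp (- \<theta> * f x)))"

end

(*
  The logarithmic Sobolev inequality and the lower bound on V_i'' give a lower bound for the density
  of mu_i in terms of its tails, so that mu_i is the image of the standard Gaussian measure under an
  increasing C^1 map with bounded derivative. This transfers f to a function F on Gaussian space
  that is increasing and whose partial derivatives are dominated by increasing functions.

  There the covariance of F and exp(-F) is computed by rotating two independent Gaussian vectors into
  each other. The decreasing factor exp(-F) is split off by a correlation inequality, and on the
  m-th dyadic range of correlations Gaussian hypercontractivity bounds what remains by the
  squared L^p-norms of the partial derivatives with p = 2 - 2^(-m-1). The sum over m is controlled by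
  the Orlicz norm. Jensen's inequality turns the covariance bound into the entropy bound; applied
  to all multiples of f, it also bounds the growth of the Laplace transform (Herbst's argument, done
  here with finite differences), hence the deviation probability.
*)
theory Submission
  imports Defs "HOL-Real_Asymp.Real_Asymp"
begin

section \<open>Gaussian measure\<close>

text \<open>The prescribed constant \<open>C\<close> tends to infinity as \<open>T\<close> tends to
  0, so any bound that depends only on \<rho> and \<kappa> is enough. The semigroup of a general
  mu_i has no explicit kernel; a coordinatewise Lipschitz map replaces it by explicitly correlated
  Gaussian vectors. Since V'' may be negative, the Lipschitz bound cannot come from convexity: the
  logarithmic Sobolev inequality gives a Muckenhoupt-type condition, which in dimension one bounds
  the density from below by the tails. The derivative of the map is not monotone, so transported
  partial derivatives are not monotone either. Only the Lipschitz constant times |partial derivative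
  of f| stays increasing, and this is where the sign of all second derivatives enters. The norm
  defined by \<phi> is weaker than the L^2 norm by a logarithm, while close to correlation 1
  hypercontractivity gains almost nothing over L^2. No single exponent p < 2 can therefore serve on
  the whole path; the loss in the m-th exponent is paid for by the length 2^(-m-1) of the m-th
  range.\<close>

definition gauss :: "real measure" where
  "gauss = density lborel (\<lambda>x. ennreal (std_normal_density x))"

lemma sets_gauss [measurable_cong, simp]: "sets gauss = sets borel"
  by (simp add: gauss_def)

lemma space_gauss [simp]: "space gauss = UNIV"
  by (simp add: gauss_def)

interpretation gauss: prob_space gauss
  unfolding gauss_def by (rule prob_space_normal_density) simp

lemma emeasure_gauss_UNIV [simp]: "emeasure gauss UNIV = 1"
  using gauss.emeasure_space_1 by simp

section \<open>Rotation invariance and correlated Gaussian pairs\<close>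

lemma nn_integral_gauss:
  assumes [measurable]: "F \<in> borel_measurable borel"
  shows "(\<integral>\<^sup>+x. F x \<partial>gauss) = (\<integral>\<^sup>+x. ennreal (std_normal_density x) * F x \<partial>lborel)"
  unfolding gauss_def by (subst nn_integral_density) auto

lemma nn_integral_gauss_minus:
  fixes F :: "real \<Rightarrow> ennreal"
  assumes [measurable]: "F \<in> borel_measurable borel"
  shows "(\<integral>\<^sup>+x. F (- x) \<partial>gauss) = (\<integral>\<^sup>+x. F x \<partial>gauss)"
proof -
  have "(\<integral>\<^sup>+x. F x \<partial>gauss) = (\<integral>\<^sup>+x. ennreal (std_normal_density x) * F x \<partial>lborel)"
    by (rule nn_integral_gauss) simp
  also have "\<dots> = (\<integral>\<^sup>+x. ennreal (std_normal_density (- x)) * F (- x) \<partial>lborel)"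
    by (subst nn_integral_real_affine[where c="-1" and t=0]) auto
  also have "\<dots> = (\<integral>\<^sup>+x. F (- x) \<partial>gauss)"
    by (subst nn_integral_gauss) (simp_all add: std_normal_density_def)
  finally show ?thesis by simp
qed

text \<open>The product of two standard normal densities depends only on the radius. Instead of a
  two-dimensional change of variables, two affine substitutions are made: u = c x + s z in place of
  z at fixed x and, after exchanging the integrals, x = c u - s v at fixed u. The Jacobian factors
  1/|s| and |s| cancel; dividing by \<open>s\<close> is why \<open>s\<close> = 0 is
  excluded.\<close>

lemma nn_integral_gauss_rotate:
  fixes F :: "real \<times> real \<Rightarrow> ennreal"
  assumes [measurable]: "F \<in> borel_measurable (borel \<Otimes>\<^sub>M borel)"
    and cs: "c\<^sup>2 + s\<^sup>2 = 1" and s: "s \<noteq> 0"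
  shows "(\<integral>\<^sup>+x. \<integral>\<^sup>+z. F (c * x + s * z, c * z - s * x) \<partial>gauss \<partial>gauss) =
    (\<integral>\<^sup>+x. \<integral>\<^sup>+z. F (x, z) \<partial>gauss \<partial>gauss)"
proof -
  let ?n = "\<lambda>x. ennreal (std_normal_density x)"
  have dens: "std_normal_density (c * u - s * v) * std_normal_density (s * u + c * v) =
      std_normal_density u * std_normal_density v" for u v
  proof -
    have "(c * u - s * v)\<^sup>2 + (s * u + c * v)\<^sup>2 = (c\<^sup>2 + s\<^sup>2) * (u\<^sup>2 + v\<^sup>2)"
      by (simp add: power2_eq_square algebra_simps)
    then have "- ((c * u - s * v)\<^sup>2 / 2) + - ((s * u + c * v)\<^sup>2 / 2) = - (u\<^sup>2 / 2) + - (v\<^sup>2 / 2)"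
      using cs by (simp add: field_simps)
    then show ?thesis
      by (simp add: std_normal_density_def flip: exp_add)
  qed
  have "(\<integral>\<^sup>+x. \<integral>\<^sup>+z. F (c * x + s * z, c * z - s * x) \<partial>gauss \<partial>gauss) =
      (\<integral>\<^sup>+x. \<integral>\<^sup>+z. ?n x * ?n z * F (c * x + s * z, c * z - s * x) \<partial>lborel \<partial>lborel)"
    by (simp add: nn_integral_gauss nn_integral_cmult mult.assoc)
  also have "\<dots> = (\<integral>\<^sup>+x. ennreal \<bar>1/s\<bar> * (\<integral>\<^sup>+u. ?n x * ?n (- (c/s) * x + (1/s) * u) *
      F (c * x + s * (- (c/s) * x + (1/s) * u), c * (- (c/s) * x + (1/s) * u) - s * x) \<partial>lborel) \<partial>lborel)"
    using s
    by (intro nn_integral_cong, intro nn_integral_real_affine) auto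
  also have "\<dots> = (\<integral>\<^sup>+x. \<integral>\<^sup>+u. ennreal \<bar>1/s\<bar> * (?n x * ?n ((u - c * x) / s) *
      F (u, (c * u - x) / s)) \<partial>lborel \<partial>lborel)"
  proof -
    have 1: "c * x + s * (- (c/s) * x + (1/s) * u) = u" for x u
      using s by (simp add: field_simps)
    have "c * (- (c/s) * x + (1/s) * u) - s * x = (c * u - (c\<^sup>2 + s\<^sup>2) * x) / s" for x u
      using s by (simp add: field_simps power2_eq_square)
    then have 2: "c * (- (c/s) * x + (1/s) * u) - s * x = (c * u - x) / s" for x u
      using cs by simp
    have 3: "- (c/s) * x + (1/s) * u = (u - c * x) / s" for x u
      using s by (simp add: field_simps)
    show ?thesis
      unfolding 1 2 unfolding 3 by (intro nn_integral_cong nn_integral_cmult[symmetric]) measurable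
  qed
  also have "\<dots> = (\<integral>\<^sup>+u. \<integral>\<^sup>+x. ennreal \<bar>1/s\<bar> * (?n x * ?n ((u - c * x) / s) *
      F (u, (c * u - x) / s)) \<partial>lborel \<partial>lborel)"
    by (rule lborel_pair.Fubini') measurable
  also have "\<dots> = (\<integral>\<^sup>+u. ennreal \<bar>-s\<bar> * (\<integral>\<^sup>+v. ennreal \<bar>1/s\<bar> * (?n (c * u + - s * v) * ?n ((u - c * (c * u + - s * v)) / s) *
      F (u, (c * u - (c * u + - s * v)) / s)) \<partial>lborel) \<partial>lborel)"
    using s
    by (intro nn_integral_cong, intro nn_integral_real_affine) auto
  also have "\<dots> = (\<integral>\<^sup>+u. \<integral>\<^sup>+v. ?n u * ?n v * F (u, v) \<partial>lborel \<partial>lborel)"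
  proof -
    have 1: "(u - c * (c * u + - s * v)) / s = s * u + c * v" for u v
    proof -
      have "u - c * (c * u + - s * v) = (c\<^sup>2 + s\<^sup>2) * u - c * (c * u + - s * v)"
        using cs by simp
      then show ?thesis using s by (simp add: field_simps power2_eq_square)
    qed
    have 2: "(c * u - (c * u + - s * v)) / s = v" for u v
      using s by simp
    have 3: "?n (c * u + - s * v) * ?n (s * u + c * v) = ?n u * ?n v" for u v
      using dens[of u v] by (simp flip: ennreal_mult')
    show ?thesis
      unfolding 1 2 3 using s
      by (subst nn_integral_cmult) (auto simp flip: mult.assoc ennreal_mult' simp: divide_simps)
  qed
  also have "\<dots> = (\<integral>\<^sup>+x. \<integral>\<^sup>+z. F (x, z) \<partial>gauss \<partial>gauss)"
    by (simp add: nn_integral_gauss nn_integral_cmult mult.assoc)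
  finally show ?thesis .
qed

text \<open>The law of two standard normal variables with correlation cos \<theta>. An angle is the
  parameter because the \<theta>-derivative of cos \<theta> x + sin \<theta> z, namely cos \<theta>
  z - sin \<theta> x, is again standard normal and independent of it.\<close>

definition gauss_pair :: "real \<Rightarrow> (real \<times> real) measure" where
  "gauss_pair \<theta> = distr (gauss \<Otimes>\<^sub>M gauss) (borel \<Otimes>\<^sub>M borel) (\<lambda>(x, z). (x, cos \<theta> * x + sin \<theta> * z))"

lemma sets_gauss_pair [measurable_cong, simp]: "sets (gauss_pair \<theta>) = sets (borel \<Otimes>\<^sub>M borel)"
  by (simp add: gauss_pair_def)

lemma space_gauss_pair [simp]: "space (gauss_pair \<theta>) = UNIV"
  by (simp add: gauss_pair_def space_pair_measure)

interpretation gauss2: pair_prob_space gauss gauss ..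

lemma prob_space_gauss_pair: "prob_space (gauss_pair \<theta>)"
  unfolding gauss_pair_def by (rule gauss2.prob_space_distr) measurable

interpretation gauss_pair: prob_space "gauss_pair \<theta>" for \<theta>
  by (rule prob_space_gauss_pair)

lemma nn_integral_gauss_pair:
  fixes F :: "real \<times> real \<Rightarrow> ennreal"
  assumes [measurable]: "F \<in> borel_measurable (borel \<Otimes>\<^sub>M borel)"
  shows "(\<integral>\<^sup>+p. F p \<partial>gauss_pair \<theta>) =
    (\<integral>\<^sup>+x. \<integral>\<^sup>+z. F (x, cos \<theta> * x + sin \<theta> * z) \<partial>gauss \<partial>gauss)"
  unfolding gauss_pair_def
  by (subst nn_integral_distr) (auto simp: case_prod_beta' gauss.nn_integral_fst[symmetric])

text \<open>Rotating (x, z) to (y, w) makes the second component the free variable and recovers x as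
  cos \<theta> y - sin \<theta> w. The first component can then be integrated by parts in w while y
  is held fixed.\<close>

lemma nn_integral_gauss_pair_swap:
  fixes F :: "real \<times> real \<Rightarrow> ennreal"
  assumes [measurable]: "F \<in> borel_measurable (borel \<Otimes>\<^sub>M borel)" and "sin \<theta> \<noteq> 0"
  shows "(\<integral>\<^sup>+p. F p \<partial>gauss_pair \<theta>) =
    (\<integral>\<^sup>+y. \<integral>\<^sup>+w. F (cos \<theta> * y - sin \<theta> * w, y) \<partial>gauss \<partial>gauss)"
proof -
  have "cos \<theta> * (cos \<theta> * x + sin \<theta> * z) - sin \<theta> * (cos \<theta> * z - sin \<theta> * x) = ((cos \<theta>)\<^sup>2 + (sin \<theta>)\<^sup>2) * x" for x z
    by algebra
  then have eq: "cos \<theta> * (cos \<theta> * x + sin \<theta> * z) - sin \<theta> * (cos \<theta> * z - sin \<theta> * x) = x" for x z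
    by (simp only: sin_cos_squared_add2 mult_1)
  show ?thesis
    using nn_integral_gauss_rotate[of "\<lambda>(y, w). F (cos \<theta> * y - sin \<theta> * w, y)" "cos \<theta>" "sin \<theta>"] assms
    by (simp add: nn_integral_gauss_pair eq)
qed

lemma distr_gauss_pair_fst: "distr (gauss_pair \<theta>) gauss fst = gauss"
proof (rule measure_eqI)
  fix A assume "A \<in> sets (distr (gauss_pair \<theta>) gauss fst)"
  then have [measurable]: "A \<in> sets borel" by simp
  have "emeasure (distr (gauss_pair \<theta>) gauss fst) A = (\<integral>\<^sup>+p. indicator A (fst p) \<partial>gauss_pair \<theta>)"
    by (subst nn_integral_indicator[symmetric], simp, subst nn_integral_distr) auto
  also have "\<dots> = emeasure gauss A"
    by (simp add: nn_integral_gauss_pair)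
  finally show "emeasure (distr (gauss_pair \<theta>) gauss fst) A = emeasure gauss A" .
qed simp

lemma distr_gauss_pair_snd: "distr (gauss_pair \<theta>) gauss snd = gauss"
proof (rule measure_eqI)
  fix A assume "A \<in> sets (distr (gauss_pair \<theta>) gauss snd)"
  then have [measurable]: "A \<in> sets borel" by simp
  have "emeasure (distr (gauss_pair \<theta>) gauss snd) A = (\<integral>\<^sup>+p. indicator A (snd p) \<partial>gauss_pair \<theta>)"
    by (subst nn_integral_indicator[symmetric], simp, subst nn_integral_distr) auto
  also have "\<dots> = emeasure gauss A"
  proof (cases "sin \<theta> = 0")
    case False
    then show ?thesis
      by (simp add: nn_integral_gauss_pair_swap)
  next
    case True
    then have "cos \<theta> = 1 \<or> cos \<theta> = -1"
      using sin_zero_abs_cos_one by fastforce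
    then show ?thesis
    proof
      assume "cos \<theta> = -1"
      then show ?thesis
        using True nn_integral_gauss_minus[of "indicator A"] by (simp add: nn_integral_gauss_pair)
    qed (use True in \<open>simp add: nn_integral_gauss_pair gauss.emeasure_space_1\<close>)
  qed
  finally show "emeasure (distr (gauss_pair \<theta>) gauss snd) A = emeasure gauss A" .
qed simp

section \<open>Correlation inequality for one increasing and one decreasing function\<close>

lemma ennreal_rearrangement:
  fixes a b c d :: ennreal
  assumes "a \<le> b" "d \<le> c"
  shows "a * c + b * d \<le> a * d + b * c"
proof -
  obtain e k where "b = a + e" "c = d + k"
    using assms by (auto simp: le_iff_add)
  then have "a * d + b * c = (a * c + b * d) + e * k"
    by (simp add: algebra_simps)
  then show ?thesis
    by simp
qed

text \<open>The property in Harris's inequality. Values in \<open>ennreal\<close> spare all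
  integrability conditions, and a free order \<open>le\<close> lets the same notion serve for
  numbers, for pairs and for families of pairs.\<close>

definition neg_associated :: "('a \<Rightarrow> 'a \<Rightarrow> bool) \<Rightarrow> 'a measure \<Rightarrow> bool" where
  "neg_associated le M \<longleftrightarrow>
     (\<forall>A\<in>borel_measurable M. \<forall>B\<in>borel_measurable M.
        (\<forall>x\<in>space M. \<forall>y\<in>space M. le x y \<longrightarrow> A x \<le> A y \<and> B y \<le> B x) \<longrightarrow>
        (\<integral>\<^sup>+x. A x * B x \<partial>M) \<le> (\<integral>\<^sup>+x. A x \<partial>M) * (\<integral>\<^sup>+x. B x \<partial>M))"

lemma neg_associatedD:
  fixes A B :: "'a \<Rightarrow> ennreal"
  assumes "neg_associated le M" "A \<in> borel_measurable M" "B \<in> borel_measurable M"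
    and "\<And>x y. x \<in> space M \<Longrightarrow> y \<in> space M \<Longrightarrow> le x y \<Longrightarrow> A x \<le> A y"
    and "\<And>x y. x \<in> space M \<Longrightarrow> y \<in> space M \<Longrightarrow> le x y \<Longrightarrow> B y \<le> B x"
  shows "(\<integral>\<^sup>+x. A x * B x \<partial>M) \<le> (\<integral>\<^sup>+x. A x \<partial>M) * (\<integral>\<^sup>+x. B x \<partial>M)"
  using assms unfolding neg_associated_def by blast

lemma ennreal_add_self_le: "(a::ennreal) + a \<le> b + b \<Longrightarrow> a \<le> b"
  by (cases a; cases b) (auto simp flip: ennreal_plus simp: ennreal_le_iff top_unique)

text \<open>Chebyshev's argument with an independent copy y of x: integrate (A x - A y) (B x - B y)
  \<le> 0. The products are moved to opposite sides so that no subtraction occurs in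
  \<open>ennreal\<close>; integration gives twice the wanted inequality.\<close>

lemma neg_associated_linorder:
  fixes M :: "'a::linorder measure"
  assumes "prob_space M"
  shows "neg_associated (\<le>) M"
  unfolding neg_associated_def
proof (intro ballI impI)
  interpret prob_space M by fact
  interpret MM: pair_prob_space M M ..
  fix A B :: "'a \<Rightarrow> ennreal"
  assume [measurable]: "A \<in> borel_measurable M" "B \<in> borel_measurable M"
    and mono: "\<forall>x\<in>space M. \<forall>y\<in>space M. x \<le> y \<longrightarrow> A x \<le> A y \<and> B y \<le> B x"
  let ?I = "\<lambda>F. \<integral>\<^sup>+x. F x \<partial>M"
  have "A x * B x + A y * B y \<le> A x * B y + A y * B x"
    if "x \<in> space M" "y \<in> space M" for x y
    using mono that ennreal_rearrangement[of "A x" "A y" "B y" "B x"]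
      ennreal_rearrangement[of "A y" "A x" "B x" "B y"]
    by (metis add.commute linear)
  then have "(\<integral>\<^sup>+x. \<integral>\<^sup>+y. A x * B x + A y * B y \<partial>M \<partial>M) \<le> (\<integral>\<^sup>+x. \<integral>\<^sup>+y. A x * B y + A y * B x \<partial>M \<partial>M)"
    by (intro nn_integral_mono) simp
  then have "?I (\<lambda>x. A x * B x) + ?I (\<lambda>x. A x * B x) \<le> ?I A * ?I B + ?I A * ?I B"
    by (simp add: nn_integral_add nn_integral_cmult nn_integral_multc emeasure_space_1)
  then show "?I (\<lambda>x. A x * B x) \<le> ?I A * ?I B"
    by (rule ennreal_add_self_le)
qed

definition pair_le :: "real \<times> real \<Rightarrow> real \<times> real \<Rightarrow> bool" where
  "pair_le p q \<longleftrightarrow> fst p \<le> fst q \<and> snd p \<le> snd q"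

text \<open>With nonnegative cos \<theta> and sin \<theta>, both components are nondecreasing in the
  independent variables x and z. The one-dimensional inequality is used in z at fixed x and then for
  the conditional means, which inherit the monotonicity in x.\<close>

lemma neg_associated_gauss_pair:
  assumes "0 \<le> cos \<theta>" "0 \<le> sin \<theta>"
  shows "neg_associated pair_le (gauss_pair \<theta>)"
  unfolding neg_associated_def
proof (intro ballI impI)
  fix A B :: "real \<times> real \<Rightarrow> ennreal"
  assume "A \<in> borel_measurable (gauss_pair \<theta>)" "B \<in> borel_measurable (gauss_pair \<theta>)"
  then have [measurable]: "A \<in> borel_measurable (borel \<Otimes>\<^sub>M borel)" "B \<in> borel_measurable (borel \<Otimes>\<^sub>M borel)"
    by simp_all
  assume "\<forall>x\<in>space (gauss_pair \<theta>). \<forall>y\<in>space (gauss_pair \<theta>). pair_le x y \<longrightarrow> A x \<le> A y \<and> B y \<le> B x"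
  then have mono: "A (x, y) \<le> A (x', y')" "B (x', y') \<le> B (x, y)" if "x \<le> x'" "y \<le> y'" for x y x' y'
    using that by (simp_all add: pair_le_def)
  note harris = neg_associatedD[OF neg_associated_linorder[OF gauss.prob_space_axioms]]
  let ?A = "\<lambda>x z. A (x, cos \<theta> * x + sin \<theta> * z)" and ?B = "\<lambda>x z. B (x, cos \<theta> * x + sin \<theta> * z)"
  have "(\<integral>\<^sup>+p. A p * B p \<partial>gauss_pair \<theta>) = (\<integral>\<^sup>+x. \<integral>\<^sup>+z. ?A x z * ?B x z \<partial>gauss \<partial>gauss)"
    by (simp add: nn_integral_gauss_pair)
  also have "\<dots> \<le> (\<integral>\<^sup>+x. (\<integral>\<^sup>+z. ?A x z \<partial>gauss) * (\<integral>\<^sup>+z. ?B x z \<partial>gauss) \<partial>gauss)"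
    using assms by (intro nn_integral_mono harris mono add_mono mult_left_mono) simp_all
  also have "\<dots> \<le> (\<integral>\<^sup>+x. (\<integral>\<^sup>+z. ?A x z \<partial>gauss) \<partial>gauss) * (\<integral>\<^sup>+x. (\<integral>\<^sup>+z. ?B x z \<partial>gauss) \<partial>gauss)"
    using assms by (intro harris nn_integral_mono mono add_mono mult_left_mono) simp_all
  finally show "(\<integral>\<^sup>+p. A p * B p \<partial>gauss_pair \<theta>) \<le> (\<integral>\<^sup>+p. A p \<partial>gauss_pair \<theta>) * (\<integral>\<^sup>+p. B p \<partial>gauss_pair \<theta>)"
    by (simp add: nn_integral_gauss_pair)
qed

lemma nn_integral_PiM_empty: "(\<integral>\<^sup>+w. f w \<partial>PiM {} M) = f (\<lambda>_. undefined)"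
proof -
  have "(\<integral>\<^sup>+w. f w \<partial>PiM {} M) = (\<integral>\<^sup>+w. f (\<lambda>_. undefined) \<partial>PiM {} M)"
    by (intro nn_integral_cong) (simp add: space_PiM_empty)
  also have "\<dots> = f (\<lambda>_. undefined)"
    using emeasure_PiM_empty[of M] by (simp add: space_PiM_empty)
  finally show ?thesis .
qed

text \<open>Integrating out one coordinate preserves the monotonicity of \<open>A\<close> and
  \<open>B\<close> in the others, so the inequality tensorizes. Reflexivity of \<open>le\<close>
  permits varying one coordinate while the others stay fixed.\<close>

lemma neg_associated_PiM:
  assumes "finite I" and prob: "\<And>i. prob_space (M i)"
    and assoc: "\<And>i. i \<in> I \<Longrightarrow> neg_associated le (M i)" and le_refl: "\<And>x. le x x"
  shows "neg_associated (\<lambda>x y. \<forall>i\<in>I. le (x i) (y i)) (PiM I M)"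
  using \<open>finite I\<close> assoc
proof (induction I)
  case empty
  then show ?case
    by (simp add: neg_associated_def nn_integral_PiM_empty)
next
  case (insert i I)
  interpret product_prob_space M
    by (rule product_prob_spaceI) (rule prob)
  show ?case
    unfolding neg_associated_def
  proof (intro ballI impI)
    fix A B :: "('a \<Rightarrow> 'b) \<Rightarrow> ennreal"
    assume [measurable]: "A \<in> borel_measurable (PiM (insert i I) M)" "B \<in> borel_measurable (PiM (insert i I) M)"
    assume *: "\<forall>x\<in>space (PiM (insert i I) M). \<forall>y\<in>space (PiM (insert i I) M).
      (\<forall>j\<in>insert i I. le (x j) (y j)) \<longrightarrow> A x \<le> A y \<and> B y \<le> B x"
    have upd: "(w(i := a)) \<in> space (PiM (insert i I) M)" if "w \<in> space (PiM I M)" "a \<in> space (M i)" for w a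
      using that by (simp add: space_PiM PiE_fun_upd)
    have mono: "A (w(i := a)) \<le> A (w'(i := a'))" "B (w'(i := a')) \<le> B (w(i := a))"
      if "w \<in> space (PiM I M)" "a \<in> space (M i)" "w' \<in> space (PiM I M)" "a' \<in> space (M i)"
        "\<And>j. j \<in> I \<Longrightarrow> le (w j) (w' j)" "le a a'" for w a w' a'
    proof -
      have "\<forall>j\<in>insert i I. le ((w(i := a)) j) ((w'(i := a')) j)"
        using that(5,6) by simp
      then show "A (w(i := a)) \<le> A (w'(i := a'))" "B (w'(i := a')) \<le> B (w(i := a))"
        using * upd[OF that(1,2)] upd[OF that(3,4)] by blast+
    qed
    have "(\<integral>\<^sup>+w. A w * B w \<partial>PiM (insert i I) M) =
        (\<integral>\<^sup>+w. \<integral>\<^sup>+a. A (w(i := a)) * B (w(i := a)) \<partial>M i \<partial>PiM I M)"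
      using insert by (intro product_nn_integral_insert) auto
    also have "\<dots> \<le> (\<integral>\<^sup>+w. (\<integral>\<^sup>+a. A (w(i := a)) \<partial>M i) * (\<integral>\<^sup>+a. B (w(i := a)) \<partial>M i) \<partial>PiM I M)"
      using insert le_refl
      by (intro nn_integral_mono neg_associatedD[OF insert.prems] mono)
        (auto intro!: measurable_compose[OF measurable_component_update])
    also have "\<dots> \<le> (\<integral>\<^sup>+w. (\<integral>\<^sup>+a. A (w(i := a)) \<partial>M i) \<partial>PiM I M) * (\<integral>\<^sup>+w. (\<integral>\<^sup>+a. B (w(i := a)) \<partial>M i) \<partial>PiM I M)"
      using insert le_refl by (intro neg_associatedD[OF insert.IH] nn_integral_mono mono) auto
    also have "\<dots> = (\<integral>\<^sup>+w. A w \<partial>PiM (insert i I) M) * (\<integral>\<^sup>+w. B w \<partial>PiM (insert i I) M)"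
      using insert by (simp add: product_nn_integral_insert)
    finally show "(\<integral>\<^sup>+w. A w * B w \<partial>PiM (insert i I) M) \<le>
      (\<integral>\<^sup>+w. A w \<partial>PiM (insert i I) M) * (\<integral>\<^sup>+w. B w \<partial>PiM (insert i I) M)" .
  qed
qed

section \<open>Gaussian moments and the second-order expansion behind hypercontractivity\<close>

lemma integrable_gauss_iff:
  fixes f :: "real \<Rightarrow> real"
  assumes [measurable]: "f \<in> borel_measurable borel"
  shows "integrable gauss f \<longleftrightarrow> integrable lborel (\<lambda>x. std_normal_density x * f x)"
  unfolding gauss_def by (subst integrable_density) auto

lemma integral_gauss:
  fixes f :: "real \<Rightarrow> real"
  assumes [measurable]: "f \<in> borel_measurable borel"
  shows "(\<integral>x. f x \<partial>gauss) = (\<integral>x. std_normal_density x * f x \<partial>lborel)"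
  unfolding gauss_def by (subst integral_density) auto

lemma integrable_gauss_power [simp]: "integrable gauss (\<lambda>x. x ^ k)"
  by (subst integrable_gauss_iff) (use integrable_std_normal_moment[of k] in auto)

lemma integrable_gauss_id [simp]: "integrable gauss (\<lambda>x. x)"
  using integrable_gauss_power[of 1] by simp

lemma integral_gauss_id [simp]: "(\<integral>x. x \<partial>gauss) = 0"
  using integral_std_normal_moment_odd[of 0] by (subst integral_gauss) auto

lemma integral_gauss_square [simp]: "(\<integral>x. x\<^sup>2 \<partial>gauss) = 1"
  using integral_std_normal_moment_even[of 1] by (subst integral_gauss) auto

lemma gauss_pair_fst:
  fixes f :: "real \<Rightarrow> real"
  assumes [measurable]: "f \<in> borel_measurable borel"
  shows "integrable (gauss_pair \<theta>) (\<lambda>p. f (fst p)) \<longleftrightarrow> integrable gauss f"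
    and "(\<integral>p. f (fst p) \<partial>gauss_pair \<theta>) = (\<integral>x. f x \<partial>gauss)"
  using integrable_distr_eq[of fst "gauss_pair \<theta>" gauss f] integral_distr[of fst "gauss_pair \<theta>" gauss f]
  by (simp_all add: distr_gauss_pair_fst)

lemma gauss_pair_snd:
  fixes f :: "real \<Rightarrow> real"
  assumes [measurable]: "f \<in> borel_measurable borel"
  shows "integrable (gauss_pair \<theta>) (\<lambda>p. f (snd p)) \<longleftrightarrow> integrable gauss f"
    and "(\<integral>p. f (snd p) \<partial>gauss_pair \<theta>) = (\<integral>x. f x \<partial>gauss)"
  using integrable_distr_eq[of snd "gauss_pair \<theta>" gauss f] integral_distr[of snd "gauss_pair \<theta>" gauss f]
  by (simp_all add: distr_gauss_pair_snd)

lemma integrable_gauss_pair_prod: "integrable (gauss_pair \<theta>) (\<lambda>p. fst p * snd p)"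
proof (rule Bochner_Integration.integrable_bound)
  show "integrable (gauss_pair \<theta>) (\<lambda>p. (fst p)\<^sup>2 + (snd p)\<^sup>2)"
    by (simp add: gauss_pair_fst(1)[where f="\<lambda>x. x\<^sup>2"] gauss_pair_snd(1)[where f="\<lambda>x. x\<^sup>2"])
  show "AE p in gauss_pair \<theta>. norm (fst p * snd p) \<le> norm ((fst p)\<^sup>2 + (snd p)\<^sup>2)"
  proof (rule AE_I2)
    fix p :: "real \<times> real"
    have "2 * \<bar>fst p * snd p\<bar> \<le> (fst p)\<^sup>2 + (snd p)\<^sup>2"
      using sum_squares_bound[of "\<bar>fst p\<bar>" "\<bar>snd p\<bar>"] by (simp add: abs_mult)
    then show "norm (fst p * snd p) \<le> norm ((fst p)\<^sup>2 + (snd p)\<^sup>2)" by simp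
  qed
qed measurable

lemma integral_gauss_pair_prod: "(\<integral>p. fst p * snd p \<partial>gauss_pair \<theta>) = cos \<theta>"
proof -
  have int: "integrable (gauss \<Otimes>\<^sub>M gauss) (\<lambda>p. fst p * (cos \<theta> * fst p + sin \<theta> * snd p))"
    using integrable_gauss_pair_prod[of \<theta>] unfolding gauss_pair_def
    by (subst (asm) integrable_distr_eq) (auto simp: case_prod_beta')
  have "(\<integral>p. fst p * snd p \<partial>gauss_pair \<theta>) = (\<integral>p. fst p * (cos \<theta> * fst p + sin \<theta> * snd p) \<partial>(gauss \<Otimes>\<^sub>M gauss))"
    unfolding gauss_pair_def by (subst integral_distr) (auto simp: case_prod_beta')
  also have "\<dots> = (\<integral>x. \<integral>z. x * (cos \<theta> * x + sin \<theta> * z) \<partial>gauss \<partial>gauss)"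
    using gauss2.integral_fst'[OF int] by simp
  also have "\<dots> = (\<integral>x. cos \<theta> * x\<^sup>2 \<partial>gauss)"
    by (simp add: power2_eq_square gauss.prob_space[simplified] algebra_simps)
  also have "\<dots> = cos \<theta>" by simp
  finally show ?thesis .
qed

lemma powr_le_Taylor:
  fixes \<alpha> t :: real
  assumes "0 < \<alpha>" "\<alpha> < 1" "0 < t"
  shows "t powr \<alpha> \<le> 1 + \<alpha> * (t - 1) - \<alpha> * (1 - \<alpha>) / 2 * (t - 1)\<^sup>2 + \<bar>t - 1\<bar> ^ 3"
proof (cases "t = 1")
  case False
  define diff where "diff = (\<lambda>(m::nat) t. (\<Prod>i<m. \<alpha> - real i) * t powr (\<alpha> - real m))"
  let ?a = "min t 1 :: real" and ?b = "max t 1 :: real"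
  have "\<exists>\<xi>. (if t < 1 then t < \<xi> \<and> \<xi> < 1 else 1 < \<xi> \<and> \<xi> < t) \<and>
      t powr \<alpha> = (\<Sum>m<3::nat. diff m 1 / fact m * (t - 1) ^ m) + diff 3 \<xi> / fact 3 * (t - 1) ^ 3"
  proof (rule Taylor[where a="?a" and b="?b"])
    show "diff 0 = (\<lambda>t. t powr \<alpha>)" by (simp add: diff_def)
    show "\<forall>m x. m < 3 \<and> ?a \<le> x \<and> x \<le> ?b \<longrightarrow> (diff m has_real_derivative diff (Suc m) x) (at x)"
    proof (intro allI impI)
      fix m :: nat and x assume "m < 3 \<and> ?a \<le> x \<and> x \<le> ?b"
      then have "x > 0" using assms by auto
      then show "(diff m has_real_derivative diff (Suc m) x) (at x)"
        using DERIV_cmult[OF has_real_derivative_powr[of x "\<alpha> - real m"], of "\<Prod>i<m. \<alpha> - real i"]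
        by (simp add: diff_def algebra_simps)
    qed
  qed (use False in auto)
  then obtain \<xi> where \<xi>: "if t < 1 then t < \<xi> \<and> \<xi> < 1 else 1 < \<xi> \<and> \<xi> < t"
    "t powr \<alpha> = (\<Sum>m<3::nat. diff m 1 / fact m * (t - 1) ^ m) + diff 3 \<xi> / fact 3 * (t - 1) ^ 3"
    by blast
  have d3: "diff 3 \<xi> = \<alpha> * (1 - \<alpha>) * (2 - \<alpha>) * \<xi> powr (\<alpha> - 3)"
    by (simp add: diff_def eval_nat_numeral algebra_simps)
  have "diff 3 \<xi> / fact 3 * (t - 1) ^ 3 \<le> \<bar>t - 1\<bar> ^ 3"
  proof (cases "t < 1")
    case True
    then have "(t - 1) ^ 3 \<le> 0" by (simp add: power_le_zero_eq)
    moreover have "diff 3 \<xi> / fact 3 \<ge> 0" using assms by (simp add: d3)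
    ultimately show ?thesis
      by (smt (verit) mult_nonneg_nonpos zero_le_power abs_ge_zero)
  next
    case False
    then have "\<xi> powr (\<alpha> - 3) \<le> 1" using \<xi> assms
      by (smt (verit) powr_le_one_le powr_mono powr_zero_eq_one)
    moreover have "\<alpha> * (1 - \<alpha>) * (2 - \<alpha>) \<le> 1 * 1 * 2"
      using assms by (intro mult_mono) auto
    ultimately have "diff 3 \<xi> \<le> 2 * 1"
      unfolding d3 using assms by (intro mult_mono) auto
    then have "diff 3 \<xi> / fact 3 \<le> 1" by (simp add: fact_numeral)
    then show ?thesis
      using False mult_right_mono[of "diff 3 \<xi> / fact 3" 1 "(t - 1) ^ 3"] by simp
  qed
  moreover have "(\<Sum>m<3::nat. diff m 1 / fact m * (t - 1) ^ m) = 1 + \<alpha> * (t - 1) - \<alpha> * (1 - \<alpha>) / 2 * (t - 1)\<^sup>2"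
    by (simp add: diff_def eval_nat_numeral field_simps)
  ultimately show ?thesis using \<xi>(2) by linarith
qed (use assms in auto)

text \<open>Multiply the two one-variable bounds and absorb every term of total degree above two
  into the cubes. Terms of degree four to six also occur; the bound \<open>R\<close> on the
  variables reduces them to cubes and enters only the coefficient.\<close>

lemma powr_prod_le_Taylor:
  fixes \<alpha> u v R :: real
  assumes \<alpha>: "0 < \<alpha>" "\<alpha> < 1" and "-1 < u" "-1 < v" "\<bar>u\<bar> \<le> R" "\<bar>v\<bar> \<le> R"
  shows "((1 + u) * (1 + v)) powr \<alpha> \<le> 1 + \<alpha> * u + \<alpha> * v - \<alpha> * (1 - \<alpha>) / 2 * (u\<^sup>2 + v\<^sup>2) + \<alpha>\<^sup>2 * (u * v)
     + (10 + 10 * R ^ 3) * (\<bar>u\<bar> ^ 3 + \<bar>v\<bar> ^ 3)"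
proof -
  define \<beta> where "\<beta> = \<alpha> * (1 - \<alpha>) / 2"
  have \<beta>: "0 \<le> \<beta>" "\<beta> \<le> 1"
    using \<alpha> mult_mono[of \<alpha> 1 "1 - \<alpha>" 1] by (auto simp: \<beta>_def)
  define P where "P = (\<lambda>u. 1 + \<alpha> * u - \<beta> * u\<^sup>2 + \<bar>u\<bar> ^ 3)"
  have P: "(1 + u) powr \<alpha> \<le> P u" if "-1 < u" for u
    using powr_le_Taylor[OF \<alpha>, of "1 + u"] that by (simp add: P_def \<beta>_def)
  have R: "R \<ge> 0" using assms by linarith
  define U V where "U = \<bar>u\<bar>" and "V = \<bar>v\<bar>"
  have UV: "0 \<le> U" "0 \<le> V" "U \<le> R" "V \<le> R" using assms by (auto simp: U_def V_def)
  have mix: "U * V\<^sup>2 \<le> U ^ 3 + V ^ 3" "U\<^sup>2 * V \<le> U ^ 3 + V ^ 3"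
  proof -
    have "U * V\<^sup>2 \<le> U ^ 3 + V ^ 3 \<and> U\<^sup>2 * V \<le> U ^ 3 + V ^ 3"
    proof (cases "U \<le> V")
      case True
      then have "U * V\<^sup>2 \<le> V * V\<^sup>2" "U\<^sup>2 * V \<le> V\<^sup>2 * V" using UV by (auto intro!: mult_right_mono power_mono)
      moreover have "0 \<le> U ^ 3" using UV by simp
      ultimately show ?thesis by (simp add: power3_eq_cube power2_eq_square)
    next
      case False
      then have "U * V\<^sup>2 \<le> U * U\<^sup>2" "U\<^sup>2 * V \<le> U\<^sup>2 * U" using UV by (auto intro!: mult_left_mono power_mono)
      moreover have "0 \<le> V ^ 3" using UV by simp
      ultimately show ?thesis by (simp add: power3_eq_cube power2_eq_square)
    qed
    then show "U * V\<^sup>2 \<le> U ^ 3 + V ^ 3" "U\<^sup>2 * V \<le> U ^ 3 + V ^ 3" by auto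
  qed
  let ?S = "U ^ 3 + V ^ 3"
  have S0: "0 \<le> ?S" using UV by simp
  have Rpow: "R \<le> 1 + R ^ 3" "R\<^sup>2 \<le> 1 + R ^ 3"
  proof -
    show "R \<le> 1 + R ^ 3"
    proof (cases "R \<le> 1")
      case True then show ?thesis using R by (smt (verit) zero_le_power)
    next
      case False then have "R ^ 1 \<le> R ^ 3" by (intro power_increasing) auto
      then show ?thesis by simp
    qed
    show "R\<^sup>2 \<le> 1 + R ^ 3"
    proof (cases "R \<le> 1")
      case True then show ?thesis using R by (smt (verit) zero_le_power power_le_one)
    next
      case False then have "R ^ 2 \<le> R ^ 3" by (intro power_increasing) auto
      then show ?thesis by simp
    qed
  qed
  have small: "\<alpha> * x \<le> R" if "\<bar>x\<bar> \<le> R" for x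
    using \<alpha> that R by (smt (verit) mult_le_cancel_right1 mult_nonneg_nonpos)
  have r1: "U ^ 3 * P v \<le> ?S * (2 + 2 * R ^ 3)"
  proof -
    have "V ^ 3 \<le> R ^ 3" "0 \<le> \<beta> * v\<^sup>2" using UV \<beta> by (auto intro: power_mono)
    then have "P v \<le> 2 + 2 * R ^ 3"
      using small[of v] Rpow(1) assms(6) unfolding P_def V_def by linarith
    moreover have "U ^ 3 \<le> ?S" using UV by simp
    ultimately show ?thesis
      using S0 UV P[of v] assms by (intro mult_mono) (auto intro: order_trans[OF powr_ge_zero])
  qed
  have r2: "V ^ 3 * (1 + \<alpha> * u - \<beta> * u\<^sup>2) \<le> ?S * (2 + R ^ 3)"
  proof -
    have "0 \<le> \<beta> * u\<^sup>2" using \<beta> by simp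
    then have "1 + \<alpha> * u - \<beta> * u\<^sup>2 \<le> 2 + R ^ 3"
      using small[of u] Rpow(1) assms(5) by linarith
    then have "V ^ 3 * (1 + \<alpha> * u - \<beta> * u\<^sup>2) \<le> V ^ 3 * (2 + R ^ 3)"
      using UV by (intro mult_left_mono) auto
    also have "\<dots> \<le> ?S * (2 + R ^ 3)"
      using UV R by (intro mult_right_mono) auto
    finally show ?thesis .
  qed
  have r3: "- (\<alpha> * \<beta>) * (u * v\<^sup>2 + u\<^sup>2 * v) \<le> 2 * ?S"
  proof -
    have "\<bar>u * v\<^sup>2 + u\<^sup>2 * v\<bar> \<le> U * V\<^sup>2 + U\<^sup>2 * V"
      unfolding U_def V_def by (rule order_trans[OF abs_triangle_ineq]) (simp add: abs_mult)
    also have "\<dots> \<le> ?S + ?S" by (intro add_mono mix)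
    finally have "\<bar>u * v\<^sup>2 + u\<^sup>2 * v\<bar> \<le> 2 * ?S" by simp
    moreover have "0 \<le> \<alpha> * \<beta>" "\<alpha> * \<beta> \<le> 1" using \<alpha> \<beta> by (auto intro: mult_le_one)
    ultimately have "(\<alpha> * \<beta>) * \<bar>u * v\<^sup>2 + u\<^sup>2 * v\<bar> \<le> 1 * (2 * ?S)"
      by (intro mult_mono) auto
    then show ?thesis
      using \<open>0 \<le> \<alpha> * \<beta>\<close> by (smt (verit) abs_ge_minus_self mult_left_mono mult_minus_left mult_minus_right)
  qed
  have r4: "\<beta>\<^sup>2 * (u\<^sup>2 * v\<^sup>2) \<le> ?S * (1 + R ^ 3)"
  proof -
    have "\<beta>\<^sup>2 * (u\<^sup>2 * v\<^sup>2) \<le> 1 * (u\<^sup>2 * v\<^sup>2)"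
      using \<beta> by (intro mult_right_mono power_le_one) auto
    also have "\<dots> = (U * V\<^sup>2) * U" by (simp add: U_def V_def power2_eq_square)
    also have "\<dots> \<le> ?S * R" using UV mix S0 by (intro mult_mono) auto
    also have "\<dots> \<le> ?S * (1 + R ^ 3)" using S0 Rpow by (intro mult_left_mono) auto
    finally show ?thesis .
  qed
  have "((1 + u) * (1 + v)) powr \<alpha> = (1 + u) powr \<alpha> * (1 + v) powr \<alpha>"
    using assms by (simp add: powr_mult)
  also have "\<dots> \<le> P u * P v"
    using P[of u] P[of v] assms by (intro mult_mono) (auto intro: order_trans[OF powr_ge_zero])
  also have "\<dots> = 1 + \<alpha> * u + \<alpha> * v - \<beta> * (u\<^sup>2 + v\<^sup>2) + \<alpha>\<^sup>2 * (u * v)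
      + (U ^ 3 * P v + V ^ 3 * (1 + \<alpha> * u - \<beta> * u\<^sup>2)
        + - (\<alpha> * \<beta>) * (u * v\<^sup>2 + u\<^sup>2 * v) + \<beta>\<^sup>2 * (u\<^sup>2 * v\<^sup>2))"
    unfolding P_def U_def[symmetric] V_def[symmetric] by algebra
  also have "\<dots> \<le> 1 + \<alpha> * u + \<alpha> * v - \<beta> * (u\<^sup>2 + v\<^sup>2) + \<alpha>\<^sup>2 * (u * v)
      + (10 + 10 * R ^ 3) * ?S"
  proof -
    have "?S * (2 + 2 * R ^ 3) + ?S * (2 + R ^ 3) + 2 * ?S + ?S * (1 + R ^ 3) = ?S * (7 + 4 * R ^ 3)"
      by (simp add: algebra_simps)
    also have "\<dots> \<le> ?S * (10 + 10 * R ^ 3)" using S0 R by (intro mult_left_mono) auto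
    finally show ?thesis using r1 r2 r3 r4 by (simp only: mult.commute[of "10 + 10 * R ^ 3"])
  qed
  finally show ?thesis by (simp only: \<beta>_def U_def V_def)
qed

text \<open>Here u and v stand for relative fluctuations over a step of length \<delta>, with linear
  parts a \<delta> X and b \<delta> Y and errors of order \<delta>^2. Substitution leaves a
  quadratic form in (a X, b Y) of order \<delta>^2 and an error of order \<delta>^3. The weight (1 +
  X^2)^3 dominates all error terms and has a finite Gaussian integral.\<close>

lemma second_order_pointwise:
  fixes u v a b X Y \<delta> E \<alpha> \<beta> K :: real
  assumes u: "\<bar>u - a * \<delta> * X\<bar> \<le> E * \<delta>\<^sup>2 * (1 + X\<^sup>2)" and v: "\<bar>v - b * \<delta> * Y\<bar> \<le> E * \<delta>\<^sup>2 * (1 + Y\<^sup>2)"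
    and ab: "\<bar>a\<bar> \<le> E" "\<bar>b\<bar> \<le> E" and \<delta>: "0 \<le> \<delta>" "\<delta> \<le> 1" and E: "0 \<le> E"
    and \<alpha>: "0 \<le> \<alpha>" "\<alpha> \<le> 1" "0 \<le> \<beta>" "\<beta> \<le> 1" "0 \<le> K"
  shows "- \<beta> * (u\<^sup>2 + v\<^sup>2) + \<alpha>\<^sup>2 * (u * v) + K * (\<bar>u\<bar> ^ 3 + \<bar>v\<bar> ^ 3) \<le>
    \<delta>\<^sup>2 * (\<alpha>\<^sup>2 * (a * b) * (X * Y) - \<beta> * (a\<^sup>2 * X\<^sup>2 + b\<^sup>2 * Y\<^sup>2))
      + \<delta> ^ 3 * ((5 * E\<^sup>2 + 8 * E ^ 3 * K) * ((1 + X\<^sup>2) ^ 3 + (1 + Y\<^sup>2) ^ 3))"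
proof -
  have cube: "w \<le> w ^ 3" "w\<^sup>2 \<le> w ^ 3" if "1 \<le> w" for w :: real
    using that power_increasing[of 1 3 w] power_increasing[of 2 3 w] by auto
  have abs1: "\<bar>w\<bar> \<le> 1 + w\<^sup>2" for w :: real
    using zero_le_power2[of "\<bar>w\<bar> - 1 / 2"] by (simp add: power2_diff field_simps)
  have d32: "\<delta> ^ 3 \<le> \<delta>\<^sup>2" "\<delta>\<^sup>2 \<le> \<delta>" "0 \<le> \<delta> ^ 3" "\<delta> ^ 4 \<le> \<delta> ^ 3"
    using \<delta> power_decreasing[of 2 3 \<delta>] power_decreasing[of 1 2 \<delta>] power_decreasing[of 3 4 \<delta>] by auto
  define P Q where "P = 1 + X\<^sup>2" and "Q = 1 + Y\<^sup>2"
  have PQ: "1 \<le> P" "1 \<le> Q" "\<bar>X\<bar> \<le> P" "\<bar>Y\<bar> \<le> Q"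
    using abs1 by (auto simp: P_def Q_def)
  have sq: "\<delta>\<^sup>2 * (a\<^sup>2 * X\<^sup>2) - 2 * E\<^sup>2 * \<delta> ^ 3 * (1 + X\<^sup>2) ^ 3 \<le> u\<^sup>2"
    if u: "\<bar>u - a * \<delta> * X\<bar> \<le> E * \<delta>\<^sup>2 * (1 + X\<^sup>2)" and a: "\<bar>a\<bar> \<le> E" for u a X
  proof -
    define r where "r = u - a * \<delta> * X"
    have "\<bar>(a * \<delta> * X) * r\<bar> \<le> (E * \<delta> * (1 + X\<^sup>2)) * (E * \<delta>\<^sup>2 * (1 + X\<^sup>2))"
      unfolding abs_mult using u a \<delta> E abs1[of X] by (intro mult_mono) (auto simp: r_def)
    also have "\<dots> = E\<^sup>2 * \<delta> ^ 3 * (1 + X\<^sup>2)\<^sup>2"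
      by (simp add: power2_eq_square power3_eq_cube algebra_simps)
    also have "\<dots> \<le> E\<^sup>2 * \<delta> ^ 3 * (1 + X\<^sup>2) ^ 3"
      using cube(2)[of "1 + X\<^sup>2"] d32 by (intro mult_left_mono) auto
    finally have "- (2 * E\<^sup>2 * \<delta> ^ 3 * (1 + X\<^sup>2) ^ 3) \<le> 2 * ((a * \<delta> * X) * r)" by linarith
    moreover have "u\<^sup>2 = (a * \<delta> * X)\<^sup>2 + 2 * ((a * \<delta> * X) * r) + r\<^sup>2"
      by (simp add: r_def power2_eq_square algebra_simps)
    moreover have "(a * \<delta> * X)\<^sup>2 = \<delta>\<^sup>2 * (a\<^sup>2 * X\<^sup>2)" by (simp add: power_mult_distrib)
    moreover have "0 \<le> r\<^sup>2" by simp
    ultimately show ?thesis by linarith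
  qed
  have absu: "\<bar>u\<bar> \<le> 2 * E * \<delta> * (1 + X\<^sup>2)"
    if u: "\<bar>u - a * \<delta> * X\<bar> \<le> E * \<delta>\<^sup>2 * (1 + X\<^sup>2)" and a: "\<bar>a\<bar> \<le> E" for u a X
  proof -
    have "\<bar>a * \<delta> * X\<bar> \<le> E * \<delta> * (1 + X\<^sup>2)"
      using mult_mono[OF mult_right_mono[OF a \<delta>(1)] abs1[of X] _ abs_ge_zero] \<delta> E
      by (simp add: abs_mult)
    moreover have "E * \<delta>\<^sup>2 * (1 + X\<^sup>2) \<le> E * \<delta> * (1 + X\<^sup>2)"
      by (intro mult_right_mono mult_left_mono d32(2) E add_nonneg_nonneg zero_le_one zero_le_power2)
    ultimately show ?thesis using u by linarith
  qed
  have cb: "\<bar>u\<bar> ^ 3 \<le> 8 * E ^ 3 * \<delta> ^ 3 * (1 + X\<^sup>2) ^ 3"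
    if u: "\<bar>u - a * \<delta> * X\<bar> \<le> E * \<delta>\<^sup>2 * (1 + X\<^sup>2)" and a: "\<bar>a\<bar> \<le> E" for u a X
    using power_mono[OF absu[OF that], of 3] by (simp add: power_mult_distrib)
  have uv: "u * v \<le> \<delta>\<^sup>2 * ((a * b) * (X * Y)) + 3 * E\<^sup>2 * \<delta> ^ 3 * (P ^ 3 + Q ^ 3)"
  proof -
    define r q where "r = u - a * \<delta> * X" and "q = v - b * \<delta> * Y"
    have rq: "\<bar>r\<bar> \<le> E * \<delta>\<^sup>2 * P" "\<bar>q\<bar> \<le> E * \<delta>\<^sup>2 * Q" using u v by (auto simp: r_def q_def P_def Q_def)
    have PQ3: "P * Q \<le> P ^ 3 + Q ^ 3"
    proof -
      have "P * Q \<le> P\<^sup>2 + Q\<^sup>2" using sum_squares_bound[of P Q] mult_nonneg_nonneg[of P Q] PQ by linarith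
      then show ?thesis using cube(2)[of P] cube(2)[of Q] PQ by linarith
    qed
    define S where "S = E\<^sup>2 * \<delta> ^ 3 * (P * Q)"
    have n: "0 \<le> E * \<delta> * P" "0 \<le> E * \<delta> * Q" "0 \<le> E * \<delta>\<^sup>2 * P" 
      by (intro mult_nonneg_nonneg E \<delta> zero_le_power order_trans[OF zero_le_one PQ(1)] order_trans[OF zero_le_one PQ(2)])+
    have aX: "\<bar>a * \<delta> * X\<bar> \<le> E * \<delta> * P" and bY: "\<bar>b * \<delta> * Y\<bar> \<le> E * \<delta> * Q"
      using mult_mono[OF mult_right_mono[OF ab(1) \<delta>(1)] PQ(3) _ abs_ge_zero]
        mult_mono[OF mult_right_mono[OF ab(2) \<delta>(1)] PQ(4) _ abs_ge_zero] \<delta> E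
      by (simp_all add: abs_mult)
    have h1: "a * \<delta> * X * q \<le> S"
    proof -
      have "a * \<delta> * X * q \<le> \<bar>a * \<delta> * X\<bar> * \<bar>q\<bar>" by (metis abs_ge_self abs_mult)
      also have "\<dots> \<le> (E * \<delta> * P) * (E * \<delta>\<^sup>2 * Q)"
        by (rule mult_mono[OF aX rq(2) n(1) abs_ge_zero])
      also have "\<dots> = S" by (simp add: S_def power2_eq_square power3_eq_cube)
      finally show ?thesis .
    qed
    have h2: "b * \<delta> * Y * r \<le> S"
    proof -
      have "b * \<delta> * Y * r \<le> \<bar>b * \<delta> * Y\<bar> * \<bar>r\<bar>" by (metis abs_ge_self abs_mult)
      also have "\<dots> \<le> (E * \<delta> * Q) * (E * \<delta>\<^sup>2 * P)"
        by (rule mult_mono[OF bY rq(1) n(2) abs_ge_zero])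
      also have "\<dots> = S" by (simp add: S_def power2_eq_square power3_eq_cube)
      finally show ?thesis .
    qed
    have h3: "r * q \<le> S"
    proof -
      have "r * q \<le> \<bar>r\<bar> * \<bar>q\<bar>" by (metis abs_ge_self abs_mult)
      also have "\<dots> \<le> (E * \<delta>\<^sup>2 * P) * (E * \<delta>\<^sup>2 * Q)"
        by (rule mult_mono[OF rq(1) rq(2) n(3) abs_ge_zero])
      also have "\<dots> = E\<^sup>2 * \<delta> ^ 4 * (P * Q)"
        by (simp add: power2_eq_square eval_nat_numeral)
      also have "\<dots> \<le> S"
        unfolding S_def
        by (intro mult_right_mono mult_left_mono d32(4) zero_le_power2 mult_nonneg_nonneg
            order_trans[OF zero_le_one PQ(1)] order_trans[OF zero_le_one PQ(2)])
      finally show ?thesis .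
    qed
    have S: "S \<le> E\<^sup>2 * \<delta> ^ 3 * (P ^ 3 + Q ^ 3)" (is "_ \<le> ?V")
      unfolding S_def by (rule mult_left_mono[OF PQ3]) (use d32 in simp)
    have "u * v = \<delta>\<^sup>2 * ((a * b) * (X * Y)) + a * \<delta> * X * q + b * \<delta> * Y * r + r * q"
      unfolding r_def q_def by algebra
    also have "\<dots> \<le> \<delta>\<^sup>2 * ((a * b) * (X * Y)) + S + S + S"
      by (intro add_mono order_refl h1 h2 h3)
    also have "\<dots> \<le> \<delta>\<^sup>2 * ((a * b) * (X * Y)) + ?V + ?V + ?V"
      by (intro add_mono order_refl S)
    also have "\<dots> = \<delta>\<^sup>2 * ((a * b) * (X * Y)) + 3 * E\<^sup>2 * \<delta> ^ 3 * (P ^ 3 + Q ^ 3)"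
      by algebra
    finally show ?thesis .
  qed
  define G T F A W where "G = P ^ 3 + Q ^ 3" and "T = E\<^sup>2 * \<delta> ^ 3 * G"
    and "F = E ^ 3 * \<delta> ^ 3 * G" and "A = a\<^sup>2 * X\<^sup>2 + b\<^sup>2 * Y\<^sup>2" and "W = (a * b) * (X * Y)"
  have "0 \<le> G" using PQ by (simp add: G_def)
  then have T: "0 \<le> T" using d32(3) by (simp add: T_def)
  have "\<delta>\<^sup>2 * A = \<delta>\<^sup>2 * (a\<^sup>2 * X\<^sup>2) + \<delta>\<^sup>2 * (b\<^sup>2 * Y\<^sup>2)"
    "2 * T = 2 * E\<^sup>2 * \<delta> ^ 3 * P ^ 3 + 2 * E\<^sup>2 * \<delta> ^ 3 * Q ^ 3"
    unfolding A_def T_def G_def by algebra+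
  then have "\<delta>\<^sup>2 * A - 2 * T \<le> u\<^sup>2 + v\<^sup>2"
    using sq[OF u ab(1)] sq[OF v ab(2)] unfolding P_def[symmetric] Q_def[symmetric] by linarith
  then have "\<beta> * (\<delta>\<^sup>2 * A - 2 * T) \<le> \<beta> * (u\<^sup>2 + v\<^sup>2)"
    by (rule mult_left_mono) (rule \<alpha>)
  moreover have "\<beta> * (\<delta>\<^sup>2 * A - 2 * T) = \<beta> * (\<delta>\<^sup>2 * A) - 2 * (\<beta> * T)" by algebra
  moreover have "\<beta> * T \<le> T" by (rule mult_left_le_one_le[OF T \<alpha>(3,4)])
  ultimately have t1: "- \<beta> * (u\<^sup>2 + v\<^sup>2) \<le> - (\<beta> * (\<delta>\<^sup>2 * A)) + 2 * T"
    unfolding mult_minus_left by linarith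
  have "u * v \<le> \<delta>\<^sup>2 * W + 3 * T"
    using uv unfolding W_def T_def G_def by (simp only: mult.assoc)
  then have "\<alpha>\<^sup>2 * (u * v) \<le> \<alpha>\<^sup>2 * (\<delta>\<^sup>2 * W + 3 * T)"
    by (rule mult_left_mono) simp
  moreover have "\<alpha>\<^sup>2 * (\<delta>\<^sup>2 * W + 3 * T) = \<alpha>\<^sup>2 * (\<delta>\<^sup>2 * W) + 3 * (\<alpha>\<^sup>2 * T)" by algebra
  moreover have "\<alpha>\<^sup>2 * T \<le> T"
    using \<alpha> by (intro mult_left_le_one_le[OF T] power_le_one) simp_all
  ultimately have t2: "\<alpha>\<^sup>2 * (u * v) \<le> \<alpha>\<^sup>2 * (\<delta>\<^sup>2 * W) + 3 * T" by linarith
  have "8 * E ^ 3 * \<delta> ^ 3 * P ^ 3 + 8 * E ^ 3 * \<delta> ^ 3 * Q ^ 3 = 8 * F"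
    unfolding F_def G_def by algebra
  then have "\<bar>u\<bar> ^ 3 + \<bar>v\<bar> ^ 3 \<le> 8 * F"
    using cb[OF u ab(1)] cb[OF v ab(2)] unfolding P_def[symmetric] Q_def[symmetric] by linarith
  then have t3: "K * (\<bar>u\<bar> ^ 3 + \<bar>v\<bar> ^ 3) \<le> K * (8 * F)"
    by (rule mult_left_mono) (rule \<alpha>)
  have "- \<beta> * (u\<^sup>2 + v\<^sup>2) + \<alpha>\<^sup>2 * (u * v) + K * (\<bar>u\<bar> ^ 3 + \<bar>v\<bar> ^ 3)
      \<le> (- (\<beta> * (\<delta>\<^sup>2 * A)) + 2 * T) + (\<alpha>\<^sup>2 * (\<delta>\<^sup>2 * W) + 3 * T) + K * (8 * F)"
    by (intro add_mono t1 t2 t3)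
  also have "\<dots> = \<delta>\<^sup>2 * (\<alpha>\<^sup>2 * (a * b) * (X * Y) - \<beta> * (a\<^sup>2 * X\<^sup>2 + b\<^sup>2 * Y\<^sup>2))
      + \<delta> ^ 3 * ((5 * E\<^sup>2 + 8 * E ^ 3 * K) * (P ^ 3 + Q ^ 3))"
    unfolding A_def W_def T_def F_def G_def by algebra
  finally show ?thesis unfolding P_def Q_def .
qed

text \<open>The function \<open>f1\<close> acts as the derivative of \<open>f\<close>, but is tied
  to it only by a quadratic Taylor bound. In this form the property passes to averages without
  differentiation under the integral and with unchanged constants, so that the one-step bound can be
  iterated any number of times.\<close>

definition C2_bounded :: "real \<Rightarrow> real \<Rightarrow> real \<Rightarrow> (real \<Rightarrow> real) \<Rightarrow> (real \<Rightarrow> real) \<Rightarrow> bool" where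
  "C2_bounded \<epsilon> M D f f1 \<longleftrightarrow> f \<in> borel_measurable borel \<and> f1 \<in> borel_measurable borel \<and>
     (\<forall>x. \<epsilon> \<le> f x \<and> f x \<le> M \<and> \<bar>f1 x\<bar> \<le> D) \<and>
     (\<forall>x u. \<bar>f (x + u) - f x - f1 x * u\<bar> \<le> D * u\<^sup>2)"

lemma integrable_gauss_bounded:
  fixes f :: "real \<Rightarrow> real"
  assumes "f \<in> borel_measurable borel" "\<And>x. \<bar>f x\<bar> \<le> B"
  shows "integrable gauss f"
  by (rule gauss.integrable_const_bound[of _ B]) (use assms in auto)

lemma integral_gauss_bounds:
  fixes f :: "real \<Rightarrow> real"
  assumes "f \<in> borel_measurable borel" "\<And>x. a \<le> f x" "\<And>x. f x \<le> b"
  shows "a \<le> (\<integral>x. f x \<partial>gauss)" "(\<integral>x. f x \<partial>gauss) \<le> b"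
proof -
  have f: "integrable gauss f"
  proof (rule integrable_gauss_bounded)
    fix x show "\<bar>f x\<bar> \<le> \<bar>a\<bar> + \<bar>b\<bar>" using assms(2)[of x] assms(3)[of x] by linarith
  qed (use assms in simp)
  show "a \<le> (\<integral>x. f x \<partial>gauss)" using f assms by (intro gauss.integral_ge_const) auto
  show "(\<integral>x. f x \<partial>gauss) \<le> b" using f assms by (intro gauss.integral_le_const) auto
qed

lemma C2_bounded_integrable:
  assumes "C2_bounded \<epsilon> M D f f1"
  shows "integrable gauss (\<lambda>z. f (x + \<delta> * z))" "integrable gauss (\<lambda>z. f1 (x + \<delta> * z))"
proof -
  have [measurable]: "f \<in> borel_measurable borel" "f1 \<in> borel_measurable borel"
    using assms by (auto simp: C2_bounded_def)
  show "integrable gauss (\<lambda>z. f1 (x + \<delta> * z))"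
    using assms by (intro integrable_gauss_bounded[of _ D]) (auto simp: C2_bounded_def)
  have "\<epsilon> \<le> f y" "f y \<le> M" for y
    using assms by (auto simp: C2_bounded_def)
  then have "\<bar>f y\<bar> \<le> \<bar>\<epsilon>\<bar> + \<bar>M\<bar>" for y
    by (smt (verit, best))
  then show "integrable gauss (\<lambda>z. f (x + \<delta> * z))"
    by (intro integrable_gauss_bounded[of _ "\<bar>\<epsilon>\<bar> + \<bar>M\<bar>"]) auto
qed

lemma C2_bounded_average:
  assumes "C2_bounded \<epsilon> M D f f1"
  shows "C2_bounded \<epsilon> M D (\<lambda>x. \<integral>z. f (x + \<delta> * z) \<partial>gauss) (\<lambda>x. \<integral>z. f1 (x + \<delta> * z) \<partial>gauss)"
proof -
  note int = C2_bounded_integrable[OF assms, of _ \<delta>]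
  have [measurable]: "f \<in> borel_measurable borel" "f1 \<in> borel_measurable borel"
    using assms by (auto simp: C2_bounded_def)
  have b: "\<epsilon> \<le> f x" "f x \<le> M" "-D \<le> f1 x" "f1 x \<le> D" "\<bar>f (x + u) - f x - f1 x * u\<bar> \<le> D * u\<^sup>2" for x u
    using assms by (auto simp: C2_bounded_def abs_le_iff minus_le_iff)
  have "\<bar>(\<integral>z. f (x + u + \<delta> * z) \<partial>gauss) - (\<integral>z. f (x + \<delta> * z) \<partial>gauss) - (\<integral>z. f1 (x + \<delta> * z) \<partial>gauss) * u\<bar> \<le> D * u\<^sup>2" for x u
  proof -
    have pt: "\<bar>f (x + u + \<delta> * z) - f (x + \<delta> * z) - f1 (x + \<delta> * z) * u\<bar> \<le> D * u\<^sup>2" for z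
      using b(5)[of "x + \<delta> * z" u] by (simp add: add.assoc add.commute add.left_commute)
    let ?d = "\<lambda>z. f (x + u + \<delta> * z) - f (x + \<delta> * z) - f1 (x + \<delta> * z) * u"
    have "(\<integral>z. f (x + u + \<delta> * z) \<partial>gauss) - (\<integral>z. f (x + \<delta> * z) \<partial>gauss) - (\<integral>z. f1 (x + \<delta> * z) \<partial>gauss) * u
        = (\<integral>z. ?d z \<partial>gauss)"
      using int[of "x + u"] int[of x] by simp
    moreover have "\<bar>\<integral>z. ?d z \<partial>gauss\<bar> \<le> (\<integral>z. \<bar>?d z\<bar> \<partial>gauss)"
      by (rule integral_abs_bound)
    moreover have "(\<integral>z. \<bar>?d z\<bar> \<partial>gauss) \<le> (\<integral>z. D * u\<^sup>2 \<partial>gauss)"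
      using pt int[of "x + u"] int[of x] by (intro integral_mono) auto
    moreover have "(\<integral>z. D * u\<^sup>2 \<partial>gauss) = D * u\<^sup>2" by (simp add: gauss.prob_space[simplified])
    ultimately show ?thesis by linarith
  qed
  moreover have "\<epsilon> \<le> (\<integral>z. f (x + \<delta> * z) \<partial>gauss)" "(\<integral>z. f (x + \<delta> * z) \<partial>gauss) \<le> M"
    "- D \<le> (\<integral>z. f1 (x + \<delta> * z) \<partial>gauss)" "(\<integral>z. f1 (x + \<delta> * z) \<partial>gauss) \<le> D" for x
    using b(1-4) by (auto intro!: integral_gauss_bounds)
  moreover have "(\<lambda>x. \<integral>z. f (x + \<delta> * z) \<partial>gauss) \<in> borel_measurable borel"
    "(\<lambda>x. \<integral>z. f1 (x + \<delta> * z) \<partial>gauss) \<in> borel_measurable borel"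
    by measurable
  ultimately show ?thesis
    by (simp add: C2_bounded_def abs_le_iff minus_le_iff)
qed

text \<open>The linear term has integral 0, so the mean over a Gaussian step differs from
  \<open>f x\<close> only by order \<delta>^2 and may replace it in the first-order
  expansion.\<close>

lemma C2_bounded_deviation:
  assumes "C2_bounded \<epsilon> M D f f1"
  shows "\<bar>f (x + \<delta> * z) - (\<integral>z. f (x + \<delta> * z) \<partial>gauss) - f1 x * (\<delta> * z)\<bar> \<le> D * \<delta>\<^sup>2 * (1 + z\<^sup>2)"
proof -
  note int = C2_bounded_integrable[OF assms, of _ \<delta>]
  have [measurable]: "f \<in> borel_measurable borel" "f1 \<in> borel_measurable borel"
    using assms by (auto simp: C2_bounded_def)
  have b: "\<bar>f (x + \<delta> * z) - f x - f1 x * (\<delta> * z)\<bar> \<le> D * \<delta>\<^sup>2 * z\<^sup>2" for z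
    using assms by (metis C2_bounded_def mult.assoc power_mult_distrib)
  have "(\<integral>z. f (x + \<delta> * z) \<partial>gauss) - f x = (\<integral>z. f (x + \<delta> * z) - f x - f1 x * (\<delta> * z) \<partial>gauss)"
    using int by (simp add: gauss.prob_space[simplified])
  also have "\<bar>\<dots>\<bar> \<le> (\<integral>z. \<bar>f (x + \<delta> * z) - f x - f1 x * (\<delta> * z)\<bar> \<partial>gauss)"
    by (rule integral_abs_bound)
  also have "\<dots> \<le> (\<integral>z. D * \<delta>\<^sup>2 * z\<^sup>2 \<partial>gauss)"
    using b int by (intro integral_mono) auto
  also have "\<dots> = D * \<delta>\<^sup>2" by simp
  finally show ?thesis
    using b[of z] unfolding distrib_left mult_1_right by linarith
qed

text \<open>After division by the means the first-order terms integrate to 0, and the term of order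
  \<delta>^2 is \<alpha>^2 cos \<theta> a b - \<beta> (a^2 + b^2) with \<beta> = \<alpha> (1 -
  \<alpha>) / 2. It is nonpositive because \<alpha> cos \<theta> \<le> 1 - \<alpha>; for \<alpha> =
  1/p this is the hypercontractive condition p \<ge> 1 + cos \<theta>. What is left is of order
  \<delta>^3, and \<open>C\<close> depends neither on the functions nor on the base points.\<close>

lemma hypercontractive_one_step:
  fixes \<alpha> \<epsilon> M D \<theta> :: real
  assumes \<alpha>: "0 < \<alpha>" "\<alpha> < 1" and \<theta>: "0 \<le> cos \<theta>" "\<alpha> * (1 + cos \<theta>) \<le> 1"
    and \<epsilon>: "0 < \<epsilon>" "\<epsilon> \<le> M" "0 \<le> D"
  shows "\<exists>C\<ge>0. \<forall>f f1 g g1 x y \<delta>. C2_bounded \<epsilon> M D f f1 \<longrightarrow> C2_bounded \<epsilon> M D g g1 \<longrightarrow> 0 \<le> \<delta> \<longrightarrow> \<delta> \<le> 1 \<longrightarrow>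
    (\<integral>p. (f (x + \<delta> * fst p) * g (y + \<delta> * snd p)) powr \<alpha> \<partial>gauss_pair \<theta>) \<le>
      ((\<integral>z. f (x + \<delta> * z) \<partial>gauss) * (\<integral>z. g (y + \<delta> * z) \<partial>gauss)) powr \<alpha> + C * \<delta> ^ 3"
proof -
  define \<beta> where "\<beta> = \<alpha> * (1 - \<alpha>) / 2"
  have \<beta>: "0 \<le> \<beta>" "\<beta> \<le> 1"
    using \<alpha> mult_mono[of \<alpha> 1 "1 - \<alpha>" 1] by (auto simp: \<beta>_def)
  define E R where "E = D / \<epsilon>" and "R = M / \<epsilon>"
  have E: "0 \<le> E" and R: "1 \<le> R" using \<epsilon> by (simp_all add: E_def R_def)
  define K where "K = 10 + 10 * R ^ 3"
  have K: "0 \<le> K" using R by (simp add: K_def)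
  define C0 where "C0 = 5 * E\<^sup>2 + 8 * E ^ 3 * K"
  have C0: "0 \<le> C0" using E K by (simp add: C0_def)
  define H :: "real \<Rightarrow> real" where "H = (\<lambda>x. (1 + x\<^sup>2) ^ 3)"
  have H_eq: "H = (\<lambda>x. 1 + 3 * x ^ 2 + 3 * x ^ 4 + x ^ 6)"
    unfolding H_def by (rule ext) algebra
  have [measurable]: "H \<in> borel_measurable borel" by (simp add: H_def)
  have H: "integrable gauss H" unfolding H_eq by simp
  have H0: "0 \<le> (\<integral>x. H x \<partial>gauss)" by (simp add: H_def)
  let ?C = "(M * M) powr \<alpha> * (2 * C0 * (\<integral>x. H x \<partial>gauss))"
  show ?thesis
  proof (intro exI[of _ ?C] conjI allI impI)
    show "0 \<le> ?C" using C0 H0 by simp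
    fix f f1 g g1 :: "real \<Rightarrow> real" and x y \<delta> :: real
    assume f: "C2_bounded \<epsilon> M D f f1" and g: "C2_bounded \<epsilon> M D g g1" and \<delta>: "0 \<le> \<delta>" "\<delta> \<le> 1"
    have [measurable]: "f \<in> borel_measurable borel" "g \<in> borel_measurable borel"
      using f g by (auto simp: C2_bounded_def)
    define m n where "m = (\<integral>z. f (x + \<delta> * z) \<partial>gauss)" and "n = (\<integral>z. g (y + \<delta> * z) \<partial>gauss)"
    have mn: "\<epsilon> \<le> m" "m \<le> M" "\<epsilon> \<le> n" "n \<le> M"
      using C2_bounded_average[OF f, of \<delta>] C2_bounded_average[OF g, of \<delta>]
      by (auto simp: C2_bounded_def m_def n_def)
    have mn0: "0 < m" "0 < n" using mn \<epsilon> by auto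
    \<comment> \<open>Division by the means makes \<open>u\<close> and \<open>v\<close> integrate to
      0; by homogeneity of the power, the factor (m n)^\<alpha> is restored at the end.\<close>
    define u v where "u = (\<lambda>z. f (x + \<delta> * z) / m - 1)" and "v = (\<lambda>z. g (y + \<delta> * z) / n - 1)"
    have [measurable]: "u \<in> borel_measurable borel" "v \<in> borel_measurable borel"
      by (simp_all add: u_def v_def)
    define a b where "a = f1 x / m" and "b = g1 y / n"
    have quot: "-1 < h / k - 1 \<and> \<bar>h / k - 1\<bar> \<le> R" if "\<epsilon> \<le> h" "h \<le> M" "\<epsilon> \<le> k" "k \<le> M" for h k
    proof -
      have "0 < h / k" using that \<epsilon> by simp
      moreover have "h / k \<le> R" unfolding R_def using that \<epsilon> by (intro frac_le) auto
      ultimately show ?thesis using R by linarith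
    qed
    have uv: "-1 < u z" "\<bar>u z\<bar> \<le> R" "-1 < v z" "\<bar>v z\<bar> \<le> R" for z
      using f g quot[OF _ _ mn(1,2)] quot[OF _ _ mn(3,4)] by (auto simp: u_def v_def C2_bounded_def)
    have dev: "\<bar>h / k - 1 - c / k * \<delta> * z\<bar> \<le> E * \<delta>\<^sup>2 * (1 + z\<^sup>2)"
      if "\<bar>h - k - c * (\<delta> * z)\<bar> \<le> D * \<delta>\<^sup>2 * (1 + z\<^sup>2)" "\<epsilon> \<le> k" for h k c z
    proof -
      have k: "0 < k" using that \<epsilon> by auto
      then have "h / k - 1 - c / k * \<delta> * z = (h - k - c * (\<delta> * z)) / k"
        by (simp add: field_simps)
      then have "\<bar>h / k - 1 - c / k * \<delta> * z\<bar> = \<bar>h - k - c * (\<delta> * z)\<bar> / k"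
        using k by simp
      also have "\<dots> \<le> (D * \<delta>\<^sup>2 * (1 + z\<^sup>2)) / \<epsilon>"
        using that k \<epsilon> by (intro frac_le) auto
      finally show ?thesis by (simp add: E_def)
    qed
    have du: "\<bar>u z - a * \<delta> * z\<bar> \<le> E * \<delta>\<^sup>2 * (1 + z\<^sup>2)" "\<bar>v z - b * \<delta> * z\<bar> \<le> E * \<delta>\<^sup>2 * (1 + z\<^sup>2)" for z
      using dev[OF C2_bounded_deviation[OF f, of x \<delta> z]] dev[OF C2_bounded_deviation[OF g, of y \<delta> z]] mn
      by (simp_all add: u_def v_def a_def b_def m_def n_def)
    have ab: "\<bar>a\<bar> \<le> E" "\<bar>b\<bar> \<le> E"
    proof -
      have "\<bar>f1 x\<bar> \<le> D" "\<bar>g1 y\<bar> \<le> D" using f g by (simp_all add: C2_bounded_def)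
      then show "\<bar>a\<bar> \<le> E" "\<bar>b\<bar> \<le> E"
        using frac_le[of D "\<bar>f1 x\<bar>" \<epsilon> m] frac_le[of D "\<bar>g1 y\<bar>" \<epsilon> n] mn mn0 \<epsilon>
        by (simp_all add: a_def b_def E_def)
    qed
    let ?X = "fst :: real \<times> real \<Rightarrow> real" and ?Y = "snd :: real \<times> real \<Rightarrow> real"
    let ?P = "gauss_pair \<theta>"
    have iu: "integrable gauss u" "integrable gauss v"
      using uv by (auto intro!: integrable_gauss_bounded[of _ R])
    have mean: "(\<integral>z. u z \<partial>gauss) = 0" "(\<integral>z. v z \<partial>gauss) = 0"
      using C2_bounded_integrable(1)[OF f, of x \<delta>] C2_bounded_integrable(1)[OF g, of y \<delta>] mn0
      by (simp_all add: u_def v_def gauss.prob_space[simplified] flip: m_def n_def)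
    have int: "integrable ?P (\<lambda>p. u (?X p))" "integrable ?P (\<lambda>p. v (?Y p))"
      "integrable ?P (\<lambda>p. H (?X p))" "integrable ?P (\<lambda>p. H (?Y p))"
      "integrable ?P (\<lambda>p. (?X p)\<^sup>2)" "integrable ?P (\<lambda>p. (?Y p)\<^sup>2)"
      using iu H by (simp_all add: gauss_pair_fst gauss_pair_snd gauss_pair_fst(1)[of "\<lambda>x. x\<^sup>2"] gauss_pair_snd(1)[of "\<lambda>x. x\<^sup>2"])
    note int' = int integrable_gauss_pair_prod[of \<theta>]
    have ev: "(\<integral>p. u (?X p) \<partial>?P) = 0" "(\<integral>p. v (?Y p) \<partial>?P) = 0"
      "(\<integral>p. H (?X p) \<partial>?P) = (\<integral>x. H x \<partial>gauss)" "(\<integral>p. H (?Y p) \<partial>?P) = (\<integral>x. H x \<partial>gauss)"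
      "(\<integral>p. (?X p)\<^sup>2 \<partial>?P) = 1" "(\<integral>p. (?Y p)\<^sup>2 \<partial>?P) = 1"
      by (simp_all add: gauss_pair_fst gauss_pair_snd mean gauss_pair_fst(2)[of "\<lambda>x. x\<^sup>2"] gauss_pair_snd(2)[of "\<lambda>x. x\<^sup>2"])
    let ?L = "\<lambda>p. ((1 + u (?X p)) * (1 + v (?Y p))) powr \<alpha>"
    let ?Q = "\<lambda>p. \<alpha>\<^sup>2 * (a * b) * (?X p * ?Y p) - \<beta> * (a\<^sup>2 * (?X p)\<^sup>2 + b\<^sup>2 * (?Y p)\<^sup>2)"
    let ?U = "\<lambda>p. 1 + \<alpha> * u (?X p) + \<alpha> * v (?Y p) + (\<delta>\<^sup>2 * ?Q p + \<delta> ^ 3 * (C0 * (H (?X p) + H (?Y p))))"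
    have pw: "?L p \<le> ?U p" for p
    proof -
      have "?L p \<le> 1 + \<alpha> * u (?X p) + \<alpha> * v (?Y p) - \<beta> * ((u (?X p))\<^sup>2 + (v (?Y p))\<^sup>2) + \<alpha>\<^sup>2 * (u (?X p) * v (?Y p))
          + K * (\<bar>u (?X p)\<bar> ^ 3 + \<bar>v (?Y p)\<bar> ^ 3)"
        using powr_prod_le_Taylor[OF \<alpha> uv(1)[of "?X p"] uv(3)[of "?Y p"] uv(2)[of "?X p"] uv(4)[of "?Y p"]]
        by (simp only: \<beta>_def K_def)
      moreover have "- \<beta> * ((u (?X p))\<^sup>2 + (v (?Y p))\<^sup>2) + \<alpha>\<^sup>2 * (u (?X p) * v (?Y p)) + K * (\<bar>u (?X p)\<bar> ^ 3 + \<bar>v (?Y p)\<bar> ^ 3)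
        \<le> \<delta>\<^sup>2 * ?Q p + \<delta> ^ 3 * (C0 * (H (?X p) + H (?Y p)))"
        unfolding H_def C0_def using \<alpha>
        by (intro second_order_pointwise du ab \<delta> E \<beta> K) auto
      ultimately show ?thesis unfolding mult_minus_left by linarith
    qed
    have intU: "integrable ?P ?U" using int' by simp
    have "(\<integral>p. ?L p \<partial>?P) \<le> (\<integral>p. ?U p \<partial>?P)"
      by (rule integral_mono'[OF intU pw order_trans[OF powr_ge_zero pw]])
    also have "\<dots> = 1 + (\<delta>\<^sup>2 * (\<alpha>\<^sup>2 * (a * b) * cos \<theta> - \<beta> * (a\<^sup>2 + b\<^sup>2)) + \<delta> ^ 3 * (C0 * (2 * (\<integral>x. H x \<partial>gauss))))"
      using int' by (simp add: ev integral_gauss_pair_prod gauss_pair.prob_space[simplified])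
    also have "\<dots> \<le> 1 + 2 * C0 * (\<integral>x. H x \<partial>gauss) * \<delta> ^ 3"
    proof -
      have "2 * \<beta> = \<alpha> * (1 - \<alpha>)" by (simp add: \<beta>_def)
      moreover have "\<alpha> * (\<alpha> * cos \<theta>) \<le> \<alpha> * (1 - \<alpha>)"
        using \<alpha> \<theta> by (intro mult_left_mono) (auto simp: algebra_simps)
      ultimately have 1: "\<alpha>\<^sup>2 * cos \<theta> \<le> 2 * \<beta>" by (simp add: power2_eq_square)
      have 2: "2 * \<bar>a * b\<bar> \<le> a\<^sup>2 + b\<^sup>2"
        using sum_squares_bound[of "\<bar>a\<bar>" "\<bar>b\<bar>"] by (simp add: abs_mult)
      have "\<alpha>\<^sup>2 * (a * b) * cos \<theta> \<le> (\<alpha>\<^sup>2 * cos \<theta>) * \<bar>a * b\<bar>"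
        using mult_left_mono[OF abs_ge_self[of "a * b"], of "\<alpha>\<^sup>2 * cos \<theta>"] \<theta> by (simp add: mult.commute mult.left_commute)
      also have "\<dots> \<le> (2 * \<beta>) * \<bar>a * b\<bar>" using 1 by (intro mult_right_mono) auto
      also have "\<dots> \<le> \<beta> * (a\<^sup>2 + b\<^sup>2)" using mult_left_mono[OF 2 \<beta>(1)] by (simp add: mult.assoc mult.left_commute)
      finally have "\<delta>\<^sup>2 * (\<alpha>\<^sup>2 * (a * b) * cos \<theta> - \<beta> * (a\<^sup>2 + b\<^sup>2)) \<le> 0"
        by (intro mult_nonneg_nonpos) auto
      then show ?thesis by (simp add: ac_simps)
    qed
    finally have main: "(\<integral>p. ?L p \<partial>?P) \<le> 1 + 2 * C0 * (\<integral>x. H x \<partial>gauss) * \<delta> ^ 3" .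
    have "(\<integral>p. (f (x + \<delta> * ?X p) * g (y + \<delta> * ?Y p)) powr \<alpha> \<partial>?P) = (\<integral>p. (m * n) powr \<alpha> * ?L p \<partial>?P)"
      using mn0 by (intro Bochner_Integration.integral_cong)
        (auto simp: u_def v_def powr_mult[symmetric] less_imp_le)
    also have "\<dots> = (m * n) powr \<alpha> * (\<integral>p. ?L p \<partial>?P)" by simp
    also have "\<dots> \<le> (m * n) powr \<alpha> * (1 + 2 * C0 * (\<integral>x. H x \<partial>gauss) * \<delta> ^ 3)"
      using main by (rule mult_left_mono) simp
    also have "\<dots> = (m * n) powr \<alpha> + (m * n) powr \<alpha> * (2 * C0 * (\<integral>x. H x \<partial>gauss) * \<delta> ^ 3)"
      by (simp add: distrib_left)
    also have "(m * n) powr \<alpha> * (2 * C0 * (\<integral>x. H x \<partial>gauss) * \<delta> ^ 3) \<le> (M * M) powr \<alpha> * (2 * C0 * (\<integral>x. H x \<partial>gauss) * \<delta> ^ 3)"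
    proof (rule mult_right_mono)
      have "m * n \<le> M * M" using mn mn0 by (intro mult_mono) simp_all
      then show "(m * n) powr \<alpha> \<le> (M * M) powr \<alpha>" using mn0 \<alpha> by (intro powr_mono2) simp_all
    qed (use C0 H0 \<delta> in simp)
    finally show "(\<integral>p. (f (x + \<delta> * fst p) * g (y + \<delta> * snd p)) powr \<alpha> \<partial>gauss_pair \<theta>) \<le>
      ((\<integral>z. f (x + \<delta> * z) \<partial>gauss) * (\<integral>z. g (y + \<delta> * z) \<partial>gauss)) powr \<alpha> + ?C * \<delta> ^ 3"
      unfolding m_def n_def by (simp only: mult.assoc)
  qed
qed

lemma emeasure_gauss_pair_UNIV [simp]: "emeasure (gauss_pair \<theta>) UNIV = 1"
  using gauss_pair.emeasure_space_1[of \<theta>] by simp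

lemma gauss_stable:
  fixes F :: "real \<Rightarrow> ennreal"
  assumes [measurable]: "F \<in> borel_measurable borel" and r: "a\<^sup>2 + b\<^sup>2 = r\<^sup>2" and "b \<noteq> 0"
  shows "(\<integral>\<^sup>+p. \<integral>\<^sup>+q. F (a * p + b * q) \<partial>gauss \<partial>gauss) = (\<integral>\<^sup>+p. F (r * p) \<partial>gauss)"
proof -
  have "r \<noteq> 0" using r \<open>b \<noteq> 0\<close> by (auto simp: sum_power2_eq_zero_iff)
  then have "(a / r)\<^sup>2 + (b / r)\<^sup>2 = 1" using r by (simp add: power_divide flip: add_divide_distrib)
  from nn_integral_gauss_rotate[of "\<lambda>(u, v). F (r * u)", OF _ this] \<open>r \<noteq> 0\<close> \<open>b \<noteq> 0\<close>
  show ?thesis by (simp add: distrib_left)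
qed

lemma gauss_stable_integral:
  fixes f :: "real \<Rightarrow> real"
  assumes [measurable]: "f \<in> borel_measurable borel" and f: "\<And>x. 0 \<le> f x" "\<And>x. f x \<le> M"
    and r: "a\<^sup>2 + b\<^sup>2 = r\<^sup>2" "b \<noteq> 0"
  shows "(\<integral>p. \<integral>q. f (x + a * p + b * q) \<partial>gauss \<partial>gauss) = (\<integral>p. f (x + r * p) \<partial>gauss)"
proof -
  have conv: "(\<integral>\<^sup>+p. ennreal (h p) \<partial>gauss) = ennreal (\<integral>p. h p \<partial>gauss)"
    if [measurable]: "h \<in> borel_measurable borel" and "\<And>p. 0 \<le> h p" "\<And>p. h p \<le> M" for h
    using that by (intro nn_integral_eq_integral integrable_gauss_bounded[of _ M]) (auto simp: abs_of_nonneg)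
  have "ennreal (\<integral>p. \<integral>q. f (x + a * p + b * q) \<partial>gauss \<partial>gauss) = (\<integral>\<^sup>+p. \<integral>\<^sup>+q. ennreal (f (x + a * p + b * q)) \<partial>gauss \<partial>gauss)"
  proof -
    have "(\<integral>\<^sup>+q. ennreal (f (x + a * p + b * q)) \<partial>gauss) = ennreal (\<integral>q. f (x + a * p + b * q) \<partial>gauss)" for p
      using f by (intro conv) auto
    moreover have "(\<integral>\<^sup>+p. ennreal (\<integral>q. f (x + a * p + b * q) \<partial>gauss) \<partial>gauss) = ennreal (\<integral>p. \<integral>q. f (x + a * p + b * q) \<partial>gauss \<partial>gauss)"
      using f by (intro conv integral_gauss_bounds[of _ 0 M]) measurable
    ultimately show ?thesis by simp
  qed
  also have "\<dots> = (\<integral>\<^sup>+p. ennreal (f (x + r * p)) \<partial>gauss)"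
    using gauss_stable[of "\<lambda>t. ennreal (f (x + t))", OF _ r] by (simp add: add.assoc)
  also have "\<dots> = ennreal (\<integral>p. f (x + r * p) \<partial>gauss)" using f by (intro conv) auto
  finally show ?thesis using f by (simp add: integral_nonneg_AE)
qed

text \<open>A sum of two independent scaled copies of a correlated pair is again such a pair, with
  the same angle. One more increment of size \<delta> after N earlier ones thus amounts to a single
  pair of scale sqrt (N + 1) \<delta>.\<close>

lemma gauss_pair_stable:
  fixes F :: "real \<times> real \<Rightarrow> ennreal"
  assumes [measurable]: "F \<in> borel_measurable (borel \<Otimes>\<^sub>M borel)" and r: "a\<^sup>2 + b\<^sup>2 = r\<^sup>2" "b \<noteq> 0"
  shows "(\<integral>\<^sup>+p. \<integral>\<^sup>+q. F (a * fst p + b * fst q, a * snd p + b * snd q) \<partial>gauss_pair \<theta> \<partial>gauss_pair \<theta>)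
    = (\<integral>\<^sup>+p. F (r * fst p, r * snd p) \<partial>gauss_pair \<theta>)"
proof -
  let ?C = "cos \<theta>" and ?S = "sin \<theta>"
  have "(\<integral>\<^sup>+p. \<integral>\<^sup>+q. F (a * fst p + b * fst q, a * snd p + b * snd q) \<partial>gauss_pair \<theta> \<partial>gauss_pair \<theta>)
    = (\<integral>\<^sup>+x. \<integral>\<^sup>+z. \<integral>\<^sup>+x'. \<integral>\<^sup>+z'. F (a * x + b * x', a * (?C * x + ?S * z) + b * (?C * x' + ?S * z'))
        \<partial>gauss \<partial>gauss \<partial>gauss \<partial>gauss)"
    by (simp add: nn_integral_gauss_pair)
  also have "\<dots> = (\<integral>\<^sup>+x. \<integral>\<^sup>+x'. \<integral>\<^sup>+z. \<integral>\<^sup>+z'. F (a * x + b * x', a * (?C * x + ?S * z) + b * (?C * x' + ?S * z'))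
        \<partial>gauss \<partial>gauss \<partial>gauss \<partial>gauss)"
    by (intro nn_integral_cong gauss2.Fubini') measurable
  also have "\<dots> = (\<integral>\<^sup>+x. \<integral>\<^sup>+x'. \<integral>\<^sup>+z. \<integral>\<^sup>+z'. F (a * x + b * x', ?C * (a * x + b * x') + ?S * (a * z + b * z'))
        \<partial>gauss \<partial>gauss \<partial>gauss \<partial>gauss)"
    by (simp add: algebra_simps)
  also have "\<dots> = (\<integral>\<^sup>+x. \<integral>\<^sup>+x'. \<integral>\<^sup>+z. F (a * x + b * x', ?C * (a * x + b * x') + ?S * (r * z))
        \<partial>gauss \<partial>gauss \<partial>gauss)"
    by (intro nn_integral_cong gauss_stable[OF _ r, of "\<lambda>t. F (u, ?C * u + ?S * t)" for u]) measurable
  also have "\<dots> = (\<integral>\<^sup>+x. \<integral>\<^sup>+z. F (r * x, ?C * (r * x) + ?S * (r * z)) \<partial>gauss \<partial>gauss)"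
    by (intro gauss_stable[OF _ r, of "\<lambda>t. \<integral>\<^sup>+z. F (t, ?C * t + ?S * (r * z)) \<partial>gauss"]) measurable
  also have "\<dots> = (\<integral>\<^sup>+p. F (r * fst p, r * snd p) \<partial>gauss_pair \<theta>)"
    by (simp add: nn_integral_gauss_pair algebra_simps)
  finally show ?thesis .
qed

text \<open>The pair is split into N independent increments of size \<delta> = 1 / sqrt N. Each
  costs an error C \<delta>^3, so the total N C \<delta>^3 = C / sqrt N vanishes in the limit. Sums
  of Gaussian increments are exactly Gaussian, hence no central limit theorem is involved.\<close>

lemma hypercontractive_C2:
  fixes \<alpha> \<epsilon> M D \<theta> :: real
  assumes \<alpha>: "0 < \<alpha>" "\<alpha> < 1" and \<theta>: "0 \<le> cos \<theta>" "\<alpha> * (1 + cos \<theta>) \<le> 1"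
    and \<epsilon>: "0 < \<epsilon>" "\<epsilon> \<le> M" "0 \<le> D"
    and fg: "C2_bounded \<epsilon> M D f f1" "C2_bounded \<epsilon> M D g g1"
  shows "(\<integral>p. (f (fst p) * g (snd p)) powr \<alpha> \<partial>gauss_pair \<theta>) \<le>
    ((\<integral>z. f z \<partial>gauss) * (\<integral>z. g z \<partial>gauss)) powr \<alpha>"
proof -
  obtain C where C: "C \<ge> 0" and step: "\<And>f f1 g g1 x y \<delta>. C2_bounded \<epsilon> M D f f1 \<Longrightarrow> C2_bounded \<epsilon> M D g g1 \<Longrightarrow> 0 \<le> \<delta> \<Longrightarrow> \<delta> \<le> 1 \<Longrightarrow>
    (\<integral>p. (f (x + \<delta> * fst p) * g (y + \<delta> * snd p)) powr \<alpha> \<partial>gauss_pair \<theta>) \<le>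
      ((\<integral>z. f (x + \<delta> * z) \<partial>gauss) * (\<integral>z. g (y + \<delta> * z) \<partial>gauss)) powr \<alpha> + C * \<delta> ^ 3"
    using hypercontractive_one_step[OF \<alpha> \<theta> \<epsilon>] by blast
  have meas: "f \<in> borel_measurable borel" if "C2_bounded \<epsilon> M D f f1" for f f1
    using that by (simp add: C2_bounded_def)
  have bd: "0 \<le> f x" "f x \<le> M" "\<epsilon> \<le> f x" if "C2_bounded \<epsilon> M D f f1" for f f1 x
    using that \<epsilon> by (auto simp: C2_bounded_def intro: order_trans[of 0 \<epsilon>])
  have conv: "(\<integral>\<^sup>+p. ennreal ((f (x + r * fst p) * g (y + r * snd p)) powr \<alpha>) \<partial>gauss_pair \<theta>)
      = ennreal (\<integral>p. (f (x + r * fst p) * g (y + r * snd p)) powr \<alpha> \<partial>gauss_pair \<theta>)"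
    if f: "C2_bounded \<epsilon> M D f f1" and g: "C2_bounded \<epsilon> M D g g1" for f f1 g g1 x y r
  proof -
    note [measurable] = meas[OF f] meas[OF g]
    have "(f s * g t) powr \<alpha> \<le> (M * M) powr \<alpha>" for s t
      using bd[OF f] bd[OF g] \<alpha> by (intro powr_mono2 mult_mono) (auto intro: order_trans)
    then show ?thesis
      by (intro nn_integral_eq_integral gauss_pair.integrable_const_bound[where B="(M * M) powr \<alpha>"]) auto
  qed
  \<comment> \<open>The last increment is integrated first: the one-step bound replaces
    \<open>f\<close> and \<open>g\<close> by their averages, which lie in the same class, and the
    induction hypothesis applies to these averages.\<close>
  have iter: "(\<integral>\<^sup>+p. ennreal ((f (x + sqrt (real N) * \<delta> * fst p) * g (y + sqrt (real N) * \<delta> * snd p)) powr \<alpha>) \<partial>gauss_pair \<theta>)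
      \<le> ennreal (((\<integral>z. f (x + sqrt (real N) * \<delta> * z) \<partial>gauss) * (\<integral>z. g (y + sqrt (real N) * \<delta> * z) \<partial>gauss)) powr \<alpha> + real N * (C * \<delta> ^ 3))"
    if \<delta>: "0 < \<delta>" "\<delta> \<le> 1" and f: "C2_bounded \<epsilon> M D f f1" and g: "C2_bounded \<epsilon> M D g g1"
    for N \<delta> f f1 g g1 x y
    using f g
  proof (induction N arbitrary: f f1 g g1 x y)
    case 0
    then show ?case by (simp add: gauss.prob_space[simplified])
  next
    case (Suc N)
    note f = Suc.prems(1) and g = Suc.prems(2)
    note [measurable] = meas[OF f] meas[OF g]
    let ?a = "sqrt (real N) * \<delta>" and ?r = "sqrt (real (Suc N)) * \<delta>"
    have r: "?a\<^sup>2 + \<delta>\<^sup>2 = ?r\<^sup>2" "\<delta> \<noteq> 0" using \<delta> by (auto simp: power_mult_distrib algebra_simps)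
    let ?Qf = "\<lambda>x. \<integral>z. f (x + \<delta> * z) \<partial>gauss" and ?Qg = "\<lambda>x. \<integral>z. g (x + \<delta> * z) \<partial>gauss"
    note Qf = C2_bounded_average[OF f, of \<delta>] and Qg = C2_bounded_average[OF g, of \<delta>]
    note [measurable] = meas[OF Qf] meas[OF Qg]
    have "(\<integral>\<^sup>+p. ennreal ((f (x + ?r * fst p) * g (y + ?r * snd p)) powr \<alpha>) \<partial>gauss_pair \<theta>)
      = (\<integral>\<^sup>+p. \<integral>\<^sup>+q. ennreal ((f ((x + ?a * fst p) + \<delta> * fst q) * g ((y + ?a * snd p) + \<delta> * snd q)) powr \<alpha>) \<partial>gauss_pair \<theta> \<partial>gauss_pair \<theta>)"
      using gauss_pair_stable[OF _ r, of "\<lambda>(s, t). ennreal ((f (x + s) * g (y + t)) powr \<alpha>)" \<theta>]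
      by (simp add: add.assoc)
    also have "\<dots> \<le> (\<integral>\<^sup>+p. ennreal ((?Qf (x + ?a * fst p) * ?Qg (y + ?a * snd p)) powr \<alpha>) + ennreal (C * \<delta> ^ 3) \<partial>gauss_pair \<theta>)"
      using step[OF f g, of \<delta>] \<delta> C
      by (intro nn_integral_mono) (simp add: conv[OF f g] flip: ennreal_plus)
    also have "\<dots> = (\<integral>\<^sup>+p. ennreal ((?Qf (x + ?a * fst p) * ?Qg (y + ?a * snd p)) powr \<alpha>) \<partial>gauss_pair \<theta>) + ennreal (C * \<delta> ^ 3)"
      using gauss_pair.emeasure_space_1 by (subst nn_integral_add) auto
    also have "\<dots> \<le> ennreal (((\<integral>z. ?Qf (x + ?a * z) \<partial>gauss) * (\<integral>z. ?Qg (y + ?a * z) \<partial>gauss)) powr \<alpha> + real N * (C * \<delta> ^ 3)) + ennreal (C * \<delta> ^ 3)"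
      by (intro add_right_mono Suc.IH[OF Qf Qg])
    also have "\<dots> = ennreal (((\<integral>z. f (x + ?r * z) \<partial>gauss) * (\<integral>z. g (y + ?r * z) \<partial>gauss)) powr \<alpha> + real (Suc N) * (C * \<delta> ^ 3))"
      using gauss_stable_integral[OF meas[OF f] bd(1,2)[OF f] r, of x] gauss_stable_integral[OF meas[OF g] bd(1,2)[OF g] r, of y] C \<delta>
      by (simp add: algebra_simps flip: ennreal_plus)
    finally show ?case .
  qed
  let ?L = "\<integral>p. (f (fst p) * g (snd p)) powr \<alpha> \<partial>gauss_pair \<theta>"
  let ?R = "((\<integral>z. f z \<partial>gauss) * (\<integral>z. g z \<partial>gauss)) powr \<alpha>"
  have "?L \<le> ?R + C * (1 / sqrt (real (Suc N)))" for N
  proof -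
    define \<delta> where "\<delta> = 1 / sqrt (real (Suc N))"
    have \<delta>: "0 < \<delta>" "\<delta> \<le> 1" "sqrt (real (Suc N)) * \<delta> = 1" by (simp_all add: \<delta>_def)
    have "real (Suc N) * \<delta>\<^sup>2 = 1" by (simp add: \<delta>_def power_divide)
    then have d: "real (Suc N) * (C * \<delta> ^ 3) = C * \<delta>"
      by (simp add: power3_eq_cube power2_eq_square algebra_simps)
    have "ennreal ?L \<le> ennreal (?R + C * \<delta>)"
      using iter[OF \<delta>(1,2) fg, where N="Suc N" and x=0 and y=0] conv[OF fg, of 0 1 0] by (simp add: \<delta>(3) d del: of_nat_Suc)
    then have "?L \<le> ?R + C * \<delta>" using C \<delta>(1) by (subst (asm) ennreal_le_iff) simp_all
    then show ?thesis by (simp add: \<delta>_def)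
  qed
  moreover have "(\<lambda>N. ?R + C * (1 / sqrt (real (Suc N)))) \<longlonglongrightarrow> ?R + C * 0"
    by (intro tendsto_intros) real_asymp
  ultimately show ?thesis
    by (intro LIMSEQ_le_const[of "\<lambda>N. ?R + C * (1 / sqrt (real (Suc N)))"]) auto
qed

text \<open>With f = F^p, g = G^p and \<alpha> = 1/p for nonnegative F and G this reads E[F(X) G(Y)]
  \<le> ||F||_p ||G||_p for a pair (X, Y) of correlation cos \<theta>: Gaussian hypercontractivity
  in bilinear form. The right-hand side contains plain integrals of f and g, so averaging over one
  coordinate fits into an induction.\<close>

definition two_function_bound :: "real \<Rightarrow> real \<Rightarrow> (real \<Rightarrow> real) \<Rightarrow> (real \<Rightarrow> real) \<Rightarrow> bool" where
  "two_function_bound \<alpha> \<theta> f g \<longleftrightarrow>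
     (\<integral>p. (f (fst p) * g (snd p)) powr \<alpha> \<partial>gauss_pair \<theta>) \<le> ((\<integral>x. f x \<partial>gauss) * (\<integral>x. g x \<partial>gauss)) powr \<alpha>"

section \<open>From C^2 functions to bounded measurable functions\<close>

lemma two_function_bound_limit:
  fixes F G :: "nat \<Rightarrow> real \<Rightarrow> real"
  assumes \<alpha>: "0 < \<alpha>"
    and [measurable]: "\<And>n. F n \<in> borel_measurable borel" "\<And>n. G n \<in> borel_measurable borel"
      "f \<in> borel_measurable borel" "g \<in> borel_measurable borel"
    and F: "\<And>n x. 0 \<le> F n x" "\<And>n x. F n x \<le> M" and G: "\<And>n x. 0 \<le> G n x" "\<And>n x. G n x \<le> M"
    and lim: "AE x in gauss. (\<lambda>n. F n x) \<longlonglongrightarrow> f x" "AE x in gauss. (\<lambda>n. G n x) \<longlonglongrightarrow> g x"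
    and hyp: "\<And>n. two_function_bound \<alpha> \<theta> (F n) (G n)"
  shows "two_function_bound \<alpha> \<theta> f g"
proof -
  have "AE p in gauss_pair \<theta>. (\<lambda>n. F n (fst p)) \<longlonglongrightarrow> f (fst p)"
    using lim(1) AE_distrD[of fst "gauss_pair \<theta>" gauss "\<lambda>x. (\<lambda>n. F n x) \<longlonglongrightarrow> f x"]
    unfolding distr_gauss_pair_fst by simp
  moreover have "AE p in gauss_pair \<theta>. (\<lambda>n. G n (snd p)) \<longlonglongrightarrow> g (snd p)"
    using lim(2) AE_distrD[of snd "gauss_pair \<theta>" gauss "\<lambda>x. (\<lambda>n. G n x) \<longlonglongrightarrow> g x"]
    unfolding distr_gauss_pair_snd by simp
  ultimately have "AE p in gauss_pair \<theta>. (\<lambda>n. (F n (fst p) * G n (snd p)) powr \<alpha>) \<longlonglongrightarrow> (f (fst p) * g (snd p)) powr \<alpha>"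
  proof eventually_elim
    case (elim p)
    then show ?case
      using \<alpha> F G by (intro tendsto_powr' tendsto_mult tendsto_const) (auto intro!: always_eventually)
  qed
  moreover have "(F n s * G n t) powr \<alpha> \<le> (M * M) powr \<alpha>" for n s t
    using F G \<alpha> order_trans[OF F(1) F(2)] by (intro powr_mono2 mult_mono) simp_all
  ultimately have L: "(\<lambda>n. \<integral>p. (F n (fst p) * G n (snd p)) powr \<alpha> \<partial>gauss_pair \<theta>)
      \<longlonglongrightarrow> (\<integral>p. (f (fst p) * g (snd p)) powr \<alpha> \<partial>gauss_pair \<theta>)"
    by (intro integral_dominated_convergence[where w="\<lambda>_. (M * M) powr \<alpha>"]) (auto intro!: AE_I2)
  have "(\<lambda>n. \<integral>x. F n x \<partial>gauss) \<longlonglongrightarrow> (\<integral>x. f x \<partial>gauss)"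
    using lim F by (intro integral_dominated_convergence[where w="\<lambda>_. M"]) auto
  moreover have "(\<lambda>n. \<integral>x. G n x \<partial>gauss) \<longlonglongrightarrow> (\<integral>x. g x \<partial>gauss)"
    using lim G by (intro integral_dominated_convergence[where w="\<lambda>_. M"]) auto
  ultimately have R: "(\<lambda>n. ((\<integral>x. F n x \<partial>gauss) * (\<integral>x. G n x \<partial>gauss)) powr \<alpha>)
      \<longlonglongrightarrow> ((\<integral>x. f x \<partial>gauss) * (\<integral>x. g x \<partial>gauss)) powr \<alpha>"
    using \<alpha> F G by (intro tendsto_powr' tendsto_mult tendsto_const) (auto intro!: always_eventually integral_nonneg_AE)
  show ?thesis
    unfolding two_function_bound_def
    by (rule LIMSEQ_le[OF L R]) (use hyp in \<open>auto simp: two_function_bound_def\<close>)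
qed

lemma second_difference_mvt:
  fixes g2 g1 h :: "real \<Rightarrow> real"
  assumes g2: "\<And>x. (g2 has_real_derivative g1 x) (at x)" and g1: "\<And>x. (g1 has_real_derivative h x) (at x)"
    and \<eta>: "0 < \<eta>"
  shows "\<exists>t. x \<le> t \<and> t \<le> x + 2 * \<eta> \<and> g2 (x + 2 * \<eta>) - 2 * g2 (x + \<eta>) + g2 x = \<eta>\<^sup>2 * h t"
proof -
  have "((\<lambda>t. g2 (t + \<eta>) - g2 t) has_real_derivative (g1 (t + \<eta>) - g1 t)) (at t)" for t
    by (intro DERIV_diff g2) (use g2[of "t + \<eta>"] in \<open>simp add: DERIV_shift\<close>)
  from MVT2[of x "x + \<eta>", OF _ this] \<eta>
  obtain z where z: "x < z" "z < x + \<eta>"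
    "(g2 (x + \<eta> + \<eta>) - g2 (x + \<eta>)) - (g2 (x + \<eta>) - g2 x) = \<eta> * (g1 (z + \<eta>) - g1 z)"
    by auto
  from MVT2[of z "z + \<eta>" g1 h] g1 \<eta> obtain t where t: "z < t" "t < z + \<eta>" "g1 (z + \<eta>) - g1 z = \<eta> * h t"
    by auto
  show ?thesis
    using z t by (intro exI[of _ t]) (auto simp: power2_eq_square algebra_simps)
qed

lemma continuous_on_DERIV:
  fixes f :: "real \<Rightarrow> real"
  assumes "\<And>x. (f has_real_derivative f' x) (at x)"
  shows "continuous_on UNIV f"
  using assms by (meson DERIV_isCont continuous_at_imp_continuous_on)

lemma C2_boundedI:
  fixes f f1 f2 :: "real \<Rightarrow> real"
  assumes f: "\<And>x. (f has_real_derivative f1 x) (at x)" and f1: "\<And>x. (f1 has_real_derivative f2 x) (at x)"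
    and bd: "\<And>x. \<epsilon> \<le> f x" "\<And>x. f x \<le> M" "\<And>x. \<bar>f1 x\<bar> \<le> D" "\<And>x. \<bar>f2 x\<bar> \<le> D"
  shows "C2_bounded \<epsilon> M D f f1"
proof -
  have lip: "\<bar>f1 y - f1 x\<bar> \<le> D * \<bar>y - x\<bar>" for x y
  proof -
    have "\<bar>f1 y - f1 x\<bar> \<le> D * \<bar>y - x\<bar>" if xy: "x < y" for x y
    proof -
      obtain z where "f1 y - f1 x = (y - x) * f2 z" using MVT2[OF xy f1] by blast
      then show ?thesis using bd(4)[of z] xy by (simp add: abs_mult mult.commute mult_right_mono)
    qed
    from this[of x y] this[of y x] show ?thesis by (cases x y rule: linorder_cases) (auto simp: abs_minus_commute)
  qed
  have D: "0 \<le> D" using bd(3)[of 0] by linarith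
  have "\<bar>f (x + u) - f x - f1 x * u\<bar> \<le> D * u\<^sup>2" for x u
  proof -
    have "\<exists>z. \<bar>z - x\<bar> \<le> \<bar>u\<bar> \<and> f (x + u) - f x = u * f1 z"
    proof (cases u "0 :: real" rule: linorder_cases)
      case less
      then obtain z where "x + u < z" "z < x" "f x - f (x + u) = (x - (x + u)) * f1 z"
        using MVT2[of "x + u" x f f1] f by auto
      then show ?thesis by (intro exI[of _ z]) auto
    next
      case greater
      then obtain z where "x < z" "z < x + u" "f (x + u) - f x = (x + u - x) * f1 z"
        using MVT2[of x "x + u" f f1] f by auto
      then show ?thesis by (intro exI[of _ z]) auto
    qed auto
    then obtain z where z: "\<bar>z - x\<bar> \<le> \<bar>u\<bar>" "f (x + u) - f x = u * f1 z" by blast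
    then have "\<bar>f (x + u) - f x - f1 x * u\<bar> = \<bar>u\<bar> * \<bar>f1 z - f1 x\<bar>"
      by (simp add: abs_mult[symmetric] algebra_simps)
    also have "\<dots> \<le> \<bar>u\<bar> * (D * \<bar>u\<bar>)"
      using order_trans[OF lip[of z x] mult_left_mono[OF z(1) D]] by (intro mult_left_mono) simp_all
    also have "\<dots> = D * u\<^sup>2" by (simp add: power2_eq_square)
    finally show ?thesis .
  qed
  moreover have "f \<in> borel_measurable borel" "f1 \<in> borel_measurable borel"
    by (rule borel_measurable_continuous_onI, rule continuous_on_DERIV, rule f)
      (rule borel_measurable_continuous_onI, rule continuous_on_DERIV, rule f1)
  ultimately show ?thesis using bd by (simp add: C2_bounded_def)
qed

text \<open>The approximation is a second difference quotient of a twofold antiderivative of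
  \<open>h\<close>, that is, an average of \<open>h\<close> over [x, x + 2 \<eta>] with a triangular
  weight. By the mean value theorem it takes a value of \<open>h\<close> on that interval, which
  gives both bounds and later the convergence; its second derivative is a difference quotient of
  \<open>h\<close> itself and hence bounded.\<close>

lemma continuous_C2_approximation:
  fixes h :: "real \<Rightarrow> real"
  assumes h: "continuous_on UNIV h" and bd: "\<And>x. \<epsilon> \<le> h x" "\<And>x. h x \<le> M" and \<epsilon>: "0 < \<epsilon>" and \<eta>: "0 < \<eta>"
  shows "\<exists>D F F1. 0 \<le> D \<and> C2_bounded \<epsilon> M D F F1 \<and> (\<forall>x. \<exists>t. x \<le> t \<and> t \<le> x + 2 * \<eta> \<and> F x = h t)"
proof -
  have M: "0 < M" using order_trans[OF bd(1) bd(2)] \<epsilon> by linarith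
  have anti: "\<exists>g. \<forall>x. (g has_real_derivative k x) (at x)" if "continuous_on UNIV k" for k :: "real \<Rightarrow> real"
  proof -
    have "\<exists>F. \<forall>x. -\<infinity> < ereal x \<longrightarrow> ereal x < \<infinity> \<longrightarrow> (F has_vector_derivative k x) (at x)"
      using that by (intro einterval_antiderivative) (auto simp: continuous_on_eq_continuous_at)
    then show ?thesis by (simp add: has_real_derivative_iff_has_vector_derivative)
  qed
  obtain g1 where g1: "\<And>x. (g1 has_real_derivative h x) (at x)" using anti[OF h] by blast
  have "continuous_on UNIV g1" by (rule continuous_on_DERIV) (rule g1)
  then obtain g2 where g2: "\<And>x. (g2 has_real_derivative g1 x) (at x)" using anti by blast
  define S where "S = (\<lambda>(g :: real \<Rightarrow> real) x. (g (x + 2 * \<eta>) - 2 * g (x + \<eta>) + g x) / \<eta>\<^sup>2)"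
  have S: "(S g has_real_derivative S g' x) (at x)" if "\<And>x. (g has_real_derivative g' x) (at x)" for g g' x
    unfolding S_def
    by (intro DERIV_cdivide DERIV_add DERIV_diff DERIV_cmult that)
      (use that[of "x + 2 * \<eta>"] that[of "x + \<eta>"] in \<open>simp_all add: DERIV_shift\<close>)
  have mvt: "\<exists>t. x \<le> t \<and> t \<le> x + 2 * \<eta> \<and> S g2 x = h t" for x
    using second_difference_mvt[OF g2 g1 \<eta>, of x] \<eta> by (auto simp: S_def)
  define D where "D = M / \<eta> + 4 * M / \<eta>\<^sup>2"
  have D: "0 \<le> D" "M / \<eta> \<le> D" "4 * M / \<eta>\<^sup>2 \<le> D" using M \<eta> by (auto simp: D_def)
  have hb: "0 \<le> h x" "h x \<le> M" for x using bd[of x] \<epsilon> by auto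
  have "\<bar>S g1 x\<bar> \<le> M / \<eta>" for x
  proof -
    obtain t where t: "g1 (x + 2 * \<eta>) - g1 (x + \<eta>) = \<eta> * h t"
      using MVT2[of "x + \<eta>" "x + 2 * \<eta>" g1 h] g1 \<eta> by auto
    obtain s where s: "g1 (x + \<eta>) - g1 x = \<eta> * h s"
      using MVT2[of "x" "x + \<eta>" g1 h] g1 \<eta> by auto
    have "S g1 x = (\<eta> * h t - \<eta> * h s) / \<eta>\<^sup>2" unfolding t[symmetric] s[symmetric] S_def by simp
    also have "\<dots> = (h t - h s) / \<eta>" using \<eta> by (simp add: power2_eq_square field_simps)
    finally have "\<bar>S g1 x\<bar> = \<bar>h t - h s\<bar> / \<eta>" using \<eta> by simp
    moreover have "\<bar>h t - h s\<bar> \<le> M" using hb[of t] hb[of s] by linarith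
    ultimately show ?thesis using \<eta> by (simp add: divide_right_mono)
  qed
  moreover have "\<bar>S h x\<bar> \<le> 4 * M / \<eta>\<^sup>2" for x
  proof -
    have "\<bar>h (x + 2 * \<eta>) - 2 * h (x + \<eta>) + h x\<bar> \<le> 4 * M"
      using hb[of "x + 2 * \<eta>"] hb[of "x + \<eta>"] hb[of x] by linarith
    then show ?thesis using \<eta> by (simp add: S_def divide_right_mono)
  qed
  moreover have "\<epsilon> \<le> S g2 x" "S g2 x \<le> M" for x
    using mvt[of x] bd by auto
  ultimately have "C2_bounded \<epsilon> M D (S g2) (S g1)"
    using D by (intro C2_boundedI[OF S[OF g2] S[OF g1]]) (auto intro: order_trans)
  then show ?thesis using mvt D by blast
qed

text \<open>The derivative bound of the approximations may blow up as \<eta> tends to 0. This is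
  harmless, since it does not occur in the inequality that is passed to the limit.\<close>

lemma two_function_bound_continuous:
  fixes f g :: "real \<Rightarrow> real"
  assumes \<alpha>: "0 < \<alpha>" "\<alpha> < 1" and \<theta>: "0 \<le> cos \<theta>" "\<alpha> * (1 + cos \<theta>) \<le> 1" and \<epsilon>: "0 < \<epsilon>"
    and f: "continuous_on UNIV f" "\<And>x. \<epsilon> \<le> f x" "\<And>x. f x \<le> M"
    and g: "continuous_on UNIV g" "\<And>x. \<epsilon> \<le> g x" "\<And>x. g x \<le> M"
  shows "two_function_bound \<alpha> \<theta> f g"
proof -
  define \<eta> :: "nat \<Rightarrow> real" where "\<eta> = (\<lambda>n. 1 / real (Suc n))"
  have \<eta>: "0 < \<eta> n" for n by (simp add: \<eta>_def)
  have \<eta>0: "\<eta> \<longlonglongrightarrow> 0" unfolding \<eta>_def by real_asymp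
  have approx: "\<exists>D F F1. \<forall>n. 0 \<le> D n \<and> C2_bounded \<epsilon> M (D n) (F n) (F1 n) \<and> (\<forall>x. \<exists>t. x \<le> t \<and> t \<le> x + 2 * \<eta> n \<and> F n x = h t)"
    if "continuous_on UNIV h" "\<And>x. \<epsilon> \<le> h x" "\<And>x. h x \<le> M" for h
    using continuous_C2_approximation[OF that \<epsilon> \<eta>] by metis
  have conv: "(\<lambda>n. F n x) \<longlonglongrightarrow> h x" if h: "continuous_on UNIV h"
    and F: "\<And>n x. \<exists>t. x \<le> t \<and> t \<le> x + 2 * \<eta> n \<and> F n x = h t" for h :: "real \<Rightarrow> real" and F x
  proof -
    obtain t where t: "\<And>n. x \<le> t n" "\<And>n. t n \<le> x + 2 * \<eta> n" "\<And>n. F n x = h (t n)"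
      using F[of x] by metis
    have "(\<lambda>n. x + 2 * \<eta> n) \<longlonglongrightarrow> x + 2 * 0" by (intro tendsto_intros \<eta>0)
    then have "t \<longlonglongrightarrow> x"
      using t by (intro tendsto_sandwich[of "\<lambda>_. x" t sequentially "\<lambda>n. x + 2 * \<eta> n"]) auto
    then have "(\<lambda>n. h (t n)) \<longlonglongrightarrow> h x"
      using h by (auto simp: continuous_on_eq_continuous_at intro: isCont_tendsto_compose)
    then show ?thesis using t by simp
  qed
  obtain D F F1 where F: "\<And>n. 0 \<le> D n" "\<And>n. C2_bounded \<epsilon> M (D n) (F n) (F1 n)"
    "\<And>n x. \<exists>t. x \<le> t \<and> t \<le> x + 2 * \<eta> n \<and> F n x = f t"
    using approx[OF f] by metis
  obtain E G G1 where G: "\<And>n. 0 \<le> E n" "\<And>n. C2_bounded \<epsilon> M (E n) (G n) (G1 n)"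
    "\<And>n x. \<exists>t. x \<le> t \<and> t \<le> x + 2 * \<eta> n \<and> G n x = g t"
    using approx[OF g] by metis
  have mono: "C2_bounded \<epsilon> M K u u1" if "C2_bounded \<epsilon> M K' u u1" "K' \<le> K" for K K' u u1
    using that unfolding C2_bounded_def by (meson order_trans mult_right_mono zero_le_power2)
  have M: "\<epsilon> \<le> M" using order_trans[OF f(2) f(3)] .
  show ?thesis
  proof (rule two_function_bound_limit[OF \<alpha>(1), where F=F and G=G and M=M])
    show "F n \<in> borel_measurable borel" "G n \<in> borel_measurable borel" for n
      using F(2)[of n] G(2)[of n] by (auto simp: C2_bounded_def)
    show "0 \<le> F n x" "F n x \<le> M" "0 \<le> G n x" "G n x \<le> M" for n x
      using F(2)[of n] G(2)[of n] \<epsilon> by (auto simp: C2_bounded_def intro: order_trans[of 0 \<epsilon>])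
    show "AE x in gauss. (\<lambda>n. F n x) \<longlonglongrightarrow> f x" "AE x in gauss. (\<lambda>n. G n x) \<longlonglongrightarrow> g x"
      using conv[OF f(1) F(3)] conv[OF g(1) G(3)] by auto
    show "two_function_bound \<alpha> \<theta> (F n) (G n)" for n
      unfolding two_function_bound_def
      using F(1)[of n] G(1)[of n]
      by (intro hypercontractive_C2[OF \<alpha> \<theta> \<epsilon> M _ mono[OF F(2)] mono[OF G(2)], where D="max (D n) (E n)"]) auto
  qed (use f(1) g(1) in \<open>auto intro: borel_measurable_continuous_onI\<close>)
qed

text \<open>A Borel function is a limit of continuous functions outside a Lebesgue null set, and
  such sets are null for the Gaussian measure. Clipping to [\<epsilon>, M] keeps the bounds and does
  not change the limit.\<close>

lemma gauss_AE_continuous_limit: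
  fixes f :: "real \<Rightarrow> real"
  assumes f: "f \<in> borel_measurable borel" "\<And>x. \<epsilon> \<le> f x" "\<And>x. f x \<le> M" and "\<epsilon> \<le> M"
  shows "\<exists>F. (\<forall>n. continuous_on UNIV (F n) \<and> (\<forall>x. \<epsilon> \<le> F n x \<and> F n x \<le> M)) \<and> (AE x in gauss. (\<lambda>n. F n x) \<longlonglongrightarrow> f x)"
proof -
  have "f measurable_on UNIV"
    using f by (intro lebesgue_measurable_imp_measurable_on_real) (auto intro: measurable_completion)
  then obtain N g where N: "negligible N" and g: "\<And>n. continuous_on UNIV (g n)" "\<And>x. x \<notin> N \<Longrightarrow> (\<lambda>n. g n x) \<longlonglongrightarrow> f x"
    by (auto simp: measurable_on_def)
  obtain N' where N': "N' \<in> null_sets lborel" "N \<subseteq> N'"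
    using N by (auto simp: negligible_iff_null_sets null_sets_completion_iff2)
  let ?F = "\<lambda>n x. max \<epsilon> (min M (g n x))"
  have "(\<lambda>n. ?F n x) \<longlonglongrightarrow> max \<epsilon> (min M (f x))" if "x \<notin> N'" for x
    using that N'(2) by (intro tendsto_max tendsto_min tendsto_const g(2)) auto
  moreover have "max \<epsilon> (min M (f x)) = f x" for x using f(2,3)[of x] by auto
  ultimately have lim: "(\<lambda>n. ?F n x) \<longlonglongrightarrow> f x" if "x \<notin> N'" for x using that by simp
  have "AE x in lborel. (\<lambda>n. ?F n x) \<longlonglongrightarrow> f x"
    using AE_not_in[OF N'(1)] by (rule eventually_mono) (rule lim)
  then have "AE x in gauss. (\<lambda>n. ?F n x) \<longlonglongrightarrow> f x"
    unfolding gauss_def by (subst AE_density) auto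
  moreover have "continuous_on UNIV (?F n)" for n
    by (intro continuous_on_max continuous_on_min continuous_on_const g)
  ultimately show ?thesis using \<open>\<epsilon> \<le> M\<close> by (intro exI[of _ ?F]) auto
qed

lemma two_function_bound_bounded:
  fixes f g :: "real \<Rightarrow> real"
  assumes \<alpha>: "0 < \<alpha>" "\<alpha> < 1" and \<theta>: "0 \<le> cos \<theta>" "\<alpha> * (1 + cos \<theta>) \<le> 1"
    and f: "f \<in> borel_measurable borel" "\<And>x. 0 \<le> f x" "\<And>x. f x \<le> M"
    and g: "g \<in> borel_measurable borel" "\<And>x. 0 \<le> g x" "\<And>x. g x \<le> M"
  shows "two_function_bound \<alpha> \<theta> f g"
proof -
  have pos: "two_function_bound \<alpha> \<theta> f g" if \<epsilon>: "0 < \<epsilon>"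
    and f: "f \<in> borel_measurable borel" "\<And>x. \<epsilon> \<le> f x" "\<And>x. f x \<le> M"
    and g: "g \<in> borel_measurable borel" "\<And>x. \<epsilon> \<le> g x" "\<And>x. g x \<le> M" for f g \<epsilon> M
  proof -
    have M: "\<epsilon> \<le> M" using order_trans[OF f(2) f(3)] .
    obtain F where F: "\<And>n. continuous_on UNIV (F n)" "\<And>n x. \<epsilon> \<le> F n x" "\<And>n x. F n x \<le> M" "AE x in gauss. (\<lambda>n. F n x) \<longlonglongrightarrow> f x"
      using gauss_AE_continuous_limit[OF f M] by blast
    obtain G where G: "\<And>n. continuous_on UNIV (G n)" "\<And>n x. \<epsilon> \<le> G n x" "\<And>n x. G n x \<le> M" "AE x in gauss. (\<lambda>n. G n x) \<longlonglongrightarrow> g x"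
      using gauss_AE_continuous_limit[OF g M] by blast
    show ?thesis
    proof (rule two_function_bound_limit[OF \<alpha>(1), where F=F and G=G and M=M])
      show "F n \<in> borel_measurable borel" "G n \<in> borel_measurable borel" for n
        using F(1) G(1) by (auto intro: borel_measurable_continuous_onI)
      show "0 \<le> F n x" "F n x \<le> M" "0 \<le> G n x" "G n x \<le> M" for n x
        using F(2,3)[of n x] G(2,3)[of n x] \<epsilon> by auto
      show "two_function_bound \<alpha> \<theta> (F n) (G n)" for n
        by (rule two_function_bound_continuous[OF \<alpha> \<theta> \<epsilon> F(1-3) G(1-3)])
    qed (use f g F(4) G(4) in auto)
  qed
  \<comment> \<open>Adding 1 / (n + 1) provides the strict lower bound that \<open>pos\<close> asks
    for, and it disappears in the limit.\<close>
  have lim: "(\<lambda>n. h + 1 / real (Suc n)) \<longlonglongrightarrow> h" for h :: real by real_asymp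
  show ?thesis
  proof (rule two_function_bound_limit[OF \<alpha>(1), where F="\<lambda>n x. f x + 1 / real (Suc n)" and G="\<lambda>n x. g x + 1 / real (Suc n)" and M="M + 1"])
    show "two_function_bound \<alpha> \<theta> (\<lambda>x. f x + 1 / real (Suc n)) (\<lambda>x. g x + 1 / real (Suc n))" for n
      using f g by (intro pos[of "1 / real (Suc n)" _ "M + 1"]) (auto intro!: add_mono)
  qed (use f g lim in \<open>auto intro!: add_mono\<close>)
qed

definition comp_fst :: "'i set \<Rightarrow> ('i \<Rightarrow> real \<times> real) \<Rightarrow> 'i \<Rightarrow> real" where
  "comp_fst I w = (\<lambda>i\<in>I. fst (w i))"

definition comp_snd :: "'i set \<Rightarrow> ('i \<Rightarrow> real \<times> real) \<Rightarrow> 'i \<Rightarrow> real" where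
  "comp_snd I w = (\<lambda>i\<in>I. snd (w i))"

section \<open>Covariances on Gaussian product spaces\<close>

abbreviation gauss_PiM :: "'i set \<Rightarrow> ('i \<Rightarrow> real) measure" where
  "gauss_PiM I \<equiv> PiM I (\<lambda>_. gauss)"

abbreviation pair_PiM :: "'i set \<Rightarrow> ('i \<Rightarrow> real) \<Rightarrow> ('i \<Rightarrow> real \<times> real) measure" where
  "pair_PiM I \<theta> \<equiv> PiM I (\<lambda>i. gauss_pair (\<theta> i))"

lemma product_prob_space_gauss: "product_prob_space (\<lambda>_. gauss)"
  by (rule product_prob_spaceI) (rule gauss.prob_space_axioms)

lemma product_prob_space_gauss_pair: "product_prob_space (\<lambda>i. gauss_pair (\<theta> i))"
  by (rule product_prob_spaceI) (rule prob_space_gauss_pair)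

lemma prob_space_gauss_PiM: "prob_space (gauss_PiM I)"
  by (rule prob_space_PiM) (rule gauss.prob_space_axioms)

lemma prob_space_pair_PiM: "prob_space (pair_PiM I \<theta>)"
  by (rule prob_space_PiM) (rule prob_space_gauss_pair)

lemma comp_fst_space [simp]: "comp_fst I w \<in> space (gauss_PiM I)"
  and comp_snd_space [simp]: "comp_snd I w \<in> space (gauss_PiM I)"
  by (auto simp: space_PiM comp_fst_def comp_snd_def)

lemma measurable_comp_fst [measurable]: "comp_fst I \<in> measurable (pair_PiM I \<theta>) (gauss_PiM I)"
  and measurable_comp_snd [measurable]: "comp_snd I \<in> measurable (pair_PiM I \<theta>) (gauss_PiM I)"
  unfolding comp_fst_def comp_snd_def by measurable

lemma comp_upd:
  assumes "i \<notin> I"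
  shows "comp_fst (insert i I) (w(i := p)) = (comp_fst I w)(i := fst p)"
    "comp_snd (insert i I) (w(i := p)) = (comp_snd I w)(i := snd p)"
  using assms by (auto simp: comp_fst_def comp_snd_def fun_eq_iff)

lemma measurable_section:
  assumes "f \<in> measurable (PiM (insert i I) M) N" "x \<in> space (PiM I M)" "i \<notin> I"
  shows "(\<lambda>t. f (x(i := t))) \<in> measurable (M i) N"
  using measurable_compose[OF measurable_component_update[OF assms(2,3)] assms(1)] .

lemma measurable_two_sections:
  assumes "f \<in> measurable (PiM (insert i I) M) N"
  shows "(\<lambda>(x, t). f (x(i := t))) \<in> measurable (PiM I M \<Otimes>\<^sub>M M i) N"
  using measurable_compose[OF measurable_add_dim assms] by (simp add: case_prod_beta')

lemma distr_comp:
  assumes "finite I"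
  shows "distr (pair_PiM I \<theta>) (gauss_PiM I) (comp_fst I) = gauss_PiM I"
    "distr (pair_PiM I \<theta>) (gauss_PiM I) (comp_snd I) = gauss_PiM I"
proof -
  have "distr (pair_PiM I \<theta>) (gauss_PiM I) (compose I fst) = PiM I (\<lambda>i. distr (gauss_pair (\<theta> i)) gauss fst)"
    "distr (pair_PiM I \<theta>) (gauss_PiM I) (compose I snd) = PiM I (\<lambda>i. distr (gauss_pair (\<theta> i)) gauss snd)"
    by (intro distr_PiM_finite_prob_space' assms prob_space_gauss_pair gauss.prob_space_axioms, measurable)+
  moreover have "comp_fst I = compose I fst" "comp_snd I = compose I snd"
    by (auto simp: comp_fst_def comp_snd_def compose_def fun_eq_iff)
  ultimately show "distr (pair_PiM I \<theta>) (gauss_PiM I) (comp_fst I) = gauss_PiM I"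
    "distr (pair_PiM I \<theta>) (gauss_PiM I) (comp_snd I) = gauss_PiM I"
    by (simp_all only: distr_gauss_pair_fst distr_gauss_pair_snd)
qed

text \<open>The bound in one coordinate is applied to sections, and the induction hypothesis to the
  averages over that coordinate, which are still between 0 and \<open>M\<close>. Each coordinate has
  its own angle, since coordinates will be rotated one after another.\<close>

lemma two_function_bound_PiM:
  fixes f g :: "('i \<Rightarrow> real) \<Rightarrow> real"
  assumes "finite I"
    and \<alpha>: "0 < \<alpha>" "\<alpha> < 1" and \<theta>: "\<And>i. i \<in> I \<Longrightarrow> 0 \<le> cos (\<theta> i)" "\<And>i. i \<in> I \<Longrightarrow> \<alpha> * (1 + cos (\<theta> i)) \<le> 1"
    and f: "f \<in> borel_measurable (gauss_PiM I)" "\<And>x. 0 \<le> f x" "\<And>x. f x \<le> M"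
    and g: "g \<in> borel_measurable (gauss_PiM I)" "\<And>x. 0 \<le> g x" "\<And>x. g x \<le> M"
  shows "(\<integral>w. (f (comp_fst I w) * g (comp_snd I w)) powr \<alpha> \<partial>pair_PiM I \<theta>)
    \<le> ((\<integral>x. f x \<partial>gauss_PiM I) * (\<integral>x. g x \<partial>gauss_PiM I)) powr \<alpha>"
  using \<open>finite I\<close> \<theta> f g
proof (induction I arbitrary: f g)
  case empty
  have int: "(\<integral>w. h w \<partial>PiM {} N) = h (\<lambda>_. undefined)" for h :: "('i \<Rightarrow> 'b) \<Rightarrow> real" and N
  proof -
    have "(\<integral>w. h w \<partial>PiM {} N) = (\<integral>w. h (\<lambda>_. undefined) \<partial>PiM {} N)"
      by (intro Bochner_Integration.integral_cong) (auto simp: space_PiM_empty)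
    then show ?thesis
      using emeasure_PiM_empty[of N] by (simp add: space_PiM_empty measure_def)
  qed
  show ?case by (simp add: int comp_fst_def comp_snd_def restrict_def prob_space.prob_space[OF prob_space_pair_PiM])
next
  case (insert i I)
  note [measurable] = insert.prems(3) insert.prems(6)
  note f = insert.prems(4,5) and g = insert.prems(7,8)
  let ?f = "\<lambda>x. \<integral>t. f (x(i := t)) \<partial>gauss" and ?g = "\<lambda>x. \<integral>t. g (x(i := t)) \<partial>gauss"
  have [measurable]: "(\<lambda>(x, t). f (x(i := t))) \<in> borel_measurable (gauss_PiM I \<Otimes>\<^sub>M gauss)"
    "(\<lambda>(x, t). g (x(i := t))) \<in> borel_measurable (gauss_PiM I \<Otimes>\<^sub>M gauss)"
    using insert.prems(3,6) by (auto intro!: measurable_two_sections)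
  have fg[measurable]: "?f \<in> borel_measurable (gauss_PiM I)" "?g \<in> borel_measurable (gauss_PiM I)"
    by measurable
  have M: "0 \<le> M" using order_trans[OF f] .
  \<comment> \<open>For points outside the product space a section may fail to be measurable; its
    integral is then 0 by convention, which also lies between 0 and \<open>M\<close>.\<close>
  have bnd: "0 \<le> (\<integral>t. h (x(i := t)) \<partial>gauss) \<and> (\<integral>t. h (x(i := t)) \<partial>gauss) \<le> M"
    if "\<And>x. 0 \<le> h x" "\<And>x. h x \<le> M" for h :: "('i \<Rightarrow> real) \<Rightarrow> real" and x
  proof (cases "integrable gauss (\<lambda>t. h (x(i := t)))")
    case True
    then show ?thesis using that by (auto intro!: gauss.integral_le_const)
  next
    case False
    then show ?thesis using M by (simp add: not_integrable_integral_eq)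
  qed
  have MM: "(f s * g t) powr \<alpha> \<le> (M * M) powr \<alpha>" for s t
    using f g \<alpha> M by (intro powr_mono2 mult_mono) simp_all
  have MM': "(?f s * ?g t) powr \<alpha> \<le> (M * M) powr \<alpha>" for s t
    using bnd[where h=f, OF f] bnd[where h=g, OF g] \<alpha> M by (intro powr_mono2 mult_mono) simp_all
  interpret gauss_prod: product_prob_space "\<lambda>_ :: 'i. gauss" by (rule product_prob_space_gauss)
  interpret pair_prod: product_prob_space "\<lambda>i. gauss_pair (\<theta> i)" by (rule product_prob_space_gauss_pair)
  interpret P: prob_space "pair_PiM (insert i I) \<theta>" by (rule prob_space_pair_PiM)
  interpret P': prob_space "pair_PiM I \<theta>" by (rule prob_space_pair_PiM)
  let ?h = "\<lambda>w. (f (comp_fst (insert i I) w) * g (comp_snd (insert i I) w)) powr \<alpha>"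
  have h: "?h \<in> borel_measurable (pair_PiM (insert i I) \<theta>)" by measurable
  have "integrable (pair_PiM (insert i I) \<theta>) ?h"
    by (rule P.integrable_const_bound[where B="(M * M) powr \<alpha>"]) (use MM h in auto)
  then have "(\<integral>w. ?h w \<partial>pair_PiM (insert i I) \<theta>) = (\<integral>w. \<integral>p. ?h (w(i := p)) \<partial>gauss_pair (\<theta> i) \<partial>pair_PiM I \<theta>)"
    using insert.hyps by (intro pair_prod.product_integral_insert)
  also have "\<dots> \<le> (\<integral>w. (?f (comp_fst I w) * ?g (comp_snd I w)) powr \<alpha> \<partial>pair_PiM I \<theta>)"
  proof (rule integral_mono')
    show "integrable (pair_PiM I \<theta>) (\<lambda>w. (?f (comp_fst I w) * ?g (comp_snd I w)) powr \<alpha>)"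
      by (rule P'.integrable_const_bound[where B="(M * M) powr \<alpha>"]) (use MM' in auto)
    fix w
    have "two_function_bound \<alpha> (\<theta> i) (\<lambda>t. f ((comp_fst I w)(i := t))) (\<lambda>t. g ((comp_snd I w)(i := t)))"
      using insert.prems(1,2)[of i] f g measurable_section[OF insert.prems(3) comp_fst_space insert.hyps(2)]
        measurable_section[OF insert.prems(6) comp_snd_space insert.hyps(2)]
      by (intro two_function_bound_bounded[OF \<alpha>, of _ _ M]) auto
    then show "(\<integral>p. ?h (w(i := p)) \<partial>gauss_pair (\<theta> i)) \<le> (?f (comp_fst I w) * ?g (comp_snd I w)) powr \<alpha>"
      unfolding comp_upd[OF insert.hyps(2)] two_function_bound_def .
  qed simp
  also have "\<dots> \<le> ((\<integral>x. ?f x \<partial>gauss_PiM I) * (\<integral>x. ?g x \<partial>gauss_PiM I)) powr \<alpha>"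
  proof (rule insert.IH)
    show "0 \<le> cos (\<theta> j)" "\<alpha> * (1 + cos (\<theta> j)) \<le> 1" if "j \<in> I" for j
      using insert.prems(1,2) that by blast+
    show "?f \<in> borel_measurable (gauss_PiM I)" "?g \<in> borel_measurable (gauss_PiM I)" by (rule fg)+
    show "0 \<le> ?f x" "?f x \<le> M" "0 \<le> ?g x" "?g x \<le> M" for x
      using bnd[where h=f and x=x, OF f] bnd[where h=g and x=x, OF g] by blast+
  qed
  also have "(\<integral>x. ?f x \<partial>gauss_PiM I) = (\<integral>x. f x \<partial>gauss_PiM (insert i I))"
    using insert.hyps f insert.prems(3)
    by (intro gauss_prod.product_integral_insert[symmetric] finite_measure.integrable_const_bound[where B=M]
        prob_space.finite_measure prob_space_gauss_PiM) auto
  also have "(\<integral>x. ?g x \<partial>gauss_PiM I) = (\<integral>x. g x \<partial>gauss_PiM (insert i I))"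
    using insert.hyps g insert.prems(6)
    by (intro gauss_prod.product_integral_insert[symmetric] finite_measure.integrable_const_bound[where B=M]
        prob_space.finite_measure prob_space_gauss_PiM) auto
  finally show ?case .
qed

section \<open>Integration by parts and rotation of one coordinate\<close>

lemma gauss_stein:
  fixes f f' :: "real \<Rightarrow> real"
  assumes f: "\<And>x. (f has_real_derivative f' x) (at x)" and cont: "continuous_on UNIV f'"
    and f': "\<And>x. 0 \<le> f' x" and B: "\<And>x. \<bar>f x\<bar> \<le> B"
  shows "(\<integral>\<^sup>+x. ennreal (f' x) \<partial>gauss) = ennreal (\<integral>x. x * f x \<partial>gauss)"
proof -
  let ?n = std_normal_density
  have n: "(?n has_real_derivative - x * ?n x) (at x)" for x
  proof -
    have "((\<lambda>x. exp (- x\<^sup>2 / 2)) has_real_derivative exp (- x\<^sup>2 / 2) * (- x)) (at x)"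
      by (auto intro!: derivative_eq_intros)
    from DERIV_cmult[OF this, of "1 / sqrt (2 * pi)"] show ?thesis
      by (simp add: std_normal_density_def[abs_def] mult.commute)
  qed
  have contf: "continuous_on UNIV f" by (rule continuous_on_DERIV) (rule f)
  have contn: "continuous_on UNIV ?n" by (rule continuous_on_DERIV) (rule n)
  have [measurable]: "f \<in> borel_measurable borel" "f' \<in> borel_measurable borel"
    using contf cont by (auto intro: borel_measurable_continuous_onI)
  \<comment> \<open>The derivative of \<open>F\<close> is f' n - x f n for the normal density n.
    Integrate over [-k, k]: the boundary terms vanish as k grows because f is bounded, and on the f'
    side the limit is monotone, so that integrability of f' is a conclusion and not an
    assumption.\<close>
  define F where "F = (\<lambda>x. f x * ?n x)"
  have F: "(F has_real_derivative (f' x * ?n x - x * f x * ?n x)) (at x)" for x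
    unfolding F_def using DERIV_mult[OF f n, of x] by (simp add: algebra_simps)
  define I where "I = (\<lambda>k::nat. {- real k..real k})"
  have int_xf: "integrable lborel (\<lambda>x. x * f x * ?n x)"
  proof -
    have "integrable gauss (\<lambda>x. x * f x)"
    proof (rule Bochner_Integration.integrable_bound)
      show "integrable gauss (\<lambda>x. B * x)" by simp
      have "\<bar>x * f x\<bar> \<le> \<bar>B * x\<bar>" for x
        using mult_right_mono[OF B[of x], of "\<bar>x\<bar>"] order_trans[OF abs_ge_zero B[of x]]
        by (simp add: abs_mult mult.commute)
      then show "AE x in gauss. norm (x * f x) \<le> norm (B * x)" by simp
    qed measurable
    then show ?thesis by (subst (asm) integrable_gauss_iff) (simp_all add: mult.commute mult.left_commute)
  qed
  have A: "(\<integral>\<^sup>+x. ennreal (f' x * ?n x) * indicator (I k) x \<partial>lborel)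
      = ennreal (F (real k) - F (- real k) + (\<integral>x. indicator (I k) x *\<^sub>R (x * f x * ?n x) \<partial>lborel))" for k
  proof -
    have 1: "has_bochner_integral lborel (\<lambda>x. indicator (I k) x *\<^sub>R (f' x * ?n x - x * f x * ?n x)) (F (real k) - F (- real k))"
      unfolding I_def
      by (intro has_bochner_integral_FTC_Icc) (auto intro!: continuous_intros continuous_on_subset[OF cont]
          continuous_on_subset[OF contf] continuous_on_subset[OF contn]
          has_vector_derivative_at_within F[unfolded has_real_derivative_iff_has_vector_derivative])
    have 2: "has_bochner_integral lborel (\<lambda>x. indicator (I k) x *\<^sub>R (x * f x * ?n x)) (\<integral>x. indicator (I k) x *\<^sub>R (x * f x * ?n x) \<partial>lborel)"
      using int_xf by (intro has_bochner_integral_integrable integrable_mult_indicator) (auto simp: I_def)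
    have "has_bochner_integral lborel (\<lambda>x. indicator (I k) x *\<^sub>R (f' x * ?n x))
        (F (real k) - F (- real k) + (\<integral>x. indicator (I k) x *\<^sub>R (x * f x * ?n x) \<partial>lborel))"
      using has_bochner_integral_add[OF 1 2] by (simp add: algebra_simps)
    then have 3: "integrable lborel (\<lambda>x. indicator (I k) x *\<^sub>R (f' x * ?n x))"
      "(\<integral>x. indicator (I k) x *\<^sub>R (f' x * ?n x) \<partial>lborel) = F (real k) - F (- real k) + (\<integral>x. indicator (I k) x *\<^sub>R (x * f x * ?n x) \<partial>lborel)"
      by (simp_all only: has_bochner_integral_iff)
    have "(\<integral>\<^sup>+x. ennreal (f' x * ?n x) * indicator (I k) x \<partial>lborel) = (\<integral>\<^sup>+x. ennreal (indicator (I k) x *\<^sub>R (f' x * ?n x)) \<partial>lborel)"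
      by (intro nn_integral_cong) (auto simp: indicator_def)
    then show ?thesis
      using nn_integral_eq_integral[OF 3(1)] f' by (simp only: 3(2)) simp
  qed
  have "(\<lambda>k. \<integral>\<^sup>+x. ennreal (f' x * ?n x) * indicator (I k) x \<partial>lborel) \<longlonglongrightarrow> (\<integral>\<^sup>+x. ennreal (f' x * ?n x) \<partial>lborel)"
  proof (rule nn_integral_LIMSEQ)
    show "incseq (\<lambda>k x. ennreal (f' x * ?n x) * indicator (I k) x)"
      by (auto simp: incseq_def le_fun_def I_def indicator_def)
    fix x
    have "\<forall>\<^sub>F k in sequentially. x \<in> I k"
      using eventually_ge_at_top[of "nat \<lceil>\<bar>x\<bar>\<rceil>"] by eventually_elim (auto simp: I_def; linarith)
    then show "(\<lambda>k. ennreal (f' x * ?n x) * indicator (I k) x) \<longlonglongrightarrow> ennreal (f' x * ?n x)"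
      by (intro tendsto_eventually, elim eventually_mono) simp
  qed (auto simp: I_def)
  moreover have "(\<lambda>k. ennreal (F (real k) - F (- real k) + (\<integral>x. indicator (I k) x *\<^sub>R (x * f x * ?n x) \<partial>lborel)))
      \<longlonglongrightarrow> ennreal (0 - 0 + (\<integral>x. x * f x * ?n x \<partial>lborel))"
  proof (intro tendsto_ennrealI tendsto_add tendsto_diff)
    have n0: "(\<lambda>k. B * ?n (real k)) \<longlonglongrightarrow> 0" "(\<lambda>k. B * ?n (- real k)) \<longlonglongrightarrow> 0"
      unfolding std_normal_density_def by real_asymp+
    have Fb: "norm (F x) \<le> B * ?n x" for x
      using B[of x] by (simp add: F_def abs_mult mult_right_mono)
    show "(\<lambda>k. F (real k)) \<longlonglongrightarrow> 0"
      by (rule Lim_null_comparison[OF always_eventually n0(1)]) (rule allI, rule Fb)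
    show "(\<lambda>k. F (- real k)) \<longlonglongrightarrow> 0"
      by (rule Lim_null_comparison[OF always_eventually n0(2)]) (rule allI, rule Fb)
    show "(\<lambda>k. \<integral>x. indicator (I k) x *\<^sub>R (x * f x * ?n x) \<partial>lborel) \<longlonglongrightarrow> (\<integral>x. x * f x * ?n x \<partial>lborel)"
    proof (rule integral_dominated_convergence[where w="\<lambda>x. norm (x * f x * ?n x)"])
      show "AE x in lborel. (\<lambda>k. indicator (I k) x *\<^sub>R (x * f x * ?n x)) \<longlonglongrightarrow> x * f x * ?n x"
      proof (rule AE_I2)
        fix x
        have "\<forall>\<^sub>F k in sequentially. x \<in> I k"
          using eventually_ge_at_top[of "nat \<lceil>\<bar>x\<bar>\<rceil>"] by eventually_elim (auto simp: I_def; linarith)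
        then show "(\<lambda>k. indicator (I k) x *\<^sub>R (x * f x * ?n x)) \<longlonglongrightarrow> x * f x * ?n x"
          by (intro tendsto_eventually, elim eventually_mono) simp
      qed
    qed (use int_xf in \<open>auto simp: I_def indicator_def\<close>)
  qed
  ultimately have "(\<integral>\<^sup>+x. ennreal (f' x * ?n x) \<partial>lborel) = ennreal (\<integral>x. x * f x * ?n x \<partial>lborel)"
    unfolding A by (simp add: LIMSEQ_unique)
  moreover have "(\<integral>\<^sup>+x. ennreal (f' x) \<partial>gauss) = (\<integral>\<^sup>+x. ennreal (f' x * ?n x) \<partial>lborel)"
    using f' by (subst nn_integral_gauss) (auto simp: ennreal_mult' mult.commute intro!: nn_integral_cong)
  moreover have "(\<integral>x. x * f x \<partial>gauss) = (\<integral>x. x * f x * ?n x \<partial>lborel)"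
    by (subst integral_gauss) (auto simp: ac_simps)
  ultimately show ?thesis by simp
qed

lemma distr_gauss_rotate:
  assumes "c\<^sup>2 + s\<^sup>2 = 1" and "s \<noteq> 0"
  shows "distr (gauss \<Otimes>\<^sub>M gauss) (gauss \<Otimes>\<^sub>M gauss) (\<lambda>(x, z). (c * x + s * z, c * z - s * x)) = gauss \<Otimes>\<^sub>M gauss"
proof (rule measure_eqI)
  let ?r = "\<lambda>(x, z). (c * x + s * z, c * z - s * x)"
  fix A assume "A \<in> sets (distr (gauss \<Otimes>\<^sub>M gauss) (gauss \<Otimes>\<^sub>M gauss) ?r)"
  then have [measurable]: "A \<in> sets (borel \<Otimes>\<^sub>M borel)" by (simp cong: sets_pair_measure_cong)
  have "emeasure (distr (gauss \<Otimes>\<^sub>M gauss) (gauss \<Otimes>\<^sub>M gauss) ?r) A = (\<integral>\<^sup>+p. indicator A (?r p) \<partial>(gauss \<Otimes>\<^sub>M gauss))"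
    by (subst nn_integral_indicator[symmetric], simp cong: sets_pair_measure_cong, subst nn_integral_distr) auto
  also have "\<dots> = (\<integral>\<^sup>+x. \<integral>\<^sup>+z. indicator A (c * x + s * z, c * z - s * x) \<partial>gauss \<partial>gauss)"
    by (subst gauss.nn_integral_fst[symmetric]) auto
  also have "\<dots> = (\<integral>\<^sup>+x. \<integral>\<^sup>+z. indicator A (x, z) \<partial>gauss \<partial>gauss)"
    using assms by (intro nn_integral_gauss_rotate) auto
  also have "\<dots> = (\<integral>\<^sup>+p. indicator A p \<partial>(gauss \<Otimes>\<^sub>M gauss))"
    by (subst gauss.nn_integral_fst[symmetric]) auto
  also have "\<dots> = emeasure (gauss \<Otimes>\<^sub>M gauss) A"
    by (rule nn_integral_indicator) (simp cong: sets_pair_measure_cong)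
  finally show "emeasure (distr (gauss \<Otimes>\<^sub>M gauss) (gauss \<Otimes>\<^sub>M gauss) ?r) A = emeasure (gauss \<Otimes>\<^sub>M gauss) A" .
qed simp

text \<open>The \<theta>-derivative of E[f(X) g(Y)] is E[f(X) (-k(Y)) W], where W is the
  \<theta>-derivative of Y and is independent of Y. Writing X = cos \<theta> Y - sin \<theta> W and
  integrating by parts in W turns it into sin \<theta> E[f'(X) k(Y)]. As f increases and g
  decreases, this is nonnegative, so the increment can be stated in \<open>ennreal\<close>.\<close>

lemma gauss_pair_interpolation:
  fixes f f' g k :: "real \<Rightarrow> real"
  assumes f: "\<And>x. (f has_real_derivative f' x) (at x)" "continuous_on UNIV f'" "\<And>x. 0 \<le> f' x"
    and fB: "\<And>x. 0 \<le> f x" "\<And>x. f x \<le> B"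
    and g: "\<And>x. (g has_real_derivative - k x) (at x)" "continuous_on UNIV k" "\<And>x. 0 \<le> k x"
    and gB: "\<And>x. 0 \<le> g x" "\<And>x. g x \<le> B"
    and \<theta>: "0 < \<theta>1" "\<theta>1 \<le> \<theta>2" "\<theta>2 < pi"
  shows "(\<integral>\<^sup>+p. ennreal (f (fst p) * g (snd p)) \<partial>gauss_pair \<theta>2) \<le>
    (\<integral>\<^sup>+p. ennreal (f (fst p) * g (snd p)) \<partial>gauss_pair \<theta>1) +
    (\<integral>\<^sup>+t. ennreal (sin t) * (\<integral>\<^sup>+p. ennreal (f' (fst p) * k (snd p)) \<partial>gauss_pair t) * indicator {\<theta>1..\<theta>2} t \<partial>lborel)"
proof -
  have contf: "continuous_on UNIV f" by (rule continuous_on_DERIV) (rule f)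
  have contg: "continuous_on UNIV g" by (rule continuous_on_DERIV) (rule g)
  have [measurable]: "f \<in> borel_measurable borel" "f' \<in> borel_measurable borel"
      "g \<in> borel_measurable borel" "k \<in> borel_measurable borel"
    using contf contg f(2) g(2) by (auto intro: borel_measurable_continuous_onI)
  have B: "0 \<le> B" using order_trans[OF fB] .
  let ?P = "gauss \<Otimes>\<^sub>M gauss"
  let ?J = "{\<theta>1..\<theta>2}"
  have sin_pos: "0 < sin t" if "t \<in> ?J" for t using that \<theta> by (intro sin_gt_zero) auto
  \<comment> \<open>\<open>F\<close> is the derivative along the path in the variables (x, z), and
    \<open>\<Phi>\<close> is the same function in the rotated variables (y, w). Only in the latter
    are the factors k(y) and w independent, which yields an integrable bound uniform in t.\<close>
  define \<Phi> where "\<Phi> = (\<lambda>t (y, w). f (cos t * y - sin t * w) * (- k y * w))"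
  define F where "F = (\<lambda>t (x, z). f x * (- k (cos t * x + sin t * z) * (cos t * z - sin t * x)))"
  have F_eq: "F t p = \<Phi> t (case p of (x, z) \<Rightarrow> (cos t * x + sin t * z, cos t * z - sin t * x))" for t p
  proof -
    have "cos t * (cos t * x + sin t * z) - sin t * (cos t * z - sin t * x) = x" for x z
    proof -
      have "cos t * (cos t * x + sin t * z) - sin t * (cos t * z - sin t * x) = ((cos t)\<^sup>2 + (sin t)\<^sup>2) * x"
        by algebra
      then show ?thesis by (simp only: sin_cos_squared_add2 mult_1)
    qed
    then show ?thesis by (cases p) (simp add: F_def \<Phi>_def)
  qed
  have Phi_meas [measurable]: "\<Phi> t \<in> borel_measurable ?P" for t
    unfolding \<Phi>_def by measurable
  have rot: "(cos t)\<^sup>2 + (sin t)\<^sup>2 = 1" "sin t \<noteq> 0" if "t \<in> ?J" for t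
    using sin_pos[OF that] by auto
  \<comment> \<open>Finiteness of E[k] is not assumed: integration by parts for -g derives it from
    the boundedness of g.\<close>
  have k_int: "(\<integral>\<^sup>+x. ennreal (k x) \<partial>gauss) < \<infinity>"
    using gauss_stein[of "\<lambda>x. - g x" k B] g gB DERIV_minus[OF g(1)] by (auto simp: abs_of_nonneg)
  have w_int: "(\<integral>\<^sup>+x. ennreal \<bar>x\<bar> \<partial>gauss) < \<infinity>"
    using integrable_norm[OF integrable_gauss_id] by (simp add: integrable_iff_bounded)
  define K where "K = ennreal B * ((\<integral>\<^sup>+x. ennreal (k x) \<partial>gauss) * (\<integral>\<^sup>+x. ennreal \<bar>x\<bar> \<partial>gauss))"
  have K: "K < \<infinity>" using k_int w_int by (simp add: K_def ennreal_mult_less_top)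
  have Phi_bound: "(\<integral>\<^sup>+p. ennreal (norm (\<Phi> t p)) \<partial>?P) \<le> K" for t
  proof -
    have "(\<integral>\<^sup>+p. ennreal (norm (\<Phi> t p)) \<partial>?P) \<le> (\<integral>\<^sup>+p. ennreal B * (ennreal (k (fst p)) * ennreal \<bar>snd p\<bar>) \<partial>?P)"
    proof (rule nn_integral_mono)
      fix p :: "real \<times> real"
      have "norm (\<Phi> t p) \<le> B * (k (fst p) * \<bar>snd p\<bar>)"
        using fB g(3) by (auto simp: \<Phi>_def abs_mult case_prod_beta' intro!: mult_right_mono)
      then show "ennreal (norm (\<Phi> t p)) \<le> ennreal B * (ennreal (k (fst p)) * ennreal \<bar>snd p\<bar>)"
        using B g(3) by (simp flip: ennreal_mult')
    qed
    also have "\<dots> = K"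
      unfolding K_def
      by (subst gauss.nn_integral_fst[symmetric]) (auto simp: nn_integral_cmult nn_integral_multc)
    finally show ?thesis .
  qed
  have Phi_integrable: "integrable ?P (\<Phi> t)" for t
    using Phi_bound[of t] K by (intro integrableI_bounded) (auto intro: le_less_trans)
  have F_meas: "(\<lambda>(t, p). indicator ?J t * F t p) \<in> borel_measurable (lborel \<Otimes>\<^sub>M ?P)"
    unfolding F_def by measurable
  have [measurable]: "F t \<in> borel_measurable ?P" for t
    unfolding F_def by measurable
  have rot_meas [measurable]: "(\<lambda>(x, z). (cos t * x + sin t * z, cos t * z - sin t * x)) \<in> measurable ?P ?P" for t
    by measurable
  have F_bound: "(\<integral>\<^sup>+p. ennreal (norm (F t p)) \<partial>?P) \<le> K" if "t \<in> ?J" for t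
  proof -
    have "(\<integral>\<^sup>+p. ennreal (norm (F t p)) \<partial>?P) = (\<integral>\<^sup>+p. ennreal (norm (\<Phi> t p)) \<partial>?P)"
      unfolding F_eq by (subst (2) distr_gauss_rotate[OF rot[OF that], symmetric], subst nn_integral_distr) auto
    then show ?thesis using Phi_bound by simp
  qed
  have sfP: "sigma_finite_measure ?P"
    by (rule prob_space_imp_sigma_finite) (rule gauss2.prob_space_axioms)
  interpret P: sigma_finite_measure ?P by (rule sfP)
  interpret Q: pair_sigma_finite lborel ?P ..
  have F_integrable: "integrable (lborel \<Otimes>\<^sub>M ?P) (\<lambda>(t, p). indicator ?J t * F t p)"
  proof (rule integrableI_bounded[OF F_meas])
    have "(\<integral>\<^sup>+q. ennreal (norm ((\<lambda>(t, p). indicator ?J t * F t p) q)) \<partial>(lborel \<Otimes>\<^sub>M ?P))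
      = (\<integral>\<^sup>+t. \<integral>\<^sup>+p. ennreal (norm (indicator ?J t * F t p)) \<partial>?P \<partial>lborel)"
      using F_meas by (subst sigma_finite_measure.nn_integral_fst[OF sfP, symmetric]) auto
    also have "\<dots> \<le> (\<integral>\<^sup>+t. K * indicator ?J t \<partial>lborel)"
    proof (rule nn_integral_mono)
      fix t :: real
      show "(\<integral>\<^sup>+p. ennreal (norm (indicator ?J t * F t p)) \<partial>?P) \<le> K * indicator ?J t"
        using F_bound[of t] by (cases "t \<in> ?J") auto
    qed
    also have "\<dots> = K * ennreal (\<theta>2 - \<theta>1)" using \<theta> by (simp add: nn_integral_cmult)
    also have "\<dots> < \<infinity>" using K by (simp add: ennreal_mult_less_top)
    finally show "(\<integral>\<^sup>+q. ennreal (norm ((\<lambda>(t, p). indicator ?J t * F t p) q)) \<partial>(lborel \<Otimes>\<^sub>M ?P)) < \<infinity>" .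
  qed
  have path: "(\<integral>t. indicator ?J t * F t (x, z) \<partial>lborel) = f x * g (cos \<theta>2 * x + sin \<theta>2 * z) - f x * g (cos \<theta>1 * x + sin \<theta>1 * z)" for x z
  proof -
    have d: "((\<lambda>t. f x * g (cos t * x + sin t * z)) has_real_derivative F t (x, z)) (at t)" for t
    proof -
      have "((\<lambda>t. cos t * x + sin t * z) has_real_derivative (cos t * z - sin t * x)) (at t)"
        by (auto intro!: derivative_eq_intros)
      from DERIV_cmult[OF DERIV_chain2[OF g(1) this], of "f x"] show ?thesis
        by (simp add: F_def)
    qed
    have "continuous_on ?J (\<lambda>t. F t (x, z))"
      unfolding F_def prod.case
      by (intro continuous_intros continuous_on_compose2[OF g(2)]) auto
    from integral_FTC_atLeastAtMost[OF \<theta>(2) _ this] d show ?thesis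
      by (auto simp: has_real_derivative_iff_has_vector_derivative intro: has_vector_derivative_at_within)
  qed
  define h where "h = (\<lambda>t (x, z). f x * g (cos t * x + sin t * z))"
  have h_meas [measurable]: "h t \<in> borel_measurable ?P" for t unfolding h_def by measurable
  have hB: "0 \<le> h t p" "h t p \<le> B * B" for t p
    using fB gB B by (auto simp: h_def case_prod_beta' intro!: mult_mono)
  have h_int: "integrable ?P (h t)" for t
    using hB by (intro gauss2.integrable_const_bound[of _ "B * B"]) (auto simp: abs_of_nonneg)
  have pair_h: "(\<integral>\<^sup>+p. ennreal (f (fst p) * g (snd p)) \<partial>gauss_pair t) = ennreal (\<integral>p. h t p \<partial>?P)" for t
  proof -
    have "(\<integral>\<^sup>+p. ennreal (f (fst p) * g (snd p)) \<partial>gauss_pair t) = (\<integral>\<^sup>+p. ennreal (h t p) \<partial>?P)"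
      unfolding gauss_pair_def h_def by (subst nn_integral_distr) (auto simp: case_prod_beta' intro!: nn_integral_cong)
    then show ?thesis using h_int hB by (simp add: nn_integral_eq_integral)
  qed
  define r where "r = (\<lambda>t. \<integral>\<^sup>+p. ennreal (f' (fst p) * k (snd p)) \<partial>gauss_pair t)"
  have inner: "ennreal (\<integral>p. F t p \<partial>?P) = ennreal (sin t) * r t \<and> 0 \<le> (\<integral>p. F t p \<partial>?P)" if t: "t \<in> ?J" for t
  proof -
    have s: "0 < sin t" using sin_pos[OF t] .
    define u where "u = (\<lambda>y. \<integral>w. w * - f (cos t * y - sin t * w) \<partial>gauss)"
    have stein: "(\<integral>\<^sup>+w. ennreal (sin t * f' (cos t * y - sin t * w)) \<partial>gauss) = ennreal (u y)" for y
      unfolding u_def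
    proof (rule gauss_stein[where B=B])
      fix w
      have "((\<lambda>w. cos t * y - sin t * w) has_real_derivative - sin t) (at w)"
        by (auto intro!: derivative_eq_intros)
      from DERIV_minus[OF DERIV_chain2[OF f(1) this]]
      show "((\<lambda>w. - f (cos t * y - sin t * w)) has_real_derivative sin t * f' (cos t * y - sin t * w)) (at w)"
        by (simp add: mult.commute)
    qed (use f(2,3) fB s in \<open>auto intro!: continuous_intros continuous_on_compose2[OF f(2)]\<close>)
    have u_meas [measurable]: "u \<in> borel_measurable borel" unfolding u_def by measurable
    \<comment> \<open>The identity \<open>stein\<close> cannot decide this sign, since
      \<open>ennreal\<close> maps negative numbers to 0. It follows from w (v(w) - v(0)) \<ge> 0 for
      the increasing function v; the constant v(0) contributes nothing because w has mean 0.\<close>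
    have u0: "0 \<le> u y" for y
    proof (rule ccontr)
      assume neg: "\<not> 0 \<le> u y"
      let ?v = "\<lambda>w. - f (cos t * y - sin t * w)"
      have inc: "?v w \<le> ?v w'" if "w \<le> w'" for w w'
      proof -
        have "cos t * y - sin t * w' \<le> cos t * y - sin t * w" using that s by simp
        from DERIV_nonneg_imp_nondecreasing[OF this] f show ?thesis by auto
      qed
      have bd: "\<bar>?v w\<bar> \<le> B" for w using fB by (auto simp: abs_of_nonneg)
      have i1: "integrable gauss (\<lambda>w. w * ?v w)"
      proof (rule Bochner_Integration.integrable_bound[of _ "\<lambda>w. B * w"])
        have "norm (w * ?v w) \<le> norm (B * w)" for w
          using mult_right_mono[OF bd[of w], of "\<bar>w\<bar>"] B by (simp add: abs_mult mult.commute)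
        then show "AE w in gauss. norm (w * ?v w) \<le> norm (B * w)" by simp
      qed (simp, measurable)
      have "0 \<le> (\<integral>w. w * (?v w - ?v 0) \<partial>gauss)"
      proof (rule integral_nonneg_AE, rule AE_I2)
        fix w show "0 \<le> w * (?v w - ?v 0)"
          using inc[of 0 w] inc[of w 0] by (cases "0 \<le> w") (auto intro: mult_nonneg_nonneg mult_nonpos_nonpos)
      qed
      also have "(\<integral>w. w * (?v w - ?v 0) \<partial>gauss) = (\<integral>w. w * ?v w - ?v 0 * w \<partial>gauss)"
        by (intro Bochner_Integration.integral_cong) (auto simp: algebra_simps)
      also have "\<dots> = u y" using i1 by (simp add: u_def)
      finally show False using neg by simp
    qed
    have "(\<integral>p. F t p \<partial>?P) = (\<integral>p. \<Phi> t p \<partial>?P)"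
      unfolding F_eq by (subst (2) distr_gauss_rotate[OF rot[OF t], symmetric], subst integral_distr) auto
    also have "\<dots> = (\<integral>y. \<integral>w. \<Phi> t (y, w) \<partial>gauss \<partial>gauss)"
      using gauss2.integral_fst'[OF Phi_integrable] by simp
    also have "\<dots> = (\<integral>y. k y * u y \<partial>gauss)"
    proof (rule Bochner_Integration.integral_cong)
      fix y
      have "(\<integral>w. \<Phi> t (y, w) \<partial>gauss) = (\<integral>w. k y * (w * - f (cos t * y - sin t * w)) \<partial>gauss)"
        by (intro Bochner_Integration.integral_cong) (auto simp: \<Phi>_def)
      then show "(\<integral>w. \<Phi> t (y, w) \<partial>gauss) = k y * u y" by (simp only: integral_mult_right_zero u_def)
    qed simp
    finally have FI: "(\<integral>p. F t p \<partial>?P) = (\<integral>y. k y * u y \<partial>gauss)" .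
    have "integrable gauss (\<lambda>y. \<integral>w. \<Phi> t (y, w) \<partial>gauss)"
      using gauss2.integrable_fst'[OF Phi_integrable] by simp
    moreover have "(\<integral>w. \<Phi> t (y, w) \<partial>gauss) = k y * u y" for y
    proof -
      have "(\<integral>w. \<Phi> t (y, w) \<partial>gauss) = (\<integral>w. k y * (w * - f (cos t * y - sin t * w)) \<partial>gauss)"
        by (intro Bochner_Integration.integral_cong) (auto simp: \<Phi>_def)
      then show ?thesis by (simp only: integral_mult_right_zero u_def)
    qed
    ultimately have ku: "integrable gauss (\<lambda>y. k y * u y)" by simp
    have "ennreal (\<integral>y. k y * u y \<partial>gauss) = (\<integral>\<^sup>+y. ennreal (k y * u y) \<partial>gauss)"
      using ku u0 g(3) by (intro nn_integral_eq_integral[symmetric]) auto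
    also have "\<dots> = (\<integral>\<^sup>+y. ennreal (k y) * (\<integral>\<^sup>+w. ennreal (sin t * f' (cos t * y - sin t * w)) \<partial>gauss) \<partial>gauss)"
      using g(3) by (intro nn_integral_cong) (simp add: stein ennreal_mult')
    also have "\<dots> = (\<integral>\<^sup>+y. \<integral>\<^sup>+w. ennreal (sin t) * ennreal (f' (cos t * y - sin t * w) * k y) \<partial>gauss \<partial>gauss)"
      using s f(3) g(3)
      by (intro nn_integral_cong, subst nn_integral_cmult[symmetric]) (auto intro!: nn_integral_cong simp: ac_simps simp flip: ennreal_mult')
    also have "\<dots> = ennreal (sin t) * (\<integral>\<^sup>+y. \<integral>\<^sup>+w. ennreal (f' (cos t * y - sin t * w) * k y) \<partial>gauss \<partial>gauss)"
      by (simp add: nn_integral_cmult)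
    also have "\<dots> = ennreal (sin t) * r t"
      unfolding r_def using s by (subst nn_integral_gauss_pair_swap) auto
    finally show ?thesis
      unfolding FI using u0 g(3) by (auto intro!: integral_nonneg_AE)
  qed
  have "(\<integral>p. h \<theta>2 p \<partial>?P) - (\<integral>p. h \<theta>1 p \<partial>?P) = (\<integral>p. \<integral>t. indicator ?J t * F t p \<partial>lborel \<partial>?P)"
  proof -
    have "(\<integral>p. \<integral>t. indicator ?J t * F t p \<partial>lborel \<partial>?P) = (\<integral>p. h \<theta>2 p - h \<theta>1 p \<partial>?P)"
      using path by (intro Bochner_Integration.integral_cong) (auto simp: h_def)
    then show ?thesis using h_int by simp
  qed
  also have "\<dots> = (\<integral>t. \<integral>p. indicator ?J t * F t p \<partial>?P \<partial>lborel)"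
    using Q.Fubini_integral[OF F_integrable] by simp
  finally have diff: "(\<integral>p. h \<theta>2 p \<partial>?P) = (\<integral>p. h \<theta>1 p \<partial>?P) + (\<integral>t. \<integral>p. indicator ?J t * F t p \<partial>?P \<partial>lborel)"
    by simp
  have J0: "0 \<le> (\<integral>p. indicator ?J t * F t p \<partial>?P)" for t
    using inner[of t] by (cases "t \<in> ?J") auto
  have "ennreal (\<integral>t. \<integral>p. indicator ?J t * F t p \<partial>?P \<partial>lborel) = (\<integral>\<^sup>+t. ennreal (\<integral>p. indicator ?J t * F t p \<partial>?P) \<partial>lborel)"
    using Q.integrable_fst'[OF F_integrable] J0 by (intro nn_integral_eq_integral[symmetric]) auto
  also have "\<dots> = (\<integral>\<^sup>+t. ennreal (sin t) * r t * indicator ?J t \<partial>lborel)"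
  proof (rule nn_integral_cong)
    fix t show "ennreal (\<integral>p. indicator ?J t * F t p \<partial>?P) = ennreal (sin t) * r t * indicator ?J t"
      using inner[of t] by (cases "t \<in> ?J") auto
  qed
  finally show ?thesis
    unfolding pair_h diff using hB J0
    by (simp add: r_def integral_nonneg_AE ennreal_plus)
qed

text \<open>The other angles stay fixed, and the one-dimensional inequality is integrated over the
  other coordinates. The exchange of integrals needs joint measurability in the angle and these
  coordinates; it is obtained by writing the pair through two independent Gaussian
  variables.\<close>

lemma coordinate_interpolation:
  fixes f f' g k :: "('i \<Rightarrow> real) \<Rightarrow> real"
  assumes J: "finite J" "i \<notin> J"
    and meas: "f \<in> borel_measurable (gauss_PiM (insert i J))" "f' \<in> borel_measurable (gauss_PiM (insert i J))"
      "g \<in> borel_measurable (gauss_PiM (insert i J))" "k \<in> borel_measurable (gauss_PiM (insert i J))"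
    and f: "\<And>x t. x \<in> space (gauss_PiM J) \<Longrightarrow> ((\<lambda>t. f (x(i := t))) has_real_derivative f' (x(i := t))) (at t)"
      "\<And>x. x \<in> space (gauss_PiM J) \<Longrightarrow> continuous_on UNIV (\<lambda>t. f' (x(i := t)))"
      "\<And>x t. x \<in> space (gauss_PiM J) \<Longrightarrow> 0 \<le> f' (x(i := t))"
    and fB: "\<And>x. 0 \<le> f x" "\<And>x. f x \<le> B"
    and g: "\<And>x t. x \<in> space (gauss_PiM J) \<Longrightarrow> ((\<lambda>t. g (x(i := t))) has_real_derivative - k (x(i := t))) (at t)"
      "\<And>x. x \<in> space (gauss_PiM J) \<Longrightarrow> continuous_on UNIV (\<lambda>t. k (x(i := t)))"
      "\<And>x t. x \<in> space (gauss_PiM J) \<Longrightarrow> 0 \<le> k (x(i := t))"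
    and gB: "\<And>x. 0 \<le> g x" "\<And>x. g x \<le> B"
    and ang: "0 < \<theta>1" "\<theta>1 \<le> \<theta>2" "\<theta>2 < pi"
  shows "(\<integral>\<^sup>+w. ennreal (f (comp_fst (insert i J) w) * g (comp_snd (insert i J) w)) \<partial>pair_PiM (insert i J) (\<theta>(i := \<theta>2))) \<le>
    (\<integral>\<^sup>+w. ennreal (f (comp_fst (insert i J) w) * g (comp_snd (insert i J) w)) \<partial>pair_PiM (insert i J) (\<theta>(i := \<theta>1))) +
    (\<integral>\<^sup>+t. ennreal (sin t) * (\<integral>\<^sup>+w. ennreal (f' (comp_fst (insert i J) w) * k (comp_snd (insert i J) w)) \<partial>pair_PiM (insert i J) (\<theta>(i := t)))
      * indicator {\<theta>1..\<theta>2} t \<partial>lborel)"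
proof -
  interpret prob_space "pair_PiM J \<theta>" by (rule prob_space_pair_PiM)
  interpret Q: pair_sigma_finite lborel "pair_PiM J \<theta>" ..
  have split: "(\<integral>\<^sup>+w. ennreal (u (comp_fst (insert i J) w) * v (comp_snd (insert i J) w)) \<partial>pair_PiM (insert i J) (\<theta>(i := t)))
      = (\<integral>\<^sup>+w. \<integral>\<^sup>+p. ennreal (u ((comp_fst J w)(i := fst p)) * v ((comp_snd J w)(i := snd p))) \<partial>gauss_pair t \<partial>pair_PiM J \<theta>)"
    if [measurable]: "u \<in> borel_measurable (gauss_PiM (insert i J))" "v \<in> borel_measurable (gauss_PiM (insert i J))" for u v t
  proof -
    interpret P: product_prob_space "\<lambda>j. gauss_pair ((\<theta>(i := t)) j)" by (rule product_prob_space_gauss_pair)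
    have "pair_PiM J (\<theta>(i := t)) = pair_PiM J \<theta>"
      using J by (intro PiM_cong) auto
    then show ?thesis
      using J by (subst P.product_nn_integral_insert) (simp_all add: comp_upd)
  qed
  note [measurable] = meas
  have two[measurable]: "(\<lambda>(x, t). u (x(i := t))) \<in> borel_measurable (gauss_PiM J \<Otimes>\<^sub>M gauss)"
    if "u \<in> borel_measurable (gauss_PiM (insert i J))" for u :: "('i \<Rightarrow> real) \<Rightarrow> real"
    using measurable_two_sections[OF that] by simp
  define R where "R = (\<lambda>t w. \<integral>\<^sup>+p. ennreal (f' ((comp_fst J w)(i := fst p)) * k ((comp_snd J w)(i := snd p))) \<partial>gauss_pair t)"
  have sec: "(\<lambda>t. u ((comp_fst J w)(i := t))) \<in> borel_measurable borel" "(\<lambda>t. u ((comp_snd J w)(i := t))) \<in> borel_measurable borel"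
    if "u \<in> borel_measurable (gauss_PiM (insert i J))" for u :: "('i \<Rightarrow> real) \<Rightarrow> real" and w :: "'i \<Rightarrow> real \<times> real"
    using measurable_section[OF that comp_fst_space J(2), of w] measurable_section[OF that comp_snd_space J(2), of w] by simp_all
  have R_eq: "R t w = (\<integral>\<^sup>+x. \<integral>\<^sup>+z. ennreal (f' ((comp_fst J w)(i := x)) * k ((comp_snd J w)(i := cos t * x + sin t * z))) \<partial>gauss \<partial>gauss)" for t w
  proof -
    note [measurable] = sec(1)[OF meas(2), of w] sec(2)[OF meas(4), of w]
    show ?thesis unfolding R_def by (subst nn_integral_gauss_pair) auto
  qed
  have R_meas [measurable]: "(\<lambda>(t, w). R t w) \<in> borel_measurable (lborel \<Otimes>\<^sub>M pair_PiM J \<theta>)"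
    unfolding R_eq by measurable
  have [measurable]: "R t \<in> borel_measurable (pair_PiM J \<theta>)" for t
    using measurable_compose[OF measurable_Pair1' R_meas, of t] by simp
  let ?h = "\<lambda>t w. \<integral>\<^sup>+p. ennreal (f ((comp_fst J w)(i := fst p)) * g ((comp_snd J w)(i := snd p))) \<partial>gauss_pair t"
  have h_eq: "?h t w = (\<integral>\<^sup>+x. \<integral>\<^sup>+z. ennreal (f ((comp_fst J w)(i := x)) * g ((comp_snd J w)(i := cos t * x + sin t * z))) \<partial>gauss \<partial>gauss)" for t w
  proof -
    note [measurable] = sec(1)[OF meas(1), of w] sec(2)[OF meas(3), of w]
    show ?thesis by (subst nn_integral_gauss_pair) auto
  qed
  have h_meas [measurable]: "?h t \<in> borel_measurable (pair_PiM J \<theta>)" for t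
    unfolding h_eq by measurable
  have "(\<integral>\<^sup>+w. ennreal (f (comp_fst (insert i J) w) * g (comp_snd (insert i J) w)) \<partial>pair_PiM (insert i J) (\<theta>(i := \<theta>2)))
      = (\<integral>\<^sup>+w. ?h \<theta>2 w \<partial>pair_PiM J \<theta>)"
    by (rule split) (rule meas)+
  also have "\<dots> \<le> (\<integral>\<^sup>+w. ?h \<theta>1 w + (\<integral>\<^sup>+t. ennreal (sin t) * R t w * indicator {\<theta>1..\<theta>2} t \<partial>lborel) \<partial>pair_PiM J \<theta>)"
  proof (rule nn_integral_mono)
    fix w
    have "((\<lambda>t. f ((comp_fst J w)(i := t))) has_real_derivative f' ((comp_fst J w)(i := t))) (at t)" for t
      by (rule f) simp
    moreover have "((\<lambda>t. g ((comp_snd J w)(i := t))) has_real_derivative - k ((comp_snd J w)(i := t))) (at t)" for t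
      by (rule g) simp
    ultimately show "?h \<theta>2 w \<le> ?h \<theta>1 w + (\<integral>\<^sup>+t. ennreal (sin t) * R t w * indicator {\<theta>1..\<theta>2} t \<partial>lborel)"
      unfolding R_def
      by (intro gauss_pair_interpolation[where B=B] f g fB gB ang) simp_all
  qed
  also have "\<dots> = (\<integral>\<^sup>+w. ?h \<theta>1 w \<partial>pair_PiM J \<theta>)
      + (\<integral>\<^sup>+w. \<integral>\<^sup>+t. ennreal (sin t) * R t w * indicator {\<theta>1..\<theta>2} t \<partial>lborel \<partial>pair_PiM J \<theta>)"
    by (intro nn_integral_add) measurable
  also have "(\<integral>\<^sup>+w. \<integral>\<^sup>+t. ennreal (sin t) * R t w * indicator {\<theta>1..\<theta>2} t \<partial>lborel \<partial>pair_PiM J \<theta>)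
      = (\<integral>\<^sup>+t. \<integral>\<^sup>+w. ennreal (sin t) * R t w * indicator {\<theta>1..\<theta>2} t \<partial>pair_PiM J \<theta> \<partial>lborel)"
    by (intro Q.Fubini') measurable
  also have "\<dots> = (\<integral>\<^sup>+t. ennreal (sin t) * (\<integral>\<^sup>+w. R t w \<partial>pair_PiM J \<theta>) * indicator {\<theta>1..\<theta>2} t \<partial>lborel)"
    by (simp add: nn_integral_cmult nn_integral_multc)
  also have "\<dots> = (\<integral>\<^sup>+t. ennreal (sin t) * (\<integral>\<^sup>+w. ennreal (f' (comp_fst (insert i J) w) * k (comp_snd (insert i J) w)) \<partial>pair_PiM (insert i J) (\<theta>(i := t)))
      * indicator {\<theta>1..\<theta>2} t \<partial>lborel)"
    unfolding R_def by (simp only: split[OF meas(2,4)])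
  also have "(\<integral>\<^sup>+w. ?h \<theta>1 w \<partial>pair_PiM J \<theta>)
      = (\<integral>\<^sup>+w. ennreal (f (comp_fst (insert i J) w) * g (comp_snd (insert i J) w)) \<partial>pair_PiM (insert i J) (\<theta>(i := \<theta>1)))"
    by (rule split[symmetric]) (rule meas)+
  finally show ?thesis .
qed

section \<open>Correlated families as functions of two independent families\<close>

definition mix :: "'i set \<Rightarrow> ('i \<Rightarrow> real) \<Rightarrow> ('i \<Rightarrow> real) \<Rightarrow> ('i \<Rightarrow> real) \<Rightarrow> 'i \<Rightarrow> real" where
  "mix I \<theta> x z = (\<lambda>i\<in>I. cos (\<theta> i) * x i + sin (\<theta> i) * z i)"

lemma measurable_mix [measurable]:
  "(\<lambda>(x, z). mix I \<theta> x z) \<in> measurable (gauss_PiM I \<Otimes>\<^sub>M gauss_PiM I) (gauss_PiM I)"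
  unfolding mix_def by measurable

lemma mix_upd:
  assumes "i \<notin> I"
  shows "mix (insert i I) \<theta> (x(i := s)) (z(i := t)) = (mix I \<theta> x z)(i := cos (\<theta> i) * s + sin (\<theta> i) * t)"
  using assms by (auto simp: mix_def fun_eq_iff)

lemma mix_space [simp]: "mix I \<theta> x z \<in> space (gauss_PiM I)"
  by (auto simp: mix_def space_PiM)

text \<open>In terms of two independent Gaussian vectors x and z the angle occurs only in the
  integrand. Limits in the angle can then be taken by dominated convergence on a fixed
  space.\<close>

lemma nn_integral_pair_PiM:
  fixes H :: "('i \<Rightarrow> real) \<Rightarrow> ('i \<Rightarrow> real) \<Rightarrow> ennreal"
  assumes "finite I" "(\<lambda>(x, y). H x y) \<in> borel_measurable (gauss_PiM I \<Otimes>\<^sub>M gauss_PiM I)"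
  shows "(\<integral>\<^sup>+w. H (comp_fst I w) (comp_snd I w) \<partial>pair_PiM I \<theta>) =
    (\<integral>\<^sup>+x. \<integral>\<^sup>+z. H x (mix I \<theta> x z) \<partial>gauss_PiM I \<partial>gauss_PiM I)"
  using assms
proof (induction I arbitrary: H)
  case empty
  then show ?case by (simp add: nn_integral_PiM_empty comp_fst_def comp_snd_def mix_def restrict_def
      prob_space.emeasure_space_1[OF prob_space_pair_PiM] prob_space.emeasure_space_1[OF prob_space_gauss_PiM])
next
  case (insert i I)
  interpret pair_prod: product_prob_space "\<lambda>i. gauss_pair (\<theta> i)" by (rule product_prob_space_gauss_pair)
  interpret gauss_prod: product_prob_space "\<lambda>_ :: 'i. gauss" by (rule product_prob_space_gauss)
  interpret G: prob_space "gauss_PiM I" by (rule prob_space_gauss_PiM)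
  interpret GG: pair_sigma_finite gauss "gauss_PiM I" ..
  note [measurable] = insert.prems
  have H4: "(\<lambda>(x, y, s, t). H (x(i := s)) (y(i := t))) \<in> borel_measurable (gauss_PiM I \<Otimes>\<^sub>M gauss_PiM I \<Otimes>\<^sub>M gauss \<Otimes>\<^sub>M gauss)"
  proof -
    have "(\<lambda>(x, y, s, t). (x(i := s), y(i := t))) \<in> measurable (gauss_PiM I \<Otimes>\<^sub>M gauss_PiM I \<Otimes>\<^sub>M gauss \<Otimes>\<^sub>M gauss)
      (gauss_PiM (insert i I) \<Otimes>\<^sub>M gauss_PiM (insert i I))"
      by measurable
    from measurable_compose[OF this insert.prems] show ?thesis by (simp add: case_prod_beta')
  qed
  define H' where "H' = (\<lambda>x y. \<integral>\<^sup>+s. \<integral>\<^sup>+t. H (x(i := s)) (y(i := cos (\<theta> i) * s + sin (\<theta> i) * t)) \<partial>gauss \<partial>gauss)"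
  have K: "(\<lambda>(x, y, s, t). H (x(i := s)) (y(i := cos (\<theta> i) * s + sin (\<theta> i) * t)))
      \<in> borel_measurable (gauss_PiM I \<Otimes>\<^sub>M gauss_PiM I \<Otimes>\<^sub>M gauss \<Otimes>\<^sub>M gauss)"
  proof -
    have "(\<lambda>(x, y, s, t). (x, y, s, cos (\<theta> i) * s + sin (\<theta> i) * t)) \<in> measurable
      (gauss_PiM I \<Otimes>\<^sub>M gauss_PiM I \<Otimes>\<^sub>M gauss \<Otimes>\<^sub>M gauss) (gauss_PiM I \<Otimes>\<^sub>M gauss_PiM I \<Otimes>\<^sub>M gauss \<Otimes>\<^sub>M gauss)"
      by measurable
    from measurable_compose[OF this H4] show ?thesis by (simp add: case_prod_beta')
  qed
  have H'_meas: "(\<lambda>(x, y). H' x y) \<in> borel_measurable (gauss_PiM I \<Otimes>\<^sub>M gauss_PiM I)"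
  proof -
    have "(\<lambda>((x, y), s, t). H (x(i := s)) (y(i := cos (\<theta> i) * s + sin (\<theta> i) * t)))
      \<in> borel_measurable ((gauss_PiM I \<Otimes>\<^sub>M gauss_PiM I) \<Otimes>\<^sub>M gauss \<Otimes>\<^sub>M gauss)"
      using measurable_compose[OF _ K, of "\<lambda>((x, y), s, t). (x, y, s, t)"] by (simp add: case_prod_beta')
    then have [measurable]: "(\<lambda>(((x, y), s), t). H (x(i := s)) (y(i := cos (\<theta> i) * s + sin (\<theta> i) * t)))
      \<in> borel_measurable (((gauss_PiM I \<Otimes>\<^sub>M gauss_PiM I) \<Otimes>\<^sub>M gauss) \<Otimes>\<^sub>M gauss)"
      using measurable_compose[of "\<lambda>(((x, y), s), t). ((x, y), s, t)"] by (simp add: case_prod_beta')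
    show ?thesis unfolding H'_def case_prod_beta' by measurable
  qed
  have "(\<integral>\<^sup>+w. H (comp_fst (insert i I) w) (comp_snd (insert i I) w) \<partial>pair_PiM (insert i I) \<theta>)
      = (\<integral>\<^sup>+w. \<integral>\<^sup>+p. H ((comp_fst I w)(i := fst p)) ((comp_snd I w)(i := snd p)) \<partial>gauss_pair (\<theta> i) \<partial>pair_PiM I \<theta>)"
    using insert.hyps by (subst pair_prod.product_nn_integral_insert) (simp_all add: comp_upd)
  also have "\<dots> = (\<integral>\<^sup>+w. H' (comp_fst I w) (comp_snd I w) \<partial>pair_PiM I \<theta>)"
    unfolding H'_def
  proof (intro nn_integral_cong nn_integral_gauss_pair[of "\<lambda>(s, t). H (x(i := s)) (y(i := t))" for x y, simplified case_prod_beta' fst_conv snd_conv])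
    fix w
    show "(\<lambda>p. H ((comp_fst I w)(i := fst p)) ((comp_snd I w)(i := snd p))) \<in> borel_measurable (borel \<Otimes>\<^sub>M borel)"
      using measurable_compose[OF _ H4, of "\<lambda>p. (comp_fst I w, comp_snd I w, fst p, snd p)" "borel \<Otimes>\<^sub>M borel"] by simp
  qed
  also have "\<dots> = (\<integral>\<^sup>+x. \<integral>\<^sup>+z. H' x (mix I \<theta> x z) \<partial>gauss_PiM I \<partial>gauss_PiM I)"
    by (rule insert.IH[OF H'_meas])
  also have "\<dots> = (\<integral>\<^sup>+x. \<integral>\<^sup>+s. \<integral>\<^sup>+z. \<integral>\<^sup>+t. H (x(i := s)) (mix (insert i I) \<theta> (x(i := s)) (z(i := t))) \<partial>gauss \<partial>gauss_PiM I \<partial>gauss \<partial>gauss_PiM I)"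
  proof (rule nn_integral_cong)
    fix x assume x: "x \<in> space (gauss_PiM I)"
    have 1: "(\<lambda>(s, z, t). H (x(i := s)) ((mix I \<theta> x z)(i := cos (\<theta> i) * s + sin (\<theta> i) * t))) \<in> borel_measurable (gauss \<Otimes>\<^sub>M gauss_PiM I \<Otimes>\<^sub>M gauss)"
      using measurable_compose[OF _ K, of "\<lambda>(s, z, t). (x, mix I \<theta> x z, s, t)" "gauss \<Otimes>\<^sub>M gauss_PiM I \<Otimes>\<^sub>M gauss"] x
      by (simp add: case_prod_beta')
    have 2: "(\<lambda>((s, z), t). H (x(i := s)) ((mix I \<theta> x z)(i := cos (\<theta> i) * s + sin (\<theta> i) * t))) \<in> borel_measurable ((gauss \<Otimes>\<^sub>M gauss_PiM I) \<Otimes>\<^sub>M gauss)"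
      using measurable_compose[OF _ 1, of "\<lambda>((s, z), t). (s, z, t)" "(gauss \<Otimes>\<^sub>M gauss_PiM I) \<Otimes>\<^sub>M gauss"] by (simp add: case_prod_beta')
    show "(\<integral>\<^sup>+z. H' x (mix I \<theta> x z) \<partial>gauss_PiM I) = (\<integral>\<^sup>+s. \<integral>\<^sup>+z. \<integral>\<^sup>+t. H (x(i := s)) (mix (insert i I) \<theta> (x(i := s)) (z(i := t))) \<partial>gauss \<partial>gauss_PiM I \<partial>gauss)"
      unfolding H'_def mix_upd[OF insert.hyps(2)]
    proof (rule GG.Fubini')
      show "(\<lambda>(s, z). \<integral>\<^sup>+t. H (x(i := s)) ((mix I \<theta> x z)(i := cos (\<theta> i) * s + sin (\<theta> i) * t)) \<partial>gauss)
        \<in> borel_measurable (gauss \<Otimes>\<^sub>M gauss_PiM I)"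
        using gauss.borel_measurable_nn_integral[of "\<lambda>(s, z) t. H (x(i := s)) ((mix I \<theta> x z)(i := cos (\<theta> i) * s + sin (\<theta> i) * t))" "gauss \<Otimes>\<^sub>M gauss_PiM I"] 2
        by (simp add: case_prod_beta')
    qed
  qed
  also have "\<dots> = (\<integral>\<^sup>+x. \<integral>\<^sup>+s. \<integral>\<^sup>+z. H (x(i := s)) (mix (insert i I) \<theta> (x(i := s)) z) \<partial>gauss_PiM (insert i I) \<partial>gauss \<partial>gauss_PiM I)"
  proof (intro nn_integral_cong gauss_prod.product_nn_integral_insert[symmetric] insert.hyps)
    fix x s assume "x \<in> space (gauss_PiM I)"
    then have "x(i := s) \<in> space (gauss_PiM (insert i I))" by (simp add: space_PiM PiE_fun_upd)
    then show "(\<lambda>z. H (x(i := s)) (mix (insert i I) \<theta> (x(i := s)) z)) \<in> borel_measurable (gauss_PiM (insert i I))"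
      using measurable_compose[OF _ insert.prems, of "\<lambda>z. (x(i := s), mix (insert i I) \<theta> (x(i := s)) z)"] by simp
  qed
  also have "\<dots> = (\<integral>\<^sup>+x. \<integral>\<^sup>+z. H x (mix (insert i I) \<theta> x z) \<partial>gauss_PiM (insert i I) \<partial>gauss_PiM (insert i I))"
  proof (rule gauss_prod.product_nn_integral_insert[symmetric])
    interpret G': prob_space "gauss_PiM (insert i I)" by (rule prob_space_gauss_PiM)
    have "(\<lambda>(x, z). H x (mix (insert i I) \<theta> x z)) \<in> borel_measurable (gauss_PiM (insert i I) \<Otimes>\<^sub>M gauss_PiM (insert i I))"
      using measurable_compose[OF _ insert.prems, of "\<lambda>(x, z). (x, mix (insert i I) \<theta> x z)"] by (simp add: case_prod_beta')
    then show "(\<lambda>x. \<integral>\<^sup>+z. H x (mix (insert i I) \<theta> x z) \<partial>gauss_PiM (insert i I)) \<in> borel_measurable (gauss_PiM (insert i I))"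
      by measurable
  qed (rule insert.hyps)+
  finally show ?case .
qed

text \<open>The two-function bound with \<alpha> = 1/p is applied to the p-th power of h truncated
  at level M; the condition \<alpha> (1 + cos \<theta>) \<le> 1 becomes cos \<theta> \<le> p - 1.
  Monotone convergence removes the truncation.\<close>

lemma two_function_bound_Lp:
  fixes h :: "('i \<Rightarrow> real) \<Rightarrow> real"
  assumes "finite I" and p: "1 < p" "p < 2" and \<theta>: "\<And>i. i \<in> I \<Longrightarrow> 0 \<le> cos (\<theta> i)" "\<And>i. i \<in> I \<Longrightarrow> cos (\<theta> i) \<le> p - 1"
    and h: "h \<in> borel_measurable (gauss_PiM I)" "\<And>x. 0 \<le> h x" "integrable (gauss_PiM I) (\<lambda>x. h x powr p)"
  shows "(\<integral>\<^sup>+w. ennreal (h (comp_fst I w) * h (comp_snd I w)) \<partial>pair_PiM I \<theta>)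
    \<le> ennreal ((\<integral>x. h x powr p \<partial>gauss_PiM I) powr (2 / p))"
proof -
  note [measurable] = h(1)
  interpret P: prob_space "pair_PiM I \<theta>" by (rule prob_space_pair_PiM)
  define H where "H = (\<lambda>M x. min (h x) (real M))"
  have [measurable]: "H M \<in> borel_measurable (gauss_PiM I)" for M unfolding H_def by measurable
  have H: "0 \<le> H M x" "H M x \<le> real M" "H M x \<le> h x" for M x using h(2) by (auto simp: H_def)
  have bound: "(\<integral>\<^sup>+w. ennreal (H M (comp_fst I w) * H M (comp_snd I w)) \<partial>pair_PiM I \<theta>)
    \<le> ennreal ((\<integral>x. h x powr p \<partial>gauss_PiM I) powr (2 / p))" for M
  proof -
    have eq: "(H M x powr p * H M y powr p) powr (1 / p) = H M x * H M y" for x y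
      using H p by (simp add: powr_mult[symmetric] powr_powr)
    have "(\<integral>w. H M (comp_fst I w) * H M (comp_snd I w) \<partial>pair_PiM I \<theta>)
      \<le> ((\<integral>x. H M x powr p \<partial>gauss_PiM I) * (\<integral>x. H M x powr p \<partial>gauss_PiM I)) powr (1 / p)"
      unfolding eq[symmetric]
    proof (rule two_function_bound_PiM[OF \<open>finite I\<close>, where M="real M powr p"])
      show "1 / p * (1 + cos (\<theta> i)) \<le> 1" if "i \<in> I" for i using \<theta>(2)[OF that] p by (simp add: field_simps)
    qed (use p \<theta>(1) H in \<open>auto intro: powr_mono2\<close>)
    also have "\<dots> \<le> ((\<integral>x. h x powr p \<partial>gauss_PiM I) * (\<integral>x. h x powr p \<partial>gauss_PiM I)) powr (1 / p)"
    proof (intro powr_mono2 mult_mono)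
      show "(\<integral>x. H M x powr p \<partial>gauss_PiM I) \<le> (\<integral>x. h x powr p \<partial>gauss_PiM I)"
        using H p h by (intro integral_mono' powr_mono2) auto
      then show "(\<integral>x. H M x powr p \<partial>gauss_PiM I) \<le> (\<integral>x. h x powr p \<partial>gauss_PiM I)" .
    qed (use p in \<open>auto intro!: integral_nonneg_AE\<close>)
    also have "\<dots> = (\<integral>x. h x powr p \<partial>gauss_PiM I) powr (2 / p)"
      using p by (subst powr_mult) (auto intro!: integral_nonneg_AE simp flip: powr_add)
    finally have *: "(\<integral>w. H M (comp_fst I w) * H M (comp_snd I w) \<partial>pair_PiM I \<theta>) \<le> (\<integral>x. h x powr p \<partial>gauss_PiM I) powr (2 / p)" .
    have HM: "H M x * H M y \<le> real M * real M" for x y using H by (intro mult_mono) auto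
    have "integrable (pair_PiM I \<theta>) (\<lambda>w. H M (comp_fst I w) * H M (comp_snd I w))"
      by (rule P.integrable_const_bound[where B="real M * real M"]) (use H HM in \<open>auto simp: abs_of_nonneg\<close>)
    then have "(\<integral>\<^sup>+w. ennreal (H M (comp_fst I w) * H M (comp_snd I w)) \<partial>pair_PiM I \<theta>)
        = ennreal (\<integral>w. H M (comp_fst I w) * H M (comp_snd I w) \<partial>pair_PiM I \<theta>)"
      using H by (intro nn_integral_eq_integral) auto
    then show ?thesis using * by (simp add: ennreal_leI)
  qed
  have "(\<lambda>M. \<integral>\<^sup>+w. ennreal (H M (comp_fst I w) * H M (comp_snd I w)) \<partial>pair_PiM I \<theta>)
    \<longlonglongrightarrow> (\<integral>\<^sup>+w. ennreal (h (comp_fst I w) * h (comp_snd I w)) \<partial>pair_PiM I \<theta>)"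
  proof (rule nn_integral_LIMSEQ)
    have "H M x \<le> H M' x" if "M \<le> M'" for M M' x using that by (auto simp: H_def)
    then show "incseq (\<lambda>M w. ennreal (H M (comp_fst I w) * H M (comp_snd I w)))"
      using H by (auto simp: incseq_def le_fun_def intro!: ennreal_leI mult_mono)
    fix w
    have ev: "\<forall>\<^sub>F M in sequentially. H M x = h x" for x
      using eventually_ge_at_top[of "nat \<lceil>h x\<rceil>"] by eventually_elim (auto simp: H_def min_def; linarith)
    show "(\<lambda>M. ennreal (H M (comp_fst I w) * H M (comp_snd I w))) \<longlonglongrightarrow> ennreal (h (comp_fst I w) * h (comp_snd I w))"
      by (intro tendsto_eventually eventually_elim2[OF ev[of "comp_fst I w"] ev[of "comp_snd I w"]]) simp
  qed measurable
  then show ?thesis by (rule LIMSEQ_le_const2) (use bound in auto)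
qed

section \<open>Dyadic steps towards correlation 1 and the covariance bound\<close>

definition corr :: "nat \<Rightarrow> real" where "corr m = 1 - (1/2) ^ m"
definition angle :: "nat \<Rightarrow> real" where "angle m = arccos (corr m)"
text \<open>In step m the correlation rises from \<open>corr m\<close> to
  \<open>corr (Suc m)\<close>, by 2^(-m-1), while the angle decreases. The exponent is 1 +
  \<open>corr (Suc m)\<close>, the smallest one for which hypercontractivity covers the whole
  step.\<close>

definition lp_exp :: "nat \<Rightarrow> real" where "lp_exp m = 2 - (1/2) ^ Suc m"

lemma corr_bounds: "0 \<le> corr m" "corr m < 1"
  by (simp_all add: corr_def power_le_one)

lemma corr_Suc: "corr (Suc m) - corr m = (1/2) ^ Suc m"
  by (simp add: corr_def)

lemma lp_exp: "1 < lp_exp m" "lp_exp m < 2" "lp_exp m - 1 = corr (Suc m)"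
proof -
  have "(1/2::real) ^ Suc m \<le> 1/2" using power_le_one[of "1/2::real" m] by simp
  then show "1 < lp_exp m" by (simp add: lp_exp_def)
qed (simp_all add: lp_exp_def corr_def)

lemma cos_angle [simp]: "cos (angle m) = corr m"
  using corr_bounds[of m] by (simp add: angle_def)

lemma angle_bounds: "0 < angle m" "angle m < pi" "angle (Suc m) \<le> angle m" "angle 0 = pi / 2"
proof -
  have c: "-1 \<le> corr m" "corr m < 1" "corr m \<le> corr (Suc m)" "corr (Suc m) < 1" "-1 < corr m"
    using corr_bounds[of m] corr_bounds[of "Suc m"] corr_Suc[of m] zero_le_power[of "1/2::real" "Suc m"] by linarith+
  have "arccos 1 < arccos (corr m)" using c by (intro arccos_less_arccos) auto
  then show "0 < angle m" by (simp add: angle_def)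
  have "arccos (corr m) < arccos (-1)" using c by (intro arccos_less_arccos) auto
  then show "angle m < pi" by (simp add: angle_def)
  show "angle (Suc m) \<le> angle m" using c by (auto simp: angle_def intro!: arccos_le_arccos)
qed (simp add: angle_def corr_def)

lemma sin_nn_integral:
  assumes "0 \<le> a" "a \<le> b" "b \<le> pi"
  shows "(\<integral>\<^sup>+t. ennreal (sin t) * indicator {a..b} t \<partial>lborel) = ennreal (cos a - cos b)"
proof -
  have "(\<integral>\<^sup>+t. ennreal (sin t) * indicator {a..b} t \<partial>lborel) = ennreal (- cos b - (- cos a))"
    using assms by (intro nn_integral_FTC_Icc) (auto intro!: derivative_eq_intros sin_ge_zero borel_measurable_continuous_onI continuous_intros)
  then show ?thesis by simp
qed

text \<open>The data on Gaussian space after transport. The partial derivatives \<open>f'\<close>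
  need not be increasing, so the correlation inequality will be applied to their increasing
  majorants \<open>h\<close>. The number \<open>S i\<close> bounds the sums of step length times
  squared L^p-norm of \<open>h i\<close>, uniformly in the number of dyadic steps.\<close>

locale gauss_gradient =
  fixes I :: "'i set" and f :: "('i \<Rightarrow> real) \<Rightarrow> real" and f' h :: "'i \<Rightarrow> ('i \<Rightarrow> real) \<Rightarrow> real" and S :: "'i \<Rightarrow> real"
  assumes fin: "finite I"
    and f_meas: "f \<in> borel_measurable (gauss_PiM I)"
    and f_mono: "\<And>x y. x \<in> space (gauss_PiM I) \<Longrightarrow> y \<in> space (gauss_PiM I) \<Longrightarrow> (\<And>j. j \<in> I \<Longrightarrow> x j \<le> y j) \<Longrightarrow> f x \<le> f y"
    and f_cont: "\<And>X x. (\<And>n. X n \<in> space (gauss_PiM I)) \<Longrightarrow> x \<in> space (gauss_PiM I) \<Longrightarrow>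
      (\<And>j. j \<in> I \<Longrightarrow> (\<lambda>n::nat. X n j) \<longlonglongrightarrow> x j) \<Longrightarrow> (\<lambda>n. f (X n)) \<longlonglongrightarrow> f x"
    and f'_meas: "\<And>i. i \<in> I \<Longrightarrow> f' i \<in> borel_measurable (gauss_PiM I)"
    and f_deriv: "\<And>i x t. i \<in> I \<Longrightarrow> x \<in> space (gauss_PiM I) \<Longrightarrow> ((\<lambda>t. f (x(i := t))) has_real_derivative f' i (x(i := t))) (at t)"
    and f'_cont: "\<And>i x. i \<in> I \<Longrightarrow> x \<in> space (gauss_PiM I) \<Longrightarrow> continuous_on UNIV (\<lambda>t. f' i (x(i := t)))"
    and f'_bounds: "\<And>i x. i \<in> I \<Longrightarrow> x \<in> space (gauss_PiM I) \<Longrightarrow> 0 \<le> f' i x \<and> f' i x \<le> h i x"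
    and h_meas: "\<And>i. i \<in> I \<Longrightarrow> h i \<in> borel_measurable (gauss_PiM I)"
    and h_nonneg: "\<And>i x. 0 \<le> h i x"
    and h_mono: "\<And>i x y. i \<in> I \<Longrightarrow> x \<in> space (gauss_PiM I) \<Longrightarrow> y \<in> space (gauss_PiM I) \<Longrightarrow> (\<And>j. j \<in> I \<Longrightarrow> x j \<le> y j) \<Longrightarrow> h i x \<le> h i y"
    and h_int: "\<And>i m. i \<in> I \<Longrightarrow> integrable (gauss_PiM I) (\<lambda>x. h i x powr lp_exp m)"
    and S: "\<And>i N. i \<in> I \<Longrightarrow> (\<Sum>m<N. (1/2) ^ Suc m * (\<integral>x. h i x powr lp_exp m \<partial>gauss_PiM I) powr (2 / lp_exp m)) \<le> S i"
begin

text \<open>With g = exp(-f), E[f(X) g(Y)] is the product of the means at angle \<pi>/2 and tends to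
  E[f g] as the angle tends to 0, so the covariance is a sum of increments. All coordinates are
  moved to the next dyadic angle before any of them moves further; at each moment all angles then
  lie in the same dyadic step and one exponent serves for all coordinates.\<close>

lemma bounded_covariance:
  assumes B: "\<And>x. \<bar>f x\<bar> \<le> B"
  shows "(\<integral>x. f x \<partial>gauss_PiM I) * (\<integral>x. exp (- f x) \<partial>gauss_PiM I) - (\<integral>x. f x * exp (- f x) \<partial>gauss_PiM I)
    \<le> (\<Sum>i\<in>I. S i) * (\<integral>x. exp (- f x) \<partial>gauss_PiM I)"
proof -
  note [measurable] = f_meas f'_meas h_meas
  interpret G: prob_space "gauss_PiM I" by (rule prob_space_gauss_PiM)
  have B0: "0 \<le> B" using order_trans[OF abs_ge_zero B] .
  \<comment> \<open>Adding \<open>B\<close> makes the function nonnegative and exp(-f0) at most 1,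
    as the statements in \<open>ennreal\<close> require; the factor exp(-B) cancels at the
    end.\<close>
  define f0 where "f0 = (\<lambda>x. f x + B)"
  define g where "g = (\<lambda>x. exp (- f0 x))"
  define M where "M = 2 * B + 1"
  have [measurable]: "f0 \<in> borel_measurable (gauss_PiM I)" "g \<in> borel_measurable (gauss_PiM I)"
    unfolding f0_def g_def by measurable
  have f0: "0 \<le> f0 x" "f0 x \<le> M" for x using B[of x] B0 by (auto simp: f0_def M_def)
  have g: "0 \<le> g x" "g x \<le> 1" "g x \<le> M" for x
    using f0[of x] B0 by (auto simp: g_def M_def intro: order_trans[of _ 1])
  have M1: "1 \<le> M" using B0 by (simp add: M_def)
  define A where "A = (\<lambda>\<theta>. \<integral>\<^sup>+w. ennreal (f0 (comp_fst I w) * g (comp_snd I w)) \<partial>pair_PiM I \<theta>)"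
  define Eg where "Eg = (\<integral>\<^sup>+x. ennreal (g x) \<partial>gauss_PiM I)"
  define N where "N = (\<lambda>i m. ennreal ((\<integral>x. h i x powr lp_exp m \<partial>gauss_PiM I) powr (2 / lp_exp m)))"
  \<comment> \<open>Negative association is used for the order on families of pairs: h(X) h(Y)
    increases in both components, and g(Y) is decreasing. As the second marginal is again Gaussian,
    the split-off factor is \<open>Eg\<close>.\<close>
  have remainder: "(\<integral>\<^sup>+w. ennreal (f' i (comp_fst I w) * (f' i (comp_snd I w) * g (comp_snd I w))) \<partial>pair_PiM I \<theta>) \<le> N i m * Eg"
    if i: "i \<in> I" and \<theta>: "\<And>j. j \<in> I \<Longrightarrow> 0 \<le> cos (\<theta> j)" "\<And>j. j \<in> I \<Longrightarrow> cos (\<theta> j) \<le> corr (Suc m)" "\<And>j. j \<in> I \<Longrightarrow> 0 \<le> sin (\<theta> j)" for i m \<theta>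
  proof -
    note [measurable] = h_meas[OF i] f'_meas[OF i]
    let ?H = "\<lambda>w. ennreal (h i (comp_fst I w) * h i (comp_snd I w))"
    have "(\<integral>\<^sup>+w. ennreal (f' i (comp_fst I w) * (f' i (comp_snd I w) * g (comp_snd I w))) \<partial>pair_PiM I \<theta>)
      \<le> (\<integral>\<^sup>+w. ?H w * ennreal (g (comp_snd I w)) \<partial>pair_PiM I \<theta>)"
    proof (rule nn_integral_mono)
      fix w
      have "f' i (comp_fst I w) * (f' i (comp_snd I w) * g (comp_snd I w)) \<le> h i (comp_fst I w) * (h i (comp_snd I w) * g (comp_snd I w))"
        using f'_bounds[OF i comp_fst_space, of w] f'_bounds[OF i comp_snd_space, of w] g h_nonneg
        by (intro mult_mono) auto
      then show "ennreal (f' i (comp_fst I w) * (f' i (comp_snd I w) * g (comp_snd I w))) \<le> ?H w * ennreal (g (comp_snd I w))"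
        using h_nonneg g by (simp add: mult.assoc flip: ennreal_mult')
    qed
    also have "\<dots> \<le> (\<integral>\<^sup>+w. ?H w \<partial>pair_PiM I \<theta>) * (\<integral>\<^sup>+w. ennreal (g (comp_snd I w)) \<partial>pair_PiM I \<theta>)"
    proof (rule neg_associatedD[where le="\<lambda>v w. \<forall>j\<in>I. pair_le (v j) (w j)"])
      have "\<exists>\<theta>'. (\<forall>j\<in>I. \<theta>' j = \<theta> j) \<and> (\<forall>j. 0 \<le> cos (\<theta>' j) \<and> 0 \<le> sin (\<theta>' j))"
        using \<theta> by (intro exI[of _ "\<lambda>j. if j \<in> I then \<theta> j else 0"]) auto
      then obtain \<theta>' where \<theta>': "\<And>j. j \<in> I \<Longrightarrow> \<theta>' j = \<theta> j" "\<And>j. 0 \<le> cos (\<theta>' j)" "\<And>j. 0 \<le> sin (\<theta>' j)" by blast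
      have "neg_associated (\<lambda>v w. \<forall>j\<in>I. pair_le (v j) (w j)) (pair_PiM I \<theta>')"
        by (rule neg_associated_PiM[OF fin prob_space_gauss_pair neg_associated_gauss_pair[OF \<theta>'(2,3)]]) (simp add: pair_le_def)
      moreover have "pair_PiM I \<theta>' = pair_PiM I \<theta>" using \<theta>' by (intro PiM_cong) auto
      ultimately show "neg_associated (\<lambda>v w. \<forall>j\<in>I. pair_le (v j) (w j)) (pair_PiM I \<theta>)" by simp
    next
      fix v w :: "'i \<Rightarrow> real \<times> real" assume "\<forall>j\<in>I. pair_le (v j) (w j)"
      then have le: "\<And>j. j \<in> I \<Longrightarrow> comp_fst I v j \<le> comp_fst I w j" "\<And>j. j \<in> I \<Longrightarrow> comp_snd I v j \<le> comp_snd I w j"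
        by (auto simp: pair_le_def comp_fst_def comp_snd_def)
      show "?H v \<le> ?H w"
        using le h_nonneg by (intro ennreal_leI mult_mono h_mono[OF i]) auto
      show "ennreal (g (comp_snd I w)) \<le> ennreal (g (comp_snd I v))"
        using f_mono[OF comp_snd_space comp_snd_space le(2)] by (auto simp: g_def f0_def intro!: ennreal_leI)
    qed measurable
    also have "(\<integral>\<^sup>+w. ennreal (g (comp_snd I w)) \<partial>pair_PiM I \<theta>) = Eg"
      using nn_integral_distr[of "comp_snd I" "pair_PiM I \<theta>" "gauss_PiM I" "\<lambda>x. ennreal (g x)"]
      by (simp add: distr_comp(2)[OF fin] Eg_def)
    also have "(\<integral>\<^sup>+w. ?H w \<partial>pair_PiM I \<theta>) \<le> N i m"
      unfolding N_def using \<theta> i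
      by (intro two_function_bound_Lp fin lp_exp h_int h_nonneg) (auto simp: lp_exp(3))
    finally show ?thesis by (simp add: mult_right_mono)
  qed
  have one: "A (\<theta>(i := angle m)) \<le> A (\<theta>(i := angle (Suc m))) + ennreal ((1/2) ^ Suc m) * (N i m * Eg)"
    if i: "i \<in> I" and \<theta>: "\<And>j. j \<in> I \<Longrightarrow> \<theta> j = angle m \<or> \<theta> j = angle (Suc m)" for i m \<theta>
  proof -
    define J where "J = I - {i}"
    have J: "finite J" "i \<notin> J" "insert i J = I" using fin i by (auto simp: J_def)
    have up: "x(i := t) \<in> space (gauss_PiM I)" if "x \<in> space (gauss_PiM J)" for x t
      unfolding J(3)[symmetric] using that by (simp add: space_PiM PiE_fun_upd)
    have d: "((\<lambda>t. f (x(i := t))) has_real_derivative f' i (x(i := t))) (at t)"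
      "continuous_on UNIV (\<lambda>t. f' i (x(i := t)))" if "x \<in> space (gauss_PiM J)" for x t
      using f_deriv[OF i up[OF that, of 0], of t] f'_cont[OF i up[OF that, of 0]] by simp_all
    have dg: "((\<lambda>t. g (x(i := t))) has_real_derivative - (f' i (x(i := t)) * g (x(i := t)))) (at t)"
      if "x \<in> space (gauss_PiM J)" for x t
      unfolding g_def f0_def using d(1)[OF that, of t] by (auto intro!: derivative_eq_intros)
    have df0: "((\<lambda>t. f0 (x(i := t))) has_real_derivative f' i (x(i := t))) (at t)"
      if "x \<in> space (gauss_PiM J)" for x t
      unfolding f0_def using d(1)[OF that, of t] by (auto intro!: derivative_eq_intros)
    have cg: "continuous_on UNIV (\<lambda>t. f' i (x(i := t)) * g (x(i := t)))" if "x \<in> space (gauss_PiM J)" for x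
      by (intro continuous_on_mult d(2)[OF that] continuous_on_DERIV[OF dg[OF that]])
    have n1: "0 \<le> f' i (x(i := t))" and n2: "0 \<le> f' i (x(i := t)) * g (x(i := t))" if "x \<in> space (gauss_PiM J)" for x t
      using f'_bounds[OF i up[OF that]] g by auto
    have m: "f0 \<in> borel_measurable (gauss_PiM (insert i J))" "f' i \<in> borel_measurable (gauss_PiM (insert i J))"
      "g \<in> borel_measurable (gauss_PiM (insert i J))" "(\<lambda>x. f' i x * g x) \<in> borel_measurable (gauss_PiM (insert i J))"
      using f'_meas[OF i] by (simp_all add: J(3))
    have step: "A (\<theta>(i := angle m)) \<le> A (\<theta>(i := angle (Suc m))) +
      (\<integral>\<^sup>+t. ennreal (sin t) * (\<integral>\<^sup>+w. ennreal (f' i (comp_fst I w) * (f' i (comp_snd I w) * g (comp_snd I w))) \<partial>pair_PiM I (\<theta>(i := t)))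
      * indicator {angle (Suc m)..angle m} t \<partial>lborel)"
      unfolding A_def
      by (rule coordinate_interpolation[OF J(1,2) m df0 d(2) n1 f0 dg cg n2 g(1,3) angle_bounds(1,3,2), unfolded J(3)])
    have "(\<integral>\<^sup>+t. ennreal (sin t) * (\<integral>\<^sup>+w. ennreal (f' i (comp_fst I w) * (f' i (comp_snd I w) * g (comp_snd I w))) \<partial>pair_PiM I (\<theta>(i := t)))
      * indicator {angle (Suc m)..angle m} t \<partial>lborel) \<le> (\<integral>\<^sup>+t. (ennreal (sin t) * indicator {angle (Suc m)..angle m} t) * (N i m * Eg) \<partial>lborel)"
    proof (rule nn_integral_mono)
      fix t
      show "ennreal (sin t) * (\<integral>\<^sup>+w. ennreal (f' i (comp_fst I w) * (f' i (comp_snd I w) * g (comp_snd I w))) \<partial>pair_PiM I (\<theta>(i := t)))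
        * indicator {angle (Suc m)..angle m} t \<le> (ennreal (sin t) * indicator {angle (Suc m)..angle m} t) * (N i m * Eg)"
      proof (cases "t \<in> {angle (Suc m)..angle m}")
        case True
        have a0: "angle m \<le> pi / 2" for m
          using angle_bounds(4) decseqD[of angle 0 m] angle_bounds(3) by (auto simp: decseq_Suc_iff)
        have ang: "0 \<le> cos s" "cos s \<le> corr (Suc m)" "0 \<le> sin s" if "angle (Suc m) \<le> s" "s \<le> angle m" for s
        proof -
          have s: "0 \<le> s" "s \<le> pi / 2" "s \<le> pi" using that angle_bounds(1)[of "Suc m"] a0[of m] by auto
          show "0 \<le> cos s" using s by (intro cos_ge_zero) auto
          show "0 \<le> sin s" using s by (intro sin_ge_zero) auto
          have "cos s \<le> cos (angle (Suc m))" using s that angle_bounds(1)[of "Suc m"] by (intro cos_monotone_0_pi_le) auto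
          then show "cos s \<le> corr (Suc m)" by simp
        qed
        have "(\<integral>\<^sup>+w. ennreal (f' i (comp_fst I w) * (f' i (comp_snd I w) * g (comp_snd I w))) \<partial>pair_PiM I (\<theta>(i := t))) \<le> N i m * Eg"
        proof (rule remainder[OF i])
          fix j assume j: "j \<in> I"
          have "angle (Suc m) \<le> (\<theta>(i := t)) j \<and> (\<theta>(i := t)) j \<le> angle m"
            using True \<theta>[OF j] angle_bounds(3)[of m] by auto
          then show "0 \<le> cos ((\<theta>(i := t)) j)" "cos ((\<theta>(i := t)) j) \<le> corr (Suc m)" "0 \<le> sin ((\<theta>(i := t)) j)"
            using ang by blast+
        qed
        then show ?thesis using True by (simp add: mult_left_mono)
      qed simp
    qed
    \<comment> \<open>The integral of sin over the step is exactly the increment 2^(-m-1) of the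
      correlation.\<close>
    also have "\<dots> = ennreal (cos (angle (Suc m)) - cos (angle m)) * (N i m * Eg)"
      using angle_bounds(1)[of "Suc m"] angle_bounds(3)[of m] angle_bounds(2)[of m]
      by (subst nn_integral_multc) (auto simp: sin_nn_integral)
    also have "cos (angle (Suc m)) - cos (angle m) = (1/2) ^ Suc m" using corr_Suc[of m] by simp
    finally show ?thesis by (rule order_trans[OF step add_left_mono])
  qed
  have all: "A (\<lambda>_. angle m) \<le> A (\<lambda>j. if j \<in> T then angle (Suc m) else angle m) + (\<Sum>i\<in>T. ennreal ((1/2) ^ Suc m) * (N i m * Eg))"
    if "T \<subseteq> I" for T m
    using finite_subset[OF that fin] that
  proof (induction T)
    case (insert i T)
    let ?\<theta> = "\<lambda>j. if j \<in> T then angle (Suc m) else angle m"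
    have "A (\<lambda>_. angle m) \<le> A ?\<theta> + (\<Sum>i\<in>T. ennreal ((1/2) ^ Suc m) * (N i m * Eg))" using insert by auto
    also have "A ?\<theta> = A (?\<theta>(i := angle m))"
      using insert.hyps by (intro arg_cong[where f=A]) auto
    also have "\<dots> \<le> A (?\<theta>(i := angle (Suc m))) + ennreal ((1/2) ^ Suc m) * (N i m * Eg)"
      using insert.prems by (intro one) auto
    also have "?\<theta>(i := angle (Suc m)) = (\<lambda>j. if j \<in> insert i T then angle (Suc m) else angle m)" by auto
    finally show ?case using insert.hyps by (simp add: add.assoc add_right_mono)
  qed simp
  have A_cong: "A \<theta> = A \<theta>'" if "\<And>j. j \<in> I \<Longrightarrow> \<theta> j = \<theta>' j" for \<theta> \<theta>'
    unfolding A_def using that by (intro arg_cong2[where f=nn_integral] PiM_cong refl) auto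
  have iter: "A (\<lambda>_. angle 0) \<le> A (\<lambda>_. angle n) + (\<Sum>m<n. \<Sum>i\<in>I. ennreal ((1/2) ^ Suc m) * (N i m * Eg))" for n
  proof (induction n)
    case (Suc n)
    have "A (\<lambda>_. angle n) \<le> A (\<lambda>_. angle (Suc n)) + (\<Sum>i\<in>I. ennreal ((1/2) ^ Suc n) * (N i n * Eg))"
      using all[of I n] A_cong[of "\<lambda>j. if j \<in> I then angle (Suc n) else angle n" "\<lambda>_. angle (Suc n)"] by simp
    note step = this
    note Suc
    also note add_right_mono[OF step]
    finally show ?case by (simp only: sum.lessThan_Suc ac_simps)
  qed simp
  have rest: "(\<Sum>m<n. \<Sum>i\<in>I. ennreal ((1/2) ^ Suc m) * (N i m * Eg)) \<le> ennreal (\<Sum>i\<in>I. S i) * Eg" for n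
  proof -
    have "(\<Sum>m<n. \<Sum>i\<in>I. ennreal ((1/2) ^ Suc m) * (N i m * Eg)) = (\<Sum>i\<in>I. \<Sum>m<n. ennreal ((1/2) ^ Suc m) * N i m) * Eg"
      by (subst sum.swap) (simp add: sum_distrib_right mult.assoc)
    also have "(\<Sum>i\<in>I. \<Sum>m<n. ennreal ((1/2) ^ Suc m) * N i m)
      = (\<Sum>i\<in>I. ennreal (\<Sum>m<n. (1/2) ^ Suc m * (\<integral>x. h i x powr lp_exp m \<partial>gauss_PiM I) powr (2 / lp_exp m)))"
      unfolding N_def by (intro sum.cong refl) (simp add: sum_ennreal[symmetric] ennreal_mult' del: power_Suc)
    also have "\<dots> \<le> (\<Sum>i\<in>I. ennreal (S i))"
      by (intro sum_mono ennreal_leI S)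
    also have "\<dots> = ennreal (\<Sum>i\<in>I. S i)"
      using S[of _ 0] by (intro sum_ennreal) simp
    finally show ?thesis by (simp add: mult_right_mono)
  qed
  have A_mix: "A \<theta> = (\<integral>\<^sup>+x. \<integral>\<^sup>+z. ennreal (f0 x * g (mix I \<theta> x z)) \<partial>gauss_PiM I \<partial>gauss_PiM I)" for \<theta>
    unfolding A_def by (rule nn_integral_pair_PiM[OF fin, of "\<lambda>x y. ennreal (f0 x * g y)"]) measurable
  \<comment> \<open>At angle \<pi>/2 the vector \<open>mix\<close> is z itself, so the two families
    are independent.\<close>
  have A0: "A (\<lambda>_. angle 0) = (\<integral>\<^sup>+x. ennreal (f0 x) \<partial>gauss_PiM I) * Eg"
  proof -
    have "mix I (\<lambda>_. angle 0) x z = z" if "z \<in> space (gauss_PiM I)" for x z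
    proof -
      have "mix I (\<lambda>_. angle 0) x z = restrict z I"
        by (simp add: mix_def angle_bounds(4) fun_eq_iff)
      then show ?thesis using that by (simp add: space_PiM)
    qed
    then have "A (\<lambda>_. angle 0) = (\<integral>\<^sup>+x. \<integral>\<^sup>+z. ennreal (f0 x) * ennreal (g z) \<partial>gauss_PiM I \<partial>gauss_PiM I)"
      unfolding A_mix using f0 by (intro nn_integral_cong) (simp add: ennreal_mult')
    then show ?thesis by (simp add: nn_integral_cmult nn_integral_multc Eg_def)
  qed
  \<comment> \<open>As the angles tend to 0, \<open>mix\<close> tends to x coordinatewise; the
    sequential continuity of f and the bound \<open>M\<close> justify the limit in both
    integrals.\<close>
  have lim: "(\<lambda>n. A (\<lambda>_. angle n)) \<longlonglongrightarrow> (\<integral>\<^sup>+x. ennreal (f0 x * g x) \<partial>gauss_PiM I)"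
  proof -
    have corr_lim: "corr \<longlonglongrightarrow> 1" unfolding corr_def by real_asymp
    have "sin (angle n) = sqrt (1 - (corr n)\<^sup>2)" for n
      using angle_bounds(1,2)[of n] sin_squared_eq[of "angle n"] sin_gt_zero[of "angle n"]
      by (simp add: real_sqrt_unique[symmetric])
    moreover have "(\<lambda>n. sqrt (1 - (corr n)\<^sup>2)) \<longlonglongrightarrow> sqrt (1 - 1\<^sup>2)"
      by (intro tendsto_intros corr_lim)
    ultimately have sin_lim: "(\<lambda>n. sin (angle n)) \<longlonglongrightarrow> 0" by simp
    have pt: "(\<lambda>n. ennreal (f0 x * g (mix I (\<lambda>_. angle n) x z))) \<longlonglongrightarrow> ennreal (f0 x * g x)"
      if "x \<in> space (gauss_PiM I)" for x z
    proof -
      have "(\<lambda>n. f (mix I (\<lambda>_. angle n) x z)) \<longlonglongrightarrow> f x"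
      proof (rule f_cont)
        fix j assume "j \<in> I"
        have "(\<lambda>n. corr n * x j + sin (angle n) * z j) \<longlonglongrightarrow> 1 * x j + 0 * z j"
          by (intro tendsto_intros corr_lim sin_lim)
        then show "(\<lambda>n. mix I (\<lambda>_. angle n) x z j) \<longlonglongrightarrow> x j"
          using \<open>j \<in> I\<close> by (simp add: mix_def)
      qed (use that in simp_all)
      then show ?thesis unfolding g_def f0_def by (intro tendsto_intros)
    qed
    have fgM: "f0 x * g y \<le> M" for x y using mult_mono[OF f0(2)[of x] g(2)[of y]] g(1)[of y] M1 by simp
    show ?thesis
      unfolding A_mix
    proof (rule nn_integral_dominated_convergence[where w="\<lambda>_. ennreal M"])
      show "AE x in gauss_PiM I. (\<lambda>n. \<integral>\<^sup>+z. ennreal (f0 x * g (mix I (\<lambda>_. angle n) x z)) \<partial>gauss_PiM I) \<longlonglongrightarrow> ennreal (f0 x * g x)"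
      proof (rule AE_I2)
        fix x assume x: "x \<in> space (gauss_PiM I)"
        have m: "(\<lambda>z. ennreal (f0 x * g (mix I \<theta> x z))) \<in> borel_measurable (gauss_PiM I)" for \<theta>
        proof -
          have "(\<lambda>z. mix I \<theta> x z) \<in> measurable (gauss_PiM I) (gauss_PiM I)"
            using measurable_compose[OF measurable_Pair1'[OF x] measurable_mix] by simp
          then show ?thesis by measurable
        qed
        have "(\<lambda>n. \<integral>\<^sup>+z. ennreal (f0 x * g (mix I (\<lambda>_. angle n) x z)) \<partial>gauss_PiM I) \<longlonglongrightarrow> (\<integral>\<^sup>+z. ennreal (f0 x * g x) \<partial>gauss_PiM I)"
          by (rule nn_integral_dominated_convergence[where w="\<lambda>_. ennreal M"])
            (use m pt[OF x] fgM M1 in \<open>auto intro!: ennreal_leI simp: G.emeasure_space_1\<close>)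
        then show "(\<lambda>n. \<integral>\<^sup>+z. ennreal (f0 x * g (mix I (\<lambda>_. angle n) x z)) \<partial>gauss_PiM I) \<longlonglongrightarrow> ennreal (f0 x * g x)"
          by (simp add: G.emeasure_space_1)
      qed
      show "AE x in gauss_PiM I. (\<integral>\<^sup>+z. ennreal (f0 x * g (mix I (\<lambda>_. angle n) x z)) \<partial>gauss_PiM I) \<le> ennreal M" for n
      proof (rule AE_I2)
        fix x
        have "(\<integral>\<^sup>+z. ennreal (f0 x * g (mix I (\<lambda>_. angle n) x z)) \<partial>gauss_PiM I) \<le> (\<integral>\<^sup>+z. ennreal M \<partial>gauss_PiM I)"
          using fgM by (intro nn_integral_mono ennreal_leI)
        then show "(\<integral>\<^sup>+z. ennreal (f0 x * g (mix I (\<lambda>_. angle n) x z)) \<partial>gauss_PiM I) \<le> ennreal M"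
          by (simp add: G.emeasure_space_1)
      qed
    qed (simp_all add: G.emeasure_space_1)
  qed
  have main: "(\<integral>\<^sup>+x. ennreal (f0 x) \<partial>gauss_PiM I) * Eg \<le> (\<integral>\<^sup>+x. ennreal (f0 x * g x) \<partial>gauss_PiM I) + ennreal (\<Sum>i\<in>I. S i) * Eg"
  proof (rule LIMSEQ_le_const)
    show "(\<lambda>n. A (\<lambda>_. angle n) + ennreal (\<Sum>i\<in>I. S i) * Eg) \<longlonglongrightarrow> (\<integral>\<^sup>+x. ennreal (f0 x * g x) \<partial>gauss_PiM I) + ennreal (\<Sum>i\<in>I. S i) * Eg"
      by (intro tendsto_add lim tendsto_const)
    show "\<exists>N. \<forall>n\<ge>N. (\<integral>\<^sup>+x. ennreal (f0 x) \<partial>gauss_PiM I) * Eg \<le> A (\<lambda>_. angle n) + ennreal (\<Sum>i\<in>I. S i) * Eg"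
      using order_trans[OF iter add_left_mono[OF rest]] by (auto simp: A0)
  qed
  have conv: "(\<integral>\<^sup>+x. ennreal (u x) \<partial>gauss_PiM I) = ennreal (\<integral>x. u x \<partial>gauss_PiM I)"
    if [measurable]: "u \<in> borel_measurable (gauss_PiM I)" and "\<And>x. 0 \<le> u x" "\<And>x. u x \<le> M * M" for u
    using that by (intro nn_integral_eq_integral G.integrable_const_bound[where B="M * M"]) (auto simp: abs_of_nonneg)
  have "M * 1 \<le> M * M" using M1 by (intro mult_left_mono) auto
  then have MM: "u \<le> M * M" if "u \<le> M" for u using that by linarith
  have S0: "0 \<le> (\<Sum>i\<in>I. S i)" using S[of _ 0] by (intro sum_nonneg) simp
  have "(\<integral>x. f0 x \<partial>gauss_PiM I) * (\<integral>x. g x \<partial>gauss_PiM I) \<le> (\<integral>x. f0 x * g x \<partial>gauss_PiM I) + (\<Sum>i\<in>I. S i) * (\<integral>x. g x \<partial>gauss_PiM I)"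
  proof -
    have fg: "f0 x * g x \<le> M * M" for x using f0 g M1 by (intro mult_mono) auto
    have c: "(\<integral>\<^sup>+x. ennreal (f0 x) \<partial>gauss_PiM I) = ennreal (\<integral>x. f0 x \<partial>gauss_PiM I)"
      "Eg = ennreal (\<integral>x. g x \<partial>gauss_PiM I)"
      "(\<integral>\<^sup>+x. ennreal (f0 x * g x) \<partial>gauss_PiM I) = ennreal (\<integral>x. f0 x * g x \<partial>gauss_PiM I)"
      unfolding Eg_def using f0 g MM fg by (intro conv; simp)+
    have n: "0 \<le> (\<integral>x. f0 x \<partial>gauss_PiM I)" "0 \<le> (\<integral>x. g x \<partial>gauss_PiM I)" "0 \<le> (\<integral>x. f0 x * g x \<partial>gauss_PiM I)"
      using f0 g by (auto intro!: integral_nonneg_AE)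
    have "ennreal ((\<integral>x. f0 x \<partial>gauss_PiM I) * (\<integral>x. g x \<partial>gauss_PiM I)) \<le> ennreal ((\<integral>x. f0 x * g x \<partial>gauss_PiM I) + (\<Sum>i\<in>I. S i) * (\<integral>x. g x \<partial>gauss_PiM I))"
      using main n S0 by (simp add: c ennreal_mult' ennreal_plus)
    then show ?thesis using n S0 by (subst (asm) ennreal_le_iff) simp_all
  qed
  moreover have "integrable (gauss_PiM I) f"
    by (rule G.integrable_const_bound[where B=B]) (use B in auto)
  moreover have ig: "integrable (gauss_PiM I) g"
    by (rule G.integrable_const_bound[where B=1]) (use g in auto)
  moreover have ifg: "integrable (gauss_PiM I) (\<lambda>x. f x * g x)"
  proof (rule G.integrable_const_bound[where B="B * 1"])
    have "\<bar>f x * g x\<bar> \<le> B * 1" for x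
      using mult_mono[OF B[of x] g(2)[of x]] g(1)[of x] B0 by (simp add: abs_mult)
    then show "AE x in gauss_PiM I. norm (f x * g x) \<le> B * 1" by simp
  qed measurable
  ultimately have "(\<integral>x. f x \<partial>gauss_PiM I) * (\<integral>x. g x \<partial>gauss_PiM I) - (\<integral>x. f x * g x \<partial>gauss_PiM I) \<le> (\<Sum>i\<in>I. S i) * (\<integral>x. g x \<partial>gauss_PiM I)"
    by (simp add: f0_def distrib_right G.prob_space)
  moreover have g_eq: "g x = exp (- B) * exp (- f x)" for x by (simp add: g_def f0_def flip: exp_add)
  have "(\<integral>x. f x * g x \<partial>gauss_PiM I) = (\<integral>x. exp (- B) * (f x * exp (- f x)) \<partial>gauss_PiM I)"
    by (simp only: g_eq mult.left_commute)
  then have "(\<integral>x. f x * g x \<partial>gauss_PiM I) = exp (- B) * (\<integral>x. f x * exp (- f x) \<partial>gauss_PiM I)" by simp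
  moreover have "(\<integral>x. g x \<partial>gauss_PiM I) = exp (- B) * (\<integral>x. exp (- f x) \<partial>gauss_PiM I)"
    by (simp add: g_eq)
  ultimately have "exp (- B) * ((\<integral>x. f x \<partial>gauss_PiM I) * (\<integral>x. exp (- f x) \<partial>gauss_PiM I) - (\<integral>x. f x * exp (- f x) \<partial>gauss_PiM I))
    \<le> exp (- B) * ((\<Sum>i\<in>I. S i) * (\<integral>x. exp (- f x) \<partial>gauss_PiM I))"
    by (simp only: algebra_simps)
  then show ?thesis by simp
qed

end

context gauss_gradient
begin

text \<open>M arctan(f / M) is a bounded increasing smooth function of f with slope 1 / (1 + (f /
  M)^2) in (0, 1]. The partial derivatives therefore remain continuous, nonnegative and below the
  same \<open>h\<close>, and \<open>S\<close> is unchanged. A sharp cut-off would lose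
  differentiability.\<close>

lemma truncated:
  assumes M: "0 < (M::real)"
  shows "gauss_gradient I (\<lambda>x. M * arctan (f x / M)) (\<lambda>i x. f' i x / (1 + (f x / M)\<^sup>2)) h S"
proof unfold_locales
  show "finite I" by (rule fin)
  show "(\<lambda>x. M * arctan (f x / M)) \<in> borel_measurable (gauss_PiM I)"
    using f_meas by measurable
  show "M * arctan (f x / M) \<le> M * arctan (f y / M)"
    if "x \<in> space (gauss_PiM I)" "y \<in> space (gauss_PiM I)" "\<And>j. j \<in> I \<Longrightarrow> x j \<le> y j" for x y
    using f_mono[OF that] M by (intro mult_left_mono) (auto simp: arctan_le_iff divide_right_mono)
  show "(\<lambda>n. M * arctan (f (X n) / M)) \<longlonglongrightarrow> M * arctan (f x / M)"
    if "\<And>n. X n \<in> space (gauss_PiM I)" "x \<in> space (gauss_PiM I)" "\<And>j. j \<in> I \<Longrightarrow> (\<lambda>n::nat. X n j) \<longlonglongrightarrow> x j" for X x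
    using f_cont[OF that] M by (intro tendsto_intros) auto
  show "(\<lambda>x. f' i x / (1 + (f x / M)\<^sup>2)) \<in> borel_measurable (gauss_PiM I)" if "i \<in> I" for i
    using f_meas f'_meas[OF that] by measurable
  show "((\<lambda>t. M * arctan (f (x(i := t)) / M)) has_real_derivative f' i (x(i := t)) / (1 + (f (x(i := t)) / M)\<^sup>2)) (at t)"
    if "i \<in> I" "x \<in> space (gauss_PiM I)" for i x t
  proof -
    have "M * (inverse D * (a / M)) = a / D" for D a :: real
      using M by (cases "D = 0") (auto simp: field_simps)
    with DERIV_cmult[OF DERIV_chain2[OF DERIV_arctan DERIV_cdivide[OF f_deriv[OF that, of t]]], of M M]
    show ?thesis by simp
  qed
  have pos: "1 + (y / M)\<^sup>2 \<noteq> 0" for y :: real by (smt (verit) zero_le_power2)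
  show "continuous_on UNIV (\<lambda>t. f' i (x(i := t)) / (1 + (f (x(i := t)) / M)\<^sup>2))"
    if "i \<in> I" "x \<in> space (gauss_PiM I)" for i x
    using M pos by (intro continuous_intros f'_cont[OF that] continuous_on_DERIV[OF f_deriv[OF that]]) auto
  show "0 \<le> f' i x / (1 + (f x / M)\<^sup>2) \<and> f' i x / (1 + (f x / M)\<^sup>2) \<le> h i x"
    if "i \<in> I" "x \<in> space (gauss_PiM I)" for i x
  proof -
    have "f' i x / (1 + (f x / M)\<^sup>2) \<le> f' i x / 1"
      using f'_bounds[OF that] by (intro divide_left_mono) (auto intro: add_pos_nonneg)
    then show ?thesis using f'_bounds[OF that] by auto
  qed
qed (use h_meas h_nonneg h_mono h_int S in \<open>blast+\<close>)

text \<open>Let the truncation level tend to infinity. Dominated convergence rests on |\<tau>(y)|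
  \<le> |y| and exp(-\<tau>(y)) \<le> 1 + exp(-y), the latter because \<tau>(y) \<ge> 0 for y \<ge>
  0.\<close>

lemma covariance:
  assumes int: "integrable (gauss_PiM I) f" "integrable (gauss_PiM I) (\<lambda>x. exp (- f x))"
    "integrable (gauss_PiM I) (\<lambda>x. f x * exp (- f x))"
  shows "(\<integral>x. f x \<partial>gauss_PiM I) * (\<integral>x. exp (- f x) \<partial>gauss_PiM I) - (\<integral>x. f x * exp (- f x) \<partial>gauss_PiM I)
    \<le> (\<Sum>i\<in>I. S i) * (\<integral>x. exp (- f x) \<partial>gauss_PiM I)"
proof -
  note [measurable] = f_meas
  interpret G: prob_space "gauss_PiM I" by (rule prob_space_gauss_PiM)
  define \<tau> where "\<tau> = (\<lambda>(n::nat) y::real. real (Suc n) * arctan (y / real (Suc n)))"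
  have \<tau>_bound: "\<bar>\<tau> n y\<bar> \<le> real (Suc n) * (pi / 2)" for n y
  proof -
    have "\<bar>arctan (y / real (Suc n))\<bar> \<le> pi / 2"
      using arctan_bounded[of "y / real (Suc n)"] by linarith
    then show ?thesis by (simp add: \<tau>_def abs_mult del: of_nat_Suc)
  qed
  have \<tau>_abs: "\<bar>\<tau> n y\<bar> \<le> \<bar>y\<bar>" for n y
  proof -
    have "\<bar>arctan (y / real (Suc n))\<bar> \<le> \<bar>y / real (Suc n)\<bar>"
      by (rule abs_arctan_le)
    then show ?thesis by (simp add: \<tau>_def abs_mult field_simps del: of_nat_Suc)
  qed
  have \<tau>_exp: "exp (- \<tau> n y) \<le> 1 + exp (- y)" for n y
  proof (cases "0 \<le> y")
    case True
    then have "0 \<le> \<tau> n y" by (simp add: \<tau>_def zero_le_arctan_iff)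
    then show ?thesis by (simp add: add_increasing2)
  next
    case False
    then have "- \<tau> n y \<le> - y" using \<tau>_abs[of n y] by linarith
    then show ?thesis by (simp add: add_increasing)
  qed
  have \<tau>_lim: "(\<lambda>n. \<tau> n y) \<longlonglongrightarrow> y" for y
  proof (cases y "0 :: real" rule: linorder_cases)
    case less
    then show ?thesis unfolding \<tau>_def by real_asymp
  next
    case greater
    then show ?thesis unfolding \<tau>_def by real_asymp
  qed (simp add: \<tau>_def)
  have "(\<integral>x. \<tau> n (f x) \<partial>gauss_PiM I) * (\<integral>x. exp (- \<tau> n (f x)) \<partial>gauss_PiM I) - (\<integral>x. \<tau> n (f x) * exp (- \<tau> n (f x)) \<partial>gauss_PiM I)
    \<le> (\<Sum>i\<in>I. S i) * (\<integral>x. exp (- \<tau> n (f x)) \<partial>gauss_PiM I)" for n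
  proof -
    have "0 < real (Suc n)" by simp
    from gauss_gradient.bounded_covariance[OF truncated[OF this], of "real (Suc n) * (pi / 2)"] \<tau>_bound
    show ?thesis by (simp add: \<tau>_def)
  qed
  moreover have [measurable]: "\<tau> n \<in> borel_measurable borel" for n unfolding \<tau>_def by measurable
  have "(\<lambda>n. \<integral>x. \<tau> n (f x) \<partial>gauss_PiM I) \<longlonglongrightarrow> (\<integral>x. f x \<partial>gauss_PiM I)"
    using \<tau>_lim \<tau>_abs int by (intro integral_dominated_convergence[where w="\<lambda>x. \<bar>f x\<bar>"]) auto
  moreover have e: "(\<lambda>n. \<integral>x. exp (- \<tau> n (f x)) \<partial>gauss_PiM I) \<longlonglongrightarrow> (\<integral>x. exp (- f x) \<partial>gauss_PiM I)"
    using \<tau>_lim \<tau>_exp int by (intro integral_dominated_convergence[where w="\<lambda>x. 1 + exp (- f x)"]) (auto intro!: tendsto_intros)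
  moreover have "(\<lambda>n. \<integral>x. \<tau> n (f x) * exp (- \<tau> n (f x)) \<partial>gauss_PiM I) \<longlonglongrightarrow> (\<integral>x. f x * exp (- f x) \<partial>gauss_PiM I)"
  proof (rule integral_dominated_convergence[where w="\<lambda>x. \<bar>f x\<bar> + \<bar>f x * exp (- f x)\<bar>"])
    show "AE x in gauss_PiM I. norm (\<tau> n (f x) * exp (- \<tau> n (f x))) \<le> \<bar>f x\<bar> + \<bar>f x * exp (- f x)\<bar>" for n
    proof (rule AE_I2)
      fix x
      have "\<bar>\<tau> n (f x)\<bar> * exp (- \<tau> n (f x)) \<le> \<bar>f x\<bar> * (1 + exp (- f x))"
        by (intro mult_mono \<tau>_abs \<tau>_exp) auto
      then show "norm (\<tau> n (f x) * exp (- \<tau> n (f x))) \<le> \<bar>f x\<bar> + \<bar>f x * exp (- f x)\<bar>"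
        by (simp add: abs_mult distrib_left)
    qed
  qed (use \<tau>_lim int in \<open>auto intro!: tendsto_intros\<close>)
  ultimately show ?thesis
    by (intro LIMSEQ_le[OF tendsto_diff[OF tendsto_mult] tendsto_mult[OF tendsto_const]]) auto
qed

end

section \<open>Measures satisfying a logarithmic Sobolev inequality\<close>

lemma antiderivative_exists:
  fixes k :: "real \<Rightarrow> real"
  assumes "continuous_on UNIV k"
  shows "\<exists>g. \<forall>x. (g has_real_derivative k x) (at x)"
proof -
  have "\<exists>F. \<forall>x. -\<infinity> < ereal x \<longrightarrow> ereal x < \<infinity> \<longrightarrow> (F has_vector_derivative k x) (at x)"
    using assms by (intro einterval_antiderivative) (auto simp: continuous_on_eq_continuous_at)
  then show ?thesis by (simp add: has_real_derivative_iff_has_vector_derivative)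
qed

lemma DERIV_mono_UNIV:
  fixes H :: "real \<Rightarrow> real"
  assumes "\<And>x. (H has_real_derivative k x) (at x)" "\<And>x. 0 \<le> k x" "a \<le> b"
  shows "H a \<le> H b"
  by (rule DERIV_nonneg_imp_nondecreasing[OF \<open>a \<le> b\<close>]) (use assms in blast)

lemma DERIV_lower_increment:
  fixes H :: "real \<Rightarrow> real"
  assumes "\<And>x. (H has_real_derivative k x) (at x)" "\<And>y. a \<le> y \<Longrightarrow> y \<le> b \<Longrightarrow> c \<le> k y" "a \<le> b"
  shows "c * (b - a) \<le> H b - H a"
proof (cases "a = b")
  case False
  then obtain z where "a < z" "z < b" "H b - H a = (b - a) * k z"
    using MVT2[of a b H k] assms by auto
  then show ?thesis using assms by (simp add: mult.commute mult_left_mono)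
qed simp

text \<open>A positive substitute for ln(1/r). Its form comes from the entropy estimate in
  \<open>muckenhoupt\<close>: a weight 1 + 1/(4 r) on a tail of mass r adds 1/4 to the total mass,
  which is the quarter left out at the other end.\<close>

definition tail_log :: "real \<Rightarrow> real" where
  "tail_log r = ln (1 + 1 / (4 * r))"

lemma tail_log_antimono: "0 < r \<Longrightarrow> r \<le> s \<Longrightarrow> tail_log s \<le> tail_log r"
  unfolding tail_log_def by (subst ln_le_cancel_iff) (auto intro!: add_pos_pos divide_left_mono)

lemma tail_log_ge: "0 < r \<Longrightarrow> r \<le> 1/2 \<Longrightarrow> 1/3 \<le> tail_log r"
proof -
  assume r: "0 < r" "r \<le> 1/2"
  have "exp (1/3 :: real) \<le> 1 + 1/3 + (1/3)\<^sup>2" by (rule exp_bound) auto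
  also have "\<dots> \<le> 1 + 1 / (4 * (1/2))" by (simp add: power2_eq_square)
  finally have "1/3 \<le> tail_log (1/2)"
    unfolding tail_log_def by (subst ln_ge_iff) auto
  then show ?thesis using tail_log_antimono[OF r] by linarith
qed

section \<open>Distribution functions of measures with a continuous positive density\<close>

locale potential_prob =
  fixes V :: "real \<Rightarrow> real"
  assumes V_cont: "continuous_on UNIV V" and prob: "prob_space (potential_measure V)"
begin

abbreviation "\<mu> \<equiv> potential_measure V"
abbreviation "p \<equiv> \<lambda>x. exp (- V x)"

lemma sets_mu [simp, measurable_cong]: "sets \<mu> = sets borel"
  by (simp add: potential_measure_def)

lemma space_mu [simp]: "space \<mu> = UNIV"
  by (simp add: potential_measure_def)

sublocale real_distribution \<mu>
  by (intro real_distribution.intro real_distribution_axioms.intro prob) simp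

lemma V_meas [measurable]: "V \<in> borel_measurable borel"
  using V_cont by (rule borel_measurable_continuous_onI)

lemma emeasure_mu: "A \<in> sets borel \<Longrightarrow> emeasure \<mu> A = (\<integral>\<^sup>+x. ennreal (p x) * indicator A x \<partial>lborel)"
  unfolding potential_measure_def by (subst emeasure_density) auto

lemma emeasure_mu_singleton [simp]: "emeasure \<mu> {a} = 0"
proof -
  have "emeasure \<mu> {a} = (\<integral>\<^sup>+x. ennreal (p a) * indicator {a} x \<partial>lborel)"
    by (subst emeasure_mu) (auto intro!: nn_integral_cong simp: indicator_def)
  then show ?thesis by (simp add: nn_integral_cmult)
qed

lemma measure_mu_le_FTC:
  assumes "a \<le> b" "\<And>x. a \<le> x \<Longrightarrow> x \<le> b \<Longrightarrow> p x \<le> q x" "\<And>x. (Q has_real_derivative q x) (at x)" "\<And>x. 0 \<le> q x"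
    "q \<in> borel_measurable borel"
  shows "measure \<mu> {a<..b} \<le> Q b - Q a"
proof -
  have "emeasure \<mu> {a<..b} = (\<integral>\<^sup>+x. ennreal (p x) * indicator {a<..b} x \<partial>lborel)" by (rule emeasure_mu) simp
  also have "\<dots> \<le> (\<integral>\<^sup>+x. ennreal (q x) * indicator {a..b} x \<partial>lborel)"
    using assms(2) by (intro nn_integral_mono) (auto simp: indicator_def intro: ennreal_leI)
  also have "\<dots> = ennreal (Q b - Q a)"
    using assms by (intro nn_integral_FTC_Icc) auto
  finally have "ennreal (measure \<mu> {a<..b}) \<le> ennreal (Q b - Q a)" by (simp add: emeasure_eq_measure)
  moreover have "Q a \<le> Q b" using assms(3,4,1) by (rule DERIV_mono_UNIV)
  ultimately show ?thesis by simp
qed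

lemma cdf_DERIV: "(cdf \<mu> has_real_derivative p x) (at x)"
proof -
  obtain P where P: "\<And>x. (P has_real_derivative p x) (at x)"
    using antiderivative_exists[OF continuous_on_exp[OF continuous_on_minus[OF V_cont]]] by blast
  have inc: "cdf \<mu> b - cdf \<mu> a = P b - P a" if "a \<le> b" for a b
  proof -
    have "emeasure \<mu> {a<..b} = (\<integral>\<^sup>+x. ennreal (p x) * indicator {a<..b} x \<partial>lborel)" by (rule emeasure_mu) simp
    also have "\<dots> = (\<integral>\<^sup>+x. ennreal (p x) * indicator {a..b} x \<partial>lborel)"
      using AE_lborel_singleton[of a] by (intro nn_integral_cong_AE) (auto elim!: eventually_mono simp: indicator_def)
    also have "\<dots> = ennreal (P b - P a)"
      using that P by (intro nn_integral_FTC_Icc) auto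
    finally have "ennreal (measure \<mu> {a<..b}) = ennreal (P b - P a)" by (simp add: emeasure_eq_measure)
    moreover have "P a \<le> P b" using DERIV_mono_UNIV[OF P _ that] by simp
    ultimately have "measure \<mu> {a<..b} = P b - P a" by simp
    then show ?thesis using cdf_diff_eq[of a b] that by (cases "a = b") auto
  qed
  have "cdf \<mu> x = P x + (cdf \<mu> 0 - P 0)" for x
    using inc[of 0 x] inc[of x 0] by (cases "0 \<le> x") auto
  then have "cdf \<mu> = (\<lambda>x. P x + (cdf \<mu> 0 - P 0))" by (rule ext)
  then show ?thesis using DERIV_add[OF P DERIV_const] by (metis add.right_neutral)
qed

lemma cdf_strict_mono: "a < b \<Longrightarrow> cdf \<mu> a < cdf \<mu> b"
  using DERIV_pos_imp_increasing[of a b "cdf \<mu>"] cdf_DERIV by (meson exp_gt_zero)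

lemma cdf_cont: "continuous_on UNIV (cdf \<mu>)"
  by (rule continuous_on_DERIV) (rule cdf_DERIV)

lemma cdf_surj: "0 < u \<Longrightarrow> u < 1 \<Longrightarrow> \<exists>x. cdf \<mu> x = u"
proof -
  assume u: "0 < u" "u < 1"
  obtain a where a: "cdf \<mu> a < u"
    using order_tendstoD(2)[OF cdf_lim_at_bot u(1)] by (auto simp: eventually_at_bot_linorder)
  obtain b where b: "u < cdf \<mu> b"
    using order_tendstoD(1)[OF cdf_lim_at_top_prob u(2)] by (auto simp: eventually_at_top_linorder)
  have "a \<le> b" using a b cdf_nondecreasing[of b a] by (cases "a \<le> b") auto
  then show ?thesis
    using IVT'[of "cdf \<mu>" a u b] a b cdf_cont continuous_on_subset by fastforce
qed

lemma cdf_bounds: "0 < cdf \<mu> x" "cdf \<mu> x < 1"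
proof -
  show "0 < cdf \<mu> x" using cdf_strict_mono[of "x - 1" x] cdf_nonneg[of "x - 1"] by linarith
  show "cdf \<mu> x < 1" using cdf_strict_mono[of x "x + 1"] cdf_bounded_prob[of "x + 1"] by linarith
qed

lemma tail_eq: "measure \<mu> {x<..} = 1 - cdf \<mu> x"
proof -
  have "UNIV - {..x} = {x<..}" by auto
  then show ?thesis using prob_compl[of "{..x}"] by (simp add: cdf_def)
qed

lemma tail_pos: "0 < measure \<mu> {x<..}"
  using cdf_bounds[of x] by (simp add: tail_eq)

end

section \<open>Muckenhoupt-type estimate and lower bound for the density\<close>

lemma smooth_real_DERIV:
  "smooth_real V \<Longrightarrow> ((deriv ^^ k) V has_real_derivative (deriv ^^ Suc k) V x) (at x)"
  by (simp add: smooth_real_def DERIV_deriv_iff_real_differentiable)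

lemma smooth_real_continuous: "smooth_real V \<Longrightarrow> continuous_on UNIV V"
  by (rule continuous_on_DERIV) (use smooth_real_DERIV[of V 0] in simp)

locale log_sobolev_measure = potential_prob +
  fixes \<rho> K :: real
  assumes smooth: "smooth_real V" and curvature: "\<And>x. - K \<le> deriv (deriv V) x"
    and lsi: "hypercontractive (potential_measure V) \<rho>"
    and \<rho>: "0 < \<rho>" and K: "0 < K"
begin

lemmas V_deriv = smooth_real_DERIV[OF smooth]

lemma V_lower: "V x + deriv V x * (y - x) - K / 2 * (y - x)\<^sup>2 \<le> V y"
proof (cases "y = x")
  case False
  have "\<exists>t. (if y < x then y < t \<and> t < x else x < t \<and> t < y) \<and>
      V y = (\<Sum>m<2. (deriv ^^ m) V x / fact m * (y - x) ^ m) + (deriv ^^ 2) V t / fact 2 * (y - x)\<^sup>2"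
    using False V_deriv by (intro Taylor[where a="min x y" and b="max x y"]) auto
  then obtain t where "V y = V x + deriv V x * (y - x) + deriv (deriv V) t / 2 * (y - x)\<^sup>2"
    by (auto simp: eval_nat_numeral)
  moreover have "- K / 2 * (y - x)\<^sup>2 \<le> deriv (deriv V) t / 2 * (y - x)\<^sup>2"
    using curvature[of t] by (intro mult_right_mono) auto
  ultimately show ?thesis by simp
qed simp

end

context log_sobolev_measure
begin

text \<open>The test function in the logarithmic Sobolev inequality is H - H z, clamped to the range
  of H over [z, x], where H' = exp V. Among functions rising by A = H x - H z between z and x it has
  the least energy, and this energy is A. With r the tail mass, its squared entropy is at least A^2
  r \<open>tail_log r\<close>; dividing \<rho> A^2 r \<open>tail_log r\<close> \<le> 2 A by A gives
  the claim.\<close>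

lemma muckenhoupt:
  assumes zx: "z < x" and z: "1/4 \<le> measure \<mu> {..z}" and H: "\<And>y. (H has_real_derivative exp (V y)) (at y)"
  shows "measure \<mu> {x<..} * tail_log (measure \<mu> {x<..}) * (H x - H z) \<le> 2 / \<rho>"
proof -
  define A where "A = H x - H z"
  define G where "G = (\<lambda>y. H (max z (min y x)) - H z)"
  define r where "r = measure \<mu> {x<..}"
  have r: "0 < r" unfolding r_def by (rule tail_pos)
  have Hmono: "H a \<le> H b" if "a \<le> b" for a b using DERIV_mono_UNIV[OF H _ that] by simp
  have A: "0 < A"
    using DERIV_pos_imp_increasing[OF zx, of H] H unfolding A_def by (metis diff_gt_0_iff_gt exp_gt_zero)
  have Hcont: "continuous_on UNIV H" by (rule continuous_on_DERIV) (rule H)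
  have [measurable]: "H \<in> borel_measurable borel" using Hcont by (rule borel_measurable_continuous_onI)
  have [measurable]: "G \<in> borel_measurable borel" unfolding G_def by measurable
  have G0: "G y = 0" if "y \<le> z" for y using that zx by (simp add: G_def min_def)
  have GA: "G y = A" if "x < y" for y using that zx by (simp add: G_def A_def)
  have Gb: "0 \<le> G y" "G y \<le> A" for y
    using zx by (auto simp: G_def A_def intro!: Hmono)
  have "\<exists>L. \<forall>y\<in>{z..x}. exp (V y) \<le> L"
  proof -
    have "compact ((\<lambda>y. exp (V y)) ` {z..x})"
      by (intro compact_continuous_image continuous_on_subset[OF continuous_on_exp[OF V_cont]]) auto
    then show ?thesis using compact_imp_bounded bounded_real by (metis abs_le_D1 imageI)
  qed
  then obtain L where L: "\<And>y. z \<le> y \<Longrightarrow> y \<le> x \<Longrightarrow> exp (V y) \<le> L" by (meson atLeastAtMost_iff)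
  have L0: "0 \<le> L" using order_trans[OF exp_ge_zero L[of z]] zx by simp
  have Hlip: "\<bar>H b - H a\<bar> \<le> L * \<bar>b - a\<bar>" if "z \<le> a" "a \<le> x" "z \<le> b" "b \<le> x" for a b
  proof -
    have *: "\<bar>H b - H a\<bar> \<le> L * \<bar>b - a\<bar>" if ab: "a < b" "z \<le> a" "b \<le> x" for a b
    proof -
      obtain c where c: "a < c" "c < b" "H b - H a = (b - a) * exp (V c)" using MVT2[OF ab(1) H] by blast
      have "exp (V c) \<le> L" using L[of c] c ab by simp
      from mult_left_mono[OF this, of "b - a"] show ?thesis using c(3) ab by (simp add: abs_mult mult.commute)
    qed
    show ?thesis using *[of a b] *[of b a] that by (cases a b rule: linorder_cases) (auto simp: abs_minus_commute)
  qed
  have "L-lipschitz_on UNIV G"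
  proof (rule lipschitz_onI)
    fix a b :: real
    have "\<bar>G a - G b\<bar> \<le> L * \<bar>max z (min a x) - max z (min b x)\<bar>"
      using Hlip[of "max z (min b x)" "max z (min a x)"] zx by (simp add: G_def)
    also have "\<dots> \<le> L * \<bar>a - b\<bar>" 
    proof (rule mult_left_mono)
      have "\<bar>max z u - max z v\<bar> \<le> \<bar>u - v\<bar>" "\<bar>min u x - min v x\<bar> \<le> \<bar>u - v\<bar>" for u v
        by linarith+
      then show "\<bar>max z (min a x) - max z (min b x)\<bar> \<le> \<bar>a - b\<bar>" by (rule order_trans)
    qed (rule L0)
    finally show "dist (G a) (G b) \<le> L * dist a b" by (simp add: dist_real_def)
  qed (rule L0)
  then have lip: "local_lipschitz {0::real} UNIV (\<lambda>_. G)"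
    unfolding local_lipschitz_def
    by (intro ballI) (rule exI[of _ 1], auto intro!: exI[of _ L] intro: lipschitz_on_subset)
  have int2: "integrable \<mu> (\<lambda>y. (G y)\<^sup>2)"
    using Gb by (intro integrable_const_bound[where B="A\<^sup>2"]) (auto intro: power_mono)
  define k where "k = (\<lambda>y. indicator {z..x} y * (exp (V y))\<^sup>2)"
  \<comment> \<open>The clamped function has kinks at z and x; these two points have measure 0 and
    are discarded when integrating.\<close>
  have dG: "(deriv G y)\<^sup>2 = k y" if yn: "y \<notin> {z, x}" for y
  proof -
    consider "y < z" | "x < y" | "z < y" "y < x" using yn by force
    then show ?thesis
    proof cases
      case 1
      have "\<forall>\<^sub>F t in nhds y. G t = 0"
        using eventually_nhds_in_open[of "{..<z}" y] 1 by (auto elim!: eventually_mono simp: G0)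
      then have "deriv G y = deriv (\<lambda>_. 0) y" by (intro deriv_cong_ev) auto
      then show ?thesis using 1 by (simp add: k_def)
    next
      case 2
      have "\<forall>\<^sub>F t in nhds y. G t = A"
        using eventually_nhds_in_open[of "{x<..}" y] 2 by (auto elim!: eventually_mono simp: GA)
      then have "deriv G y = deriv (\<lambda>_. A) y" by (intro deriv_cong_ev) auto
      then show ?thesis using 2 zx by (simp add: k_def)
    next
      case 3
      have "\<forall>\<^sub>F t in nhds y. G t = H t - H z"
        using eventually_nhds_in_open[of "{z<..<x}" y] 3 by (auto elim!: eventually_mono simp: G_def)
      then have "deriv G y = deriv (\<lambda>t. H t - H z) y" by (intro deriv_cong_ev) auto
      also have "\<dots> = exp (V y)"
        by (rule DERIV_imp_deriv) (use DERIV_diff[OF H DERIV_const] in simp)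
      finally show ?thesis using 3 by (simp add: k_def)
    qed
  qed
  \<comment> \<open>The density exp(-V) cancels one of the two factors exp V in the squared
    derivative, so the energy is the integral of exp V over [z, x].\<close>
  have k_lborel: "p y *\<^sub>R k y = indicator {z..x} y *\<^sub>R exp (V y)" for y
    by (simp add: k_def exp_minus power2_eq_square)
  have k_int: "has_bochner_integral lborel (\<lambda>y. indicator {z..x} y *\<^sub>R exp (V y)) A"
    unfolding A_def using zx
    by (intro has_bochner_integral_FTC_Icc) (auto intro!: has_vector_derivative_at_within H[unfolded has_real_derivative_iff_has_vector_derivative]
      continuous_on_subset[OF continuous_on_exp[OF V_cont]])
  have [measurable]: "k \<in> borel_measurable borel" unfolding k_def by measurable
  have "integrable \<mu> k \<longleftrightarrow> integrable lborel (\<lambda>y. p y *\<^sub>R k y)"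
    unfolding potential_measure_def by (rule integrable_density) auto
  moreover have "(\<integral>y. k y \<partial>\<mu>) = (\<integral>y. p y *\<^sub>R k y \<partial>lborel)"
    unfolding potential_measure_def by (rule integral_density) auto
  ultimately have k_mu: "integrable \<mu> k" "(\<integral>y. k y \<partial>\<mu>) = A"
    using k_int unfolding k_lborel has_bochner_integral_iff by auto
  have ae: "integrable \<mu> (\<lambda>y. (deriv G y)\<^sup>2) = integrable \<mu> k"
    by (rule integrable_discrete_difference[where X="{z, x}"]) (auto simp: dG)
  have dG_int: "(\<integral>y. (deriv G y)\<^sup>2 \<partial>\<mu>) = A"
    using k_mu(2) integral_discrete_difference[of "{z, x}" \<mu> "\<lambda>y. (deriv G y)\<^sup>2" k] dG by simp
  define U where "U = (\<lambda>y. (G y)\<^sup>2)"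
  have lsiG: "integrable \<mu> (\<lambda>y. U y * ln (U y))" "\<rho> * Ent \<mu> U \<le> 2 * A"
    using lsi[unfolded hypercontractive_def, rule_format, of G] lip int2 k_mu(1) by (auto simp: ae dG_int U_def)
  have intU: "integrable \<mu> U" using int2 by (simp add: U_def)
  define m where "m = (\<integral>y. U y \<partial>\<mu>)"
  \<comment> \<open>A weight for the variational formula of entropy, Ent U \<ge> E[U ln W] whenever
    E[W] \<le> 1. It vanishes up to z, as U does; the mass of at least 1/4 there pays for the extra
    1/4 on the tail.\<close>
  define W where "W = (\<lambda>y. indicator {z<..x} y + (1 + 1 / (4 * r)) * indicator {x<..} y :: real)"
  have Wb: "0 \<le> W y" for y using r by (simp add: W_def)
  have intW: "integrable \<mu> W" unfolding W_def by (intro Bochner_Integration.integrable_add integrable_mult_right) (auto simp: emeasure_eq_measure)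
  have mW: "(\<integral>y. W y \<partial>\<mu>) \<le> 1"
  proof -
    have "(\<integral>y. W y \<partial>\<mu>) = measure \<mu> {z<..x} + (1 + 1 / (4 * r)) * r"
      unfolding W_def r_def by (subst Bochner_Integration.integral_add) (auto simp: emeasure_eq_measure)
    also have "measure \<mu> {z<..x} = cdf \<mu> x - cdf \<mu> z" using cdf_diff_eq[OF zx] by simp
    also have "cdf \<mu> x = 1 - r" using tail_eq[of x] by (simp add: r_def)
    also have "(1 + 1 / (4 * r)) * r = r + 1/4" using r by (simp add: field_simps)
    finally show ?thesis using z by (simp add: cdf_def)
  qed
  have m: "0 < m"
  proof -
    have "A\<^sup>2 * r = (\<integral>y. A\<^sup>2 * indicator {x<..} y \<partial>\<mu>)" by (simp add: r_def)
    also have "\<dots> \<le> m"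
      unfolding m_def
    proof (rule integral_mono[OF _ intU])
      show "integrable \<mu> (\<lambda>y. A\<^sup>2 * indicator {x<..} y)"
        by (rule integrable_const_bound[where B="A\<^sup>2"]) (auto simp: indicator_def)
      show "A\<^sup>2 * indicator {x<..} y \<le> U y" for y by (auto simp: U_def GA indicator_def)
    qed
    finally show ?thesis using A r by (smt (verit) mult_pos_pos zero_less_power)
  qed
  \<comment> \<open>The pointwise inequality behind that formula, from ln s \<le> s - 1 with s = m W
    / U. Where U = 0 it reduces to -m W \<le> 0.\<close>
  have pw: "U y * ln m + A\<^sup>2 * tail_log r * indicator {x<..} y + U y - m * W y \<le> U y * ln (U y)" for y
  proof (cases "U y = 0")
    case True
    then have "y \<le> x" using GA[of y] A by (auto simp: U_def not_less[symmetric])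
    then show ?thesis using True m Wb[of y] by simp
  next
    case False
    then have y: "z < y" using G0[of y] by (auto simp: U_def not_le[symmetric])
    have Upos: "0 < U y" using False by (simp add: U_def)
    have Wpos: "0 < W y" using y r by (auto simp: W_def indicator_def intro: add_pos_pos)
    have "ln (m * W y / U y) \<le> m * W y / U y - 1" using Upos Wpos m by (intro ln_le_minus_one) simp
    then have "U y * ln (m * W y / U y) \<le> U y * (m * W y / U y - 1)" using Upos by (intro mult_left_mono) auto
    also have "\<dots> = m * W y - U y" using Upos by (simp add: field_simps)
    also have "ln (m * W y / U y) = ln m + ln (W y) - ln (U y)" using Upos Wpos m by (simp add: ln_mult ln_div)
    finally have "U y * ln m + U y * ln (W y) + U y - m * W y \<le> U y * ln (U y)" by (simp add: algebra_simps)
    moreover have "U y * ln (W y) = A\<^sup>2 * tail_log r * indicator {x<..} y"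
      using y zx by (auto simp: W_def indicator_def U_def GA tail_log_def)
    ultimately show ?thesis by simp
  qed
  have "(\<integral>y. U y * ln m + A\<^sup>2 * tail_log r * indicator {x<..} y + U y - m * W y \<partial>\<mu>) \<le> (\<integral>y. U y * ln (U y) \<partial>\<mu>)"
    using pw lsiG(1) intU intW by (intro integral_mono) (auto simp: emeasure_eq_measure)
  also have "(\<integral>y. U y * ln m + A\<^sup>2 * tail_log r * indicator {x<..} y + U y - m * W y \<partial>\<mu>) = m * ln m + A\<^sup>2 * tail_log r * r + m - m * (\<integral>y. W y \<partial>\<mu>)"
    using intU intW by (simp add: m_def r_def emeasure_eq_measure)
  finally have "A\<^sup>2 * tail_log r * r + (m - m * (\<integral>y. W y \<partial>\<mu>)) \<le> Ent \<mu> U"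
    by (simp add: Ent_def m_def)
  moreover have "m * (\<integral>y. W y \<partial>\<mu>) \<le> m * 1" using m mW by (intro mult_left_mono) auto
  ultimately have "A\<^sup>2 * tail_log r * r \<le> Ent \<mu> U" by simp
  then have "\<rho> * (A\<^sup>2 * tail_log r * r) \<le> 2 * A" using lsiG(2) \<rho> by (meson less_imp_le mult_left_mono order_trans)
  then have "A * (\<rho> * (A * tail_log r * r)) \<le> A * 2" by (simp add: power2_eq_square algebra_simps)
  then have "\<rho> * (A * tail_log r * r) \<le> 2" using A by (simp only: mult_le_cancel_left_pos)
  then show ?thesis using \<rho> by (simp add: A_def r_def field_simps)
qed

end

text \<open>One entry for each case of the density bound: a steep potential; a flat potential with
  the reference point z outside a small window left of x; a flat potential with z inside that
  window. The factor exp(-3/2) accounts for the growth of the density over the window.\<close>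

definition density_const :: "real \<Rightarrow> real \<Rightarrow> real" where
  "density_const \<rho> K = min (sqrt K / (2 + 6 * K / \<rho>)) (min (\<rho> / (6 * sqrt K) * exp (- 3 / 2)) (sqrt K / 4 * exp (- 3 / 2)))"

context log_sobolev_measure
begin

lemma density_const_pos: "0 < density_const \<rho> K"
proof -
  have "0 < 2 + 6 * K / \<rho>" using K \<rho> by (intro add_pos_pos divide_pos_pos) auto
  then show ?thesis using K \<rho> by (simp add: density_const_def)
qed

text \<open>Up to constants, r sqrt(ln(1/r)) is the Gaussian density as a function of its tail r, so
  this is a comparison with the Gaussian measure at equal quantiles. The slope v = V'(x) decides. If
  v is at least sqrt K times s, where s^2 = \<open>tail_log r\<close>, the tail beyond x is at most
  a multiple of p x / v. Otherwise the density just left of x is at most exp(3/2) p x on a window of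
  length 1 / (sqrt K (s + 1)).\<close>

lemma upper_tail_density:
  assumes "measure \<mu> {x<..} \<le> 1/2"
  shows "density_const \<rho> K * (measure \<mu> {x<..} * sqrt (tail_log (measure \<mu> {x<..}))) \<le> p x"
proof -
  define r where "r = measure \<mu> {x<..}"
  have r: "0 < r" "r \<le> 1/2" using assms tail_pos by (auto simp: r_def)
  define s where "s = sqrt (tail_log r)"
  have s2: "s\<^sup>2 = tail_log r" "1/3 \<le> s\<^sup>2" using tail_log_ge[OF r] by (auto simp: s_def)
  have s: "1/2 \<le> s"
  proof (rule power2_le_imp_le)
    show "(1/2)\<^sup>2 \<le> s\<^sup>2" using s2 by (simp add: power2_eq_square)
    show "0 \<le> s" using tail_log_ge[OF r] by (simp add: s_def)
  qed
  have rs: "0 < r * s" using r s by simp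
  \<comment> \<open>The lower quartile serves as reference point; x lies to its right because the
    tail beyond x is at most 1/2.\<close>
  obtain z where z: "cdf \<mu> z = 1/4" using cdf_surj[of "1/4"] by auto
  have zx: "z < x"
  proof (rule ccontr)
    assume "\<not> z < x"
    then have "cdf \<mu> x \<le> 1/4" using cdf_nondecreasing[of x z] z by simp
    then show False using r tail_eq[of x] by (simp add: r_def)
  qed
  have z': "1/4 \<le> measure \<mu> {..z}" using z by (simp add: cdf_def)
  obtain H where H: "\<And>y. (H has_real_derivative exp (V y)) (at y)"
    using antiderivative_exists[OF continuous_on_exp[OF V_cont]] by blast
  have Hmono: "H a \<le> H b" if "a \<le> b" for a b using DERIV_mono_UNIV[OF H _ that] by simp
  have px: "exp (V x) = 1 / p x" by (simp add: exp_minus field_simps)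
  define v where "v = deriv V x"
  define sK where "sK = sqrt K"
  have sK: "0 < sK" "sK * sK = K" using K by (simp_all add: sK_def)
  have goal: "density_const \<rho> K * (r * s) \<le> p x" if "c * (r * s) \<le> p x" "density_const \<rho> K \<le> c" for c
    using order_trans[OF mult_right_mono[OF that(2)] that(1)] rs by simp
  show ?thesis
  proof (cases "sK * s \<le> v")
    case True
    have "0 < sK * s" using sK s by (intro mult_pos_pos) auto
    then have v: "0 < v" using True by linarith
    \<comment> \<open>Up to x' the loss K (y - x)^2 / 2 allowed by the curvature bound is at most
      half of the linear gain v (y - x), so V stays above a line of slope v / 2.\<close>
    define x' where "x' = x + v / K"
    have xx': "x < x'" using v K by (simp add: x'_def)
    have Vlow: "V x + v / 2 * (y - x) \<le> V y" if "x \<le> y" "y \<le> x'" for y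
    proof -
      have "K / 2 * (y - x)\<^sup>2 \<le> v / 2 * (y - x)"
      proof -
        have "K * (y - x) \<le> v" using that K by (simp add: x'_def field_simps)
        then have "K * (y - x) * (y - x) \<le> v * (y - x)" using that by (intro mult_right_mono) auto
        then show ?thesis by (simp add: power2_eq_square)
      qed
      then show ?thesis using V_lower[of x y] by (simp add: v_def)
    qed
    have mass: "measure \<mu> {x<..x'} \<le> 2 * p x / v"
    proof -
      define Q where "Q = (\<lambda>y. - (2 * p x / v) * exp (- (v / 2 * (y - x))))"
      have "measure \<mu> {x<..x'} \<le> Q x' - Q x"
      proof (rule measure_mu_le_FTC)
        show "(Q has_real_derivative p x * exp (- (v / 2 * (y - x)))) (at y)" for y
          unfolding Q_def using v by (auto intro!: derivative_eq_intros)
        show "p y \<le> p x * exp (- (v / 2 * (y - x)))" if "x \<le> y" "y \<le> x'" for y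
          using Vlow[OF that] by (simp flip: exp_add)
      qed (use xx' in auto)
      also have "\<dots> \<le> - Q x" using v by (simp add: Q_def)
      finally show ?thesis by (simp add: Q_def)
    qed
    define r' where "r' = measure \<mu> {x'<..}"
    have r': "0 < r'" unfolding r'_def by (rule tail_pos)
    have split: "r = measure \<mu> {x<..x'} + r'"
      using tail_eq[of x] tail_eq[of x'] cdf_diff_eq[OF xx'] by (simp add: r_def r'_def)
    have r'r: "r' \<le> r" using split by simp
    \<comment> \<open>Beyond x' the line no longer controls V. The remaining tail is bounded by the
      Muckenhoupt estimate at x', since exp V \<ge> 1 / p x on [x, x'] makes the increment of H
      large.\<close>
    have "1 / p x * (v / K) \<le> H x' - H x"
    proof -
      have "1 / p x \<le> exp (V y)" if "x \<le> y" "y \<le> x'" for y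
      proof -
        have "V x \<le> V y" using Vlow[OF that] v that by (smt (verit) mult_nonneg_nonneg divide_nonneg_nonneg)
        then show ?thesis unfolding px[symmetric] by simp
      qed
      from DERIV_lower_increment[OF H this, of x x'] xx' show ?thesis by (simp add: x'_def)
    qed
    also have "\<dots> \<le> H x' - H z" using Hmono[of z x] zx by simp
    finally have inc: "1 / p x * (v / K) \<le> H x' - H z" .
    have "r' * s\<^sup>2 * (1 / p x * (v / K)) \<le> r' * tail_log r' * (H x' - H z)"
      using tail_log_antimono[OF r' r'r] s2 r' inc v K tail_log_ge[OF r(1)] r
      by (intro mult_mono mult_nonneg_nonneg) (auto intro: order_trans[of 0 "s\<^sup>2"])
    also have "\<dots> \<le> 2 / \<rho>"
      using muckenhoupt[of z x'] zx xx' z' H by (simp add: r'_def)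
    finally have m: "r' * s\<^sup>2 * (1 / p x * (v / K)) \<le> 2 / \<rho>" .
    have "r' * (1/3) * (1 / p x * (v / K)) \<le> r' * s\<^sup>2 * (1 / p x * (v / K))"
      using s2 r' v K by (intro mult_right_mono mult_left_mono) auto
    with m have "r' * (1/3) * (1 / p x * (v / K)) \<le> 2 / \<rho>" by simp
    then have r'_le: "r' \<le> 6 * K * p x / (\<rho> * v)"
      using v K \<rho> by (simp add: field_simps)
    have "r \<le> 2 * p x / v + 6 * K * p x / (\<rho> * v)" using split mass r'_le by simp
    also have "\<dots> = (2 + 6 * K / \<rho>) * p x / v" using v \<rho> by (simp add: field_simps)
    finally have "r * v \<le> (2 + 6 * K / \<rho>) * p x" using v by (simp add: pos_le_divide_eq)
    moreover have "r * (sK * s) \<le> r * v" using True r by (intro mult_left_mono) auto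
    ultimately have "r * (sK * s) \<le> (2 + 6 * K / \<rho>) * p x" by simp
    then have "sK / (2 + 6 * K / \<rho>) * (r * s) \<le> p x"
      using K \<rho> by (simp add: pos_divide_le_eq add_pos_pos mult.commute mult.left_commute)
    then show ?thesis unfolding r_def[symmetric] s_def[symmetric] by (rule goal) (simp add: density_const_def sK_def)
  next
    case False
    \<comment> \<open>The window length balances slope and curvature: over it the linear term
      contributes at most s / (s + 1) \<le> 1 and the quadratic one at most 1/2, together
      3/2.\<close>
    define d where "d = 1 / (sK * (s + 1))"
    have d: "0 < d" using sK s by (simp add: d_def)
    have Vd: "V x - 3/2 \<le> V y" if "x - d \<le> y" "y \<le> x" for y
    proof -
      define t where "t = x - y"
      have t: "0 \<le> t" "t \<le> d" using that by (auto simp: t_def)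
      have "v * t \<le> 1"
      proof (cases "0 \<le> v")
        case True
        have "v * t \<le> (sK * s) * d" using False t True d by (intro mult_mono) auto
        also have "\<dots> = s / (s + 1)" using sK s by (simp add: d_def)
        also have "\<dots> \<le> 1" using s by simp
        finally show ?thesis .
      next
        case False
        then show ?thesis using t by (smt (verit) mult_nonpos_nonneg)
      qed
      moreover have "K * t\<^sup>2 \<le> 1"
      proof -
        have "sK * t \<le> sK * d" using t sK by (intro mult_left_mono) auto
        also have "\<dots> = 1 / (s + 1)" using sK by (simp add: d_def)
        also have "\<dots> \<le> 1" using s by simp
        finally have "(sK * t)\<^sup>2 \<le> 1" using t sK by (intro power_le_one) auto
        moreover have "(sK * t)\<^sup>2 = (sK * sK) * t\<^sup>2" by algebra
        ultimately show ?thesis using sK(2) by simp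
      qed
      moreover have "V x - v * t - K / 2 * t\<^sup>2 \<le> V y"
        using V_lower[of x y] by (simp add: v_def t_def power2_commute algebra_simps)
      ultimately show ?thesis by simp
    qed
    have e: "exp (- 3 / 2) = 1 / exp (3/2 :: real)" by (simp add: exp_minus field_simps)
    show ?thesis
    proof (cases "z \<le> x - d")
      case True
      have "exp (- 3 / 2) / p x * d \<le> H x - H (x - d)"
      proof -
        have "exp (- 3 / 2) / p x \<le> exp (V y)" if "x - d \<le> y" "y \<le> x" for y
        proof -
          have "exp (- 3 / 2) / p x = exp (- 3 / 2) * exp (V x)"
            by (simp only: px times_divide_eq_right mult_1_right)
          also have "\<dots> = exp (V x - 3/2)" by (subst exp_add[symmetric]) simp
          finally show ?thesis using Vd[OF that] by simp
        qed
        from DERIV_lower_increment[OF H this, of "x - d" x] d show ?thesis by simp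
      qed
      also have "\<dots> \<le> H x - H z" using Hmono[OF True] by simp
      finally have "r * s\<^sup>2 * (exp (- 3 / 2) / p x * d) \<le> r * s\<^sup>2 * (H x - H z)"
        using r by (intro mult_left_mono) auto
      also have "\<dots> \<le> 2 / \<rho>"
        using muckenhoupt[OF zx z' H] by (simp add: r_def s2(1))
      finally have "r * s\<^sup>2 * exp (- 3 / 2) * d * \<rho> \<le> 2 * p x" using \<rho> by (simp add: field_simps)
      moreover have "1 / (3 * sK) \<le> s * d"
      proof -
        have "1 / 3 \<le> s / (s + 1)" using s by (simp add: pos_le_divide_eq)
        then have "1 / 3 / sK \<le> s / (s + 1) / sK" using sK by (intro divide_right_mono) auto
        then show ?thesis by (simp add: d_def mult.commute)
      qed
      then have "r * s * exp (- 3 / 2) * \<rho> * (1 / (3 * sK)) \<le> r * s * exp (- 3 / 2) * \<rho> * (s * d)"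
        using rs \<rho> by (intro mult_left_mono) auto
      ultimately have "r * s * exp (- 3 / 2) * \<rho> * (1 / (3 * sK)) \<le> 2 * p x"
        by (simp add: power2_eq_square ac_simps)
      then have "\<rho> / (6 * sK) * exp (- 3 / 2) * (r * s) \<le> p x" by (simp add: field_simps)
      then show ?thesis unfolding r_def[symmetric] s_def[symmetric] by (rule goal) (simp add: density_const_def sK_def)
    next
      case False
      \<comment> \<open>All of (z, x], of mass at least 1/4, lies in the window, so the density at x
        cannot be small.\<close>
      have "measure \<mu> {z<..x} \<le> p x * exp (3/2) * x - p x * exp (3/2) * z"
      proof (rule measure_mu_le_FTC)
        show "p y \<le> p x * exp (3/2)" if "z \<le> y" "y \<le> x" for y
          using Vd[of y] that False by (simp flip: exp_add)
        show "((\<lambda>y. p x * exp (3/2) * y) has_real_derivative p x * exp (3/2)) (at y)" for y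
          by (auto intro!: derivative_eq_intros)
      qed (use zx in auto)
      moreover have "1/4 \<le> measure \<mu> {z<..x}"
        using cdf_diff_eq[OF zx] z tail_eq[of x] r by (simp add: r_def)
      ultimately have "1/4 \<le> p x * exp (3/2) * (x - z)" by (simp add: algebra_simps)
      also have "\<dots> \<le> p x * exp (3/2) * d" using False by (intro mult_left_mono) auto
      finally have "1/4 * (sK * (s + 1)) \<le> p x * exp (3/2) * d * (sK * (s + 1))"
        using sK s by (intro mult_right_mono) auto
      also have "\<dots> = p x * exp (3/2)" using sK s by (simp add: d_def)
      finally have "1/4 * (sK * (s + 1)) \<le> p x * exp (3/2)" .
      then have "sK / 4 * exp (- 3 / 2) * (s + 1) \<le> p x" unfolding e by (simp add: field_simps)
      moreover have "sK / 4 * exp (- 3 / 2) * (r * s) \<le> sK / 4 * exp (- 3 / 2) * (s + 1)"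
      proof (rule mult_left_mono)
        have "r * s \<le> 1 * s" using r s by (intro mult_right_mono) auto
        then show "r * s \<le> s + 1" by simp
        show "0 \<le> sK / 4 * exp (- 3 / 2)" using sK by simp
      qed
      ultimately have "sK / 4 * exp (- 3 / 2) * (r * s) \<le> p x" by linarith
      then show ?thesis unfolding r_def[symmetric] s_def[symmetric] by (rule goal) (unfold density_const_def sK_def, intro min.coboundedI2 order_refl)
    qed
  qed
qed

end

section \<open>Transport from the Gaussian measure\<close>

text \<open>Stated for squares because at points of non-differentiability both values of
  \<open>deriv\<close> are the same unspecified number, without the sign change of the chain
  rule.\<close>

lemma deriv_reflect_square:
  fixes g :: "real \<Rightarrow> real"
  shows "(deriv (\<lambda>y. g (- y)) x)\<^sup>2 = (deriv g (- x))\<^sup>2"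
proof (cases "\<exists>D. (g has_real_derivative D) (at (- x))")
  case True
  then obtain D where D: "(g has_real_derivative D) (at (- x))" by blast
  then show ?thesis
    using DERIV_imp_deriv[OF D] DERIV_imp_deriv[OF DERIV_mirror[THEN iffD1, OF D]] by simp
next
  case False
  then have "\<not> ((\<lambda>y. g (- y)) has_real_derivative D) (at x)" for D
    using DERIV_mirror[where f=g and x=x and y="- D"] by auto
  then show ?thesis using False by (simp add: deriv_def)
qed

lemma potential_measure_reflect:
  assumes [measurable]: "V \<in> borel_measurable borel"
  shows "distr (potential_measure V) borel uminus = potential_measure (\<lambda>x. V (- x))"
proof (rule measure_eqI)
  fix A :: "real set" assume "A \<in> sets (distr (potential_measure V) borel uminus)"
  then have [measurable]: "A \<in> sets borel" by simp
  then have [measurable]: "uminus -` A \<in> sets borel"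
    using measurable_sets[of uminus borel borel A] by simp
  have "emeasure (distr (potential_measure V) borel uminus) A = emeasure (potential_measure V) (uminus -` A)"
    by (subst emeasure_distr) (auto simp: potential_measure_def)
  also have "\<dots> = (\<integral>\<^sup>+x. ennreal (exp (- V x)) * indicator A (- x) \<partial>lborel)"
    unfolding potential_measure_def by (subst emeasure_density) (auto simp: indicator_def intro!: nn_integral_cong)
  also have "\<dots> = (\<integral>\<^sup>+x. ennreal (exp (- V (- x))) * indicator A x \<partial>lborel)"
    by (subst nn_integral_real_affine[where c="-1" and t=0]) auto
  also have "\<dots> = emeasure (potential_measure (\<lambda>x. V (- x))) A"
    unfolding potential_measure_def by (subst emeasure_density) auto
  finally show "emeasure (distr (potential_measure V) borel uminus) A = emeasure (potential_measure (\<lambda>x. V (- x))) A" .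
qed (simp add: potential_measure_def)

lemma (in potential_prob) tail_reflect: "measure (potential_measure (\<lambda>x. V (- x))) {- y<..} = cdf \<mu> y"
proof -
  have "measure (potential_measure (\<lambda>x. V (- x))) {- y<..} = measure (distr \<mu> borel uminus) {- y<..}"
    by (simp only: potential_measure_reflect[OF V_meas])
  also have "\<dots> = measure \<mu> {..<y}" by (subst measure_distr) (auto intro!: arg_cong[where f="measure \<mu>"])
  also have "\<dots> = measure \<mu> {..y}"
  proof -
    have "{..y} = {..<y} \<union> {y}" by auto
    then show ?thesis
      using measure_Un_null_set[of "{..<y}" \<mu> "{y}"] emeasure_mu_singleton[of y]
      by (simp add: null_sets_def)
  qed
  finally show ?thesis by (simp add: cdf_def)
qed

lemma local_lipschitz_reflect:
  fixes g :: "real \<Rightarrow> real"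
  assumes "local_lipschitz {0::real} UNIV (\<lambda>_. g)"
  shows "local_lipschitz {0::real} UNIV (\<lambda>_ x. g (- x))"
  unfolding local_lipschitz_def
proof (intro ballI)
  fix x t :: real assume t: "t \<in> {0}"
  have "\<exists>u>0. \<exists>L. \<forall>t\<in>cball 0 u \<inter> {0::real}. L-lipschitz_on (cball (- x) u \<inter> UNIV) g"
    using assms unfolding local_lipschitz_def by (drule_tac bspec[OF _ UNIV_I, of _ "- x"], drule_tac bspec[OF _ singletonI]) 
  then obtain u L where u: "0 < u" and uL: "\<forall>t\<in>cball 0 u \<inter> {0::real}. L-lipschitz_on (cball (- x) u \<inter> UNIV) g" by blast
  have "0 \<in> cball 0 u \<inter> {0::real}" using u by simp
  from bspec[OF uL this] have L: "L-lipschitz_on (cball (- x) u) g" by simp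
  have "L-lipschitz_on (cball x u) (\<lambda>y. g (- y))"
  proof (rule lipschitz_onI)
    fix a b assume "a \<in> cball x u" "b \<in> cball x u"
    then have "- a \<in> cball (- x) u" "- b \<in> cball (- x) u" by (auto simp: dist_minus)
    from lipschitz_onD[OF L this] show "dist (g (- a)) (g (- b)) \<le> L * dist a b" by (simp add: dist_minus)
  qed (use L lipschitz_on_nonneg in blast)
  then have "\<forall>t\<in>cball t u \<inter> {0}. L-lipschitz_on (cball x u \<inter> UNIV) (\<lambda>x. g (- x))" by simp
  then show "\<exists>u>0. \<exists>L. \<forall>t\<in>cball t u \<inter> {0}. L-lipschitz_on (cball x u \<inter> UNIV) (\<lambda>x. g (- x))"
    using u by blast
qed

text \<open>Reflection carries the upper-tail density bound over to the lower tail.\<close>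

lemma (in log_sobolev_measure) reflected: "log_sobolev_measure (\<lambda>x. V (- x)) \<rho> K"
proof -
  let ?\<nu> = "potential_measure (\<lambda>x. V (- x))"
  have distr: "?\<nu> = distr \<mu> borel uminus" by (rule potential_measure_reflect[OF V_meas, symmetric])
  have diff: "((\<lambda>x. (deriv ^^ k) V (- x)) has_real_derivative - (deriv ^^ Suc k) V (- x)) (at x)" for k x
    by (rule DERIV_mirror[THEN iffD1, OF V_deriv])
  have d: "(deriv ^^ k) (\<lambda>x. V (- x)) = (\<lambda>x. (-1) ^ k * (deriv ^^ k) V (- x))" for k
  proof (induction k)
    case (Suc k)
    have "deriv (\<lambda>x. (-1) ^ k * (deriv ^^ k) V (- x)) x = (-1) ^ Suc k * (deriv ^^ Suc k) V (- x)" for x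
    proof (rule DERIV_imp_deriv)
      from DERIV_cmult[OF diff, of "(-1) ^ k"]
      show "((\<lambda>x. (-1) ^ k * (deriv ^^ k) V (- x)) has_real_derivative (-1) ^ Suc k * (deriv ^^ Suc k) V (- x)) (at x)"
        by simp
    qed
    then show ?case unfolding funpow.simps o_apply Suc.IH by (simp add: fun_eq_iff)
  qed simp
  show ?thesis
  proof (intro log_sobolev_measure.intro potential_prob.intro log_sobolev_measure_axioms.intro)
    show "continuous_on UNIV (\<lambda>x. V (- x))"
      by (rule continuous_on_compose2[OF V_cont]) (auto intro: continuous_intros)
    show "prob_space ?\<nu>" unfolding distr by (rule prob_space_distr) simp
    show "smooth_real (\<lambda>x. V (- x))"
      unfolding smooth_real_def d
    proof (intro allI)
      fix k x
      show "(\<lambda>x. (- 1) ^ k * (deriv ^^ k) V (- x)) differentiable at x"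
        using DERIV_cmult[OF diff, of "(-1) ^ k" k x] by (auto simp: real_differentiable_def)
    qed
    show "- K \<le> deriv (deriv (\<lambda>x. V (- x))) x" for x
      using d[of 2] curvature[of "- x"] by (simp add: eval_nat_numeral)
    show "hypercontractive ?\<nu> \<rho>"
      unfolding hypercontractive_def
    proof (intro allI impI, elim conjE)
      fix g :: "real \<Rightarrow> real"
      assume lip: "local_lipschitz {0::real} UNIV (\<lambda>_. g)" and g: "integrable ?\<nu> (\<lambda>x. (g x)\<^sup>2)"
        and dg: "integrable ?\<nu> (\<lambda>x. (deriv g x)\<^sup>2)"
      have I: "integrable ?\<nu> h \<longleftrightarrow> integrable \<mu> (\<lambda>x. h (- x))" "(\<integral>x. h x \<partial>?\<nu>) = (\<integral>x. h (- x) \<partial>\<mu>)"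
        if "h \<in> borel_measurable borel" for h :: "real \<Rightarrow> real"
        unfolding distr using that by (auto simp: integrable_distr_eq integral_distr)
      have m: "(\<lambda>x. (g x)\<^sup>2) \<in> borel_measurable borel" "(\<lambda>x. (deriv g x)\<^sup>2) \<in> borel_measurable borel"
        using borel_measurable_integrable[OF g] borel_measurable_integrable[OF dg] by (simp_all add: potential_measure_def)
      have m2: "(\<lambda>x. (g x)\<^sup>2 * ln ((g x)\<^sup>2)) \<in> borel_measurable borel" using m(1) by measurable
      have "integrable \<mu> (\<lambda>x. (g (- x))\<^sup>2)" "integrable \<mu> (\<lambda>x. (deriv (\<lambda>y. g (- y)) x)\<^sup>2)"
        using g dg by (simp_all add: I m deriv_reflect_square)
      with lsi[unfolded hypercontractive_def, rule_format, of "\<lambda>x. g (- x)"] local_lipschitz_reflect[OF lip]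
      show "integrable ?\<nu> (\<lambda>x. (g x)\<^sup>2 * ln ((g x)\<^sup>2)) \<and> \<rho> * Ent ?\<nu> (\<lambda>x. (g x)\<^sup>2) \<le> 2 * (\<integral>x. (deriv g x)\<^sup>2 \<partial>?\<nu>)"
        by (simp add: I m m2 Ent_def deriv_reflect_square)
    qed
  qed (rule \<rho> K)+
qed

section \<open>Gaussian tail estimates\<close>

lemma std_normal_density_DERIV: "(std_normal_density has_real_derivative - x * std_normal_density x) (at x)"
proof -
  have "((\<lambda>x. exp (- x\<^sup>2 / 2)) has_real_derivative exp (- x\<^sup>2 / 2) * (- x)) (at x)"
    by (auto intro!: derivative_eq_intros)
  from DERIV_cmult[OF this, of "1 / sqrt (2 * pi)"] show ?thesis
    by (simp add: std_normal_density_def[abs_def] mult.commute)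
qed

lemma std_normal_density_at_top: "(std_normal_density \<longlongrightarrow> 0) at_top"
proof -
  have "((\<lambda>x::real. exp (- x\<^sup>2 / 2)) \<longlongrightarrow> 0) at_top" by real_asymp
  from tendsto_mult_right_zero[OF this, of "1 / sqrt (2 * pi)"] show ?thesis
    by (simp add: std_normal_density_def[abs_def])
qed

definition gauss_potential :: "real \<Rightarrow> real" where
  "gauss_potential x = x\<^sup>2 / 2 + ln (sqrt (2 * pi))"

lemma exp_gauss_potential: "exp (- gauss_potential x) = std_normal_density x"
proof -
  have "exp (- gauss_potential x) = exp (- x\<^sup>2 / 2 - ln (sqrt (2 * pi)))"
    by (simp add: gauss_potential_def)
  then show ?thesis by (simp add: exp_diff std_normal_density_def)
qed

lemma gauss_eq: "gauss = potential_measure gauss_potential"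
  by (simp only: gauss_def potential_measure_def exp_gauss_potential)

interpretation gauss_pot: potential_prob gauss_potential
  rewrites "potential_measure gauss_potential = gauss" and "\<And>x. exp (- gauss_potential x) = std_normal_density x"
proof -
  show "potential_prob gauss_potential"
  proof (rule potential_prob.intro)
    show "continuous_on UNIV gauss_potential"
      unfolding gauss_potential_def by (intro continuous_intros) simp
    show "prob_space (potential_measure gauss_potential)"
      using gauss.prob_space_axioms unfolding gauss_eq .
  qed
qed (simp_all only: gauss_eq exp_gauss_potential)

lemma emeasure_gauss_tail: "emeasure gauss {y<..} = (\<integral>\<^sup>+x. ennreal (std_normal_density x) * indicator {y..} x \<partial>lborel)"
proof -
  have "emeasure gauss {y<..} = (\<integral>\<^sup>+x. ennreal (std_normal_density x) * indicator {y<..} x \<partial>lborel)"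
    by (rule gauss_pot.emeasure_mu) simp
  also have "\<dots> = (\<integral>\<^sup>+x. ennreal (std_normal_density x) * indicator {y..} x \<partial>lborel)"
    using AE_lborel_singleton[of y] by (intro nn_integral_cong_AE) (auto elim!: eventually_mono simp: indicator_def)
  finally show ?thesis .
qed

text \<open>A lower Mills ratio bound: for the normal density n, the derivative of -n(x) / (x + 1)
  is n(x) (x^2 + x + 1) / (x + 1)^2, which is at most n(x) for x \<ge> 0. Integrate it from y to
  infinity.\<close>

lemma gauss_tail_lower:
  assumes "0 \<le> y"
  shows "std_normal_density y \<le> (y + 1) * measure gauss {y<..}"
proof -
  let ?n = std_normal_density
  let ?q = "\<lambda>x. ?n x * ((x\<^sup>2 + x + 1) / (x + 1)\<^sup>2)"
  have "(\<integral>\<^sup>+x. ennreal (?q x) * indicator {y..} x \<partial>lborel) = ennreal (0 - (- (?n y / (y + 1))))"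
  proof (rule nn_integral_FTC_atLeast[where F="\<lambda>x. - (?n x / (x + 1))"])
    fix x assume "y \<le> x"
    then have x: "x + 1 \<noteq> 0" "0 \<le> x" using assms by auto
    have "((\<lambda>x. x + 1) has_real_derivative 1) (at x)" by (auto intro!: derivative_eq_intros)
    from DERIV_minus[OF DERIV_divide[OF std_normal_density_DERIV this x(1)]]
    show "((\<lambda>x. - (?n x / (x + 1))) has_real_derivative ?q x) (at x)"
    proof (rule DERIV_cong)
      have "- (- x * ?n x * (x + 1) - ?n x * 1) = ?n x * (x\<^sup>2 + x + 1)" by (simp add: power2_eq_square algebra_simps)
      then show "- ((- x * ?n x * (x + 1) - ?n x * 1) / ((x + 1) * (x + 1))) = ?q x"
        unfolding minus_divide_left power2_eq_square[of "x + 1"] times_divide_eq_right by (rule arg_cong)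
    qed
    show "0 \<le> ?q x" using x assms \<open>y \<le> x\<close> by simp
  next
    show "((\<lambda>x. - (?n x / (x + 1))) \<longlongrightarrow> 0) at_top"
    proof -
      have "((\<lambda>x::real. 1 / (x + 1)) \<longlongrightarrow> 0) at_top" by real_asymp
      from tendsto_minus[OF tendsto_mult_zero[OF std_normal_density_at_top this]] show ?thesis by simp
    qed
  qed measurable
  moreover have "(\<integral>\<^sup>+x. ennreal (?q x) * indicator {y..} x \<partial>lborel) \<le> emeasure gauss {y<..}"
    unfolding emeasure_gauss_tail
  proof (rule nn_integral_mono)
    fix x
    have "?q x \<le> ?n x" if "y \<le> x"
    proof -
      have "x\<^sup>2 + x + 1 \<le> (x + 1)\<^sup>2" using that assms by (simp add: power2_sum)
      then have "(x\<^sup>2 + x + 1) / (x + 1)\<^sup>2 \<le> 1" using that assms by simp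
      from mult_left_mono[OF this normal_density_nonneg[of 0 1 x]] show ?thesis by simp
    qed
    then show "ennreal (?q x) * indicator {y..} x \<le> ennreal (?n x) * indicator {y..} x"
      by (cases "y \<le> x") (simp_all add: ennreal_leI del: times_divide_eq_right)
  qed
  ultimately have "ennreal (?n y / (y + 1)) \<le> ennreal (measure gauss {y<..})"
    by (simp add: gauss.emeasure_eq_measure)
  then show ?thesis using assms by (simp add: pos_divide_le_eq mult.commute)
qed

lemma gauss_tail_upper:
  assumes "0 \<le> y"
  shows "measure gauss {y<..} \<le> 2 * exp (- y\<^sup>2 / 2)"
proof (cases "1 \<le> y")
  case True
  let ?n = std_normal_density
  have "emeasure gauss {y<..} \<le> (\<integral>\<^sup>+x. ennreal (x * ?n x) * indicator {y..} x \<partial>lborel)"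
    unfolding emeasure_gauss_tail using True
  proof (intro nn_integral_mono)
    fix x
    have "1 * ?n x \<le> x * ?n x" if "y \<le> x" using that True by (intro mult_right_mono) auto
    then show "ennreal (?n x) * indicator {y..} x \<le> ennreal (x * ?n x) * indicator {y..} x"
      by (auto simp: indicator_def intro: ennreal_leI)
  qed
  also have "\<dots> = ennreal (0 - (- ?n y))"
  proof (rule nn_integral_FTC_atLeast[where F="\<lambda>x. - ?n x"])
    fix x assume "y \<le> x"
    show "((\<lambda>x. - ?n x) has_real_derivative x * ?n x) (at x)"
      using DERIV_minus[OF std_normal_density_DERIV, of x] by simp
    show "0 \<le> x * ?n x" using \<open>y \<le> x\<close> True by simp
  next
    show "((\<lambda>x. - ?n x) \<longlongrightarrow> 0) at_top" using tendsto_minus[OF std_normal_density_at_top] by simp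
  qed measurable
  finally have "measure gauss {y<..} \<le> ?n y" by (simp add: gauss.emeasure_eq_measure)
  also have "?n y \<le> 1 * exp (- y\<^sup>2 / 2)"
    unfolding std_normal_density_def
  proof (rule mult_right_mono)
    have "1 \<le> sqrt (2 * pi)" using pi_gt3 by simp
    then show "1 / sqrt (2 * pi) \<le> 1" by (simp add: divide_le_eq)
  qed simp
  finally show ?thesis using exp_ge_zero[of "- y\<^sup>2 / 2"] by linarith
next
  case False
  have "y\<^sup>2 \<le> 1" using assms False by (intro power_le_one) auto
  have "1 / 2 \<le> exp (- 1 / 2 :: real)" using exp_ge_add_one_self[of "- 1 / 2"] by simp
  also have "\<dots> \<le> exp (- y\<^sup>2 / 2)" using \<open>y\<^sup>2 \<le> 1\<close> by simp
  finally show ?thesis using gauss.prob_le_1[of "{y<..}"] by linarith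
qed

text \<open>The tail is at most 2 exp(-y^2 / 2), so it suffices to bound exp((y^2 + 1) / 32) by 1 +
  exp(y^2 / 2) / 8. With w = exp(y^2 / 32) the last exponential is w^16, and Bernoulli's inequality
  applies. The factor 8 is the square root of 2 * 32, from (y + 1)^2 \<le> 2 (y^2 + 1).\<close>

lemma gauss_tail_log:
  assumes "0 \<le> y"
  shows "y + 1 \<le> 8 * sqrt (tail_log (measure gauss {y<..}))"
proof -
  define r where "r = measure gauss {y<..}"
  have r: "0 < r" unfolding r_def by (rule gauss_pot.tail_pos)
  define w where "w = exp (y\<^sup>2 / 32)"
  have w1: "1 \<le> w" by (simp add: w_def)
  have w16: "w ^ 16 = exp (y\<^sup>2 / 2)" by (simp add: w_def flip: exp_of_nat_mult)
  have "exp (1 / 32 :: real) \<le> 1 + 1 / 32 + (1 / 32)\<^sup>2" by (rule exp_bound) auto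
  then have e: "exp (1 / 32 :: real) \<le> 11 / 10" by (simp add: power2_eq_square)
  have "exp ((y\<^sup>2 + 1) / 32) = exp (1 / 32) * w" by (simp add: w_def add_divide_distrib flip: exp_add)
  also have "\<dots> \<le> 11 / 10 * w" using e w1 by (intro mult_right_mono) auto
  also have "\<dots> \<le> 1 + (1 + 16 * (w - 1)) / 8" using w1 by (simp add: field_simps)
  also have "\<dots> \<le> 1 + w ^ 16 / 8" using Bernoulli_inequality[of "w - 1" 16] w1 by simp
  also have "\<dots> = 1 + 1 / (4 * (2 * exp (- y\<^sup>2 / 2)))" by (simp add: w16 exp_minus field_simps)
  finally have "(y\<^sup>2 + 1) / 32 \<le> tail_log (2 * exp (- y\<^sup>2 / 2))"
    unfolding tail_log_def by (subst ln_ge_iff) (auto intro: add_pos_pos)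
  also have "\<dots> \<le> tail_log r"
    using gauss_tail_upper[OF assms] r by (intro tail_log_antimono) (auto simp: r_def)
  finally have le: "y\<^sup>2 + 1 \<le> 32 * tail_log r" by simp
  have "(y + 1)\<^sup>2 \<le> 2 * (y\<^sup>2 + 1)" using sum_squares_bound[of y 1] by (simp add: power2_sum)
  also have "\<dots> \<le> 2 * (32 * tail_log r)" by (rule mult_left_mono[OF le]) simp
  finally have "(y + 1)\<^sup>2 \<le> 64 * tail_log r" by simp
  then have "y + 1 \<le> sqrt (64 * tail_log r)" by (rule real_le_rsqrt)
  also have "\<dots> = 8 * sqrt (tail_log r)" by (simp add: real_sqrt_mult)
  finally show ?thesis by (simp add: r_def)
qed

lemma gauss_tail_density:
  assumes "0 \<le> y"
  shows "std_normal_density y \<le> 8 * (measure gauss {y<..} * sqrt (tail_log (measure gauss {y<..})))"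
  using order_trans[OF gauss_tail_lower[OF assms] mult_right_mono[OF gauss_tail_log[OF assms] measure_nonneg, of gauss "{y<..}"]]
  by (simp add: ac_simps)

lemma gauss_tail_reflect: "measure gauss {- y<..} = cdf gauss y"
proof -
  have "(\<lambda>x. gauss_potential (- x)) = gauss_potential" by (simp add: gauss_potential_def fun_eq_iff)
  then show ?thesis using gauss_pot.tail_reflect[of y] by (simp only: gauss_eq)
qed

lemma gauss_tail_half: "0 \<le> y \<Longrightarrow> measure gauss {y<..} \<le> 1/2"
proof -
  assume y: "0 \<le> y"
  have "measure gauss {0<..} = cdf gauss 0" using gauss_tail_reflect[of 0] by simp
  then have "measure gauss {0<..} = 1/2" using gauss_pot.tail_eq[of 0] by simp
  moreover have "measure gauss {y<..} \<le> measure gauss {0<..}"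
    using y by (intro gauss.finite_measure_mono) auto
  ultimately show ?thesis by simp
qed

text \<open>At matching quantiles the upper tails agree, so the lower bound for p and the upper
  bound for the normal density involve the same quantity r sqrt(\<open>tail_log r\<close>). For y <
  0, where the tail exceeds 1/2, both measures are reflected.\<close>

lemma (in log_sobolev_measure) transport_density_bound:
  assumes "cdf \<mu> x = cdf gauss y"
  shows "std_normal_density y * density_const \<rho> K \<le> 8 * p x"
proof (cases "0 \<le> y")
  case True
  let ?r = "measure gauss {y<..}"
  have r: "measure \<mu> {x<..} = ?r" using assms by (simp add: tail_eq gauss_pot.tail_eq)
  have "density_const \<rho> K * (?r * sqrt (tail_log ?r)) \<le> p x"
    using upper_tail_density[of x] gauss_tail_half[OF True] by (simp only: r)
  then have "8 * (density_const \<rho> K * (?r * sqrt (tail_log ?r))) \<le> 8 * p x" by simp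
  moreover have "std_normal_density y * density_const \<rho> K \<le> 8 * (?r * sqrt (tail_log ?r)) * density_const \<rho> K"
    using gauss_tail_density[OF True] density_const_pos by (intro mult_right_mono) auto
  ultimately show ?thesis by (simp add: ac_simps)
next
  case False
  interpret refl: log_sobolev_measure "\<lambda>x. V (- x)" \<rho> K by (rule reflected)
  let ?r = "measure gauss {- y<..}"
  have r: "measure (potential_measure (\<lambda>x. V (- x))) {- x<..} = ?r"
    using assms by (simp only: tail_reflect gauss_tail_reflect)
  have y: "0 \<le> - y" using False by simp
  have "density_const \<rho> K * (?r * sqrt (tail_log ?r)) \<le> p x"
    using refl.upper_tail_density[of "- x"] gauss_tail_half[OF y] by (simp only: r minus_minus)
  then have "8 * (density_const \<rho> K * (?r * sqrt (tail_log ?r))) \<le> 8 * p x" by simp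
  moreover have "std_normal_density (- y) * density_const \<rho> K \<le> 8 * (?r * sqrt (tail_log ?r)) * density_const \<rho> K"
    using gauss_tail_density[OF y] density_const_pos by (intro mult_right_mono) auto
  moreover have "std_normal_density (- y) = std_normal_density y" by (simp add: std_normal_density_def)
  ultimately show ?thesis by (simp add: ac_simps)
qed

text \<open>The monotone rearrangement: the inverse distribution function of \<open>\<mu>\<close>
  composed with the Gaussian one. Its derivative at y is the normal density at y divided by the
  density p at T y, the quotient that was bounded at matching quantiles.\<close>

lemma (in log_sobolev_measure) transport:
  obtains T T' where "\<And>y. (T has_real_derivative T' y) (at y)" "continuous_on UNIV T'"
    "\<And>y. 0 \<le> T' y" "\<And>y. T' y \<le> 8 / density_const \<rho> K" "distr gauss borel T = \<mu>"
proof -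
  let ?F = "cdf \<mu>" and ?G = "cdf gauss"
  have F: "strict_mono ?F" and G: "strict_mono ?G"
    by (auto intro: strict_monoI cdf_strict_mono gauss_pot.cdf_strict_mono)
  \<comment> \<open>\<open>S\<close> inverts the distribution function on (0, 1), where both
    distribution functions take their values; elsewhere it is arbitrary.\<close>
  have "\<exists>x. 0 < u \<and> u < 1 \<longrightarrow> ?F x = u" for u using cdf_surj[of u] by blast
  then obtain S where S: "\<And>u. 0 < u \<Longrightarrow> u < 1 \<Longrightarrow> ?F (S u) = u" by metis
  have SF: "S (?F x) = x" for x
    using S[OF cdf_bounds] strict_mono_eq[OF F] by blast
  define T where "T y = S (?G y)" for y
  define T' where "T' y = inverse (p (T y)) * std_normal_density y" for y
  have FT: "?F (T y) = ?G y" for y unfolding T_def by (rule S[OF gauss_pot.cdf_bounds])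
  have dS: "(S has_real_derivative inverse (p (T y))) (at (?G y))" for y
  proof (rule DERIV_inverse_function[where f="?F" and a=0 and b=1])
    show "(?F has_real_derivative p (T y)) (at (S (?G y)))" unfolding T_def by (rule cdf_DERIV)
    have "isCont S (?F (T y))"
      by (rule isCont_inverse_function2[where a="T y - 1" and b="T y + 1"])
        (auto simp: SF intro: DERIV_isCont[OF cdf_DERIV])
    then show "isCont S (?G y)" by (simp add: FT)
  qed (auto intro: S gauss_pot.cdf_bounds)
  have dT: "(T has_real_derivative T' y) (at y)" for y
    unfolding T_def[abs_def] T'_def by (rule DERIV_chain2[OF dS[unfolded T_def] gauss_pot.cdf_DERIV])
  have T_cont: "continuous_on UNIV T" by (rule continuous_on_DERIV) (rule dT)
  have T_meas [measurable]: "T \<in> borel_measurable borel" using T_cont by (rule borel_measurable_continuous_onI)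
  show thesis
  proof (rule that)
    show "(T has_real_derivative T' y) (at y)" for y by (rule dT)
    have "continuous_on UNIV (std_normal_density)"
      by (rule continuous_on_DERIV) (rule std_normal_density_DERIV)
    moreover have "continuous_on UNIV (\<lambda>y. p (T y))"
      by (intro continuous_intros continuous_on_compose2[OF V_cont T_cont]) auto
    ultimately show "continuous_on UNIV T'"
      unfolding T'_def[abs_def] by (intro continuous_on_mult continuous_on_inverse) auto
    show "0 \<le> T' y" for y by (simp add: T'_def)
    show "T' y \<le> 8 / density_const \<rho> K" for y
      using transport_density_bound[OF FT, of y] density_const_pos
      by (simp add: T'_def pos_le_divide_eq inverse_eq_divide pos_divide_le_eq ac_simps del: exp_minus)
    show "distr gauss borel T = \<mu>"
    proof (rule cdf_unique)
      show "real_distribution (distr gauss borel T)"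
        by (intro real_distribution.intro real_distribution_axioms.intro gauss.prob_space_distr) simp_all
      show "real_distribution \<mu>" by (rule real_distribution_axioms)
      show "cdf (distr gauss borel T) = ?F"
      proof
        fix x
        obtain z where z: "?G z = ?F x" using gauss_pot.cdf_surj[OF cdf_bounds] by blast
        have "T y \<le> x \<longleftrightarrow> y \<le> z" for y
          using strict_mono_less_eq[OF F, of "T y" x] strict_mono_less_eq[OF G, of y z] by (simp add: FT z)
        then have "T -` {..x} = {..z}" by auto
        then show "cdf (distr gauss borel T) x = ?F x"
          using z unfolding cdf_def by (subst measure_distr) auto
      qed
    qed
  qed
qed

section \<open>Orlicz norms\<close>

lemma mult_exp_minus_le: "x * exp (- x) \<le> (1 :: real)"
proof -
  have "x \<le> exp x" using exp_ge_add_one_self[of x] by linarith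
  from mult_right_mono[OF this exp_ge_zero[of "- x"]] show ?thesis by (simp flip: exp_add)
qed

text \<open>Multiply x / 2 \<le> exp(x / 2) - 1 by 2 exp(-x). The right-hand side is a difference of
  consecutive terms when x is halved at each step.\<close>

lemma mult_exp_minus_telescope: "(x :: real) * exp (- x) \<le> 2 * (exp (- (x / 2)) - exp (- x))"
proof -
  have "x \<le> 2 * (exp (x / 2) - 1)" using mult_left_mono[OF exp_ge_add_one_self[of "x / 2"], of 2] by (simp add: algebra_simps)
  from mult_right_mono[OF this exp_ge_zero[of "- x"]] show ?thesis
    by (simp add: algebra_simps flip: exp_add)
qed

text \<open>With d_m = 2^(-m-1), the part 2 d_m adds up to at most 2, and d_m L exp(-d_m L) is
  bounded by telescoping differences of total at most 2, whatever L is.\<close>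

lemma dyadic_exp_sum:
  fixes L :: real
  assumes L: "0 \<le> L"
  shows "(\<Sum>m<N. (1/2) ^ Suc m * ((2 + L) * exp (- ((1/2) ^ Suc m * L)))) \<le> 4"
proof -
  define d :: "nat \<Rightarrow> real" where "d m = (1/2) ^ Suc m" for m
  have d: "0 < d m" "d (Suc m) = d m / 2" for m by (simp_all add: d_def)
  have "d m * ((2 + L) * exp (- (d m * L)))
      \<le> (2 * d m) + 2 * (exp (- (d (Suc m) * L)) - exp (- (d m * L)))" for m
  proof -
    have "2 * d m * exp (- (d m * L)) \<le> 2 * d m * 1" using d(1)[of m] L by (intro mult_left_mono) auto
    moreover have "d m * L * exp (- (d m * L)) \<le> 2 * (exp (- (d (Suc m) * L)) - exp (- (d m * L)))"
      using mult_exp_minus_telescope[of "d m * L"] by (simp add: d(2))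
    ultimately show ?thesis by (simp add: algebra_simps)
  qed
  then have "(\<Sum>m<N. d m * ((2 + L) * exp (- (d m * L))))
      \<le> (\<Sum>m<N. (2 * d m) + 2 * (exp (- (d (Suc m) * L)) - exp (- (d m * L))))"
    by (rule sum_mono)
  also have "\<dots> = 2 * (\<Sum>m<N. d m) + 2 * (exp (- (d N * L)) - exp (- (d 0 * L)))"
    using sum_lessThan_telescope[of "\<lambda>m. exp (- (d m * L))" N]
    by (simp only: sum.distrib flip: sum_distrib_left)
  also have "\<dots> \<le> 2 * 1 + 2 * (1 - 0)"
  proof -
    have "(\<Sum>m<N. d m) = 1 - (1/2) ^ N"
      by (induction N) (simp_all add: d_def)
    then have "(\<Sum>m<N. d m) \<le> 1" by simp
    moreover have "exp (- (d N * L)) \<le> 1" using d(1)[of N] L by simp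
    moreover have "0 \<le> exp (- (d 0 * L))" by simp
    ultimately show ?thesis by (intro add_mono mult_left_mono diff_mono) auto
  qed
  finally show ?thesis by (simp add: d_def)
qed

text \<open>The exponent exceeds 1 by \<delta> / (2 - \<delta>) \<le> \<delta>. As 1 + B is at most
  4 / \<delta>, the excess factor is at most (4 / \<delta>)^\<delta>, which stays below exp 4
  however small \<delta> is.\<close>

lemma powr_dyadic_le:
  fixes B \<delta> :: real
  assumes \<delta>: "0 < \<delta>" "\<delta> \<le> 1/2" and A: "0 \<le> A" "A \<le> 1 + B" and B: "0 \<le> B" "B \<le> 2 + 1 / \<delta>"
  shows "A powr (2 / (2 - \<delta>)) \<le> exp 4 * (1 + B)"
proof -
  have p: "2 / (2 - \<delta>) = 1 + \<delta> / (2 - \<delta>)" using \<delta> by (simp add: field_simps)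
  have "A powr (2 / (2 - \<delta>)) \<le> (1 + B) powr (2 / (2 - \<delta>))"
    using A \<delta> by (intro powr_mono2) auto
  also have "\<dots> = (1 + B) * (1 + B) powr (\<delta> / (2 - \<delta>))"
    unfolding p using B by (subst powr_add) auto
  also have "\<dots> \<le> (1 + B) * exp 4"
  proof (rule mult_left_mono)
    have "\<delta> / (2 - \<delta>) \<le> \<delta> / 1" using \<delta> by (intro divide_left_mono) auto
    then have "(1 + B) powr (\<delta> / (2 - \<delta>)) \<le> (1 + B) powr \<delta>"
      using B by (intro powr_mono) auto
    also have "\<dots> \<le> (4 / \<delta>) powr \<delta>"
    proof (rule powr_mono2)
      have "3 \<le> 3 / \<delta>" using \<delta> by (simp add: pos_le_divide_eq)
      then show "1 + B \<le> 4 / \<delta>" using B by (simp add: field_simps)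
    qed (use \<delta> B in auto)
    also have "\<dots> = exp (\<delta> * ln (4 / \<delta>))" using \<delta> by (simp add: powr_def)
    also have "\<dots> \<le> exp (\<delta> * (4 / \<delta>))"
      using \<delta> ln_le_minus_one[of "4 / \<delta>"] by (intro exp_le_cancel_iff[THEN iffD2] mult_left_mono) auto
    also have "\<dots> = exp 4" using \<delta> by simp
    finally show "(1 + B) powr (\<delta> / (2 - \<delta>)) \<le> exp 4" .
  qed (use B in simp)
  finally show ?thesis by (simp add: mult.commute)
qed

text \<open>Write u^(2 - \<delta>) as u^2 exp(-\<delta> ln u) and use ln(exp 1 + u) \<le> 2 + ln u,
  which holds because exp 1 + u \<le> exp 2 * u for u \<ge> 1. The first factor on the right is the
  prescribed value of \<phi>.\<close>

lemma powr_le_phi: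
  fixes u \<delta> :: real
  assumes u: "1 \<le> u"
  shows "u powr (2 - \<delta>) \<le> u\<^sup>2 / ln (exp 1 + u) * ((2 + ln u) * exp (- (\<delta> * ln u)))"
proof -
  have e: "2 \<le> exp (1 :: real)" using exp_ge_add_one_self[of "1 :: real"] by simp
  have "exp 1 + u \<le> exp 1 * u + exp 1 * u"
  proof (rule add_mono)
    show "exp 1 \<le> exp 1 * u" using mult_left_mono[OF u, of "exp 1"] by simp
    show "u \<le> exp 1 * u" using mult_right_mono[of 1 "exp 1 :: real" u] u e by linarith
  qed
  also have "\<dots> \<le> exp 1 * exp 1 * u"
    using e u by (simp add: mult_right_mono flip: distrib_right mult_2)
  also have "\<dots> = exp (1 + (1 + ln u))" using u by (simp only: exp_add) simp
  finally have "exp 1 + u \<le> exp (1 + (1 + ln u))" .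
  moreover have "0 < exp 1 + u" using u e by linarith
  ultimately have "ln (exp 1 + u) \<le> ln (exp (1 + (1 + ln u)))" by (subst ln_le_cancel_iff) auto
  then have le: "ln (exp 1 + u) \<le> 2 + ln u" by simp
  have pos: "0 < ln (exp 1 + u)" using u e by (intro ln_gt_zero) linarith
  have "u powr (2 - \<delta>) = u powr 2 * u powr (- \<delta>)" by (simp flip: powr_add)
  also have "\<dots> = u\<^sup>2 * exp (- (\<delta> * ln u))" using u by (simp add: powr_def[of u "- \<delta>"])
  also have "\<dots> = u\<^sup>2 / ln (exp 1 + u) * (ln (exp 1 + u) * exp (- (\<delta> * ln u)))" using pos by simp
  also have "\<dots> \<le> u\<^sup>2 / ln (exp 1 + u) * ((2 + ln u) * exp (- (\<delta> * ln u)))"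
    using le pos by (intro mult_left_mono mult_right_mono) auto
  finally show ?thesis .
qed

text \<open>
  The norms in question may grow like the inverse square root of \<open>2 - p\<close> as \<open>p\<close> increases to \<open>2\<close>;
  the weighted sum is nevertheless bounded because the sum of \<open>x * exp (- x)\<close> over the dyadic
  values \<open>x = L / 2, L / 4, \<dots>\<close> is, by telescoping, bounded uniformly in \<open>L = ln (u x)\<close>.
\<close>
lemma orlicz_lp_sum:
  assumes "prob_space M" and phi: "admissible_phi \<phi>" and [measurable]: "u \<in> borel_measurable M"
    and u: "\<And>x. 0 \<le> u x" and le: "(\<integral>\<^sup>+x. ennreal (\<phi> (u x)) \<partial>M) \<le> 1"
  shows "integrable M (\<lambda>x. u x powr lp_exp m)"
    and "(\<Sum>m<N. (1/2) ^ Suc m * (\<integral>x. u x powr lp_exp m \<partial>M) powr (2 / lp_exp m)) \<le> 5 * exp 4"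
proof -
  interpret prob_space M by fact
  define d :: "nat \<Rightarrow> real" where "d m = (1/2) ^ Suc m" for m
  have d: "0 < d m" "d m \<le> 1/2" "lp_exp m = 2 - d m" for m
    by (simp_all add: d_def lp_exp_def power_le_one)
  \<comment> \<open>Only the values of \<phi> on [1, \<infinity>) are given by a formula. Where u <
    1, \<open>w\<close> is 0 and the bound u^p \<le> 1 takes over; this is the summand 1 in
    \<open>u_le\<close>.\<close>
  define w where "w x = (if 1 \<le> u x then (u x)\<^sup>2 / ln (exp 1 + u x) else 0)" for x
  define L where "L x = (if 1 \<le> u x then ln (u x) else 0)" for x
  define k where "k m x = w x * ((2 + L x) * exp (- (d m * L x)))" for m x
  have [measurable]: "w \<in> borel_measurable M" "L \<in> borel_measurable M" "\<And>m. k m \<in> borel_measurable M"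
    unfolding w_def L_def k_def by measurable
  have w0: "0 \<le> w x" for x
  proof -
    have "1 \<le> exp (1::real) + u x" using u[of x] exp_ge_add_one_self[of "1::real"] by linarith
    then show ?thesis by (simp add: w_def)
  qed
  have L0: "0 \<le> L x" for x by (simp add: L_def)
  have w_phi: "w x \<le> \<phi> (u x)" for x
    using phi u[of x] by (auto simp: w_def admissible_phi_def)
  have "(\<integral>\<^sup>+x. ennreal (w x) \<partial>M) \<le> 1"
    using nn_integral_mono[of M "\<lambda>x. ennreal (w x)" "\<lambda>x. ennreal (\<phi> (u x))"] w_phi le
    by (auto intro: ennreal_leI order_trans)
  moreover from this have wint: "integrable M w"
    using w0 by (intro integrableI_nonneg) (auto intro: le_less_trans)
  ultimately have w1: "(\<integral>x. w x \<partial>M) \<le> 1"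
    using w0 by (simp add: nn_integral_eq_integral)
  have k0: "0 \<le> k m x" for m x using w0[of x] L0[of x] by (simp add: k_def)
  have k_le: "k m x \<le> (2 + 1 / d m) * w x" for m x
  proof -
    have "2 * exp (- (d m * L x)) \<le> 2" using d(1)[of m] L0[of x] by simp
    moreover have "L x * exp (- (d m * L x)) \<le> 1 / d m"
      using mult_exp_minus_le[of "d m * L x"] d(1)[of m] by (simp add: pos_le_divide_eq ac_simps)
    ultimately have "(2 + L x) * exp (- (d m * L x)) \<le> 2 + 1 / d m" unfolding distrib_right by (rule add_mono)
    from mult_left_mono[OF this w0[of x]] show ?thesis by (simp add: k_def mult.commute)
  qed
  have kint: "integrable M (k m)" for m
    by (rule Bochner_Integration.integrable_bound[OF integrable_mult_right[OF wint, of "2 + 1 / d m"]])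
      (use k_le k0 in \<open>auto intro!: AE_I2 order_trans[OF _ abs_ge_self]\<close>)
  define B where "B m = (\<integral>x. k m x \<partial>M)" for m
  have B: "0 \<le> B m" "B m \<le> 2 + 1 / d m" for m
  proof -
    show "0 \<le> B m" unfolding B_def using k0 by simp
    have "B m \<le> (\<integral>x. (2 + 1 / d m) * w x \<partial>M)"
      unfolding B_def using k_le by (intro integral_mono kint integrable_mult_right wint)
    also have "\<dots> \<le> (2 + 1 / d m) * 1"
      unfolding integral_mult_right_zero using w1 d(1)[of m] by (intro mult_left_mono) auto
    finally show "B m \<le> 2 + 1 / d m" by simp
  qed
  have u_le: "u x powr lp_exp m \<le> 1 + k m x" for m x
  proof (cases "1 \<le> u x")
    case True
    then show ?thesis using powr_le_phi[of "u x" "d m"] by (simp add: d(3) k_def w_def L_def)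
  next
    case False
    have "u x powr lp_exp m \<le> 1 powr lp_exp m"
      using False u[of x] d(2)[of m] by (intro powr_mono2) (auto simp: d(3))
    then show ?thesis using k0[of m x] by simp
  qed
  show uint: "integrable M (\<lambda>x. u x powr lp_exp m)" for m
    by (rule Bochner_Integration.integrable_bound[where f="\<lambda>x. 1 + k m x"])
      (use u_le k0 in \<open>auto intro!: AE_I2 Bochner_Integration.integrable_add kint order_trans[OF _ abs_ge_self]\<close>)
  \<comment> \<open>The crude bound B m \<le> 2 + 1 / d m serves only to handle the exponent 2 / p.
    The sum is estimated differently: weighted by d m, the functions \<open>k m\<close> add up
    pointwise to at most 4 w.\<close>
  have "(\<integral>x. u x powr lp_exp m \<partial>M) powr (2 / lp_exp m) \<le> exp 4 * (1 + B m)" for m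
    unfolding d(3)
  proof (rule powr_dyadic_le)
    have "(\<integral>x. u x powr lp_exp m \<partial>M) \<le> (\<integral>x. 1 + k m x \<partial>M)"
      using u_le by (intro integral_mono uint Bochner_Integration.integrable_add kint) auto
    then show "(\<integral>x. u x powr (2 - d m) \<partial>M) \<le> 1 + B m"
      by (simp add: B_def Bochner_Integration.integral_add[OF _ kint] prob_space flip: d(3))
  qed (use d B in auto)
  then have "(\<Sum>m<N. d m * (\<integral>x. u x powr lp_exp m \<partial>M) powr (2 / lp_exp m)) \<le> (\<Sum>m<N. d m * (exp 4 * (1 + B m)))"
    using d(1) by (intro sum_mono mult_left_mono) (auto intro: less_imp_le)
  also have "\<dots> = exp 4 * ((\<Sum>m<N. d m) + (\<Sum>m<N. d m * B m))"
    unfolding sum_distrib_left distrib_left sum.distrib by (simp add: ac_simps)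
  also have "\<dots> \<le> exp 4 * (1 + 4)"
  proof (intro mult_left_mono add_mono)
    have "(\<Sum>m<N. d m) = 1 - (1/2) ^ N" by (induction N) (simp_all add: d_def)
    then show "(\<Sum>m<N. d m) \<le> 1" by simp
    have "(\<Sum>m<N. d m * B m) = (\<integral>x. (\<Sum>m<N. d m * k m x) \<partial>M)"
      unfolding B_def using kint by (subst Bochner_Integration.integral_sum) auto
    also have "\<dots> \<le> (\<integral>x. 4 * w x \<partial>M)"
    proof (rule integral_mono)
      fix x
      have "(\<Sum>m<N. d m * k m x) = w x * (\<Sum>m<N. d m * ((2 + L x) * exp (- (d m * L x))))"
        unfolding k_def sum_distrib_left by (intro sum.cong) (simp_all only: ac_simps)
      also have "\<dots> \<le> w x * 4"
        using dyadic_exp_sum[OF L0, of x N] w0 unfolding d_def by (intro mult_left_mono) auto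
      finally show "(\<Sum>m<N. d m * k m x) \<le> 4 * w x" by simp
    qed (auto intro!: Bochner_Integration.integrable_sum integrable_mult_right kint wint)
    also have "\<dots> \<le> 4" using w1 by simp
    finally show "(\<Sum>m<N. d m * B m) \<le> 4" .
  qed auto
  finally show "(\<Sum>m<N. (1/2) ^ Suc m * (\<integral>x. u x powr lp_exp m \<partial>M) powr (2 / lp_exp m)) \<le> 5 * exp 4"
    by (simp add: d_def)
qed

section \<open>Entropy and deviation\<close>

lemma Rn_update [simp]: "x \<in> Rn n \<Longrightarrow> i < n \<Longrightarrow> x(i := t) \<in> Rn n"
  by (auto simp: Rn_def PiE_iff extensional_def)

lemma space_PiM_Rn: "(\<And>i. i < n \<Longrightarrow> space (M i) = UNIV) \<Longrightarrow> space (PiM {..<n} M) = Rn n"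
  by (auto simp: space_PiM Rn_def PiE_iff)

text \<open>Continuity refers to the product topology on \<open>nat \<Rightarrow> real\<close>. On
  \<open>Rn n\<close> the coordinates from n onwards are constantly \<open>undefined\<close>, so the
  inclusion of the finite product is measurable coordinate by coordinate.\<close>

lemma measurable_continuous_on_Rn:
  fixes f :: "(nat \<Rightarrow> real) \<Rightarrow> real"
  assumes f: "continuous_on (Rn n) f" and M: "\<And>i. i < n \<Longrightarrow> sets (M i) = sets borel"
  shows "f \<in> borel_measurable (PiM {..<n} M)"
proof -
  have sp: "space (PiM {..<n} M) = Rn n"
    using sets_eq_imp_space_eq[OF M] by (intro space_PiM_Rn) auto
  have "(\<lambda>x. x) \<in> measurable (PiM {..<n} M) borel"
  proof (rule measurable_coordinatewise_then_product)
    fix i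
    show "(\<lambda>x. x i) \<in> borel_measurable (PiM {..<n} M)"
    proof (cases "i < n")
      case True
      then have "(\<lambda>x. x i) \<in> measurable (PiM {..<n} M) (M i)" by simp
      then show ?thesis using measurable_cong_sets[OF refl M[OF True]] by blast
    next
      case False
      have "(\<lambda>x. x i) \<in> borel_measurable (PiM {..<n} M) \<longleftrightarrow> (\<lambda>x. undefined :: real) \<in> borel_measurable (PiM {..<n} M)"
        by (rule measurable_cong) (use False in \<open>auto simp: sp Rn_def PiE_iff extensional_def\<close>)
      then show ?thesis by simp
    qed
  qed
  then have "(\<lambda>x. x) \<in> measurable (PiM {..<n} M) (restrict_space borel (Rn n))"
    by (rule measurable_restrict_space2[rotated]) (simp add: sp)
  from measurable_compose[OF this borel_measurable_continuous_on_restrict[OF f]] show ?thesis .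
qed

lemma continuous_on_Rn_sequentially:
  fixes f :: "(nat \<Rightarrow> real) \<Rightarrow> real"
  assumes f: "continuous_on (Rn n) f" and X: "\<And>m. X m \<in> Rn n" "x \<in> Rn n"
    and lim: "\<And>j. j < n \<Longrightarrow> (\<lambda>m. X m j) \<longlonglongrightarrow> x j"
  shows "(\<lambda>m. f (X m)) \<longlonglongrightarrow> f x"
proof -
  have "(\<lambda>m. X m j) \<longlonglongrightarrow> x j" for j
  proof (cases "j < n")
    case False
    then have "X m j = x j" for m using X(1)[of m] X(2) by (simp add: Rn_def PiE_iff extensional_def)
    then show ?thesis by simp
  qed (rule lim)
  then have "limitin (product_topology (\<lambda>_. euclidean) UNIV) X x sequentially"
    by (simp add: limitin_componentwise limitin_canonical_iff)
  then have "X \<longlonglongrightarrow> x" by (simp add: euclidean_product_topology flip: limitin_canonical_iff)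
  then show ?thesis by (rule continuous_on_tendsto_compose[OF f _ X(2)]) (simp add: X(1))
qed

lemma coordinatewise_mono_imp_mono:
  fixes g :: "(nat \<Rightarrow> real) \<Rightarrow> real"
  assumes g: "\<And>j x s t. j < n \<Longrightarrow> x \<in> Rn n \<Longrightarrow> s \<le> t \<Longrightarrow> g (x(j := s)) \<le> g (x(j := t))"
    and xy: "x \<in> Rn n" "y \<in> Rn n" "\<And>j. j < n \<Longrightarrow> x j \<le> y j"
  shows "g x \<le> g y"
proof -
  define z where "z k = (\<lambda>j. if j < k then y j else x j)" for k
  have z: "z k \<in> Rn n" if "k \<le> n" for k
    using xy(1,2) that by (auto simp: z_def Rn_def PiE_iff extensional_def)
  have "g x \<le> g (z k)" if "k \<le> n" for k
    using that
  proof (induction k)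
    case (Suc k)
    have "z k = (z k)(k := x k)" "z (Suc k) = (z k)(k := y k)"
      by (auto simp: z_def fun_eq_iff less_Suc_eq)
    then have "g (z k) \<le> g (z (Suc k))"
      using g[of k "z k" "x k" "y k"] z[of k] xy(3)[of k] Suc.prems by simp
    then show ?case using Suc by simp
  qed (simp add: z_def)
  moreover have "z n = y" using xy(1,2) by (auto simp: z_def fun_eq_iff Rn_def PiE_iff extensional_def)
  ultimately show ?thesis by fastforce
qed

lemma distr_gauss_PiM:
  assumes I: "finite I" and T: "\<And>i. T i \<in> borel_measurable borel"
  shows "distr (gauss_PiM I) (PiM I (\<lambda>_. borel)) (\<lambda>x. \<lambda>i\<in>I. T i (x i)) = PiM I (\<lambda>i. distr gauss borel (T i))"
proof -
  note [measurable] = T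
  interpret G: product_sigma_finite "\<lambda>_. gauss"
    by (intro product_sigma_finite.intro gauss.sigma_finite_measure_axioms)
  have "sigma_finite_measure (distr gauss borel (T i))" for i
    by (intro prob_space_imp_sigma_finite gauss.prob_space_distr) simp
  then interpret P: product_sigma_finite "\<lambda>i. distr gauss borel (T i)"
    by (intro product_sigma_finite.intro)
  have m: "(\<lambda>x. \<lambda>i\<in>I. T i (x i)) \<in> measurable (gauss_PiM I) (PiM I (\<lambda>_. borel))" by measurable
  show ?thesis
  proof (rule P.PiM_eqI[OF I])
    show "sets (distr (gauss_PiM I) (PiM I (\<lambda>_. borel)) (\<lambda>x. \<lambda>i\<in>I. T i (x i))) = sets (PiM I (\<lambda>i. distr gauss borel (T i)))"
      by (simp cong: sets_PiM_cong)
    fix A assume "\<And>i. i \<in> I \<Longrightarrow> A i \<in> sets (distr gauss borel (T i))"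
    then have A: "\<And>i. i \<in> I \<Longrightarrow> A i \<in> sets borel" by simp
    have TA: "T i -` A i \<in> sets gauss" if "i \<in> I" for i
      using measurable_sets[OF T A[OF that], of i] by simp
    have "emeasure (distr (gauss_PiM I) (PiM I (\<lambda>_. borel)) (\<lambda>x. \<lambda>i\<in>I. T i (x i))) (PiE I A)
        = emeasure (gauss_PiM I) ((\<lambda>x. \<lambda>i\<in>I. T i (x i)) -` PiE I A \<inter> space (gauss_PiM I))"
      using A I by (intro emeasure_distr m sets_PiM_I_finite)
    also have "(\<lambda>x. \<lambda>i\<in>I. T i (x i)) -` PiE I A \<inter> space (gauss_PiM I) = PiE I (\<lambda>i. T i -` A i)"
      by (auto simp: space_PiM PiE_iff)
    also have "emeasure (gauss_PiM I) \<dots> = (\<Prod>i\<in>I. emeasure gauss (T i -` A i))"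
      by (rule G.emeasure_PiM[OF I TA])
    also have "\<dots> = (\<Prod>i\<in>I. emeasure (distr gauss borel (T i)) (A i))"
      using A by (intro prod.cong refl) (simp add: emeasure_distr)
    finally show "emeasure (distr (gauss_PiM I) (PiM I (\<lambda>_. borel)) (\<lambda>x. \<lambda>i\<in>I. T i (x i))) (PiE I A)
        = (\<Prod>i\<in>I. emeasure (distr gauss borel (T i)) (A i))" .
  qed
qed

lemma partial_deriv_DERIV:
  assumes "\<forall>i<n. \<forall>x\<in>Rn n. (\<lambda>t. g (x(i := t))) differentiable (at (x i))" "i < n" "x \<in> Rn n"
  shows "((\<lambda>t. g (x(i := t))) has_real_derivative partial_deriv i g (x(i := t))) (at t)"
proof -
  have "(\<lambda>s. g ((x(i := t))(i := s))) differentiable (at ((x(i := t)) i))"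
    using assms(1)[rule_format, OF assms(2) Rn_update[OF assms(3,2)]] .
  then show ?thesis
    by (simp add: partial_deriv_def flip: DERIV_deriv_iff_real_differentiable)
qed

lemma powr_scaled_norm:
  fixes u :: "'a \<Rightarrow> real" and a p :: real
  assumes "0 \<le> a" "\<And>x. 0 \<le> u x" "0 < p"
  shows "(\<integral>x. (a * u x) powr p \<partial>M) powr (2 / p) = a\<^sup>2 * (\<integral>x. u x powr p \<partial>M) powr (2 / p)"
proof -
  have "(a * u x) powr p = a powr p * u x powr p" for x
    by (rule powr_mult)
  then have "(\<integral>x. (a * u x) powr p \<partial>M) = a powr p * (\<integral>x. u x powr p \<partial>M)" by simp
  moreover have "(a powr p) powr (2 / p) = a\<^sup>2"
    using assms by (cases "a = 0") (simp_all add: powr_powr)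
  moreover have "(a powr p * (\<integral>x. u x powr p \<partial>M)) powr (2 / p) = (a powr p) powr (2 / p) * (\<integral>x. u x powr p \<partial>M) powr (2 / p)"
    by (rule powr_mult)
  ultimately show ?thesis by simp
qed

text \<open>The hypothesis is a discrete form of \<Lambda>' \<le> A \<theta> \<Lambda>, which avoids
  differentiating \<Lambda>. The interval is cut into N steps, with N so large that y = A \<theta>^2
  / N is at most 1/2; then 1 - y \<ge> exp(-2 y), and N steps multiply to exp(2 A \<theta>^2). The
  differential inequality would give exp(A \<theta>^2 / 2); the loss only affects the
  constant.\<close>

lemma laplace_growth:
  fixes \<Lambda> :: "real \<Rightarrow> real"
  assumes step: "\<And>a b. 0 \<le> a \<Longrightarrow> a \<le> b \<Longrightarrow> \<Lambda> b * (1 - (b - a) * (A * b)) \<le> \<Lambda> a"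
    and \<Lambda>0: "\<Lambda> 0 = 1" and pos: "\<And>a. 0 \<le> a \<Longrightarrow> 0 \<le> \<Lambda> a" and A: "0 \<le> A" and \<theta>: "0 \<le> \<theta>"
  shows "\<Lambda> \<theta> \<le> exp (2 * A * \<theta>\<^sup>2)"
proof -
  obtain N0 :: nat where N0: "2 * A * \<theta>\<^sup>2 \<le> real N0" using real_arch_simple by blast
  define N where "N = Suc N0"
  have N: "0 < real N" "2 * A * \<theta>\<^sup>2 \<le> real N" using N0 by (simp_all add: N_def)
  define y where "y = A * \<theta>\<^sup>2 / real N"
  have y: "0 \<le> y" "y \<le> 1/2" using A N by (simp_all add: y_def pos_divide_le_eq)
  have ey: "exp (- (2 * y)) \<le> 1 - y"
  proof -
    have "1 \<le> (1 - y) * (1 + 2 * y)" using mult_left_mono[OF y(2), of y] y(1) by (simp add: algebra_simps)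
    also have "\<dots> \<le> (1 - y) * exp (2 * y)" using y exp_ge_add_one_self[of "2 * y"] by (intro mult_left_mono) auto
    finally have "1 * exp (- (2 * y)) \<le> (1 - y) * exp (2 * y) * exp (- (2 * y))" by (rule mult_right_mono) simp
    then show ?thesis by (simp add: mult.assoc flip: exp_add)
  qed
  have "\<Lambda> (real k * (\<theta> / real N)) \<le> exp (2 * y * real k)" if "k \<le> N" for k
    using that
  proof (induction k)
    case (Suc k)
    let ?a = "real k * (\<theta> / real N)" and ?b = "real (Suc k) * (\<theta> / real N)"
    have "?b = ?a + \<theta> / real N" by (simp only: of_nat_Suc distrib_right)
    then have ab: "0 \<le> ?a" "?a \<le> ?b" "?b - ?a = \<theta> / real N"
      using \<theta> N by auto
    have "?b \<le> real N * (\<theta> / real N)" using Suc.prems \<theta> by (intro mult_right_mono) auto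
    then have "?b \<le> \<theta>" using N by simp
    then have "\<theta> / real N * (A * ?b) \<le> \<theta> / real N * (A * \<theta>)"
      using A \<theta> N by (intro mult_left_mono) auto
    also have "\<dots> = y" by (simp add: y_def power2_eq_square)
    finally have le: "exp (- (2 * y)) \<le> 1 - \<theta> / real N * (A * ?b)" using ey by linarith
    have "\<Lambda> ?b * exp (- (2 * y)) \<le> \<Lambda> ?b * (1 - (?b - ?a) * (A * ?b))"
      unfolding ab(3) using le pos[of ?b] ab by (intro mult_left_mono) auto
    also have "\<dots> \<le> \<Lambda> ?a" by (rule step[OF ab(1,2)])
    also have "\<dots> \<le> exp (2 * y * real k)" using Suc by simp
    finally have "\<Lambda> ?b * exp (- (2 * y)) * exp (2 * y) \<le> exp (2 * y * real k) * exp (2 * y)"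
      by (rule mult_right_mono) simp
    moreover have "\<Lambda> ?b * exp (- (2 * y)) * exp (2 * y) = \<Lambda> ?b" by (simp add: mult.assoc flip: exp_add)
    moreover have "exp (2 * y * real k) * exp (2 * y) = exp (2 * y * real (Suc k))"
      by (simp add: algebra_simps flip: exp_add)
    ultimately show ?case by (simp only:)
  qed (simp add: \<Lambda>0)
  from this[of N] show ?thesis using N by (simp add: y_def power2_eq_square mult.assoc)
qed

text \<open>The transport maps are monotone in the same sense \<sigma> as f, so \<theta> f composed
  with them is increasing in both cases. The numbers \<open>c i\<close> are any admissible constants
  in the definition of the Orlicz norm. Stating the bound for every \<theta> \<ge> 0 covers the
  entropy (\<theta> = 1) as well as the Laplace transform.\<close>

lemma transported_covariance:
  fixes f :: "(nat \<Rightarrow> real) \<Rightarrow> real" and T T' :: "nat \<Rightarrow> real \<Rightarrow> real" and \<sigma> L \<theta> :: real and n :: nat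
  defines "M \<equiv> PiM {..<n} (\<lambda>i. distr gauss borel (T i))"
  assumes f: "Ck_on_Rn n 2 f"
    and hess: "\<And>i j x. i < n \<Longrightarrow> j < n \<Longrightarrow> x \<in> Rn n \<Longrightarrow> 0 \<le> partial_deriv j (partial_deriv i f) x"
    and \<sigma>: "\<sigma> = 1 \<or> \<sigma> = -1"
    and sgn: "\<And>i x. i < n \<Longrightarrow> x \<in> Rn n \<Longrightarrow> 0 \<le> \<sigma> * partial_deriv i f x"
    and T: "\<And>i y. (T i has_real_derivative T' i y) (at y)" "\<And>i. continuous_on UNIV (T' i)"
      "\<And>i y. 0 \<le> \<sigma> * T' i y" "\<And>i y. \<bar>T' i y\<bar> \<le> L"
    and phi: "admissible_phi \<phi>"
    and c: "\<And>i. i < n \<Longrightarrow> 0 < c i" "\<And>i. i < n \<Longrightarrow> (\<integral>\<^sup>+x. ennreal (\<phi> (\<bar>partial_deriv i f x\<bar> / c i)) \<partial>M) \<le> 1"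
    and \<theta>: "0 \<le> \<theta>"
    and int: "integrable M f" "integrable M (\<lambda>x. exp (- \<theta> * f x))" "integrable M (\<lambda>x. f x * exp (- \<theta> * f x))"
  shows "\<theta> * (\<integral>x. f x \<partial>M) * (\<integral>x. exp (- \<theta> * f x) \<partial>M) - \<theta> * (\<integral>x. f x * exp (- \<theta> * f x) \<partial>M)
    \<le> (\<Sum>i<n. (\<theta> * L * c i)\<^sup>2 * (5 * exp 4)) * (\<integral>x. exp (- \<theta> * f x) \<partial>M)"
proof -
  define \<Psi> where "\<Psi> x = (\<lambda>i\<in>{..<n}. T i (x i))" for x
  have Tm: "T i \<in> borel_measurable borel" for i
    by (rule borel_measurable_continuous_onI, rule continuous_on_DERIV, rule T(1))
  have T'm: "T' i \<in> borel_measurable borel" for i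
    by (rule borel_measurable_continuous_onI) (rule T(2))
  have M: "M = distr (gauss_PiM {..<n}) (PiM {..<n} (\<lambda>_. borel)) \<Psi>"
    unfolding M_def \<Psi>_def by (rule distr_gauss_PiM[symmetric]) (simp_all add: Tm)
  have \<Psi>m: "\<Psi> \<in> measurable (gauss_PiM {..<n}) (PiM {..<n} (\<lambda>_. borel))"
    using Tm unfolding \<Psi>_def by measurable
  interpret G: prob_space "gauss_PiM {..<n}" by (rule prob_space_gauss_PiM)
  have M_prob: "prob_space M" unfolding M by (rule G.prob_space_distr[OF \<Psi>m])
  have sets_M: "sets M = sets (PiM {..<n} (\<lambda>_. borel))" by (simp add: M)
  have sp: "space (gauss_PiM {..<n}) = Rn n" by (rule space_PiM_Rn) simp
  have \<Psi>_Rn: "\<Psi> x \<in> Rn n" for x by (simp add: \<Psi>_def Rn_def)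
  have \<Psi>_upd: "\<Psi> (x(i := t)) = (\<Psi> x)(i := T i t)" if "i < n" for x i t
    using that by (auto simp: \<Psi>_def fun_eq_iff)
  have L0: "0 \<le> L" using T(4)[of 0 0] by linarith
  have C2: "continuous_on (Rn n) f" "\<forall>i<n. \<forall>x\<in>Rn n. (\<lambda>t. f (x(i := t))) differentiable (at (x i))"
    "\<And>i. i < n \<Longrightarrow> continuous_on (Rn n) (partial_deriv i f)"
    "\<And>j. j < n \<Longrightarrow> \<forall>i<n. \<forall>x\<in>Rn n. (\<lambda>t. partial_deriv j f (x(i := t))) differentiable (at (x i))"
    using f by (simp_all add: numeral_2_eq_2)
  have chain: "((\<lambda>t. g (\<Psi> (x(i := t)))) has_real_derivative partial_deriv i g (\<Psi> (x(i := t))) * T' i t) (at t)"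
    if "\<forall>i<n. \<forall>x\<in>Rn n. (\<lambda>t. g (x(i := t))) differentiable (at (x i))" "i < n" for g x i t
    unfolding \<Psi>_upd[OF that(2)] by (rule DERIV_chain2[OF partial_deriv_DERIV[OF that \<Psi>_Rn] T(1)])
  define F where "F x = \<theta> * f (\<Psi> x)" for x
  define F' where "F' i x = \<theta> * (partial_deriv i f (\<Psi> x) * T' i (x i))" for i x
  \<comment> \<open>The constant L replaces |T'|, because the product with T' need not be monotone.
    Along coordinate j the derivative of \<open>h i\<close> is \<theta> L times \<sigma>
    \<open>T' j\<close> times a second partial derivative of f, hence nonnegative.\<close>
  define h where "h i x = \<theta> * L * \<bar>partial_deriv i f (\<Psi> x)\<bar>" for i x
  have F_deriv: "((\<lambda>t. F (x(i := t))) has_real_derivative F' i (x(i := t))) (at t)" if "i < n" for x i t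
    using DERIV_cmult[OF chain[OF C2(2) that], of \<theta> x t] by (simp add: F_def F'_def)
  have abs_eq: "\<bar>partial_deriv i f x\<bar> = \<sigma> * partial_deriv i f x" if "i < n" "x \<in> Rn n" for i x
    using \<sigma> sgn[OF that] by auto
  have abs_T': "\<bar>T' i y\<bar> = \<sigma> * T' i y" for i y using \<sigma> T(3)[of i y] by auto
  have prod_eq: "partial_deriv i f x * T' i y = \<bar>partial_deriv i f x\<bar> * \<bar>T' i y\<bar>" if "i < n" "x \<in> Rn n" for i x y
    unfolding abs_eq[OF that] abs_T' using \<sigma> by auto
  have bounds: "0 \<le> F' i x \<and> F' i x \<le> h i x" if "i < n" for i x
  proof -
    have "\<bar>partial_deriv i f (\<Psi> x)\<bar> * \<bar>T' i (x i)\<bar> \<le> \<bar>partial_deriv i f (\<Psi> x)\<bar> * L"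
      using T(4) by (intro mult_left_mono) auto
    from mult_left_mono[OF this \<theta>] show ?thesis
      unfolding F'_def h_def prod_eq[OF that \<Psi>_Rn] using \<theta> by (simp add: ac_simps)
  qed
  have f_m: "f \<in> borel_measurable (PiM {..<n} (\<lambda>_. borel))"
    by (rule measurable_continuous_on_Rn[OF C2(1)]) simp
  have df_m: "partial_deriv i f \<in> borel_measurable (PiM {..<n} (\<lambda>_. borel))" if "i < n" for i
    by (rule measurable_continuous_on_Rn[OF C2(3)[OF that]]) simp
  have f\<Psi>_m: "(\<lambda>x. f (\<Psi> x)) \<in> borel_measurable (gauss_PiM {..<n})"
    by (rule measurable_compose[OF \<Psi>m f_m])
  have df\<Psi>_m: "(\<lambda>x. partial_deriv i f (\<Psi> x)) \<in> borel_measurable (gauss_PiM {..<n})" if "i < n" for i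
    by (rule measurable_compose[OF \<Psi>m df_m[OF that]])
  have T'c_m: "(\<lambda>x. T' i (x i)) \<in> borel_measurable (gauss_PiM {..<n})" if "i < n" for i
  proof -
    have "T' i \<in> measurable gauss borel"
      using T'm[of i] measurable_cong_sets[of gauss "borel :: real measure" "borel :: real measure" borel] by simp
    from measurable_compose[OF measurable_component_singleton[of i "{..<n}" "\<lambda>_. gauss"] this] that show ?thesis by simp
  qed
  have tr: "integrable M g \<longleftrightarrow> integrable (gauss_PiM {..<n}) (\<lambda>x. g (\<Psi> x))" "(\<integral>x. g x \<partial>M) = (\<integral>x. g (\<Psi> x) \<partial>gauss_PiM {..<n})"
    if "g \<in> borel_measurable (PiM {..<n} (\<lambda>_. borel))" for g :: "(nat \<Rightarrow> real) \<Rightarrow> real"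
    unfolding M by (rule integrable_distr_eq[OF \<Psi>m that], rule integral_distr[OF \<Psi>m that])
  define u where "u i x = \<bar>partial_deriv i f x\<bar> / c i" for i x
  have u_m: "u i \<in> borel_measurable (PiM {..<n} (\<lambda>_. borel))" if "i < n" for i
    using df_m[OF that] unfolding u_def by measurable
  have um: "u i \<in> borel_measurable M" if "i < n" for i
    using u_m[OF that] measurable_cong_sets[OF sets_M refl] by blast
  have up_m: "(\<lambda>x. u i x powr q) \<in> borel_measurable (PiM {..<n} (\<lambda>_. borel))" if "i < n" for i and q :: real
    using u_m[OF that] by measurable
  have u0: "0 \<le> u i x" if "i < n" for i x using c(1)[OF that] by (simp add: u_def)
  have u1: "(\<integral>\<^sup>+x. ennreal (\<phi> (u i x)) \<partial>M) \<le> 1" if "i < n" for i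
    using c(2)[OF that] by (simp add: u_def)
  have h_u: "h i x = (\<theta> * L * c i) * u i (\<Psi> x)" if "i < n" for i x
    using c(1)[OF that] by (simp add: h_def u_def)
  have a0: "0 \<le> \<theta> * L * c i" if "i < n" for i using \<theta> L0 c(1)[OF that] by simp
  interpret gauss_gradient "{..<n}" F F' h "\<lambda>i. (\<theta> * L * c i)\<^sup>2 * (5 * exp 4)"
  proof (rule gauss_gradient.intro, unfold sp lessThan_iff)
    show "F \<in> borel_measurable (gauss_PiM {..<n})" unfolding F_def using f\<Psi>_m by measurable
    show "F x \<le> F y" if "x \<in> Rn n" "y \<in> Rn n" "\<And>j. j < n \<Longrightarrow> x j \<le> y j" for x y
    proof (rule coordinatewise_mono_imp_mono[OF _ that])
      fix j x and s t :: real assume j: "j < n" and st: "s \<le> t"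
      show "F (x(j := s)) \<le> F (x(j := t))"
        by (rule DERIV_mono_UNIV[OF F_deriv[OF j] _ st]) (use bounds[OF j] in blast)
    qed
    show "(\<lambda>m. F (X m)) \<longlonglongrightarrow> F x"
      if "\<And>m. X m \<in> Rn n" "x \<in> Rn n" "\<And>j. j < n \<Longrightarrow> (\<lambda>m::nat. X m j) \<longlonglongrightarrow> x j" for X x
      unfolding F_def
    proof (intro tendsto_mult_left continuous_on_Rn_sequentially[OF C2(1)] \<Psi>_Rn)
      fix j assume "j < n"
      then show "(\<lambda>m. \<Psi> (X m) j) \<longlonglongrightarrow> \<Psi> x j"
        using isCont_tendsto_compose[OF DERIV_isCont[OF T(1)] that(3), of j j] by (simp add: \<Psi>_def)
    qed
    show "F' i \<in> borel_measurable (gauss_PiM {..<n})" if "i < n" for i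
      unfolding F'_def using df\<Psi>_m[OF that] T'c_m[OF that] by measurable
    show "((\<lambda>t. F (x(i := t))) has_real_derivative F' i (x(i := t))) (at t)" if "i < n" for i x t
      by (rule F_deriv[OF that])
    show "continuous_on UNIV (\<lambda>t. F' i (x(i := t)))" if "i < n" for i x
    proof -
      have "continuous_on UNIV (\<lambda>t. partial_deriv i f (\<Psi> (x(i := t))))"
        by (rule continuous_on_DERIV) (rule chain[OF C2(4)[OF that] that])
      then show ?thesis unfolding F'_def fun_upd_same by (intro continuous_intros T(2))
    qed
    show "0 \<le> F' i x \<and> F' i x \<le> h i x" if "i < n" for i x by (rule bounds[OF that])
    show "h i \<in> borel_measurable (gauss_PiM {..<n})" if "i < n" for i
      unfolding h_def using df\<Psi>_m[OF that] by measurable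
    show "0 \<le> h i x" for i x unfolding h_def using \<theta> L0 by simp
    show "h i x \<le> h i y" if i: "i < n" and xy: "x \<in> Rn n" "y \<in> Rn n" "\<And>j. j < n \<Longrightarrow> x j \<le> y j" for i x y
    proof (rule coordinatewise_mono_imp_mono[OF _ xy])
      fix j x and s t :: real assume j: "j < n" and st: "s \<le> t"
      have "0 \<le> \<sigma> * (partial_deriv j (partial_deriv i f) (\<Psi> (x(j := t))) * T' j t)" for t
        using mult_nonneg_nonneg[OF hess[OF i j \<Psi>_Rn] T(3)] by (simp only: ac_simps)
      from DERIV_mono_UNIV[OF DERIV_cmult[OF chain[OF C2(4)[OF i] j]] this st]
      show "h i (x(j := s)) \<le> h i (x(j := t))"
        unfolding h_def abs_eq[OF i \<Psi>_Rn] by (rule mult_left_mono) (use \<theta> L0 in simp)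
    qed
    show "integrable (gauss_PiM {..<n}) (\<lambda>x. h i x powr lp_exp m)" if "i < n" for i m
      using orlicz_lp_sum(1)[OF M_prob phi um[OF that] u0[OF that] u1[OF that], of m]
      by (simp add: h_u[OF that] powr_mult tr(1)[OF up_m[OF that]])
    show "(\<Sum>m<N. (1/2) ^ Suc m * (\<integral>x. h i x powr lp_exp m \<partial>gauss_PiM {..<n}) powr (2 / lp_exp m)) \<le> (\<theta> * L * c i)\<^sup>2 * (5 * exp 4)"
      if i: "i < n" for i N
    proof -
      have "(\<integral>x. h i x powr lp_exp m \<partial>gauss_PiM {..<n}) powr (2 / lp_exp m)
          = (\<theta> * L * c i)\<^sup>2 * (\<integral>x. u i x powr lp_exp m \<partial>M) powr (2 / lp_exp m)" for m
        unfolding h_u[OF i] tr(2)[OF up_m[OF i]] using lp_exp(1)[of m]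
        by (intro powr_scaled_norm[OF a0[OF i] u0[OF i]]) linarith
      then have "(\<Sum>m<N. (1/2) ^ Suc m * (\<integral>x. h i x powr lp_exp m \<partial>gauss_PiM {..<n}) powr (2 / lp_exp m))
          = (\<theta> * L * c i)\<^sup>2 * (\<Sum>m<N. (1/2) ^ Suc m * (\<integral>x. u i x powr lp_exp m \<partial>M) powr (2 / lp_exp m))"
        by (simp only: sum_distrib_left mult.left_commute)
      also have "\<dots> \<le> (\<theta> * L * c i)\<^sup>2 * (5 * exp 4)"
        by (intro mult_left_mono orlicz_lp_sum(2)[OF M_prob phi um[OF i] u0[OF i] u1[OF i]]) simp
      finally show ?thesis .
    qed
  qed simp
  have exp_m: "(\<lambda>x. exp (- \<theta> * f x)) \<in> borel_measurable (PiM {..<n} (\<lambda>_. borel))"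
    "(\<lambda>x. f x * exp (- \<theta> * f x)) \<in> borel_measurable (PiM {..<n} (\<lambda>_. borel))"
    using f_m by measurable
  have "(\<integral>x. F x \<partial>gauss_PiM {..<n}) * (\<integral>x. exp (- F x) \<partial>gauss_PiM {..<n}) - (\<integral>x. F x * exp (- F x) \<partial>gauss_PiM {..<n})
    \<le> (\<Sum>i<n. (\<theta> * L * c i)\<^sup>2 * (5 * exp 4)) * (\<integral>x. exp (- F x) \<partial>gauss_PiM {..<n})"
    using int unfolding tr(1)[OF f_m] tr(1)[OF exp_m(1)] tr(1)[OF exp_m(2)]
    by (intro covariance) (simp_all add: F_def[abs_def] mult.assoc)
  then show ?thesis
    unfolding tr(2)[OF f_m] tr(2)[OF exp_m(1)] tr(2)[OF exp_m(2)] by (simp add: F_def mult.assoc)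
qed

text \<open>Let m = E[f] and Z = E[exp(-f)]. Jensen's inequality gives -ln Z \<le> m, so the entropy
  is at most m Z - E[f exp(-f)], the covariance term at \<theta> = 1. For the deviation, convexity
  of the exponential compares \<open>\<Lambda> a\<close> with the tangent of \<Lambda> at b, whose
  slope is bounded by the covariance; this is the step hypothesis of \<open>laplace_growth\<close>,
  and the exponential Markov inequality concludes.\<close>

lemma entropy_deviation_of_covariance:
  fixes f :: "'a \<Rightarrow> real"
  assumes "prob_space M" and f: "integrable M f"
    and int: "\<And>\<theta>. 0 \<le> \<theta> \<Longrightarrow> integrable M (\<lambda>x. exp (- \<theta> * f x))" "\<And>\<theta>. 0 \<le> \<theta> \<Longrightarrow> integrable M (\<lambda>x. f x * exp (- \<theta> * f x))"
    and A: "0 \<le> A"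
    and cov: "\<And>\<theta>. 0 \<le> \<theta> \<Longrightarrow> \<theta> * (\<integral>x. f x \<partial>M) * (\<integral>x. exp (- \<theta> * f x) \<partial>M) - \<theta> * (\<integral>x. f x * exp (- \<theta> * f x) \<partial>M)
      \<le> \<theta>\<^sup>2 * A * (\<integral>x. exp (- \<theta> * f x) \<partial>M)"
  shows "Ent M (\<lambda>x. exp (- f x)) \<le> A * (\<integral>x. exp (- f x) \<partial>M)"
    and "0 < A \<Longrightarrow> 0 \<le> t \<Longrightarrow> measure M {x \<in> space M. f x - (\<integral>y. f y \<partial>M) \<le> - t} \<le> exp (- (t\<^sup>2 / (8 * A)))"
proof -
  interpret prob_space M by fact
  note [measurable] = borel_measurable_integrable[OF f]
  define m where "m = (\<integral>x. f x \<partial>M)"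
  define Z where "Z = (\<integral>x. exp (- f x) \<partial>M)"
  have i1: "integrable M (\<lambda>x. exp (- f x))" "integrable M (\<lambda>x. f x * exp (- f x))" using int[of 1] by auto
  have "(\<integral>x. exp (- m) * (1 - (f x - m)) \<partial>M) \<le> Z"
    unfolding Z_def
  proof (intro integral_mono i1 integrable_mult_right Bochner_Integration.integrable_diff f integrable_const)
    fix x
    have "1 - (f x - m) \<le> exp (- (f x - m))" using exp_ge_add_one_self[of "- (f x - m)"] by linarith
    then have "exp (- m) * (1 - (f x - m)) \<le> exp (- m) * exp (- (f x - m))" by (rule mult_left_mono) simp
    then show "exp (- m) * (1 - (f x - m)) \<le> exp (- f x)" by (simp flip: exp_add)
  qed
  moreover have "(\<integral>x. exp (- m) * (1 - (f x - m)) \<partial>M) = exp (- m)"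
    using f by (simp add: m_def prob_space)
  ultimately have Z: "exp (- m) \<le> Z" by simp
  have Z0: "0 < Z" using less_le_trans[OF exp_gt_zero Z] .
  have "- m \<le> ln Z" using Z Z0 by (subst ln_ge_iff) auto
  from mult_left_mono[OF this, of Z] have "- (Z * ln Z) \<le> m * Z" using Z0 by (simp add: ac_simps)
  moreover have "m * Z - (\<integral>x. f x * exp (- f x) \<partial>M) \<le> A * Z"
    using cov[of 1] by (simp add: m_def Z_def)
  moreover have "Ent M (\<lambda>x. exp (- f x)) = - (\<integral>x. f x * exp (- f x) \<partial>M) - Z * ln Z"
    by (simp add: Ent_def Z_def mult.commute)
  ultimately show "Ent M (\<lambda>x. exp (- f x)) \<le> A * (\<integral>x. exp (- f x) \<partial>M)" unfolding Z_def by linarith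
  define \<Lambda> where "\<Lambda> \<theta> = (\<integral>x. exp (- \<theta> * (f x - m)) \<partial>M)" for \<theta>
  have e: "exp (- \<theta> * (f x - m)) = exp (\<theta> * m) * exp (- \<theta> * f x)" for \<theta> x
    by (simp add: algebra_simps flip: exp_add)
  have i2: "integrable M (\<lambda>x. exp (- \<theta> * (f x - m)))" "integrable M (\<lambda>x. (f x - m) * exp (- \<theta> * (f x - m)))" if "0 \<le> \<theta>" for \<theta>
  proof -
    show "integrable M (\<lambda>x. exp (- \<theta> * (f x - m)))" unfolding e by (intro integrable_mult_right int that)
    have "(\<lambda>x. (f x - m) * exp (- \<theta> * (f x - m))) = (\<lambda>x. exp (\<theta> * m) * (f x * exp (- \<theta> * f x) - m * exp (- \<theta> * f x)))"
      unfolding e by (simp add: fun_eq_iff algebra_simps)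
    then show "integrable M (\<lambda>x. (f x - m) * exp (- \<theta> * (f x - m)))"
      by (simp only:) (intro integrable_mult_right Bochner_Integration.integrable_diff int that)
  qed
  \<comment> \<open>Centering multiplies all terms by exp(b m) and turns the covariance into -b
    times the integral of (f - m) exp(-b (f - m)).\<close>
  have cov0: "- (b * (\<integral>x. (f x - m) * exp (- b * (f x - m)) \<partial>M)) \<le> b * (A * b * \<Lambda> b)" if b: "0 \<le> b" for b
  proof -
    have "(\<integral>x. (f x - m) * exp (- b * (f x - m)) \<partial>M) = (\<integral>x. exp (b * m) * (f x * exp (- b * f x) - m * exp (- b * f x)) \<partial>M)"
      unfolding e by (intro Bochner_Integration.integral_cong) (simp_all add: algebra_simps)
    also have "\<dots> = exp (b * m) * ((\<integral>x. f x * exp (- b * f x) \<partial>M) - m * (\<integral>x. exp (- b * f x) \<partial>M))"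
      unfolding integral_mult_right_zero
      by (subst Bochner_Integration.integral_diff[OF int(2)[OF b] integrable_mult_right[OF int(1)[OF b]]]) simp
    finally have eq: "(\<integral>x. (f x - m) * exp (- b * (f x - m)) \<partial>M)
        = exp (b * m) * ((\<integral>x. f x * exp (- b * f x) \<partial>M) - m * (\<integral>x. exp (- b * f x) \<partial>M))" .
    have "- (b * (\<integral>x. (f x - m) * exp (- b * (f x - m)) \<partial>M))
        = exp (b * m) * (b * m * (\<integral>x. exp (- b * f x) \<partial>M) - b * (\<integral>x. f x * exp (- b * f x) \<partial>M))"
      unfolding eq by (simp only: right_diff_distrib) (simp only: ac_simps minus_diff_eq)
    also have "\<dots> \<le> exp (b * m) * (b\<^sup>2 * A * (\<integral>x. exp (- b * f x) \<partial>M))"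
      using cov[OF b] by (intro mult_left_mono) (auto simp: m_def)
    also have "\<dots> = b * (A * b * \<Lambda> b)"
      unfolding \<Lambda>_def e integral_mult_right_zero by (simp add: power2_eq_square)
    finally show ?thesis .
  qed
  have \<Lambda>_bound: "\<Lambda> \<theta> \<le> exp (2 * A * \<theta>\<^sup>2)" if "0 \<le> \<theta>" for \<theta>
  proof (rule laplace_growth[OF _ _ _ A that])
    show "\<Lambda> 0 = 1" by (simp add: \<Lambda>_def prob_space)
    show "0 \<le> \<Lambda> a" for a by (simp add: \<Lambda>_def)
    fix a b :: real assume a: "0 \<le> a" and ab: "a \<le> b"
    show "\<Lambda> b * (1 - (b - a) * (A * b)) \<le> \<Lambda> a"
    \<comment> \<open>For a < b one has b > 0, which allows cancelling the factor b in
      \<open>cov0\<close>.\<close>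
    proof (cases "a = b")
      case False
      then have b: "0 < b" using a ab by simp
      have "\<Lambda> b + (b - a) * (\<integral>x. (f x - m) * exp (- b * (f x - m)) \<partial>M)
          = (\<integral>x. exp (- b * (f x - m)) + (b - a) * ((f x - m) * exp (- b * (f x - m))) \<partial>M)"
        unfolding \<Lambda>_def using b
        by (subst Bochner_Integration.integral_add[OF i2(1) integrable_mult_right[OF i2(2)]]) simp_all
      also have "\<dots> \<le> \<Lambda> a"
        unfolding \<Lambda>_def
      proof (intro integral_mono Bochner_Integration.integrable_add integrable_mult_right i2)
        fix x
        have "exp (- b * (f x - m)) * (1 + (b - a) * (f x - m)) \<le> exp (- b * (f x - m)) * exp ((b - a) * (f x - m))"
          using exp_ge_add_one_self[of "(b - a) * (f x - m)"] by (intro mult_left_mono) auto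
        also have "\<dots> = exp (- a * (f x - m))" by (simp add: algebra_simps flip: exp_add)
        finally show "exp (- b * (f x - m)) + (b - a) * ((f x - m) * exp (- b * (f x - m))) \<le> exp (- a * (f x - m))"
          by (simp only: distrib_left mult_1_right ac_simps)
      qed (use a b in auto)
      finally have 1: "\<Lambda> b + (b - a) * (\<integral>x. (f x - m) * exp (- b * (f x - m)) \<partial>M) \<le> \<Lambda> a" .
      have "b * - (\<integral>x. (f x - m) * exp (- b * (f x - m)) \<partial>M) \<le> b * (A * b * \<Lambda> b)"
        using cov0[of b] b by simp
      then have "- (\<integral>x. (f x - m) * exp (- b * (f x - m)) \<partial>M) \<le> A * b * \<Lambda> b"
        using b by (rule mult_left_le_imp_le)
      from mult_left_mono[OF this, of "b - a"] ab 1 show ?thesis by (simp add: algebra_simps)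
    qed simp
  qed
  assume A0: "0 < A" and t: "0 \<le> t"
  \<comment> \<open>This choice minimises -\<theta> t + 2 A \<theta>^2; the minimum is -t^2 / (8
    A).\<close>
  define \<theta> where "\<theta> = t / (4 * A)"
  have \<theta>: "0 \<le> \<theta>" using A0 t by (simp add: \<theta>_def)
  let ?E = "{x \<in> space M. f x - m \<le> - t}"
  have E: "?E \<in> sets M" by measurable
  have "measure M ?E = (\<integral>x. indicator ?E x \<partial>M)" using E by simp
  also have "\<dots> \<le> (\<integral>x. exp (- (\<theta> * t)) * exp (- \<theta> * (f x - m)) \<partial>M)"
  proof (intro integral_mono integrable_mult_right i2 \<theta>)
    show "integrable M (indicator ?E :: 'a \<Rightarrow> real)" by (rule integrable_real_indicator[OF E]) (simp add: emeasure_eq_measure)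
    fix x
    show "indicator ?E x \<le> exp (- (\<theta> * t)) * exp (- \<theta> * (f x - m))"
    proof (cases "x \<in> ?E")
      case True
      then have "\<theta> * (f x - m) \<le> \<theta> * - t" using \<theta> by (intro mult_left_mono) auto
      then have "0 \<le> - (\<theta> * t) + - \<theta> * (f x - m)" by simp
      then have "1 \<le> exp (- (\<theta> * t) + - \<theta> * (f x - m))" by (simp only: one_le_exp_iff)
      then show ?thesis using True by (simp only: indicator_simps exp_add)
    qed simp
  qed
  also have "\<dots> = exp (- (\<theta> * t)) * \<Lambda> \<theta>" by (simp only: integral_mult_right_zero \<Lambda>_def)
  also have "\<dots> \<le> exp (- (\<theta> * t)) * exp (2 * A * \<theta>\<^sup>2)" using \<Lambda>_bound[OF \<theta>] by (rule mult_left_mono) simp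
  also have "\<dots> = exp (- (t\<^sup>2 / (8 * A)))"
  proof -
    have "- (\<theta> * t) + 2 * A * \<theta>\<^sup>2 = - (t\<^sup>2 / (8 * A))"
      using A0 by (simp add: \<theta>_def power2_eq_square field_simps)
    then show ?thesis by (simp flip: exp_add)
  qed
  finally show "measure M {x \<in> space M. f x - (\<integral>y. f y \<partial>M) \<le> - t} \<le> exp (- (t\<^sup>2 / (8 * A)))" by (simp add: m_def)
qed

section \<open>Signs, Orlicz norms and the choice of constants\<close>

lemma distr_gauss_uminus: "distr gauss borel uminus = gauss"
proof -
  have "(\<lambda>x. gauss_potential (- x)) = gauss_potential" by (simp add: gauss_potential_def fun_eq_iff)
  then show ?thesis using potential_measure_reflect[OF gauss_pot.V_meas] by (simp only: gauss_eq)
qed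

text \<open>The Gaussian measure is symmetric, so an increasing transport map may be composed with y
  -> -y; this supplies the decreasing maps for non-increasing f. Indices from n onwards receive the
  zero map to make the families total.\<close>

lemma transport_signed:
  fixes V :: "nat \<Rightarrow> real \<Rightarrow> real"
  assumes V: "\<And>i. i < n \<Longrightarrow> log_sobolev_measure (V i) \<rho> K" and \<sigma>: "\<sigma> = 1 \<or> \<sigma> = -1"
    and \<rho>: "0 < density_const \<rho> K"
  obtains T T' where "\<And>i y. (T i has_real_derivative T' i y) (at y)" "\<And>i. continuous_on UNIV (T' i)"
    "\<And>i y. 0 \<le> \<sigma> * T' i y" "\<And>i y. \<bar>T' i y\<bar> \<le> 8 / density_const \<rho> K"
    "\<And>i. i < n \<Longrightarrow> distr gauss borel (T i) = potential_measure (V i)"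
proof -
  let ?L = "8 / density_const \<rho> K"
  have "\<exists>T T'. (\<forall>y. (T has_real_derivative T' y) (at y)) \<and> continuous_on UNIV T' \<and> (\<forall>y. 0 \<le> T' y \<and> T' y \<le> ?L) \<and>
      (i < n \<longrightarrow> distr gauss borel T = potential_measure (V i))" for i
  proof (cases "i < n")
    case True
    show ?thesis by (rule log_sobolev_measure.transport[OF V[OF True]]) blast
  next
    case False
    then show ?thesis using \<rho> by (intro exI[of _ "\<lambda>_. 0 :: real"]) auto
  qed
  then obtain T T' where T: "\<And>i y. (T i has_real_derivative T' i y) (at y)" "\<And>i. continuous_on UNIV (T' i)"
    "\<And>i y. 0 \<le> T' i y" "\<And>i y. T' i y \<le> ?L" "\<And>i. i < n \<Longrightarrow> distr gauss borel (T i) = potential_measure (V i)"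
    by metis
  have \<sigma>_gauss: "distr gauss borel ((*) \<sigma>) = gauss"
    using \<sigma>
  proof
    assume "\<sigma> = 1"
    then have "((*) \<sigma>) = (\<lambda>x. x)" by (simp add: fun_eq_iff)
    then show ?thesis by (simp add: distr_id2)
  next
    assume "\<sigma> = -1"
    then have "((*) \<sigma>) = uminus" by (simp add: fun_eq_iff)
    then show ?thesis by (simp only: distr_gauss_uminus)
  qed
  show thesis
  proof (rule that[of "\<lambda>i y. T i (\<sigma> * y)" "\<lambda>i y. T' i (\<sigma> * y) * \<sigma>"])
    show "((\<lambda>y. T i (\<sigma> * y)) has_real_derivative T' i (\<sigma> * y) * \<sigma>) (at y)" for i y
      by (rule DERIV_chain2[OF T(1)]) (auto intro!: derivative_eq_intros)
    show "continuous_on UNIV (\<lambda>y. T' i (\<sigma> * y) * \<sigma>)" for i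
      by (intro continuous_intros continuous_on_compose2[OF T(2)]) auto
    show "0 \<le> \<sigma> * (T' i (\<sigma> * y) * \<sigma>)" for i y using T(3) \<sigma> by auto
    show "\<bar>T' i (\<sigma> * y) * \<sigma>\<bar> \<le> ?L" for i y using T(3,4)[of i "\<sigma> * y"] \<sigma> by auto
    show "distr gauss borel (\<lambda>y. T i (\<sigma> * y)) = potential_measure (V i)" if "i < n" for i
    proof -
      have Tm: "T i \<in> borel_measurable borel"
        by (rule borel_measurable_continuous_onI, rule continuous_on_DERIV, rule T(1))
      have "distr (distr gauss borel ((*) \<sigma>)) borel (T i) = distr gauss borel (T i \<circ> (*) \<sigma>)"
        using Tm by (intro distr_distr) auto
      then show ?thesis using T(5)[OF that] by (simp add: \<sigma>_gauss comp_def)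
    qed
  qed
qed

lemma F_plus_signed:
  assumes "f \<in> F_plus n"
  obtains \<sigma> :: real where "\<sigma> = 1 \<or> \<sigma> = -1" "\<And>i x. i < n \<Longrightarrow> x \<in> Rn n \<Longrightarrow> 0 \<le> \<sigma> * partial_deriv i f x"
proof -
  have diff: "((\<lambda>t. f (x(i := t))) has_real_derivative partial_deriv i f x) (at (x i))" if "i < n" "x \<in> Rn n" for i x
    using assms that by (simp add: F_plus_def numeral_2_eq_2 partial_deriv_def DERIV_deriv_iff_real_differentiable)
  consider "\<forall>i<n. \<forall>x\<in>Rn n. mono (\<lambda>t. f (x(i := t)))" | "\<forall>i<n. \<forall>x\<in>Rn n. antimono (\<lambda>t. f (x(i := t)))"
    using assms by (auto simp: F_plus_def)
  then show thesis
  proof cases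
    case 1
    show thesis
    proof (rule that[of 1])
      fix i x assume ix: "i < n" "x \<in> Rn n"
      show "0 \<le> 1 * partial_deriv i f x"
        using mono_on_imp_deriv_nonneg[of UNIV, OF _ diff[OF ix]] 1 ix by simp
    qed simp
  next
    case 2
    show thesis
    proof (rule that[of "-1"])
      fix i x assume ix: "i < n" "x \<in> Rn n"
      have "mono (\<lambda>t. - f (x(i := t)))" using 2 ix by (simp add: mono_def antimono_def)
      then show "0 \<le> -1 * partial_deriv i f x"
        using mono_on_imp_deriv_nonneg[of UNIV, OF _ DERIV_minus[OF diff[OF ix]]] by simp
    qed simp
  qed
qed

text \<open>The infimum may fail to be attained, and when it is 0 it lies outside the range c > 0;
  an admissible c slightly above it always exists.\<close>

lemma orlicz_norm_approx:
  assumes "orlicz_norm \<phi> M h < \<infinity>" "0 < \<epsilon>"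
  obtains c where "0 < c" "c \<le> enn2real (orlicz_norm \<phi> M h) + \<epsilon>" "(\<integral>\<^sup>+x. ennreal (\<phi> (\<bar>h x\<bar> / c)) \<partial>M) \<le> 1"
proof -
  let ?r = "enn2real (orlicz_norm \<phi> M h)"
  have "orlicz_norm \<phi> M h = ennreal ?r" using assms(1) by simp
  also have "\<dots> < ennreal (?r + \<epsilon>)" using assms(2) by (intro ennreal_lessI) (auto intro: add_nonneg_pos)
  finally obtain c where "0 < c" "ennreal c < ennreal (?r + \<epsilon>)" "(\<integral>\<^sup>+x. ennreal (\<phi> (\<bar>h x\<bar> / c)) \<partial>M) \<le> 1"
    unfolding orlicz_norm_def Inf_less_iff by auto
  then show thesis using that[of c] by (auto simp: ennreal_less_iff)
qed

text \<open>The bound with admissible constants at most the norm plus \<epsilon> is proved for every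
  \<epsilon> > 0; continuity of the right-hand side lets \<epsilon> tend to 0.\<close>

lemma covariance_le_orlicz:
  fixes f :: "(nat \<Rightarrow> real) \<Rightarrow> real" and V :: "nat \<Rightarrow> real \<Rightarrow> real" and \<rho> K \<theta> :: real and n :: nat
  defines "\<mu> \<equiv> PiM {..<n} (\<lambda>i. potential_measure (V i))"
  assumes V: "\<And>i. i < n \<Longrightarrow> log_sobolev_measure (V i) \<rho> K" and dc: "0 < density_const \<rho> K"
    and phi: "admissible_phi \<phi>" and f: "f \<in> F_plus n" and int: "sufficiently_integrable \<phi> n \<mu> f" and \<theta>: "0 \<le> \<theta>"
  shows "\<theta> * (\<integral>x. f x \<partial>\<mu>) * (\<integral>x. exp (- \<theta> * f x) \<partial>\<mu>) - \<theta> * (\<integral>x. f x * exp (- \<theta> * f x) \<partial>\<mu>)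
    \<le> \<theta>\<^sup>2 * (5 * exp 4 * (8 / density_const \<rho> K)\<^sup>2 * grad_orlicz_sq \<phi> n \<mu> f) * (\<integral>x. exp (- \<theta> * f x) \<partial>\<mu>)"
    (is "?lhs \<le> ?rhs")
proof -
  let ?L = "8 / density_const \<rho> K" and ?Z = "\<integral>x. exp (- \<theta> * f x) \<partial>\<mu>"
  obtain \<sigma> :: real where \<sigma>: "\<sigma> = 1 \<or> \<sigma> = -1" "\<And>i x. i < n \<Longrightarrow> x \<in> Rn n \<Longrightarrow> 0 \<le> \<sigma> * partial_deriv i f x"
    using F_plus_signed[OF f] by metis
  have "\<exists>T T'. (\<forall>i y. (T i has_real_derivative T' i y) (at y)) \<and> (\<forall>i. continuous_on UNIV (T' i)) \<and>
      (\<forall>i y. 0 \<le> \<sigma> * T' i y) \<and> (\<forall>i y. \<bar>T' i y\<bar> \<le> ?L) \<and>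
      (\<forall>i<n. distr gauss borel (T i) = potential_measure (V i))"
  proof (rule transport_signed[OF V \<sigma>(1) dc])
    fix T T' :: "nat \<Rightarrow> real \<Rightarrow> real"
    assume "\<And>i y. (T i has_real_derivative T' i y) (at y)" "\<And>i. continuous_on UNIV (T' i)"
      "\<And>i y. 0 \<le> \<sigma> * T' i y" "\<And>i y. \<bar>T' i y\<bar> \<le> ?L"
      "\<And>i. i < n \<Longrightarrow> distr gauss borel (T i) = potential_measure (V i)"
    then show ?thesis by (intro exI[of _ T] exI[of _ T'] conjI allI impI)
  qed
  then obtain T T' where "(\<forall>i y. (T i has_real_derivative T' i y) (at y)) \<and> (\<forall>i. continuous_on UNIV (T' i)) \<and>
      (\<forall>i y. 0 \<le> \<sigma> * T' i y) \<and> (\<forall>i y. \<bar>T' i y\<bar> \<le> ?L) \<and>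
      (\<forall>i<n. distr gauss borel (T i) = potential_measure (V i))"
    by (elim exE)
  then have T: "\<And>i y. (T i has_real_derivative T' i y) (at y)" "\<And>i. continuous_on UNIV (T' i)"
    "\<And>i y. 0 \<le> \<sigma> * T' i y" "\<And>i y. \<bar>T' i y\<bar> \<le> ?L"
    "\<And>i. i < n \<Longrightarrow> distr gauss borel (T i) = potential_measure (V i)"
    by simp_all
  have \<mu>: "\<mu> = PiM {..<n} (\<lambda>i. distr gauss borel (T i))"
    unfolding \<mu>_def by (intro PiM_cong refl) (simp add: T(5))
  let ?r = "\<lambda>i. enn2real (orlicz_norm \<phi> \<mu> (partial_deriv i f))"
  note S = int[unfolded sufficiently_integrable_def]
  have int': "integrable \<mu> f" "integrable \<mu> (\<lambda>x. exp (- \<theta> * f x))" "integrable \<mu> (\<lambda>x. f x * exp (- \<theta> * f x))"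
    "\<And>i. i < n \<Longrightarrow> orlicz_norm \<phi> \<mu> (partial_deriv i f) < \<infinity>"
    by (rule conjunct1[OF S], rule conjunct1[OF mp[OF spec[OF conjunct2[OF conjunct2[OF S]]] \<theta>]],
      rule conjunct2[OF mp[OF spec[OF conjunct2[OF conjunct2[OF S]]] \<theta>]], rule mp[OF spec[OF conjunct1[OF conjunct2[OF S]]]])
  have approx: "?lhs \<le> (\<Sum>i<n. (\<theta> * ?L * (?r i + \<epsilon>))\<^sup>2 * (5 * exp 4)) * ?Z" if \<epsilon>: "0 < \<epsilon>" for \<epsilon>
  proof -
    have "\<exists>c. i < n \<longrightarrow> 0 < c \<and> c \<le> ?r i + \<epsilon> \<and> (\<integral>\<^sup>+x. ennreal (\<phi> (\<bar>partial_deriv i f x\<bar> / c)) \<partial>\<mu>) \<le> 1" for i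
    proof (cases "i < n")
      case True
      show ?thesis by (rule orlicz_norm_approx[OF int'(4)[OF True] \<epsilon>]) blast
    qed simp
    then obtain c where c: "\<And>i. i < n \<Longrightarrow> 0 < c i" "\<And>i. i < n \<Longrightarrow> c i \<le> ?r i + \<epsilon>"
      "\<And>i. i < n \<Longrightarrow> (\<integral>\<^sup>+x. ennreal (\<phi> (\<bar>partial_deriv i f x\<bar> / c i)) \<partial>\<mu>) \<le> 1"
      by metis
    have "?lhs \<le> (\<Sum>i<n. (\<theta> * ?L * c i)\<^sup>2 * (5 * exp 4)) * ?Z"
      unfolding \<mu>
    proof (rule transported_covariance[OF _ _ \<sigma> T(1-4) phi c(1) c(3)[unfolded \<mu>] \<theta> int'(1-3)[unfolded \<mu>]])
      show "Ck_on_Rn n 2 f" using f by (simp add: F_plus_def)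
      show "0 \<le> partial_deriv j (partial_deriv i f) x" if "i < n" "j < n" "x \<in> Rn n" for i j x
        using f that by (simp add: F_plus_def)
    qed
    also have "\<dots> \<le> (\<Sum>i<n. (\<theta> * ?L * (?r i + \<epsilon>))\<^sup>2 * (5 * exp 4)) * ?Z"
    proof (intro mult_right_mono sum_mono power_mono mult_left_mono)
      show "0 \<le> \<theta> * ?L * c i" if "i \<in> {..<n}" for i using c(1)[of i] that \<theta> dc by simp
    qed (use c(2) \<theta> dc in auto)
    finally show ?thesis .
  qed
  have "(\<lambda>k. (\<Sum>i<n. (\<theta> * ?L * (?r i + 1 / real (Suc k)))\<^sup>2 * (5 * exp 4)) * ?Z)
      \<longlonglongrightarrow> (\<Sum>i<n. (\<theta> * ?L * (?r i + 0))\<^sup>2 * (5 * exp 4)) * ?Z"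
    using LIMSEQ_inverse_real_of_nat by (intro tendsto_intros) (simp add: inverse_eq_divide)
  then have "?lhs \<le> (\<Sum>i<n. (\<theta> * ?L * (?r i + 0))\<^sup>2 * (5 * exp 4)) * ?Z"
    by (rule LIMSEQ_le_const) (intro exI[of _ 0] allI impI approx, simp)
  also have "(\<Sum>i<n. (\<theta> * ?L * (?r i + 0))\<^sup>2 * (5 * exp 4)) = \<theta>\<^sup>2 * (5 * exp 4 * ?L\<^sup>2 * grad_orlicz_sq \<phi> n \<mu> f)"
    unfolding grad_orlicz_sq_def sum_distrib_left
    by (intro sum.cong refl) (simp only: add_0_left add_0_right power_mult_distrib ac_simps)
  finally show ?thesis .
qed

theorem theorem1p2:
  fixes \<rho> \<kappa> :: real
  assumes "\<rho> > 0"
  shows "\<exists>T>0. \<exists>c>0.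
    let C = 2 * exp (max (1 + \<kappa> / \<rho>) 0) / (\<rho> * (1 - exp (- 2 * \<rho> * T))) in
    \<forall>(\<phi> :: real \<Rightarrow> real) (n :: nat) (V :: nat \<Rightarrow> real \<Rightarrow> real) (\<kappa>s :: nat \<Rightarrow> real)
      (f :: (nat \<Rightarrow> real) \<Rightarrow> real).
      admissible_phi \<phi> \<longrightarrow>
      n \<ge> 1 \<longrightarrow>
      (\<forall>i<n. smooth_real (V i) \<and> (\<forall>x. deriv (deriv (V i)) x \<ge> - \<kappa>s i)) \<longrightarrow>
      \<kappa> = Max (\<kappa>s ` {..<n}) \<longrightarrow>
      (\<forall>i<n. prob_space (potential_measure (V i))) \<longrightarrow>
      (\<forall>i<n. hypercontractive (potential_measure (V i)) \<rho>) \<longrightarrow>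
      (let \<mu> = PiM {..<n} (\<lambda>i. potential_measure (V i)) in
        f \<in> F_plus n \<longrightarrow>
        smooth_on_Rn n f \<longrightarrow>
        sufficiently_integrable \<phi> n \<mu> f \<longrightarrow>
          Ent \<mu> (\<lambda>x. exp (- f x))
            \<le> C * grad_orlicz_sq \<phi> n \<mu> f * (\<integral>x. exp (- f x) \<partial>\<mu>) \<and>
          (grad_orlicz_sq \<phi> n \<mu> f \<noteq> 0 \<longrightarrow>
            (\<forall>t\<ge>0. measure \<mu> {x \<in> space \<mu>. f x - (\<integral>y. f y \<partial>\<mu>) \<le> - t}
                      \<le> exp (- c * (t\<^sup>2 / (2 * grad_orlicz_sq \<phi> n \<mu> f))))))"
proof -
  \<comment> \<open>\<kappa> may be zero or negative, while the density bound divides by sqrt K. A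
    strictly positive upper bound that depends only on \<kappa> is taken instead.\<close>
  define K where "K = \<bar>\<kappa>\<bar> + 1"
  have K: "0 < K" "\<kappa> \<le> K" by (simp_all add: K_def)
  have dc: "0 < density_const \<rho> K" using K assms by (simp add: density_const_def add_pos_nonneg)
  \<comment> \<open>The factor 5 exp 4 comes from the sum of L^p-norms and the square from the
    Lipschitz constant of the transport maps.\<close>
  define C\<^sub>1 where "C\<^sub>1 = 5 * exp 4 * (8 / density_const \<rho> K)\<^sup>2"
  have C\<^sub>1: "0 < C\<^sub>1" using dc by (simp add: C\<^sub>1_def)
  define D where "D = 2 * exp (max (1 + \<kappa> / \<rho>) 0) / \<rho>"
  have D: "0 < D" using assms by (simp add: D_def)
  \<comment> \<open>Chosen so that 1 - exp(-2 \<rho> T) \<le> 2 \<rho> T =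
    \<open>D / C\<^sub>1\<close>; hence C = D / (1 - exp(-2 \<rho> T)) is at least
    \<open>C\<^sub>1\<close>.\<close>
  define T where "T = D / C\<^sub>1 / (2 * \<rho>)"
  have T: "0 < T" using D C\<^sub>1 assms by (simp add: T_def)
  define C where "C = 2 * exp (max (1 + \<kappa> / \<rho>) 0) / (\<rho> * (1 - exp (- 2 * \<rho> * T)))"
  have C: "C\<^sub>1 \<le> C"
  proof -
    have "1 - exp (- (2 * \<rho> * T)) \<le> 2 * \<rho> * T" using exp_ge_add_one_self[of "- (2 * \<rho> * T)"] by linarith
    also have "\<dots> = D / C\<^sub>1" using assms by (simp add: T_def)
    finally have le: "1 - exp (- (2 * \<rho> * T)) \<le> D / C\<^sub>1" .
    have "0 < 1 - exp (- (2 * \<rho> * T))" using T assms by simp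
    then have "0 < D / C\<^sub>1 * (1 - exp (- (2 * \<rho> * T)))" using D C\<^sub>1 by (intro mult_pos_pos divide_pos_pos)
    with le have "D / (D / C\<^sub>1) \<le> D / (1 - exp (- (2 * \<rho> * T)))" using D by (intro divide_left_mono) auto
    moreover have "D / (D / C\<^sub>1) = C\<^sub>1" using D by simp
    moreover have "D / (1 - exp (- (2 * \<rho> * T))) = C" by (simp add: C_def D_def)
    ultimately show ?thesis by (simp only:)
  qed
  \<comment> \<open>Matches the exponent \<open>t\<^sup>2 / (8 * C\<^sub>1 * G)\<close> of the
    deviation bound with c t^2 / (2 G).\<close>
  define c where "c = 1 / (4 * C\<^sub>1)"
  have c: "0 < c" using C\<^sub>1 by (simp add: c_def)
  show ?thesis
    unfolding Let_def
  proof (rule exI[of _ T], rule conjI[OF T], rule exI[of _ c], rule conjI[OF c], unfold C_def[symmetric], intro allI impI)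
    fix \<phi> :: "real \<Rightarrow> real" and n :: nat and V :: "nat \<Rightarrow> real \<Rightarrow> real" and \<kappa>s :: "nat \<Rightarrow> real"
      and f :: "(nat \<Rightarrow> real) \<Rightarrow> real"
    let ?\<mu> = "PiM {..<n} (\<lambda>i. potential_measure (V i))"
    let ?G = "grad_orlicz_sq \<phi> n ?\<mu> f"
    assume phi: "admissible_phi \<phi>"
      and V: "\<forall>i<n. smooth_real (V i) \<and> (\<forall>x. deriv (deriv (V i)) x \<ge> - \<kappa>s i)" and \<kappa>: "\<kappa> = Max (\<kappa>s ` {..<n})"
      and prob: "\<forall>i<n. prob_space (potential_measure (V i))" and lsi: "\<forall>i<n. hypercontractive (potential_measure (V i)) \<rho>"
      and f: "f \<in> F_plus n" and int: "sufficiently_integrable \<phi> n ?\<mu> f"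
    have LS: "log_sobolev_measure (V i) \<rho> K" if i: "i < n" for i
    proof (intro log_sobolev_measure.intro potential_prob.intro log_sobolev_measure_axioms.intro)
      show "continuous_on UNIV (V i)" using V i by (intro smooth_real_continuous) auto
      show "- K \<le> deriv (deriv (V i)) x" for x
      proof -
        have "\<kappa>s i \<le> \<kappa>" unfolding \<kappa> using i by (intro Max_ge) auto
        moreover have "- \<kappa>s i \<le> deriv (deriv (V i)) x" using V i by blast
        ultimately show ?thesis using K(2) by linarith
      qed
      show "smooth_real (V i)" "prob_space (potential_measure (V i))" "hypercontractive (potential_measure (V i)) \<rho>"
        using V prob lsi i by simp_all
    qed (use assms K in simp_all)
    have \<mu>_prob: "prob_space ?\<mu>" using prob by (intro prob_space_PiM) auto
    have G: "0 \<le> ?G" unfolding grad_orlicz_sq_def by (intro sum_nonneg) simp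
    have A: "0 \<le> C\<^sub>1 * ?G" using C\<^sub>1 G by simp
    note S = int[unfolded sufficiently_integrable_def]
    have I: "integrable ?\<mu> f" "\<And>\<theta>. 0 \<le> \<theta> \<Longrightarrow> integrable ?\<mu> (\<lambda>x. exp (- \<theta> * f x))"
      "\<And>\<theta>. 0 \<le> \<theta> \<Longrightarrow> integrable ?\<mu> (\<lambda>x. f x * exp (- \<theta> * f x))"
      by (rule conjunct1[OF S], rule conjunct1[OF mp[OF spec[OF conjunct2[OF conjunct2[OF S]]]]], assumption,
        rule conjunct2[OF mp[OF spec[OF conjunct2[OF conjunct2[OF S]]]]])
    have cov: "\<theta> * (\<integral>x. f x \<partial>?\<mu>) * (\<integral>x. exp (- \<theta> * f x) \<partial>?\<mu>) - \<theta> * (\<integral>x. f x * exp (- \<theta> * f x) \<partial>?\<mu>)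
        \<le> \<theta>\<^sup>2 * (C\<^sub>1 * ?G) * (\<integral>x. exp (- \<theta> * f x) \<partial>?\<mu>)" if "0 \<le> \<theta>" for \<theta>
      unfolding C\<^sub>1_def by (rule covariance_le_orlicz[OF LS dc phi f int that])
    have ED1: "Ent ?\<mu> (\<lambda>x. exp (- f x)) \<le> C\<^sub>1 * ?G * (\<integral>x. exp (- f x) \<partial>?\<mu>)"
      by (rule entropy_deviation_of_covariance(1)[OF \<mu>_prob I A cov])
    have ED2: "measure ?\<mu> {x \<in> space ?\<mu>. f x - (\<integral>y. f y \<partial>?\<mu>) \<le> - t} \<le> exp (- (t\<^sup>2 / (8 * (C\<^sub>1 * ?G))))"
      if "0 < C\<^sub>1 * ?G" "0 \<le> t" for t
      by (rule entropy_deviation_of_covariance(2)[OF \<mu>_prob I A cov]) (use that in auto)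
    show "Ent ?\<mu> (\<lambda>x. exp (- f x)) \<le> C * ?G * (\<integral>x. exp (- f x) \<partial>?\<mu>) \<and>
      (?G \<noteq> 0 \<longrightarrow> (\<forall>t\<ge>0. measure ?\<mu> {x \<in> space ?\<mu>. f x - (\<integral>y. f y \<partial>?\<mu>) \<le> - t} \<le> exp (- c * (t\<^sup>2 / (2 * ?G)))))"
    proof (intro conjI impI allI)
      have "C\<^sub>1 * ?G * (\<integral>x. exp (- f x) \<partial>?\<mu>) \<le> C * ?G * (\<integral>x. exp (- f x) \<partial>?\<mu>)"
        using C G by (intro mult_right_mono) auto
      with ED1 show "Ent ?\<mu> (\<lambda>x. exp (- f x)) \<le> C * ?G * (\<integral>x. exp (- f x) \<partial>?\<mu>)" by (rule order_trans)
      fix t :: real assume G0: "?G \<noteq> 0" and t: "0 \<le> t"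
      then have "0 < C\<^sub>1 * ?G" using C\<^sub>1 G by simp
      from ED2[OF this t]
      show "measure ?\<mu> {x \<in> space ?\<mu>. f x - (\<integral>y. f y \<partial>?\<mu>) \<le> - t} \<le> exp (- c * (t\<^sup>2 / (2 * ?G)))"
        by (simp add: c_def mult.assoc)
    qed
  qed
qed

end
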